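(* Let $w\in\widetilde{\mathrm{Sp}}(2n)$. Then: (i) If $w$ lies in the closure of $\widetilde{\mathrm{Sp}}^+_{\mathrm{ell}}(2n)$, then $\pi(w)$ has spectrum $\{e^{\pm i\theta_1},\dots,e^{\pm i\theta_n}\}$ with $\theta_j\in[0,\pi]$ for every $j$, and $$\mathrm{dist}_G(\mathrm{id},w)\le\frac{2\pi}{n}\mu(w)=\frac1n\sum_{j=1}^n\theta_j.$$ (ii) If there is a timelike curve from $\mathrm{id}$ to $w$ and $w$ is not in the closure of $\widetilde{\mathrm{Sp}}^+_{\mathrm{ell}}(2n)$, then $\mathrm{dist}_G(\mathrm{id},w)=+\infty$.
   Context: $\omega_0=\sum_j\mathrm{d}x_j\wedge\mathrm{d}y_j$ on $\mathbb{R}^{2n}$, $J_0$ the standard complex structure with $\omega_0(u,v)=J_0u\cdot v$; $\mathrm{Sp}(2n)$, $\mathrm{sp}(2n)=\{X:(u,v)\mapsto\omega_0(u,Xv)\text{ symmetric}\}$, $\mathrm{sp}^+(2n)$ those with this form positive definite, $G(X)=(\det X)^{1/(2n)}$ on $\mathrm{sp}^+(2n)$, extended by $0$ to its boundary. $\widetilde{\mathrm{Sp}}(2n)$ is the universal cover (homotopy classes of paths from $\mathrm{id}$), $\pi(w)=w(1)$. A $C^1$ curve is timelike if $W'W^{-1}\in\mathrm{sp}^+(2n)$ and causal if $W'W^{-1}$ is nonzero and in the closure of $\mathrm{sp}^+(2n)$ (for curves in $\widetilde{\mathrm{Sp}}(2n)$, via projection); $\mathrm{length}_G(W)=\int G(W'W^{-1})\,\mathrm{d}t$.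 Write $w_0\le w_1$ if $w_0=w_1$ or there is a causal curve from $w_0$ to $w_1$ in $\widetilde{\mathrm{Sp}}(2n)$ (a partial order). $\mathrm{dist}_G(w_0,w_1)=\sup\mathrm{length}_G(\gamma)$ over causal curves $\gamma$ from $w_0$ to $w_1$ if $w_0\le w_1$, and $0$ otherwise. Krein form: $\kappa(w,w')=\langle -iJ_0w,w'\rangle$ on $\mathbb{C}^{2n}$ with $\langle a,b\rangle=\sum a_k\overline{b_k}$. For an eigenvalue $\lambda$ on the unit circle $\mathbb{U}$ of $W\in\mathrm{Sp}(2n)$, its Krein signature $(p(\lambda),q(\lambda))$ is the signature of $\kappa$ on the generalized eigenspace; $\lambda$ is Krein-positive if $\kappa$ is positive definite there. $\mathrm{Sp}^+_{\mathrm{ell}}(2n)$ is the set of $W$ all of whose eigenvalues lie in $\mathbb{U}\setminus\{\pm1\}$, with those of positive imaginary part Krein-positive; $\widetilde{\mathrm{Sp}}^+_{\mathrm{ell}}(2n)$ is the set of classes of paths $w$ with $w(0)=\mathrm{id}$, $w((0,1])\subset\mathrm{Sp}^+_{\mathrm{ell}}(2n)$. Let $\upsilon(W)=(-1)^m\prod_{\lambda\in\sigma(W)\cap\mathbb{U}\setminus\{\pm1\}}\lambda^{p(\lambda)}$, with $2m$ the total algebraic multiplicity of negative real eigenvalues of $W$. The homogeneous Maslov quasimorphism $\mu:\widetilde{\mathrm{Sp}}(2n)\to\mathbb{R}$ is the unique continuous function with $e^{2\pi i\mu(w)}=\upsilon(\pi(w))$ and $\mu(\mathrm{id})=0$. 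*)

theory Defs
  imports "HOL-Analysis.Analysis"
begin

text \<open>Conventions. The phase space is R^{2n} realised as real^('n + 'n) with
  coordinates x_j = Inl j and y_j = Inr j (j :: 'n), so n = CARD('n) >= 1.\<close>

type_synonym 'n sqm = "real^('n + 'n)^('n + 'n)"
type_synonym 'n cvec = "complex^('n + 'n)"

definition omega0 :: "real^('n::finite + 'n) \<Rightarrow> real^('n + 'n) \<Rightarrow> real" where
  "omega0 u v = (\<Sum>j\<in>UNIV. u $ Inl j * v $ Inr j - u $ Inr j * v $ Inl j)"

text \<open>Standard complex structure J0, characterised by omega0 u v = (J0 u) . v.\<close>
definition J0 :: "'n::finite sqm" where
  "J0 = (\<chi> i k. case i of Inl j \<Rightarrow> (if k = Inr j then -1 else 0)
                         | Inr j \<Rightarrow> (if k = Inl j then 1 else 0))"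

definition Sp :: "'n::finite sqm set" where
  "Sp = {W. \<forall>u v. omega0 (W *v u) (W *v v) = omega0 u v}"

definition sp :: "'n::finite sqm set" where
  "sp = {X. \<forall>u v. omega0 u (X *v v) = omega0 v (X *v u)}"

definition sp_plus :: "'n::finite sqm set" where
  "sp_plus = {X. X \<in> sp \<and> (\<forall>u. u \<noteq> 0 \<longrightarrow> omega0 u (X *v u) > 0)}"

definition G :: "'n::finite sqm \<Rightarrow> real" where
  "G X = (if X \<in> sp_plus then det X powr (1 / real CARD('n + 'n)) else 0)"

definition cplx :: "'n::finite sqm \<Rightarrow> complex^('n + 'n)^('n + 'n)" where
  "cplx W = (\<chi> i k. complex_of_real (W $ i $ k))"

definition charpoly :: "'n::finite sqm \<Rightarrow> complex \<Rightarrow> complex" where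
  "charpoly W z = det ((\<chi> i k. if i = k then z else 0) - cplx W)"

definition eigenvalues :: "'n::finite sqm \<Rightarrow> complex set" where
  "eigenvalues W = {z. charpoly W z = 0}"

definition geneig :: "'n::finite sqm \<Rightarrow> complex \<Rightarrow> 'n cvec set" where
  "geneig W l = {v. ((\<lambda>x. cplx W *v x - l *s x) ^^ CARD('n + 'n)) v = 0}"

definition krein :: "'n::finite cvec \<Rightarrow> 'n cvec \<Rightarrow> complex" where
  "krein w w' = (\<Sum>k\<in>UNIV. (- \<i> * (cplx J0 *v w) $ k) * cnj (w' $ k))"

definition krein_posdef_on :: "'n::finite cvec set \<Rightarrow> bool" where
  "krein_posdef_on V \<longleftrightarrow>
     (\<forall>v\<in>V. v \<noteq> 0 \<longrightarrow> Im (krein v v) = 0 \<and> Re (krein v v) > 0)"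

text \<open>p(lambda): positive index of inertia of kappa on the generalised eigenspace,
  i.e. the maximal complex dimension of a complex subspace on which kappa is
  positive definite.\<close>
definition krein_p :: "'n::finite sqm \<Rightarrow> complex \<Rightarrow> nat" where
  "krein_p W l = Max {vec.dim V | V. vec.subspace V \<and> V \<subseteq> geneig W l \<and> krein_posdef_on V}"

definition krein_positive :: "'n::finite sqm \<Rightarrow> complex \<Rightarrow> bool" where
  "krein_positive W l \<longleftrightarrow> krein_posdef_on (geneig W l)"

definition Sp_ell_plus :: "'n::finite sqm set" where
  "Sp_ell_plus = {W. W \<in> Sp \<and>
     (\<forall>l\<in>eigenvalues W. cmod l = 1 \<and> l \<noteq> 1 \<and> l \<noteq> -1 \<and>
        (Im l > 0 \<longrightarrow> krein_positive W l))}"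

definition neg_mult :: "'n::finite sqm \<Rightarrow> nat" where
  "neg_mult W = (\<Sum>l\<in>{l\<in>eigenvalues W. l \<in> \<real> \<and> Re l < 0}. vec.dim (geneig W l))"

definition upsilon :: "'n::finite sqm \<Rightarrow> complex" where
  "upsilon W = (-1) ^ (neg_mult W div 2) *
     (\<Prod>l\<in>{l\<in>eigenvalues W. cmod l = 1 \<and> l \<noteq> 1 \<and> l \<noteq> -1}. l ^ krein_p W l)"

subsection \<open>The universal cover as homotopy classes of paths from id\<close>

definition sp_path :: "(real \<Rightarrow> 'n::finite sqm) \<Rightarrow> bool" where
  "sp_path g \<longleftrightarrow> path g \<and> path_image g \<subseteq> Sp \<and> pathstart g = mat 1"

definition cls :: "(real \<Rightarrow> 'n::finite sqm) \<Rightarrow> (real \<Rightarrow> 'n sqm) set" where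
  "cls g = {h. sp_path h \<and> homotopic_paths Sp g h}"

definition SpT :: "(real \<Rightarrow> 'n::finite sqm) set set" where
  "SpT = {cls g | g. sp_path g}"

definition idT :: "(real \<Rightarrow> 'n::finite sqm) set" where
  "idT = cls (\<lambda>t. mat 1)"

definition proj :: "(real \<Rightarrow> 'n::finite sqm) set \<Rightarrow> 'n sqm" where
  "proj w = pathfinish (SOME g. g \<in> w)"

definition nbhd :: "(real \<Rightarrow> 'n::finite sqm) set \<Rightarrow> 'n sqm set \<Rightarrow> (real \<Rightarrow> 'n sqm) set set" where
  "nbhd w V = {cls (g +++ d) | g d. g \<in> w \<and> path d \<and> path_image d \<subseteq> V \<inter> Sp
                                  \<and> pathstart d = pathfinish g}"

definition SpT_top :: "(real \<Rightarrow> 'n::finite sqm) set topology" where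
  "SpT_top = topology (\<lambda>U. U \<subseteq> SpT \<and>
      (\<forall>w\<in>U. \<exists>V. open V \<and> proj w \<in> V \<and> nbhd w V \<subseteq> U))"

definition SpT_ell_plus :: "(real \<Rightarrow> 'n::finite sqm) set set" where
  "SpT_ell_plus = {w \<in> SpT. \<exists>g\<in>w. \<forall>t\<in>{0<..1}. g t \<in> Sp_ell_plus}"

text \<open>Homogeneous Maslov quasimorphism: the unique continuous function on the
  universal cover with exp(2 pi i mu) = upsilon o pi and mu(id) = 0
  (normalised to 0 off the carrier to make it unique as a HOL function).\<close>
definition maslov :: "(real \<Rightarrow> 'n::finite sqm) set \<Rightarrow> real" where
  "maslov = (THE f. continuous_map SpT_top euclideanreal f
      \<and> (\<forall>w\<in>SpT. exp (2 * pi * \<i> * complex_of_real (f w)) = upsilon (proj w))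
      \<and> f idT = 0 \<and> (\<forall>w. w \<notin> SpT \<longrightarrow> f w = 0))"

definition C1_curve :: "(real \<Rightarrow> 'n::finite sqm) \<Rightarrow> bool" where
  "C1_curve c \<longleftrightarrow> (\<forall>t\<in>{0..1}. c differentiable (at t within {0..1}))
      \<and> continuous_on {0..1} (\<lambda>t. vector_derivative c (at t within {0..1}))"

definition logder :: "(real \<Rightarrow> 'n::finite sqm) \<Rightarrow> real \<Rightarrow> 'n sqm" where
  "logder c t = vector_derivative c (at t within {0..1}) ** matrix_inv (c t)"

definition causal_curve :: "(real \<Rightarrow> 'n::finite sqm) \<Rightarrow> bool" where
  "causal_curve c \<longleftrightarrow> C1_curve c \<and> (\<forall>t\<in>{0..1}. c t \<in> Sp)
      \<and> (\<forall>t\<in>{0..1}. logder c t \<noteq> 0 \<and> logder c t \<in> closure sp_plus)"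

definition timelike_curve :: "(real \<Rightarrow> 'n::finite sqm) \<Rightarrow> bool" where
  "timelike_curve c \<longleftrightarrow> C1_curve c \<and> (\<forall>t\<in>{0..1}. c t \<in> Sp)
      \<and> (\<forall>t\<in>{0..1}. logder c t \<in> sp_plus)"

definition lengthG :: "(real \<Rightarrow> 'n::finite sqm) \<Rightarrow> real" where
  "lengthG c = integral {0..1} (\<lambda>t. G (logder c t))"

text \<open>c, a curve in Sp, lifts to a curve in the universal cover from w0 to w1.\<close>
definition curve_from_to ::
  "(real \<Rightarrow> 'n::finite sqm) \<Rightarrow> (real \<Rightarrow> 'n sqm) set \<Rightarrow> (real \<Rightarrow> 'n sqm) set \<Rightarrow> bool" where
  "curve_from_to c w0 w1 \<longleftrightarrow> (\<exists>g\<in>w0. c 0 = pathfinish g \<and> g +++ c \<in> w1)"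

definition causal_le :: "(real \<Rightarrow> 'n::finite sqm) set \<Rightarrow> (real \<Rightarrow> 'n sqm) set \<Rightarrow> bool" where
  "causal_le w0 w1 \<longleftrightarrow> w0 = w1 \<or> (\<exists>c. causal_curve c \<and> curve_from_to c w0 w1)"

definition distG :: "(real \<Rightarrow> 'n::finite sqm) set \<Rightarrow> (real \<Rightarrow> 'n sqm) set \<Rightarrow> ereal" where
  "distG w0 w1 = (if causal_le w0 w1
      then Sup ({0} \<union> {ereal (lengthG c) | c. causal_curve c \<and> curve_from_to c w0 w1})
      else 0)"

end

theory Submission
  imports Defs "HOL-Computational_Algebra.Fundamental_Theorem_Algebra"
begin

text \<open>
  Write \<open>\<omega>\<close> for the symplectic form. A symplectic \<open>W\<close> lies in \<open>Sp_ell_plus\<close> iff \<open>\<omega>(v, W v) > 0\<close> for all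
  \<open>v \<noteq> 0\<close> (the set \<open>Spos\<close>); \<open>Snn\<close> is given by the weak inequality. By Brouwer's theorem every \<open>W\<close> has an
  invariant maximal Krein-nonnegative subspace \<open>V\<close>, and \<open>upsilon W\<close> is the phase of the determinant of \<open>W\<close> on \<open>V\<close>;
  hence \<open>upsilon\<close> is continuous and \<open>maslov\<close> exists. A matrix in \<open>Spos\<close> is symplectically conjugate to a rotation with
  angles in \<open>(0, \<pi>)\<close>, which identifies \<open>2 \<pi> maslov\<close> with the sum of the angles.

  For the upper bound, let \<open>R a = cos a + J sin a\<close>. Along a causal curve the argument of \<open>det (W - R a)\<close>, \<open>Im a > 0\<close>, does
  not decrease. As \<open>a\<close> tends to a point of \<open>(\<pi>, 2 \<pi>)\<close> its lift tends to \<open>0\<close> over the closure of the elliptic set, but it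
  jumps at every \<open>b\<close> for which \<open>W - R b\<close> is singular, and such \<open>b\<close> exists if \<open>W\<close> is not in \<open>Snn\<close>; so a causal curve
  from the identity to a point of the closure stays in \<open>Snn\<close>. After pushing it into \<open>Spos\<close> by a fractional linear map,
  the sum of the angles is approximated by \<open>tr P((W + W\<^sup>-\<^sup>1) / 2) / 2\<close> with polynomials \<open>P\<close> close to \<open>arccos\<close>, whose
  derivative along the curve is at least about \<open>n G\<close> by the inequality of arithmetic and geometric means.

  For the second part, a timelike curve leaving \<open>Spos\<close> does so at some \<open>W\<close> with \<open>W u = - u\<close>. Then
  \<open>(1 - r N) W\<close>, with \<open>N y = - \<omega>(u, y) u\<close>, lies in \<open>Snn\<close> for every \<open>r \<ge> 0\<close>, and undoing the shear while moving along the rest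
  of the curve gives timelike curves in the same class whose length tends to infinity with \<open>r\<close>.
\<close>

section \<open>Matrix analysis\<close>

text \<open>Eigenvalues and angles are not differentiable, nor even continuously labelled, where
  they collide, so every argument works with a quantity that does not name them: the determinant on
  an invariant subspace, the argument of \<open>det (W - R a)\<close>, traces of polynomials. For
  \<open>upsilon\<close> the Krein indices jump at collisions; an invariant nonnegative subspace may
  not depend continuously on \<open>W\<close>, but such subspaces form a compact set and all give
  the same phase, and this forces continuity. For real \<open>a\<close> the matrix
  \<open>W - R a\<close> can be singular; with \<open>Im a > 0\<close> the rotation strictly
  decreases the Krein form that \<open>W\<close> preserves, so the determinant has a logarithm along
  every symplectic path. AM-GM compares \<open>G\<close> with a trace of the form in the normal
  frame, where each angle occurs twice. \<open>arccos\<close> has infinite slope at \<open>1\<close>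
  and \<open>-1\<close>, and the curves start at the identity, which is why a curve is first moved
  into the interior. In the second part \<open>G\<close> is the root of a determinant: a single
  eigenvalue growing like \<open>r\<close>, the others bounded below, makes the length
  unbounded.\<close>

lemma matrix_inv_right: "invertible A \<Longrightarrow> A ** matrix_inv A = mat 1"
  and matrix_inv_left: "invertible A \<Longrightarrow> matrix_inv A ** A = mat 1"
  for A :: "'a::field^'n^'n"
  unfolding invertible_def matrix_inv_def by (metis (mono_tags, lifting) someI_ex)+

interpretation matrix_mult: bounded_bilinear
  "(**) :: 'a::{euclidean_space,real_normed_field}^'n^'m \<Rightarrow> 'a^'p^'n \<Rightarrow> 'a^'p^'m"
  unfolding bilinear_conv_bounded_bilinear[symmetric] bilinear_def
  by (auto intro!: linearI simp: matrix_matrix_mult_def vec_eq_iff sum.distrib algebra_simps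
      scaleR_sum_right)

interpretation matrix_vec_mult: bounded_bilinear
  "(*v) :: 'a::{euclidean_space,real_normed_field}^'n^'m \<Rightarrow> 'a^'n \<Rightarrow> 'a^'m"
  unfolding bilinear_conv_bounded_bilinear[symmetric] bilinear_def
  by (auto intro!: linearI simp: matrix_vector_mult_def vec_eq_iff sum.distrib algebra_simps
      scaleR_sum_right)

lemma continuous_on_det:
  fixes f :: "'b::topological_space \<Rightarrow> 'a::real_normed_field^'n^'n"
  assumes "continuous_on S f"
  shows "continuous_on S (\<lambda>x. det (f x))"
  unfolding det_def by (intro continuous_intros assms)

lemma tendsto_det:
  fixes f :: "'b \<Rightarrow> 'a::real_normed_field^'n^'n"
  assumes "(f \<longlongrightarrow> A) F"
  shows "((\<lambda>x. det (f x)) \<longlongrightarrow> det A) F"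
  unfolding det_def by (intro tendsto_intros assms)

lemma matrix_vector_mult_axis: "(A *v axis j 1) $ i = (A $ i $ j :: 'a::semiring_1)"
  by (simp add: matrix_vector_mult_def axis_def if_distrib cong: if_cong)

text \<open>Cramer's rule writes the entries of the inverse as quotients of polynomials, which makes
  inversion continuous without any norm estimate.\<close>

lemma matrix_inv_cramer:
  fixes A :: "'a::field^'n^'n"
  assumes "invertible A"
  shows "matrix_inv A = (\<chi> i j. det (\<chi> k l. if l = i then axis j 1 $ k else A $ k $ l) / det A)"
proof -
  have d: "det A \<noteq> 0" using assms invertible_det_nz by blast
  have "A *v (matrix_inv A *v axis j 1) = axis j 1" for j
    by (simp add: matrix_vector_mul_assoc matrix_inv_right assms)
  then have "matrix_inv A *v axis j 1
      = (\<chi> k. det (\<chi> i l. if l = k then axis j 1 $ i else A $ i $ l) / det A)" for j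
    using cramer[OF d] by blast
  then have "matrix_inv A $ i $ j = det (\<chi> k l. if l = i then axis j 1 $ k else A $ k $ l) / det A" for i j
    by (simp add: vec_eq_iff matrix_vector_mult_axis)
  then show ?thesis by (simp add: vec_eq_iff)
qed

lemma continuous_on_matrix_inv:
  fixes f :: "'b::topological_space \<Rightarrow> 'a::real_normed_field^'n^'n"
  assumes "continuous_on S f" "\<And>x. x \<in> S \<Longrightarrow> invertible (f x)"
  shows "continuous_on S (\<lambda>x. matrix_inv (f x))"
proof -
  have "continuous_on S (\<lambda>x. \<chi> i j. det (\<chi> k l. if l = i then axis j 1 $ k else f x $ k $ l) / det (f x))"
  proof (intro continuous_on_vec_lambda continuous_on_divide continuous_on_det assms)
    show "\<forall>x\<in>S. det (f x) \<noteq> 0" using assms(2) invertible_det_nz by blast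
    show "continuous_on S (\<lambda>x. if l = i then axis j 1 $ k else f x $ k $ l)" for i j k l
      by (cases "l = i") (auto intro!: continuous_intros assms)
  qed
  then show ?thesis
    by (rule continuous_on_eq) (simp add: matrix_inv_cramer assms)
qed

section \<open>Derivatives of the matrix inverse and of the determinant\<close>

lemma has_vector_derivative_within_iff_tendsto:
  "(f has_vector_derivative D) (at t within S)
    \<longleftrightarrow> ((\<lambda>s. (f s - f t) /\<^sub>R (s - t)) \<longlongrightarrow> D) (at t within S)"
proof -
  have "norm (f s - f t - (s - t) *\<^sub>R D) / norm (s - t) = norm ((f s - f t) /\<^sub>R (s - t) - D)"
    if "s \<noteq> t" for s
  proof -
    have "(f s - f t) /\<^sub>R (s - t) - D = (f s - f t - (s - t) *\<^sub>R D) /\<^sub>R (s - t)"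
      by (subst scaleR_diff_right) (use that in simp)
    then show ?thesis using that by (simp add: divide_inverse mult.commute)
  qed
  then have "((\<lambda>s. norm (f s - f t - (s - t) *\<^sub>R D) / norm (s - t)) \<longlongrightarrow> 0) (at t within S)
     \<longleftrightarrow> ((\<lambda>s. norm ((f s - f t) /\<^sub>R (s - t) - D)) \<longlongrightarrow> 0) (at t within S)"
    by (intro tendsto_cong) (auto simp: eventually_at_filter)
  then show ?thesis
    unfolding has_vector_derivative_def has_derivative_iff_norm
    by (simp add: bounded_linear_scaleR_left tendsto_norm_zero_iff LIM_zero_iff)
qed

text \<open>The identity \<open>A^-1 - B^-1 = - A^-1 (A - B) B^-1\<close> turns the difference
  quotient of the inverse into that of \<open>M\<close>; continuity of inversion then gives the
  limit.\<close>

lemma has_vector_derivative_matrix_inv: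
  fixes M :: "real \<Rightarrow> 'a::{euclidean_space,real_normed_field}^'n^'n"
  assumes D: "(M has_vector_derivative D) (at t within S)" and t: "t \<in> S"
    and inv: "\<And>s. s \<in> S \<Longrightarrow> invertible (M s)" and cont: "continuous_on S M"
  shows "((\<lambda>s. matrix_inv (M s)) has_vector_derivative
           - (matrix_inv (M t) ** D ** matrix_inv (M t))) (at t within S)"
proof -
  have eq: "(matrix_inv (M s) - matrix_inv (M t)) /\<^sub>R (s - t)
      = - (matrix_inv (M s) ** ((M s - M t) /\<^sub>R (s - t)) ** matrix_inv (M t))" if "s \<in> S" for s
  proof -
    have "matrix_inv (M s) ** (M s - M t) ** matrix_inv (M t)
        = matrix_inv (M t) - matrix_inv (M s)"
      using inv[OF that] inv[OF t]
      by (simp add: matrix_mult.diff_left matrix_mult.diff_right matrix_inv_left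
          matrix_mul_assoc[symmetric] matrix_inv_right)
    then show ?thesis
      by (simp add: matrix_mult.scaleR_left matrix_mult.scaleR_right flip: scaleR_minus_right)
  qed
  have "((\<lambda>s. matrix_inv (M s)) \<longlongrightarrow> matrix_inv (M t)) (at t within S)"
    using continuous_on_matrix_inv[OF cont inv] t by (auto simp: continuous_on_def)
  moreover have "((\<lambda>s. (M s - M t) /\<^sub>R (s - t)) \<longlongrightarrow> D) (at t within S)"
    using D by (simp add: has_vector_derivative_within_iff_tendsto)
  ultimately have "((\<lambda>s. - (matrix_inv (M s) ** ((M s - M t) /\<^sub>R (s - t)) ** matrix_inv (M t)))
      \<longlongrightarrow> - (matrix_inv (M t) ** D ** matrix_inv (M t))) (at t within S)"
    by (intro tendsto_intros matrix_mult.tendsto)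
  then show ?thesis
    unfolding has_vector_derivative_within_iff_tendsto
    by (rule Lim_transform_eventually) (auto simp: eventually_at_filter eq)
qed

lemma has_vector_derivative_vec_nth:
  "(f has_vector_derivative D) F \<Longrightarrow> ((\<lambda>x. f x $ i) has_vector_derivative D $ i) F"
  by (rule bounded_linear.has_vector_derivative[OF bounded_linear_vec_nth])

lemma has_vector_derivative_det_at_one:
  fixes L :: "real \<Rightarrow> 'a::real_normed_field^'n^'n"
  assumes D: "(L has_vector_derivative D) (at t within S)" and L: "L t = mat 1"
  shows "((\<lambda>s. det (L s)) has_vector_derivative trace D) (at t within S)"
proof -
  let ?U = "UNIV :: 'n set"
  let ?PU = "{p. p permutes ?U}"
  have e: "((\<lambda>s. L s $ i $ j) has_derivative (\<lambda>y. y *\<^sub>R D $ i $ j)) (at t within S)" for i j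
    using has_vector_derivative_vec_nth[OF has_vector_derivative_vec_nth[OF D, of i], of j]
    by (simp add: has_vector_derivative_def)
  have der: "((\<lambda>s. det (L s)) has_derivative (\<lambda>y. \<Sum>p\<in>?PU. of_int (sign p) *
      (\<Sum>i\<in>?U. y *\<^sub>R D $ i $ p i * (\<Prod>j\<in>?U - {i}. L t $ j $ p j)))) (at t within S)"
    unfolding det_def by (auto intro!: derivative_eq_intros e)
  \<comment> \<open>A permutation other than the identity moves at least two points, so after one
    factor has been differentiated a vanishing off-diagonal entry of \<open>mat 1\<close> is
    left.\<close>
  have z: "(\<Prod>j\<in>?U - {i}. L t $ j $ p j) = 0" if p: "p permutes ?U" "p \<noteq> id" for p i
  proof -
    obtain a where a: "p a \<noteq> a" using p by (auto simp: fun_eq_iff)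
    have inj: "inj p" using p(1) by (simp add: permutes_inj)
    obtain j where "j \<noteq> i" "p j \<noteq> j"
      using a inj by (metis injD)
    then have "\<exists>a\<in>?U - {i}. L t $ a $ p a = 0" by (intro bexI[of _ j]) (auto simp: L mat_def)
    then show ?thesis by (simp add: prod_zero)
  qed
  have "(\<Sum>p\<in>?PU. of_int (sign p) * (\<Sum>i\<in>?U. y *\<^sub>R D $ i $ p i * (\<Prod>j\<in>?U - {i}. L t $ j $ p j)))
      = (\<Sum>p\<in>{id}. of_int (sign p) * (\<Sum>i\<in>?U. y *\<^sub>R D $ i $ p i * (\<Prod>j\<in>?U - {i}. L t $ j $ p j)))" for y
    by (rule sum.mono_neutral_right) (auto simp: finite_permutations permutes_id z)
  also have "\<dots> y = y *\<^sub>R trace D" for y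
    by (simp add: L mat_def trace_def scaleR_sum_right)
  finally show ?thesis
    using der by (simp add: has_vector_derivative_def)
qed

text \<open>Left multiplication by the constant \<open>matrix_inv (M t)\<close> moves the base point
  to the identity.\<close>

lemma has_vector_derivative_det:
  fixes M :: "real \<Rightarrow> 'a::{euclidean_space,real_normed_field}^'n^'n"
  assumes D: "(M has_vector_derivative D) (at t within S)" and inv: "invertible (M t)"
  shows "((\<lambda>s. det (M s)) has_vector_derivative det (M t) * trace (matrix_inv (M t) ** D)) (at t within S)"
proof -
  have eq: "det (M s) = det (M t) * det (matrix_inv (M t) ** M s)" for s
    by (metis det_mul inv matrix_inv_right matrix_mul_assoc matrix_mul_lid)
  have "((\<lambda>s. matrix_inv (M t) ** M s) has_vector_derivative matrix_inv (M t) ** D) (at t within S)"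
    by (rule bounded_linear.has_vector_derivative[OF matrix_mult.bounded_linear_right D])
  from has_vector_derivative_det_at_one[OF this matrix_inv_left[OF inv]]
  have "((\<lambda>s. det (M t) * det (matrix_inv (M t) ** M s)) has_vector_derivative
     det (M t) * trace (matrix_inv (M t) ** D)) (at t within S)"
    by (rule has_vector_derivative_mult_right)
  then show ?thesis by (simp add: eq[symmetric])
qed

section \<open>The spectral theorem for real symmetric matrices\<close>

lemma symmetric_eigenvector_exists:
  fixes Q :: "real^'m^'m"
  assumes sym: "\<And>u v. u \<bullet> (Q *v v) = v \<bullet> (Q *v u)" and S: "subspace S" "S \<noteq> {0}"
    and inv: "\<And>v. v \<in> S \<Longrightarrow> Q *v v \<in> S"
  obtains v l where "v \<in> S" "norm v = 1" "Q *v v = l *\<^sub>R v"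
proof -
  let ?K = "S \<inter> sphere 0 1"
  have "compact ?K"
    by (simp add: S(1) closed_subspace closed_Int_compact)
  moreover have "?K \<noteq> {}"
  proof -
    obtain x where x: "x \<in> S" "x \<noteq> 0" using S subspace_0 by blast
    then have "x /\<^sub>R norm x \<in> ?K" by (simp add: S(1) subspace_scale)
    then show ?thesis by blast
  qed
  moreover have "continuous_on ?K (\<lambda>v. v \<bullet> (Q *v v))"
    by (intro continuous_intros matrix_vec_mult.continuous_on)
  ultimately have "\<exists>v\<in>?K. \<forall>x\<in>?K. x \<bullet> (Q *v x) \<le> v \<bullet> (Q *v v)"
    by (rule continuous_attains_sup)
  then obtain v where v: "v \<in> ?K" and max: "\<And>x. x \<in> ?K \<Longrightarrow> x \<bullet> (Q *v x) \<le> v \<bullet> (Q *v v)"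
    by (elim bexE) simp
  define l where "l = v \<bullet> (Q *v v)"
  have le: "x \<bullet> (Q *v x) \<le> l * (x \<bullet> x)" if "x \<in> S" for x
  proof (cases "x = 0")
    case False
    have "(x /\<^sub>R norm x) \<bullet> (Q *v (x /\<^sub>R norm x)) \<le> l"
      unfolding l_def by (rule max) (use that False S in \<open>simp add: subspace_scale\<close>)
    then have "(x \<bullet> (Q *v x)) / (norm x)\<^sup>2 \<le> l"
      by (simp add: matrix_vec_mult.scaleR_right power2_eq_square divide_inverse mult_ac)
    then show ?thesis using False by (simp add: divide_simps power2_norm_eq_inner)
  qed simp
  \<comment> \<open>Moving the maximiser in the direction of its own residual \<open>r\<close>
    changes the Rayleigh quotient at first order by \<open>2 * (r \<bullet> r)\<close>, so
    maximality forces \<open>r = 0\<close>. Invariance of the subspace keeps this direction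
    admissible.\<close>
  define r where "r = Q *v v - l *\<^sub>R v"
  have vS: "v \<in> S" and nv: "norm v = 1" using v by auto
  have vv: "v \<bullet> v = 1" using nv by (simp add: norm_eq_1)
  have rS: "r \<in> S" unfolding r_def using vS inv S by (simp add: subspace_diff subspace_scale)
  have quad: "2 * s * (r \<bullet> r) + s\<^sup>2 * (r \<bullet> (Q *v r) - l * (r \<bullet> r)) \<le> 0" for s
  proof -
    have "(v + s *\<^sub>R r) \<bullet> (Q *v (v + s *\<^sub>R r)) \<le> l * ((v + s *\<^sub>R r) \<bullet> (v + s *\<^sub>R r))"
      by (rule le) (use vS rS S in \<open>simp add: subspace_add subspace_scale\<close>)
    moreover have "v \<bullet> (Q *v r) = r \<bullet> (Q *v v)" by (rule sym)
    moreover have "r \<bullet> (Q *v v) = r \<bullet> r + l * (r \<bullet> v)"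
      unfolding r_def by (simp add: inner_diff_right inner_diff_left inner_commute algebra_simps)
    ultimately show ?thesis
      by (simp add: matrix_vec_mult.add_right matrix_vec_mult.scaleR_right inner_add_left inner_add_right
          l_def[symmetric] vv algebra_simps power2_eq_square inner_commute)
  qed
  have "r \<bullet> r = 0"
  proof (rule ccontr)
    assume "r \<bullet> r \<noteq> 0"
    then have pos: "r \<bullet> r > 0" by (simp add: order_less_le)
    define c where "c = \<bar>r \<bullet> (Q *v r) - l * (r \<bullet> r)\<bar> + 1"
    \<comment> \<open>Small enough for the quadratic term, bounded by
      \<open>s * c = r \<bullet> r\<close> after division by \<open>s\<close>, not to outweigh
      \<open>2 * (r \<bullet> r)\<close>.\<close>
    define s where "s = (r \<bullet> r) / c"
    have c: "c > 0" and s: "s > 0" using pos by (auto simp: c_def s_def)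
    have "s * (r \<bullet> (Q *v r) - l * (r \<bullet> r)) \<ge> - (s * c)"
      using s by (simp add: c_def flip: mult_minus_right)
    moreover have "s * c = r \<bullet> r" using c by (simp add: s_def)
    ultimately have "2 * (r \<bullet> r) + s * (r \<bullet> (Q *v r) - l * (r \<bullet> r)) > 0" using pos by linarith
    then have "s * (2 * (r \<bullet> r) + s * (r \<bullet> (Q *v r) - l * (r \<bullet> r))) > 0" using s by simp
    then show False using quad[of s] by (simp add: algebra_simps power2_eq_square)
  qed
  then have "Q *v v = l *\<^sub>R v" by (simp add: r_def)
  then show ?thesis using that vS nv by blast
qed

text \<open>Induction on the dimension: an eigenvector is split off, and its orthogonal complement
  in \<open>S\<close> is again invariant by symmetry.\<close>

lemma symmetric_orthonormal_eigenbasis: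
  fixes Q :: "real^'m^'m"
  assumes sym: "\<And>u v. u \<bullet> (Q *v v) = v \<bullet> (Q *v u)"
  shows "subspace S \<Longrightarrow> (\<And>v. v \<in> S \<Longrightarrow> Q *v v \<in> S) \<Longrightarrow>
    \<exists>B. B \<subseteq> S \<and> finite B \<and> card B = dim S \<and> pairwise orthogonal B \<and>
      (\<forall>b\<in>B. norm b = 1 \<and> (\<exists>l. Q *v b = l *\<^sub>R b))"
proof (induction "dim S" arbitrary: S)
  case 0
  then show ?case by (intro exI[of _ "{}"]) (auto simp: pairwise_def)
next
  case (Suc d)
  have "S \<noteq> {0}" using Suc.hyps(2) by auto
  from symmetric_eigenvector_exists[OF sym Suc.prems(1) this Suc.prems(2)]
  obtain v l where v: "v \<in> S" "norm v = 1" "Q *v v = l *\<^sub>R v" by metis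
  define T where "T = {x \<in> S. orthogonal v x}"
  have subT: "subspace T"
    using Suc.prems(1) unfolding T_def subspace_def
    by (auto simp: orthogonal_def inner_add_right)
  have invT: "Q *v x \<in> T" if "x \<in> T" for x
    using that Suc.prems(2) sym[of v x] by (auto simp: T_def orthogonal_def v(3) inner_commute)
  have "S = span (insert v T)"
  proof
    show "span (insert v T) \<subseteq> S"
      by (rule span_minimal) (use v Suc.prems(1) in \<open>auto simp: T_def\<close>)
    show "S \<subseteq> span (insert v T)"
    proof
      fix x assume x: "x \<in> S"
      have "x - (v \<bullet> x) *\<^sub>R v \<in> T"
        using x v Suc.prems(1)
        by (auto simp: T_def subspace_diff subspace_scale orthogonal_def inner_diff_right norm_eq_1)
      then have "(x - (v \<bullet> x) *\<^sub>R v) + (v \<bullet> x) *\<^sub>R v \<in> span (insert v T)"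
        by (intro span_add span_scale span_base) auto
      then show "x \<in> span (insert v T)" by simp
    qed
  qed
  moreover have vT: "v \<notin> span T"
    using v(2) subT by (auto simp: span_eq_iff[THEN iffD2] T_def orthogonal_def norm_eq_1)
  ultimately have dT: "dim S = Suc (dim T)"
    by (simp add: dim_insert)
  then obtain B where B: "B \<subseteq> T" "finite B" "card B = dim T" "pairwise orthogonal B"
      "\<forall>b\<in>B. norm b = 1 \<and> (\<exists>l. Q *v b = l *\<^sub>R b)"
    using Suc.hyps(1)[of T] Suc.hyps(2) subT invT by auto
  have "v \<notin> B" using vT B(1) span_base by blast
  then show ?case using B v dT
    by (intro exI[of _ "insert v B"])
      (auto simp: T_def pairwise_insert orthogonal_commute subset_iff)
qed

lemma symmetric_diagonalization:
  fixes Q :: "real^'m^'m"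
  assumes sym: "\<And>u v. u \<bullet> (Q *v v) = v \<bullet> (Q *v u)"
  obtains U :: "real^'m^'m" and d :: "'m \<Rightarrow> real"
  where "orthogonal_matrix U" "Q = U ** (\<chi> i j. if i = j then d i else 0) ** transpose U"
    "\<And>i. Q *v column i U = d i *\<^sub>R column i U" "\<And>i. norm (column i U) = 1"
proof -
  obtain B where B: "finite B" "card B = CARD('m)" "pairwise orthogonal B"
      "\<forall>b\<in>B. norm b = 1 \<and> (\<exists>l. Q *v b = l *\<^sub>R b)"
    using symmetric_orthonormal_eigenbasis[OF sym, of UNIV] by (auto simp: dim_UNIV)
  obtain e where e: "bij_betw e (UNIV::'m set) B"
    using B(1,2) finite_same_card_bij[of "UNIV::'m set" B] by auto
  have eB: "e i \<in> B" for i using e by (auto simp: bij_betw_def)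
  have "\<forall>i. \<exists>l. Q *v e i = l *\<^sub>R e i" using B(4) eB by blast
  then obtain d where d: "\<And>i. Q *v e i = d i *\<^sub>R e i" by metis
  have orth: "e i \<bullet> e j = (if i = j then 1 else 0)" for i j
  proof (cases "i = j")
    case False
    then have "e i \<noteq> e j" using e by (auto simp: bij_betw_def dest: injD)
    then show ?thesis using B(3) eB False unfolding pairwise_def orthogonal_def by auto
  qed (use B(4) eB in \<open>simp add: norm_eq_1\<close>)
  define U where "U = (\<chi> i j. e j $ i)"
  have col: "column j U = e j" for j by (simp add: column_def U_def vec_eq_iff)
  have OO: "orthogonal_matrix U"
    unfolding orthogonal_matrix
    by (simp add: vec_eq_iff matrix_mult_transpose_dot_column col orth mat_def)
  have QO: "Q ** U = U ** (\<chi> i j. if i = j then d i else 0)"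
  proof -
    have "(Q ** U) $ i $ j = (Q *v e j) $ i" for i j
      by (simp add: matrix_matrix_mult_def matrix_vector_mult_def U_def)
    moreover have "(U ** (\<chi> i j. if i = j then d i else 0)) $ i $ j = (d j *\<^sub>R e j) $ i" for i j
      by (simp add: matrix_matrix_mult_def U_def if_distrib cong: if_cong)
    ultimately show ?thesis by (simp add: vec_eq_iff d)
  qed
  have "Q = Q ** (U ** transpose U)"
    using OO by (simp add: orthogonal_matrix_def)
  then have "Q = U ** (\<chi> i j. if i = j then d i else 0) ** transpose U"
    by (simp add: matrix_mul_assoc QO)
  then show ?thesis using that OO d B(4) eB by (auto simp: col)
qed

section \<open>Determinant and trace inequalities for nonnegative symmetric matrices\<close>

lemma det_diag: "det (\<chi> i j. if i = j then d i else 0 :: 'a::comm_ring_1^'m^'m) = (\<Prod>i\<in>UNIV. d i)"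
  by (subst det_diagonal) auto

lemma det_orthogonal_conj:
  fixes U :: "real^'m^'m"
  assumes "orthogonal_matrix U"
  shows "det (U ** D ** transpose U) = det D" "trace (U ** D ** transpose U) = trace D"
proof -
  have "det U * det U = 1"
    using det_orthogonal_matrix[OF assms] by auto
  then show "det (U ** D ** transpose U) = det D"
    by (simp add: det_mul mult.commute mult.left_commute)
  have "trace (U ** D ** transpose U) = trace (transpose U ** (U ** D))" by (rule trace_mul_sym)
  then show "trace (U ** D ** transpose U) = trace D"
    using assms by (simp add: matrix_mul_assoc orthogonal_matrix_def)
qed

lemma AM_GM:
  fixes d :: "'m::finite \<Rightarrow> real"
  assumes "\<And>i. d i \<ge> 0"
  shows "(\<Prod>i\<in>UNIV. d i) powr (1 / real CARD('m)) \<le> (\<Sum>i\<in>UNIV. d i) / real CARD('m)"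
proof (cases "\<exists>i. d i = 0")
  case True
  then have z: "(\<Prod>i\<in>UNIV. d i) = 0" by (auto simp: prod_zero_iff)
  show ?thesis unfolding z by (simp add: sum_nonneg assms)
next
  case False
  then have pos: "d i > 0" and pos': "d i \<noteq> 0" for i using assms[of i] by (auto simp: order_less_le)
  let ?N = "real CARD('m)"
  have "(\<Sum>i\<in>UNIV. (1 / ?N) * ln (d i)) \<le> ln (\<Sum>i\<in>UNIV. (1 / ?N) * d i)"
  proof -
    have "concave_on {0<..} ln" by (rule ln_concave)
    then show ?thesis
      using concave_on_sum[of UNIV "{0<..}" ln "\<lambda>_. 1 / ?N" d] pos
      by (simp add: convex_real_interval)
  qed
  moreover have "ln (\<Prod>i\<in>UNIV. d i) = (\<Sum>i\<in>UNIV. ln (d i))"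
    by (rule ln_prod) (auto simp: pos')
  ultimately have "ln (\<Prod>i\<in>UNIV. d i) / ?N \<le> ln ((\<Sum>i\<in>UNIV. d i) / ?N)"
    by (simp flip: sum_divide_distrib)
  then have "exp (ln (\<Prod>i\<in>UNIV. d i) / ?N) \<le> exp (ln ((\<Sum>i\<in>UNIV. d i) / ?N))" by simp
  moreover have "(\<Sum>i\<in>UNIV. d i) > 0" by (rule sum_pos) (auto simp: pos)
  moreover have "(\<Prod>i\<in>UNIV. d i) > 0" by (rule prod_pos) (auto simp: pos)
  ultimately show ?thesis by (simp add: powr_def less_imp_neq[symmetric])
qed

lemma psd_det_le_trace:
  fixes Q :: "real^'m^'m"
  assumes sym: "\<And>u v. u \<bullet> (Q *v v) = v \<bullet> (Q *v u)" and psd: "\<And>u. u \<bullet> (Q *v u) \<ge> 0"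
  shows "det Q \<ge> 0" "det Q powr (1 / real CARD('m)) \<le> trace Q / real CARD('m)"
proof -
  obtain U d where U: "orthogonal_matrix U" "Q = U ** (\<chi> i j. if i = j then d i else 0) ** transpose U"
    and ev: "\<And>i. Q *v column i U = d i *\<^sub>R column i U" "\<And>i. norm (column i U) = 1"
    by (rule symmetric_diagonalization[OF sym]) (rule that)
  have d: "d i \<ge> 0" for i
    using psd[of "column i U"] ev[of i] by (simp add: norm_eq_1)
  have dQ: "det Q = (\<Prod>i\<in>UNIV. d i)" unfolding U(2) det_orthogonal_conj[OF U(1)] det_diag ..
  have tQ: "trace Q = (\<Sum>i\<in>UNIV. d i)"
    unfolding U(2) det_orthogonal_conj[OF U(1)] by (simp add: trace_def)
  show "det Q \<ge> 0" unfolding dQ by (intro prod_nonneg) (auto simp: d)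
  show "det Q powr (1 / real CARD('m)) \<le> trace Q / real CARD('m)"
    unfolding dQ tQ by (rule AM_GM) (rule d)
qed

text \<open>All eigenvalues are at least \<open>m\<close>, and since a Rayleigh quotient is a
  weighted mean of eigenvalues, one of them is at least \<open>K\<close>. This is how a single large
  direction of the form makes the determinant large.\<close>

lemma psd_det_lower_bound:
  fixes Q :: "real^'m^'m"
  assumes sym: "\<And>u v. u \<bullet> (Q *v v) = v \<bullet> (Q *v u)"
    and m: "\<And>u. u \<bullet> (Q *v u) \<ge> m * (u \<bullet> u)" "m > 0"
    and K: "v \<bullet> (Q *v v) \<ge> K * (v \<bullet> v)" "v \<noteq> 0"
  shows "det Q \<ge> m ^ (CARD('m) - 1) * K"
proof -
  obtain U d where U: "orthogonal_matrix U" "Q = U ** (\<chi> i j. if i = j then d i else 0) ** transpose U"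
    and ev: "\<And>i. Q *v column i U = d i *\<^sub>R column i U" "\<And>i. norm (column i U) = 1"
    by (rule symmetric_diagonalization[OF sym]) (rule that)
  have d: "d i \<ge> m" for i
    using m(1)[of "column i U"] ev[of i] by (simp add: norm_eq_1)
  have dQ: "det Q = (\<Prod>i\<in>UNIV. d i)" unfolding U(2) det_orthogonal_conj[OF U(1)] det_diag ..
  have "\<exists>i. d i \<ge> K"
  proof (rule ccontr)
    assume "\<not> ?thesis"
    then have lt: "d i < K" for i by (meson not_le)
    define y where "y = transpose U *v v"
    have vOy: "v = U *v y"
      using U(1) by (simp add: y_def matrix_vector_mul_assoc orthogonal_matrix_def del: transpose_matrix_vector)
    have dot: "(U *v a) \<bullet> b = a \<bullet> (transpose U *v b)" for a b
      using dot_lmul_matrix[of b U a] by (simp add: inner_commute)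
    have "v \<bullet> (Q *v v) = (\<Sum>i\<in>UNIV. d i * (y $ i)\<^sup>2)"
    proof -
      have "transpose U *v (Q *v v) = (\<chi> i j. if i = j then d i else 0) *v y"
        unfolding U(2) y_def using U(1)
        by (simp add: matrix_vector_mul_assoc orthogonal_matrix_def matrix_mul_assoc
            del: transpose_matrix_vector)
      then have "v \<bullet> (Q *v v) = y \<bullet> ((\<chi> i j. if i = j then d i else 0) *v y)"
        by (subst (1) vOy) (simp add: dot del: transpose_matrix_vector)
      also have "\<dots> = (\<Sum>i\<in>UNIV. d i * (y $ i)\<^sup>2)"
        by (simp add: inner_vec_def matrix_vector_mult_def if_distrib if_distribR power2_eq_square mult_ac cong: if_cong)
      finally show ?thesis .
    qed
    moreover have "v \<bullet> v = (\<Sum>i\<in>UNIV. (y $ i)\<^sup>2)"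
    proof -
      have "v \<bullet> v = y \<bullet> (transpose U *v v)" by (subst (1) vOy) (simp only: dot)
      then show ?thesis by (simp add: y_def[symmetric] inner_vec_def power2_eq_square del: transpose_matrix_vector)
    qed
    moreover have "(\<Sum>i\<in>UNIV. d i * (y $ i)\<^sup>2) < (\<Sum>i\<in>UNIV. K * (y $ i)\<^sup>2)"
    proof (rule sum_strict_mono_ex1)
      have "y \<noteq> 0" using vOy K(2) by auto
      then obtain i where "y $ i \<noteq> 0" by (auto simp: vec_eq_iff)
      then show "\<exists>a\<in>UNIV. d a * (y $ a)\<^sup>2 < K * (y $ a)\<^sup>2" using lt by (auto intro!: exI[of _ i])
    qed (use lt in \<open>simp_all add: mult_right_mono less_imp_le\<close>)
    ultimately show False using K(1) by (simp add: sum_distrib_left)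
  qed
  then obtain i where i: "d i \<ge> K" ..
  have "m ^ (CARD('m) - 1) = (\<Prod>j\<in>UNIV - {i}. m)" by simp
  also have "\<dots> \<le> (\<Prod>j\<in>UNIV - {i}. d j)" by (rule prod_mono) (use d m in auto)
  finally have 1: "m ^ (CARD('m) - 1) \<le> (\<Prod>j\<in>UNIV - {i}. d j)" .
  have "m ^ (CARD('m) - 1) * K \<le> m ^ (CARD('m) - 1) * d i" using i m(2) by simp
  also have "\<dots> \<le> (\<Prod>j\<in>UNIV - {i}. d j) * d i" using 1 d[of i] m(2) by (intro mult_right_mono) auto
  also have "\<dots> = det Q" unfolding dQ by (simp add: prod.remove[of UNIV i] mult.commute)
  finally show ?thesis .
qed

lemma matrix_mult_diag: "(B ** (\<chi> i j. if i = j then d i else 0)) $ i $ j = B $ i $ j * (d j :: 'a::semiring_1)"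
  by (simp add: matrix_matrix_mult_def if_distrib cong: if_cong)

lemma inner_transpose: "(transpose A *v u) \<bullet> v = u \<bullet> (A *v v)" "u \<bullet> (transpose A *v v) = (A *v u) \<bullet> v"
  for A :: "real^'n^'n"
  using dot_lmul_matrix[of u A v] dot_lmul_matrix[of v A u] by (simp_all add: inner_commute)

lemma transpose_mult_diag: "(transpose U ** B) $ i $ j = column i U \<bullet> column j B" for U B :: "real^'n^'n"
  by (simp add: matrix_matrix_mult_def transpose_def column_def inner_vec_def)

text \<open>In an orthonormal eigenbasis of \<open>Q\<close> the trace is the sum of the eigenvalues
  weighted by the values of the quadratic form of \<open>A\<close> on the basis vectors.\<close>

lemma trace_psd_mult_nonneg:
  fixes Q A :: "real^'m^'m"
  assumes sym: "\<And>u v. u \<bullet> (Q *v v) = v \<bullet> (Q *v u)" and psd: "\<And>u. u \<bullet> (Q *v u) \<ge> 0"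
    and A: "\<And>u. u \<bullet> (A *v u) \<ge> 0"
  shows "trace (A ** Q) \<ge> 0"
proof -
  obtain U d where U: "orthogonal_matrix U" "Q = U ** (\<chi> i j. if i = j then d i else 0) ** transpose U"
    and ev: "\<And>i. Q *v column i U = d i *\<^sub>R column i U" "\<And>i. norm (column i U) = 1"
    by (rule symmetric_diagonalization[OF sym]) (rule that)
  have d: "d i \<ge> 0" for i
    using psd[of "column i U"] ev[of i] by (simp add: norm_eq_1)
  have "trace (A ** Q) = trace (transpose U ** A ** U ** (\<chi> i j. if i = j then d i else 0))"
  proof -
    have "A ** Q = (A ** U ** (\<chi> i j. if i = j then d i else 0)) ** transpose U"
      unfolding U(2) by (simp add: matrix_mul_assoc)
    then show ?thesis by (simp only: trace_mul_sym[of _ "transpose U"] matrix_mul_assoc)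
  qed
  also have "\<dots> = (\<Sum>i\<in>UNIV. (transpose U ** A ** U) $ i $ i * d i)"
    unfolding trace_def by (rule sum.cong) (simp_all add: matrix_mult_diag)
  also have "\<dots> = (\<Sum>i\<in>UNIV. (column i U \<bullet> (A *v column i U)) * d i)"
  proof (rule sum.cong)
    fix i
    have "(transpose U ** A ** U) $ i $ i = (transpose U ** (A ** U)) $ i $ i" by (simp add: matrix_mul_assoc)
    also have "\<dots> = column i U \<bullet> column i (A ** U)"
      by (rule transpose_mult_diag)
    also have "column i (A ** U) = A *v column i U"
      by (simp add: column_def matrix_matrix_mult_def matrix_vector_mult_def vec_eq_iff)
    finally show "(transpose U ** A ** U) $ i $ i * d i = (column i U \<bullet> (A *v column i U)) * d i" by simp
  qed simp
  also have "\<dots> \<ge> 0" by (intro sum_nonneg mult_nonneg_nonneg A d)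
  finally show ?thesis .
qed

section \<open>The symplectic group and causal curves\<close>

lemma sum_UNIV_Plus:
  "(\<Sum>k\<in>(UNIV::('a::finite + 'b::finite) set). f k) = (\<Sum>j\<in>UNIV. f (Inl j)) + (\<Sum>j\<in>UNIV. f (Inr j))"
  by (subst UNIV_Plus_UNIV[symmetric]) (simp add: sum.Plus del: UNIV_Plus_UNIV)

lemma prod_UNIV_Plus:
  "(\<Prod>k\<in>(UNIV::('a::finite + 'b::finite) set). f k) = (\<Prod>j\<in>UNIV. f (Inl j)) * (\<Prod>j\<in>UNIV. f (Inr j))"
  by (subst UNIV_Plus_UNIV[symmetric]) (simp add: prod.Plus del: UNIV_Plus_UNIV)

lemma J0_mult_vec:
  "(J0 *v u) $ Inl j = - (u $ Inr j)" "(J0 *v u) $ Inr j = u $ Inl j"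
  by (simp_all add: J0_def matrix_vector_mult_def if_distribR sum_UNIV_Plus if_distrib sum.delta cong: if_cong)

lemma J0_J0 [simp]: "J0 *v (J0 *v u) = - u"
proof -
  have "(J0 *v (J0 *v u)) $ i = (- u) $ i" for i
    by (cases i) (simp_all add: J0_mult_vec)
  then show ?thesis by (simp add: vec_eq_iff)
qed

lemma J0_mult_J0: "J0 ** J0 = - mat 1"
  by (rule matrix_eq[THEN iffD2])
    (simp add: matrix_vec_mult.minus_left flip: matrix_vector_mul_assoc)

lemma omega0_inner: "omega0 u v = (J0 *v u) \<bullet> v"
  by (simp add: omega0_def inner_vec_def sum_UNIV_Plus J0_mult_vec sum_subtractf sum_negf)

interpretation omega: bounded_bilinear omega0
  unfolding omega0_inner bilinear_conv_bounded_bilinear[symmetric] bilinear_def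
  by (auto intro!: linearI simp: inner_add_left inner_add_right matrix_vec_mult.add_right matrix_vec_mult.scaleR_right)

lemma omega0_antisym: "omega0 u v = - omega0 v u"
  by (simp add: omega0_def sum_negf[symmetric] mult.commute)

lemma omega0_self [simp]: "omega0 u u = 0"
  using omega0_antisym[of u u] by simp

lemma omega0_J0_right: "omega0 u (J0 *v v) = u \<bullet> v"
proof -
  have "omega0 u (J0 *v v) = - omega0 (J0 *v v) u" by (rule omega0_antisym)
  then show ?thesis by (simp add: omega0_inner inner_commute)
qed

lemma omega0_J0_left: "omega0 (J0 *v u) v = - (u \<bullet> v)"
  by (simp add: omega0_inner)

lemma omega0_J0_J0: "omega0 (J0 *v u) (J0 *v v) = omega0 u v"
  by (simp only: omega0_J0_right) (simp add: omega0_inner)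

lemma omega0_nondegenerate: "(\<And>v. omega0 u v = 0) \<Longrightarrow> u = 0"
  using omega0_J0_right[of u u] by simp

lemma inner_J0_self [simp]: "u \<bullet> (J0 *v u) = 0" "(J0 *v u) \<bullet> u = 0"
proof -
  have "(J0 *v u) \<bullet> u = omega0 u u" by (simp only: omega0_inner)
  then show "(J0 *v u) \<bullet> u = 0" by simp
  then show "u \<bullet> (J0 *v u) = 0" by (simp add: inner_commute)
qed

lemma norm_J0 [simp]: "norm (J0 *v u) = norm u"
  using omega0_J0_J0[of u "J0 *v u"] omega0_J0_right[of u u]
  by (simp add: norm_eq_sqrt_inner omega0_inner)

lemma omega0_le_norm: "\<bar>omega0 u v\<bar> \<le> norm u * norm v"
  unfolding omega0_inner using Cauchy_Schwarz_ineq2[of "J0 *v u" v] by simp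

lemma Sp_omega0: "W \<in> Sp \<Longrightarrow> omega0 (W *v u) (W *v v) = omega0 u v"
  by (simp add: Sp_def)

lemma Sp_one [simp]: "mat 1 \<in> Sp" by (simp add: Sp_def)

lemma Sp_mult: "W \<in> Sp \<Longrightarrow> V \<in> Sp \<Longrightarrow> W ** V \<in> Sp"
  by (simp add: Sp_def flip: matrix_vector_mul_assoc)

lemma Sp_vec_eq_0: "W \<in> Sp \<Longrightarrow> W *v u = 0 \<longleftrightarrow> u = 0"
  using Sp_omega0[of W u "J0 *v u"] by (auto simp: omega0_J0_right omega.zero_left)

lemma invertible_iff_kernel: "invertible A \<longleftrightarrow> (\<forall>x. A *v x = 0 \<longrightarrow> x = 0)" for A :: "'a::field^'n^'n"
  by (simp add: invertible_left_inverse matrix_left_invertible_ker)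

lemma Sp_invertible: "W \<in> Sp \<Longrightarrow> invertible W"
  by (simp add: invertible_iff_kernel Sp_vec_eq_0)

lemma matrix_inv_vec: 
  fixes A :: "'a::field^'n^'n"
  assumes "invertible A"
  shows "A *v (matrix_inv A *v x) = x" "matrix_inv A *v (A *v x) = x"
  using assms by (simp_all add: matrix_vector_mul_assoc matrix_inv_left matrix_inv_right)

lemma Sp_inv: "W \<in> Sp \<Longrightarrow> matrix_inv W \<in> Sp"
proof -
  assume W: "W \<in> Sp"
  have "omega0 (matrix_inv W *v u) (matrix_inv W *v v) = omega0 u v" for u v
    using Sp_omega0[OF W, of "matrix_inv W *v u" "matrix_inv W *v v"]
    by (simp add: matrix_inv_vec Sp_invertible[OF W])
  then show ?thesis by (simp add: Sp_def)
qed

lemma closed_Sp: "closed Sp"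
proof -
  have "Sp = (\<Inter>u. \<Inter>v. {W. omega0 (W *v u) (W *v v) = omega0 u v})" by (auto simp: Sp_def)
  also have "closed \<dots>"
    by (intro closed_INT ballI closed_Collect_eq omega.continuous_on matrix_vec_mult.continuous_on
        continuous_on_id continuous_on_const)
  finally show ?thesis .
qed

lemma det_sign_path:
  fixes A :: "real \<Rightarrow> real^'m^'m"
  assumes "continuous_on {0..1} A" "\<And>t. t \<in> {0..1} \<Longrightarrow> det (A t) \<noteq> 0" "det (A 0) > 0"
  shows "det (A 1) > 0"
proof (rule ccontr)
  assume "\<not> ?thesis"
  then have "det (A 1) \<le> 0" by simp
  then obtain x where "0 \<le> x" "x \<le> 1" "det (A x) = 0"
    using IVT2'[of "\<lambda>t. det (A t)" 1 0 0] assms(3) continuous_on_det[OF assms(1)] by auto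
  then show False using assms(2) by auto
qed

lemma matrix_eqI_inner:
  fixes A B :: "real^'n^'m"
  assumes "\<And>u v. u \<bullet> (A *v v) = u \<bullet> (B *v v)"
  shows "A = B"
  unfolding matrix_eq using assms vector_eq_ldot by blast

lemma det_J0: "det (J0 :: 'n::finite sqm) = 1"
proof -
  \<comment> \<open>The segment from the identity to \<open>J0\<close> stays invertible because
    \<open>J0\<close> is skew, so \<open>det J0\<close> is positive; its square is found from
    \<open>J0 ** J0 = - mat 1\<close> in even dimension.\<close>
  let ?A = "\<lambda>s::real. (1 - s) *\<^sub>R mat 1 + s *\<^sub>R (J0 :: 'n sqm)"
  have "det (?A 1) > 0"
  proof (rule det_sign_path[of ?A])
    show "continuous_on {0..1} ?A" by (intro continuous_intros)
    fix t :: real assume "t \<in> {0..1}"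
    show "det (?A t) \<noteq> 0"
      unfolding invertible_det_nz[symmetric] invertible_iff_kernel
    proof (intro allI impI)
      fix x assume x: "?A t *v x = 0"
      then have e: "(1 - t) *\<^sub>R x + t *\<^sub>R (J0 *v x) = 0"
        by (simp add: matrix_vec_mult.add_left matrix_vec_mult.scaleR_left)
      have h1: "x \<bullet> ((1 - t) *\<^sub>R x + t *\<^sub>R (J0 *v x)) = (1 - t) * (x \<bullet> x)"
        by (simp add: inner_add_right)
      have h2: "(J0 *v x) \<bullet> ((1 - t) *\<^sub>R x + t *\<^sub>R (J0 *v x)) = t * (x \<bullet> x)"
        using omega0_J0_right[of x x] by (simp add: inner_add_right omega0_inner)
      have "(1 - t) * (x \<bullet> x) = 0" "t * (x \<bullet> x) = 0" using h1 h2 unfolding e by simp_all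
      then show "x = 0" by auto
    qed
  qed simp
  moreover have "det (J0 :: 'n sqm) * det (J0 :: 'n sqm) = det (- mat 1 :: 'n sqm)"
    by (simp add: det_mul[symmetric] J0_mult_J0)
  moreover have "- mat 1 = (\<chi> i j. if i = j then -1 else 0 :: real^('n+'n)^('n+'n))"
    by (simp add: vec_eq_iff mat_def)
  then have "det (- mat 1 :: 'n sqm) = 1"
    by (simp only: det_diag) (simp add: prod_UNIV_Plus power_mult_distrib[symmetric])
  ultimately show ?thesis by (simp add: square_eq_1_iff)
qed

text \<open>The symmetric matrix of the quadratic form attached to \<open>X\<close>. It carries the
  spectral theory of symmetric matrices over to \<open>sp\<close>, with the same
  determinant.\<close>

definition sform :: "'n::finite sqm \<Rightarrow> 'n sqm" where "sform X = - (J0 ** X)"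

lemma sform_inner: "u \<bullet> (sform X *v v) = omega0 u (X *v v)"
proof -
  have "u \<bullet> (sform X *v v) = - (u \<bullet> (J0 *v (X *v v)))"
    by (simp add: sform_def matrix_vec_mult.minus_left matrix_vector_mul_assoc)
  then show ?thesis using omega0_antisym[of u "X *v v"] by (simp add: omega0_inner inner_commute)
qed

lemma det_sform: "det (sform X) = det (X :: 'n::finite sqm)"
proof -
  have "sform X = (- J0) ** X"
    by (simp add: sform_def matrix_mult.minus_left)
  moreover have "(- J0 :: 'n sqm) = transpose J0"
  proof (rule matrix_eqI_inner)
    fix u v :: "real^('n+'n)"
    show "u \<bullet> (- J0 *v v) = u \<bullet> (transpose J0 *v v)"
      using omega0_antisym[of u v]
      by (simp add: inner_transpose omega0_inner matrix_vec_mult.minus_left inner_commute del: transpose_matrix_vector)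
  qed
  ultimately show ?thesis by (simp add: det_mul det_J0)
qed

lemma Sp_det_sq:
  fixes W :: "'a::finite sqm"
  assumes "W \<in> Sp" shows "det W * det W = 1"
proof -
  have "transpose W ** (J0 ** W) = J0"
  proof (rule matrix_eqI_inner)
    fix u v
    have "u \<bullet> ((transpose W ** (J0 ** W)) *v v) = (W *v u) \<bullet> (J0 *v (W *v v))"
      by (simp add: matrix_vector_mul_assoc[symmetric] inner_transpose del: transpose_matrix_vector)
    also have "\<dots> = omega0 (W *v v) (W *v u)" by (simp add: omega0_inner inner_commute)
    also have "\<dots> = u \<bullet> (J0 *v v)" by (simp add: Sp_omega0[OF assms]) (simp add: omega0_inner inner_commute)
    finally show "u \<bullet> ((transpose W ** (J0 ** W)) *v v) = u \<bullet> (J0 *v v)" .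
  qed
  then have "det (transpose W ** (J0 ** W)) = det (J0 :: 'a sqm)" by simp
  then show ?thesis by (simp add: det_J0 det_mul)
qed

lemma sp_sform_sym: "X \<in> sp \<Longrightarrow> u \<bullet> (sform X *v v) = v \<bullet> (sform X *v u)"
  by (simp add: sform_inner sp_def)

lemma closed_sp_nonneg: "closed {X \<in> (sp :: 'n::finite sqm set). \<forall>u. omega0 u (X *v u) \<ge> 0}"
proof -
  have "{X \<in> (sp :: 'n sqm set). \<forall>u. omega0 u (X *v u) \<ge> 0} =
     (\<Inter>u. \<Inter>v. {X. omega0 u (X *v v) = omega0 v (X *v u)}) \<inter> (\<Inter>u. {X. omega0 u (X *v u) \<ge> 0})"
    by (auto simp: sp_def)
  also have "closed \<dots>"
  proof -
    have c: "continuous_on UNIV (\<lambda>X. omega0 u (X *v v))" for u v :: "real^('n+'n)"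
      by (intro omega.continuous_on matrix_vec_mult.continuous_on continuous_on_id continuous_on_const)
    show ?thesis
      by (intro closed_Int closed_INT ballI closed_Collect_eq[OF c c] closed_Collect_le[OF continuous_on_const c])
  qed
  finally show ?thesis .
qed

section \<open>The closed cone and the function \<open>G\<close>\<close>

lemma closure_sp_plus: "closure sp_plus = {X \<in> sp. \<forall>u. omega0 u (X *v u) \<ge> 0}"
proof
  show "closure sp_plus \<subseteq> {X \<in> sp. \<forall>u. omega0 u (X *v u) \<ge> 0}"
    by (rule closure_minimal[OF _ closed_sp_nonneg])
      (auto simp: sp_plus_def intro: less_imp_le[of 0] dest: spec[of _ 0], metis less_imp_le matrix_vec_mult.zero_right omega0_self order_refl)
  show "{X \<in> sp. \<forall>u. omega0 u (X *v u) \<ge> 0} \<subseteq> closure sp_plus"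
  proof
    fix X :: "'n::finite sqm" assume X: "X \<in> {X \<in> sp. \<forall>u. omega0 u (X *v u) \<ge> 0}"
    \<comment> \<open>\<open>J0\<close> itself is a positive element, its form being the inner
      product, so adding small multiples of it approaches \<open>X\<close> from inside
      \<open>sp_plus\<close>.\<close>
    let ?f = "\<lambda>k. X + (1 / real (Suc k)) *\<^sub>R J0"
    have "?f k \<in> sp_plus" for k
      using X unfolding sp_plus_def sp_def
      by (auto simp: matrix_vec_mult.add_left matrix_vec_mult.scaleR_left omega.add_right omega.scaleR_right
          omega0_J0_right inner_commute intro!: add_nonneg_pos)
    moreover have "?f \<longlonglongrightarrow> X + 0 *\<^sub>R J0"
      by (intro tendsto_intros LIMSEQ_Suc lim_1_over_n)
    ultimately show "X \<in> closure sp_plus" unfolding closure_sequential by (intro exI[of _ ?f]) simp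
  qed
qed

text \<open>If the cross term did not vanish, the form would be affine in \<open>s\<close> along
  \<open>u + s v\<close> with nonzero slope and would take negative values. The conclusion is about
  the symmetrised form because the forms \<open>omega0 u (W *v v)\<close> of group elements are not
  symmetric.\<close>

lemma psd_kernel:
  fixes f :: "'a::real_vector \<Rightarrow> 'a \<Rightarrow> real"
  assumes bil: "\<And>u v s. f (u + s *\<^sub>R v) (u + s *\<^sub>R v) = f u u + s * (f u v + f v u) + s\<^sup>2 * f v v"
    and psd: "\<And>u. f u u \<ge> 0" and 0: "f v v = 0"
  shows "f v u + f u v = 0"
proof (rule ccontr)
  let ?b = "f u v + f v u"
  assume "f v u + f u v \<noteq> 0"
  then have b: "?b \<noteq> 0" by (simp add: add.commute)
  define s where "s = - (f u u + 1) / ?b"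
  have "f (u + s *\<^sub>R v) (u + s *\<^sub>R v) = f u u + s * ?b" using bil[of u s v] 0 by simp
  also have "s * ?b = - (f u u + 1)" using b by (simp add: s_def)
  finally show False using psd[of "u + s *\<^sub>R v"] by simp
qed

lemma add_self_eq_zero: "a + a = 0 \<Longrightarrow> a = (0::real)" by simp

text \<open>On the boundary of the cone a null vector of the form lies in the kernel of
  \<open>X\<close>, so the determinant vanishes there and the value \<open>0\<close> given to
  \<open>G\<close> agrees with the root of the determinant. Continuity of \<open>G\<close> up to the
  boundary rests on this.\<close>

lemma closure_sp_plus_det:
  fixes X :: "'n::finite sqm"
  assumes X: "X \<in> closure sp_plus"
  shows "det X \<ge> 0" "G X = det X powr (1 / real CARD('n + 'n))"
proof -
  have sp: "X \<in> sp" and nn: "\<And>u. omega0 u (X *v u) \<ge> 0" using X by (auto simp: closure_sp_plus)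
  show d: "det X \<ge> 0"
    using psd_det_le_trace(1)[OF sp_sform_sym[OF sp]] nn by (simp add: sform_inner det_sform)
  show "G X = det X powr (1 / real CARD('n + 'n))"
  proof (cases "X \<in> sp_plus")
    case False
    then obtain v where v: "v \<noteq> 0" "omega0 v (X *v v) = 0"
      using sp nn by (force simp: sp_plus_def less_le)
    have "omega0 v (X *v u) + omega0 u (X *v v) = 0" for u
      by (rule psd_kernel[where f = "\<lambda>u v. omega0 u (X *v v)"])
        (use v nn in \<open>auto simp: matrix_vec_mult.add_right matrix_vec_mult.scaleR_right omega.add_right omega.add_left
          omega.scaleR_right omega.scaleR_left algebra_simps power2_eq_square\<close>)
    moreover have "omega0 v (X *v u) = omega0 u (X *v v)" for u using sp by (simp add: sp_def)
    ultimately have "omega0 u (X *v v) = 0" for u by (metis add_self_eq_zero)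
    then have "omega0 (X *v v) u = 0" for u using omega0_antisym[of "X *v v" u] by simp
    then have "X *v v = 0" by (rule omega0_nondegenerate)
    then have "\<not> invertible X" using v(1) by (auto simp: invertible_iff_kernel)
    then have "det X = 0" by (simp add: invertible_det_nz)
    then show ?thesis using False by (simp add: G_def)
  qed (simp add: G_def)
qed

lemma continuous_on_G: "continuous_on (closure sp_plus) (G :: 'n::finite sqm \<Rightarrow> real)"
proof -
  have "continuous_on (closure sp_plus) (\<lambda>X :: 'n sqm. det X powr (1 / real CARD('n + 'n)))"
    by (rule continuous_on_powr') (auto intro!: continuous_on_det continuous_intros closure_sp_plus_det)
  then show ?thesis by (rule continuous_on_eq) (simp add: closure_sp_plus_det)
qed

lemma G_nonneg: "G X \<ge> 0" by (simp add: G_def)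

lemma G_lower_bound:
  fixes X :: "'n::finite sqm"
  assumes X: "X \<in> sp" and m: "\<And>u. omega0 u (X *v u) \<ge> m * (u \<bullet> u)" "m > 0"
    and K: "omega0 v (X *v v) \<ge> K * (v \<bullet> v)" "v \<noteq> 0" "K \<ge> 0"
  shows "G X \<ge> (m ^ (CARD('n + 'n) - 1) * K) powr (1 / real CARD('n + 'n))"
proof -
  have nn: "omega0 u (X *v u) \<ge> 0" for u
    using m(1)[of u] m(2) by (meson inner_ge_zero mult_nonneg_nonneg less_imp_le order_trans)
  have "X \<in> closure sp_plus" using X nn by (simp add: closure_sp_plus)
  moreover have "det X \<ge> m ^ (CARD('n + 'n) - 1) * K"
    using psd_det_lower_bound[where Q = "sform X" and m = m and v = v and K = K, OF sp_sform_sym[OF X]] m K by (simp add: sform_inner det_sform)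
  ultimately show ?thesis
    using m(2) K(3) by (simp add: closure_sp_plus_det powr_mono2)
qed

text \<open>Congruence by a symplectic \<open>M\<close> leaves the determinant alone, so AM-GM
  applies to the form in any symplectic frame; later \<open>M\<close> is the frame of the normal
  form.\<close>

lemma G_le_trace:
  fixes X :: "'n::finite sqm"
  assumes X: "X \<in> closure sp_plus" and M: "M \<in> Sp"
  shows "real CARD('n + 'n) * G X \<le> trace (transpose M ** sform X ** M)"
proof -
  let ?P = "transpose M ** sform X ** M"
  have sp: "X \<in> sp" and nn: "\<And>u. omega0 u (X *v u) \<ge> 0" using X by (auto simp: closure_sp_plus)
  have P: "u \<bullet> (?P *v v) = (M *v u) \<bullet> (sform X *v (M *v v))" for u v
    by (simp add: matrix_vector_mul_assoc[symmetric] inner_transpose del: transpose_matrix_vector)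
  have "det ?P powr (1 / real CARD('n + 'n)) \<le> trace ?P / real CARD('n + 'n)"
    by (rule psd_det_le_trace(2)) (simp_all only: P sform_inner nn, metis sform_inner sp sp_sform_sym)
  moreover have "det ?P = det X" using Sp_det_sq[OF M] by (simp add: det_mul det_sform)
  ultimately show ?thesis using X
    by (simp add: closure_sp_plus_det field_simps)
qed

text \<open>The derivative is carried as an explicit function \<open>D\<close>, so that product and
  quotient constructions can state theirs instead of going through
  \<open>vector_derivative\<close>.\<close>

definition c1sp :: "(real \<Rightarrow> 'n::finite sqm) \<Rightarrow> (real \<Rightarrow> 'n sqm) \<Rightarrow> bool" where
  "c1sp c D \<longleftrightarrow> (\<forall>t\<in>{0..1}. (c has_vector_derivative D t) (at t within {0..1}) \<and> c t \<in> Sp)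
     \<and> continuous_on {0..1} D"

lemma c1sp_C1:
  assumes "c1sp c D"
  shows "C1_curve c" "\<And>t. t \<in> {0..1} \<Longrightarrow> c t \<in> Sp" "\<And>t. t \<in> {0..1} \<Longrightarrow> logder c t = D t ** matrix_inv (c t)"
    "continuous_on {0..1} c" "continuous_on {0..1} D"
    "\<And>t. t \<in> {0..1} \<Longrightarrow> (c has_vector_derivative D t) (at t within {0..1})"
proof -
  have d: "(c has_vector_derivative D t) (at t within {0..1})" if "t \<in> {0..1}" for t
    using assms that by (auto simp: c1sp_def)
  have vd: "vector_derivative c (at t within {0..1}) = D t" if "t \<in> {0..1}" for t
    using vector_derivative_within_closed_interval[OF _ _ d[OF that]] that by auto
  show "continuous_on {0..1} D" using assms by (simp add: c1sp_def)
  then have "continuous_on {0..1} (\<lambda>t. vector_derivative c (at t within {0..1}))"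
    by (rule continuous_on_eq) (simp add: vd)
  then show "C1_curve c" unfolding C1_curve_def
    using differentiableI_vector[OF d] by blast
  show "\<And>t. t \<in> {0..1} \<Longrightarrow> c t \<in> Sp" using assms by (auto simp: c1sp_def)
  show "\<And>t. t \<in> {0..1} \<Longrightarrow> logder c t = D t ** matrix_inv (c t)" by (simp add: logder_def vd)
  show "continuous_on {0..1} c"
    by (meson continuous_on_eq_continuous_within d has_vector_derivative_continuous)
qed (use assms in \<open>auto simp: c1sp_def\<close>)

lemma C1_c1sp:
  assumes "C1_curve c" "\<forall>t\<in>{0..1}. c t \<in> Sp"
  shows "c1sp c (\<lambda>t. vector_derivative c (at t within {0..1}))"
  using assms by (simp add: c1sp_def C1_curve_def vector_derivative_works)

text \<open>Differentiating the constant \<open>omega0 (c t *v u) (c t *v v)\<close> gives the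
  symmetry that puts the logarithmic derivative into \<open>sp\<close>.\<close>

lemma c1sp_antisym:
  assumes "c1sp c D" "t \<in> {0..1}"
  shows "omega0 (c t *v u) (D t *v v) = omega0 (c t *v v) (D t *v u)"
proof -
  have d: "((\<lambda>s. c s *v x) has_vector_derivative D t *v x) (at t within {0..1})" for x
    by (rule bounded_linear.has_vector_derivative[OF matrix_vec_mult.bounded_linear_left])
      (use assms in \<open>auto simp: c1sp_def\<close>)
  have "((\<lambda>s. omega0 (c s *v u) (c s *v v)) has_vector_derivative
      (omega0 (c t *v u) (D t *v v) + omega0 (D t *v u) (c t *v v))) (at t within {0..1})"
    by (rule omega.has_vector_derivative[OF d d])
  moreover have "((\<lambda>s. omega0 (c s *v u) (c s *v v)) has_vector_derivative 0) (at t within {0..1})"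
    by (rule has_vector_derivative_transform[where f = "\<lambda>_. omega0 u v"])
      (use assms in \<open>auto simp: c1sp_def Sp_omega0\<close>)
  ultimately have "omega0 (c t *v u) (D t *v v) + omega0 (D t *v u) (c t *v v) = 0"
    using vector_derivative_unique_within_closed_interval[of 0 1 t] assms(2) by simp
  then show ?thesis using omega0_antisym[of "D t *v u" "c t *v v"] by simp
qed

text \<open>Evaluation at \<open>c t *v v\<close> cancels the inverse in \<open>logder\<close>.
  Positivity is therefore tested below on \<open>omega0 (c t *v v) (D t *v v)\<close>.\<close>

lemma logder_form:
  assumes "c1sp c D" "t \<in> {0..1}"
  shows "omega0 (c t *v u) (logder c t *v (c t *v v)) = omega0 (c t *v u) (D t *v v)"
  using c1sp_C1[OF assms(1)] assms(2) Sp_invertible[of "c t"]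
  by (simp add: matrix_vector_mul_assoc[symmetric] matrix_inv_vec)

lemma logder_form':
  assumes "c1sp c D" "t \<in> {0..1}"
  shows "omega0 u (logder c t *v v) = omega0 (c t *v (matrix_inv (c t) *v u)) (D t *v (matrix_inv (c t) *v v))"
  using logder_form[OF assms, of "matrix_inv (c t) *v u" "matrix_inv (c t) *v v"]
    c1sp_C1[OF assms(1)] assms(2) Sp_invertible[of "c t"]
  by (simp add: matrix_inv_vec)

lemma logder_sp:
  assumes "c1sp c D" "t \<in> {0..1}"
  shows "logder c t \<in> sp"
  unfolding sp_def using logder_form'[OF assms] c1sp_antisym[OF assms] by auto

text \<open>Causality without the requirement that the logarithmic derivative be nonzero. This
  weaker notion is stable under products and under the fractional linear maps below.\<close>

definition wcausal :: "(real \<Rightarrow> 'n::finite sqm) \<Rightarrow> (real \<Rightarrow> 'n sqm) \<Rightarrow> bool" where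
  "wcausal c D \<longleftrightarrow> c1sp c D \<and> (\<forall>t\<in>{0..1}. \<forall>v. omega0 (c t *v v) (D t *v v) \<ge> 0)"

lemma wcausal_logder:
  assumes "c1sp c D"
  shows "wcausal c D \<longleftrightarrow> (\<forall>t\<in>{0..1}. logder c t \<in> closure sp_plus)"
proof
  assume "wcausal c D"
  then show "\<forall>t\<in>{0..1}. logder c t \<in> closure sp_plus"
    using logder_sp[OF assms] by (auto simp: wcausal_def closure_sp_plus logder_form'[OF assms])
next
  assume *: "\<forall>t\<in>{0..1}. logder c t \<in> closure sp_plus"
  have "omega0 (c t *v v) (D t *v v) \<ge> 0" if "t \<in> {0..1}" for t v
    using * that unfolding closure_sp_plus logder_form[OF assms that, symmetric] by auto
  then show "wcausal c D" using assms by (auto simp: wcausal_def)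
qed

lemma timelike_logder:
  assumes "c1sp c D" "t \<in> {0..1}"
  shows "logder c t \<in> sp_plus \<longleftrightarrow> (\<forall>v. v \<noteq> 0 \<longrightarrow> omega0 (c t *v v) (D t *v v) > 0)"
proof -
  have S: "c t \<in> Sp" "matrix_inv (c t) \<in> Sp" using c1sp_C1[OF assms(1)] assms(2) Sp_inv by auto
  show ?thesis
    using logder_sp[OF assms] logder_form'[OF assms] logder_form[OF assms] S
    unfolding sp_plus_def by (auto simp: Sp_vec_eq_0) (metis Sp_vec_eq_0)
qed

lemma continuous_on_logder:
  assumes "c1sp c D"
  shows "continuous_on {0..1} (logder c)"
proof -
  have "continuous_on {0..1} (\<lambda>t. D t ** matrix_inv (c t))"
    using c1sp_C1[OF assms]
    by (intro matrix_mult.continuous_on continuous_on_matrix_inv) (auto simp: Sp_invertible)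
  then show ?thesis
    by (rule continuous_on_eq) (simp add: c1sp_C1[OF assms])
qed

lemma continuous_on_G_logder:
  assumes "wcausal c D"
  shows "continuous_on {0..1} (\<lambda>t. G (logder c t))"
proof -
  have "c1sp c D" using assms by (simp add: wcausal_def)
  then show ?thesis
    using wcausal_logder[of c D] assms
    by (intro continuous_on_compose2[OF continuous_on_G continuous_on_logder]) auto
qed

text \<open>The logarithmic derivative of a product is the first one plus a conjugate of the second,
  and symplectic conjugation preserves the cone; the second claim is this additivity of the
  forms.\<close>

lemma wcausal_mult:
  assumes a: "wcausal a A" and b: "wcausal b B"
  shows "wcausal (\<lambda>t. a t ** b t) (\<lambda>t. a t ** B t + A t ** b t)"
    and "t \<in> {0..1} \<Longrightarrow> omega0 ((a t ** b t) *v v) ((a t ** B t + A t ** b t) *v v)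
       = omega0 (b t *v v) (B t *v v) + omega0 (a t *v (b t *v v)) (A t *v (b t *v v))"
proof -
  have a1: "c1sp a A" and b1: "c1sp b B" using a b by (auto simp: wcausal_def)
  note A = c1sp_C1[OF a1] and B = c1sp_C1[OF b1]
  show eq: "omega0 ((a t ** b t) *v v) ((a t ** B t + A t ** b t) *v v)
       = omega0 (b t *v v) (B t *v v) + omega0 (a t *v (b t *v v)) (A t *v (b t *v v))" if "t \<in> {0..1}" for t v
    using A(2)[OF that]
    by (simp add: matrix_vec_mult.add_left omega.add_right matrix_vector_mul_assoc[symmetric] Sp_omega0)
  have "c1sp (\<lambda>t. a t ** b t) (\<lambda>t. a t ** B t + A t ** b t)"
    unfolding c1sp_def using A B
    by (auto intro!: matrix_mult.has_vector_derivative Sp_mult continuous_intros matrix_mult.continuous_on)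
  then show "wcausal (\<lambda>t. a t ** b t) (\<lambda>t. a t ** B t + A t ** b t)"
    using a b eq by (auto simp: wcausal_def)
qed

lemma fractional_Sp:
  fixes De :: "'n::finite sqm"
  assumes inv: "invertible De" and eq: "\<And>u v. omega0 (Nu *v u) (Nu *v v) = omega0 (De *v u) (De *v v)"
  shows "Nu ** matrix_inv De \<in> Sp"
  unfolding Sp_def using inv by (simp add: matrix_vector_mul_assoc[symmetric] eq matrix_inv_vec)

text \<open>Covers both \<open>push\<close> and \<open>eta\<close>, which are quotients of two
  matrices pulling \<open>omega0\<close> back to the same form. Evaluating at
  \<open>De t *v v\<close> keeps inverses out of the computation of the form.\<close>

lemma fractional_curve:
  fixes Nu De :: "real \<Rightarrow> 'n::finite sqm"
  assumes Nu: "\<And>t. t \<in> {0..1} \<Longrightarrow> (Nu has_vector_derivative Nu' t) (at t within {0..1})"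
    and De: "\<And>t. t \<in> {0..1} \<Longrightarrow> (De has_vector_derivative De' t) (at t within {0..1})"
    and cont: "continuous_on {0..1} Nu'" "continuous_on {0..1} De'"
    and inv: "\<And>t. t \<in> {0..1} \<Longrightarrow> invertible (De t)"
    and eq: "\<And>t u v. t \<in> {0..1} \<Longrightarrow> omega0 (Nu t *v u) (Nu t *v v) = omega0 (De t *v u) (De t *v v)"
  defines "C \<equiv> \<lambda>t. Nu t ** matrix_inv (De t)"
  defines "D \<equiv> \<lambda>t. Nu t ** (- (matrix_inv (De t) ** De' t ** matrix_inv (De t))) + Nu' t ** matrix_inv (De t)"
  shows "c1sp C D"
    and "\<And>t u v. t \<in> {0..1} \<Longrightarrow> omega0 (C t *v (De t *v u)) (D t *v (De t *v v))
        = omega0 (Nu t *v u) (Nu' t *v v) - omega0 (De t *v u) (De' t *v v)"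
proof -
  have cN: "continuous_on {0..1} Nu" and cD: "continuous_on {0..1} De"
    by (meson continuous_on_eq_continuous_within Nu De has_vector_derivative_continuous)+
  have Sp: "C t \<in> Sp" if "t \<in> {0..1}" for t
    unfolding C_def by (rule fractional_Sp) (use that inv eq in auto)
  show "c1sp C D"
    unfolding c1sp_def
  proof (intro conjI ballI)
    fix t :: real assume t: "t \<in> {0..1}"
    show "(C has_vector_derivative D t) (at t within {0..1})"
      unfolding C_def D_def
      by (intro matrix_mult.has_vector_derivative has_vector_derivative_matrix_inv Nu De t inv cD)
    show "C t \<in> Sp" by (rule Sp[OF t])
  next
    show "continuous_on {0..1} D"
      unfolding D_def
      by (intro continuous_intros matrix_mult.continuous_on continuous_on_matrix_inv cN cD cont inv)
  qed
  fix t u v assume t: "t \<in> {0..1::real}"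
  have Cx: "C t *v (De t *v x) = Nu t *v x" for x
    using inv[OF t] by (simp add: C_def matrix_vector_mul_assoc[symmetric] matrix_inv_vec)
  have "D t *v (De t *v v) = Nu' t *v v - C t *v (De' t *v v)"
    using inv[OF t]
    by (simp add: D_def C_def matrix_vec_mult.diff_left matrix_vec_mult.add_left matrix_vec_mult.minus_left matrix_mult.minus_right
        matrix_vector_mul_assoc[symmetric] matrix_inv_vec)
  then show "omega0 (C t *v (De t *v u)) (D t *v (De t *v v))
        = omega0 (Nu t *v u) (Nu' t *v v) - omega0 (De t *v u) (De' t *v v)"
    using Sp_omega0[OF Sp[OF t], of "De t *v u" "De' t *v v"]
    by (simp add: omega.diff_right Cx)
qed

section \<open>Generalised eigenspaces\<close>

definition sh :: "complex^'m^'m \<Rightarrow> complex \<Rightarrow> complex^'m \<Rightarrow> complex^'m" where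
  "sh M l x = M *v x - l *s x"

text \<open>Stated for complex matrices of any size, since it is applied both to
  \<open>cplx W\<close> and to the half-size matrices \<open>TK\<close> below.\<close>

definition gker :: "complex^'m^'m \<Rightarrow> complex \<Rightarrow> (complex^'m) set" where
  "gker M l = {v. (sh M l ^^ CARD('m)) v = 0}"

lemma geneig_eq_gker: "geneig W l = gker (cplx W) l"
  by (simp add: geneig_def gker_def sh_def[abs_def])

lemma mv_scale: "M *v (c *s x) = c *s (M *v x)" for M :: "complex^'n^'m"
  by (simp add: vec.scale)

lemma mv_add: "M *v (x + y) = M *v x + M *v y" for M :: "complex^'n^'m"
  by (simp add: vec.add)

lemma mv_diff: "M *v (x - y) = M *v x - M *v y" for M :: "complex^'n^'m"
  by (simp add: vec.diff)

lemma sh_add: "sh M l (x + y) = sh M l x + sh M l y"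
  by (simp add: sh_def mv_add vec.scale_right_distrib)

lemma sh_scale: "sh M l (c *s x) = c *s sh M l x"
  by (simp add: sh_def mv_scale vec.scale_right_diff_distrib mult.commute)

lemma sh_zero [simp]: "sh M l 0 = 0" by (simp add: sh_def)

lemma sh_pow_add: "(sh M l ^^ k) (x + y) = (sh M l ^^ k) x + (sh M l ^^ k) y"
  by (induct k) (simp_all add: sh_add)

lemma sh_pow_scale: "(sh M l ^^ k) (c *s x) = c *s (sh M l ^^ k) x"
  by (induct k) (simp_all add: sh_scale)

lemma sh_pow_zero [simp]: "(sh M l ^^ k) 0 = 0"
  by (induct k) simp_all

lemma sh_comm: "sh M a (sh M b x) = sh M b (sh M a x)"
  by (simp add: sh_def mv_diff mv_scale vec.scale_right_diff_distrib mult.commute)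

lemma sh_pow_comm: "sh M a ((sh M b ^^ k) x) = (sh M b ^^ k) (sh M a x)"
proof (induct k)
  case (Suc k)
  then show ?case using sh_comm[of M a b "(sh M b ^^ k) x"] by simp
qed simp

lemma sh_pow_mv: "M *v ((sh M b ^^ k) x) = (sh M b ^^ k) (M *v x)"
  using sh_pow_comm[where a = 0 and M = M and b = b and k = k and x = x] by (simp add: sh_def[of M 0])

text \<open>The kernels of successive powers form a chain that is constant once two neighbours
  agree, and strict growth for more than \<open>CARD('m)\<close> steps would exceed the dimension.
  Hence any power may witness membership in \<open>gker\<close>.\<close>

lemma sh_kernel_stable:
  fixes M :: "complex^'m^'m"
  assumes k: "(sh M l ^^ k) x = 0"
  shows "x \<in> gker M l"
proof -
  define Ker where "Ker i = {x. (sh M l ^^ i) x = 0}" for i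
  have sub: "vec.subspace (Ker i)" for i
    by (auto simp: vec.subspace_def Ker_def sh_pow_add sh_pow_scale)
  have step: "Ker i \<subseteq> Ker (Suc i)" for i by (auto simp: Ker_def)
  have mono: "i \<le> j \<Longrightarrow> Ker i \<subseteq> Ker j" for i j
    by (rule lift_Suc_mono_le[of Ker]) (use step in auto)
  have Suc_iff: "x \<in> Ker (Suc i) \<longleftrightarrow> sh M l x \<in> Ker i" for x i
    by (simp add: Ker_def sh_pow_comm)
  have prp: "Ker (Suc i) = Ker (Suc (Suc i))" if "Ker i = Ker (Suc i)" for i
    using that Suc_iff by blast
  have "\<exists>i\<le>CARD('m). Ker i = Ker (Suc i)"
  proof (rule ccontr)
    assume "\<not> ?thesis"
    then have str: "Ker i \<subset> Ker (Suc i)" if "i \<le> CARD('m)" for i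
      using that step[of i] by blast
    have "i \<le> Suc CARD('m) \<Longrightarrow> i \<le> vec.dim (Ker i)" for i
    proof (induction i)
      case (Suc i)
      have "vec.dim (Ker i) < vec.dim (Ker (Suc i))"
        by (rule vec.dim_psubset) (use sub str[of i] Suc.prems in \<open>simp add: vec.span_eq_iff[THEN iffD2]\<close>)
      then show ?case using Suc by simp
    qed simp
    from this[of "Suc CARD('m)"] have "Suc CARD('m) \<le> vec.dim (Ker (Suc CARD('m)))" by simp
    moreover have "vec.dim (Ker (Suc CARD('m))) \<le> CARD('m)"
      using vec.dim_subset_UNIV[of "Ker (Suc CARD('m))"] by (simp add: vec.dimension_def card_cart_basis)
    ultimately show False by simp
  qed
  then obtain i where i: "i \<le> CARD('m)" "Ker i = Ker (Suc i)" by blast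
  have eq: "Ker (i + j) = Ker i \<and> Ker (Suc (i + j)) = Ker i" for j
    using i(2) prp by (induction j) auto
  have "x \<in> Ker k" using k by (simp add: Ker_def)
  then have "x \<in> Ker CARD('m)"
  proof (cases "k \<le> CARD('m)")
    case False
    then have "Ker k = Ker i" using eq[of "k - i"] i(1) by simp
    then show ?thesis using \<open>x \<in> Ker k\<close> mono[OF i(1)] by blast
  qed (use mono in blast)
  then show ?thesis by (simp add: Ker_def gker_def)
qed

lemma gker_subspace: "vec.subspace (gker M l)"
  by (auto simp: vec.subspace_def gker_def sh_pow_add sh_pow_scale)

lemma gker_sh: "x \<in> gker M l \<Longrightarrow> sh M a x \<in> gker M l"
  by (simp add: gker_def flip: sh_pow_comm)

lemma gker_mv: "x \<in> gker M l \<Longrightarrow> M *v x \<in> gker M l"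
  by (simp add: gker_def flip: sh_pow_mv)

lemma gker_sh_pow: "x \<in> gker M l \<Longrightarrow> (sh M a ^^ k) x \<in> gker M l"
  by (induct k) (auto simp: gker_sh)

lemma eigenvector_gker: "M *v x = l *s x \<Longrightarrow> x \<in> gker M l"
  by (rule sh_kernel_stable[where k = 1]) (simp add: sh_def)

lemma gker_sh_inj:
  assumes "x \<in> gker M m" "sh M a x = 0" "a \<noteq> m"
  shows "x = 0"
proof -
  have "sh M m x = (a - m) *s x" using assms(2) by (simp add: sh_def vec.scale_left_diff_distrib)
  then have "(sh M m ^^ k) x = (a - m) ^ k *s x" for k
  proof (induct k)
    case (Suc k)
    have "(sh M m ^^ Suc k) x = sh M m ((a - m) ^ k *s x)" by (simp only: funpow.simps o_apply Suc)
    also have "\<dots> = (a - m) ^ k *s ((a - m) *s x)"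
      by (simp only: sh_scale \<open>sh M m x = (a - m) *s x\<close>)
    finally show ?case by (simp only: vec.scale_scale power_Suc mult.commute)
  qed simp
  then show ?thesis using assms(1,3) by (simp add: gker_def)
qed

lemma gker_sh_pow_inj:
  assumes "x \<in> gker M m" "(sh M a ^^ k) x = 0" "a \<noteq> m"
  shows "x = 0"
  using assms(2)
proof (induct k)
  case (Suc k)
  have "(sh M a ^^ k) x = 0"
    by (rule gker_sh_inj[OF gker_sh_pow[OF assms(1)] _ assms(3)]) (use Suc.prems in simp)
  then show ?case by (rule Suc.hyps)
qed simp

lemma gker_sh_surj:
  assumes "(sh M m ^^ k) u = 0" "a \<noteq> m"
  shows "\<exists>s\<in>gker M m. sh M a s = u"
  using assms(1)
proof (induction k arbitrary: u)
  case 0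
  then show ?case using gker_subspace[of M m] by (intro bexI[of _ 0]) (auto simp: vec.subspace_0)
next
  case (Suc k)
  have "(sh M m ^^ k) (sh M m u) = 0" using Suc.prems by (simp add: sh_pow_comm)
  then obtain s' where s': "s' \<in> gker M m" "sh M a s' = sh M m u" using Suc.IH by blast
  have u: "u \<in> gker M m" using Suc.prems by (rule sh_kernel_stable)
  \<comment> \<open>On this generalised eigenspace \<open>sh M a\<close> differs from
    \<open>sh M m\<close> by the scalar \<open>m - a\<close>, and \<open>s'\<close> corrects for the
    nilpotent part \<open>sh M m u\<close>.\<close>
  define s where "s = (1 / (m - a)) *s (u - s')"
  have "s \<in> gker M m" unfolding s_def using u s'(1) gker_subspace[of M m]
    by (simp add: vec.subspace_diff vec.subspace_scale)
  moreover have "sh M a s = u"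
  proof -
    have "sh M a (u - s') = sh M a u - sh M a s'"
      using sh_add[of M a "u - s'" s'] by simp
    also have "\<dots> = (m - a) *s u" by (simp add: s') (simp add: sh_def vec.scale_left_diff_distrib)
    finally have e: "sh M a (u - s') = (m - a) *s u" .
    show ?thesis unfolding s_def sh_scale e vec.scale_scale using assms(2) by simp
  qed
  ultimately show ?case by blast
qed

text \<open>A vector of the span is \<open>sh M a s + g\<close> with \<open>s\<close> in the span
  and \<open>g\<close> in \<open>gker M a\<close>, because \<open>sh M a\<close> is onto on every
  other generalised eigenspace. Then \<open>v - s\<close> is killed by one more power than
  \<open>g\<close>.\<close>

lemma span_gker_lift:
  assumes "sh M a v \<in> vec.span (\<Union>l. gker M l)"
  shows "v \<in> vec.span (\<Union>l. gker M l)"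
proof -
  let ?S = "vec.span (\<Union>l. gker M l)"
  have "\<exists>s g. s \<in> ?S \<and> g \<in> gker M a \<and> u = sh M a s + g" if "u \<in> ?S" for u
    using that
  proof (induction rule: vec.span_induct_alt)
    case base
    show ?case using gker_subspace[of M a] by (intro exI[of _ 0]) (auto simp: vec.subspace_0 vec.span_zero)
  next
    case (step c x y)
    obtain s g where sg: "s \<in> ?S" "g \<in> gker M a" "y = sh M a s + g" using step by blast
    obtain m where m: "x \<in> gker M m" using step by blast
    have "\<exists>s' g'. s' \<in> ?S \<and> g' \<in> gker M a \<and> x = sh M a s' + g'"
    proof (cases "m = a")
      case True
      then show ?thesis using m by (intro exI[of _ 0] exI[of _ x]) (auto simp: vec.span_zero)
    next
      case False
      then obtain s' where "s' \<in> gker M m" "sh M a s' = x"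
        using gker_sh_surj[where M = M and m = m and k = "CARD('a)" and u = x and a = a] m unfolding gker_def by auto
      then show ?thesis using gker_subspace[of M a]
        by (intro exI[of _ s'] exI[of _ 0]) (auto simp: vec.subspace_0 intro: vec.span_base)
    qed
    then obtain s' g' where s': "s' \<in> ?S" "g' \<in> gker M a" "x = sh M a s' + g'" by blast
    show ?case
      by (intro exI[of _ "c *s s' + s"] exI[of _ "c *s g' + g"])
        (use sg s' gker_subspace[of M a] in \<open>auto simp: sh_add sh_scale vec.scale_right_distrib
          vec.span_add vec.span_scale vec.subspace_add vec.subspace_scale\<close>)
  qed
  from this[OF assms] obtain s g where s: "s \<in> ?S" "g \<in> gker M a" "sh M a v = sh M a s + g" by blast
  have "sh M a (v - s) = g" using sh_add[of M a "v - s" s] s(3) by simp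
  then have "(sh M a ^^ Suc CARD('a)) (v - s) = 0" using s(2) by (simp add: gker_def sh_pow_comm)
  then have "v - s \<in> gker M a" by (rule sh_kernel_stable)
  then have "(v - s) + s \<in> ?S" by (intro vec.span_add s(1) vec.span_base) auto
  then show ?thesis by simp
qed

section \<open>Polynomials in a matrix and the decomposition into generalised eigenspaces\<close>

definition pact :: "complex^'m^'m \<Rightarrow> complex poly \<Rightarrow> complex^'m \<Rightarrow> complex^'m" where
  "pact M p x = (\<Sum>i\<le>degree p. coeff p i *s (sh M 0 ^^ i) x)"

lemma pact_le: "degree p \<le> n \<Longrightarrow> pact M p x = (\<Sum>i\<le>n. coeff p i *s (sh M 0 ^^ i) x)"
  unfolding pact_def by (rule sum.mono_neutral_left) (auto simp: coeff_eq_0)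

lemma sh_0: "sh M 0 x = M *v x" by (simp add: sh_def)

lemma pact_root_factor: "pact M ([:- a, 1:] * q) x = pact M q (sh M a x)"
proof -
  let ?n = "Suc (degree q)"
  let ?P = "\<lambda>i. (sh M 0 ^^ i)"
  have d: "degree ([:- a, 1:] * q) \<le> ?n"
    using degree_mult_le[of "[:- a, 1:]" q] by simp
  have c: "coeff ([:- a, 1:] * q) i = (case i of 0 \<Rightarrow> 0 | Suc j \<Rightarrow> coeff q j) - a * coeff q i" for i
    by (simp add: coeff_pCons split: nat.split)
  have "pact M ([:- a, 1:] * q) x = (\<Sum>i\<le>?n. (case i of 0 \<Rightarrow> 0 | Suc j \<Rightarrow> coeff q j) *s ?P i x)
      - (\<Sum>i\<le>?n. (a * coeff q i) *s ?P i x)"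
    unfolding pact_le[OF d] c by (simp only: vec.scale_left_diff_distrib sum_subtractf)
  also have "(\<Sum>i\<le>?n. (case i of 0 \<Rightarrow> 0 | Suc j \<Rightarrow> coeff q j) *s ?P i x) = (\<Sum>i\<le>degree q. coeff q i *s ?P i (M *v x))"
    by (subst sum.atMost_Suc_shift) (simp add: sh_pow_comm sh_0)
  also have "(\<Sum>i\<le>?n. (a * coeff q i) *s ?P i x) = (\<Sum>i\<le>degree q. coeff q i *s ?P i (a *s x))"
    by (simp add: sh_pow_scale mult.commute coeff_eq_0)
  finally have e: "pact M ([:- a, 1:] * q) x = pact M q (M *v x) - pact M q (a *s x)"
    by (simp add: pact_def)
  have "pact M q (u + v) = pact M q u + pact M q v" for u v
    by (simp add: pact_def sh_pow_add vec.scale_right_distrib sum.distrib)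
  from this[of "sh M a x" "a *s x"] have "pact M q (M *v x) = pact M q (sh M a x) + pact M q (a *s x)"
    by (simp add: sh_def[of M a])
  then show ?thesis unfolding e by simp
qed

text \<open>More vectors \<open>x, M x, M^2 x, ...\<close> than the dimension satisfy a linear
  relation. The case split is there because dependence is a property of sets, which do not see a
  repeated vector.\<close>

lemma annihilating_poly:
  fixes M :: "complex^'m^'m"
  obtains p where "p \<noteq> 0" "pact M p x = 0"
proof -
  let ?P = "\<lambda>i. (sh M 0 ^^ i) x"
  let ?N = "CARD('m)"
  have "\<exists>c. (\<exists>i\<le>?N. c i \<noteq> 0) \<and> (\<Sum>i\<le>?N. c i *s ?P i) = 0"
  proof (cases "inj_on ?P {..?N}")
    case True
    have "card (?P ` {..?N}) = Suc ?N" using True by (simp add: card_image)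
    moreover have "vec.dim (?P ` {..?N}) \<le> ?N"
      using vec.dim_subset_UNIV[of "?P ` {..?N}"] by (simp add: vec.dimension_def card_cart_basis)
    ultimately have "vec.dependent (?P ` {..?N})"
      by (intro vec.dependent_biggerset_general) auto
    then obtain u where u: "\<exists>v\<in>?P ` {..?N}. u v \<noteq> 0" "(\<Sum>v\<in>?P ` {..?N}. u v *s v) = 0"
      using vec.dependent_finite[of "?P ` {..?N}"] by auto
    show ?thesis
      by (intro exI[of _ "\<lambda>i. u (?P i)"]) (use u in \<open>auto simp: sum.reindex[OF True]\<close>)
  next
    case False
    then obtain i j where ij: "i \<le> ?N" "j \<le> ?N" "i \<noteq> j" "?P i = ?P j" by (auto simp: inj_on_def)
    let ?c = "\<lambda>k. if k = i then 1 else if k = j then -1 else (0::complex)"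
    have "(\<Sum>k\<le>?N. ?c k *s ?P k) = (\<Sum>k\<in>{i, j}. ?c k *s ?P k)"
      by (rule sum.mono_neutral_right) (use ij in auto)
    also have "\<dots> = 0" using ij by simp
    finally show ?thesis using ij(1) by (intro exI[of _ ?c]) auto
  qed
  then obtain c where c: "\<exists>i\<le>?N. c i \<noteq> 0" "(\<Sum>i\<le>?N. c i *s ?P i) = 0" by blast
  define p where "p = (\<Sum>i\<le>?N. monom (c i) i)"
  have co: "coeff p i = (if i \<le> ?N then c i else 0)" for i
    by (simp add: p_def coeff_sum if_distrib cong: if_cong)
  have "degree p \<le> ?N" by (rule degree_le) (simp add: co)
  then have "pact M p x = 0" using c(2) by (simp add: pact_le co)
  moreover have "p \<noteq> 0" using c(1) co by (metis coeff_0)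
  ultimately show ?thesis using that by blast
qed

lemma complex_poly_root_factor:
  fixes p :: "complex poly"
  assumes "degree p = Suc d"
  obtains a q where "p = [:- a, 1:] * q" "degree q = d" "q \<noteq> 0"
proof -
  have "\<not> constant (poly p)" using assms by (simp add: constant_degree)
  then obtain a where "poly p a = 0" using fundamental_theorem_of_algebra by blast
  then have "[:- a, 1:] dvd p" by (simp only: poly_eq_0_iff_dvd)
  then obtain q where q: "p = [:- a, 1:] * q" by (elim dvdE)
  have q0: "q \<noteq> 0"
  proof
    assume "q = 0"
    then show False using q assms by simp
  qed
  then have "degree p = degree [:- a, 1:] + degree q" unfolding q by (intro degree_mult_eq) auto
  then have "degree q = d" using assms by simp
  then show ?thesis using that q q0 by blast
qed

text \<open>Linear factors of an annihilating polynomial are removed one at a time; membership in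
  the span is carried back through each factor by \<open>span_gker_lift\<close>.\<close>

lemma gker_span: "vec.span (\<Union>l. gker M l) = UNIV"
proof -
  let ?S = "vec.span (\<Union>l. gker M l)"
  have "p \<noteq> 0 \<Longrightarrow> pact M p v = 0 \<Longrightarrow> v \<in> ?S" for p v
  proof (induction "degree p" arbitrary: p v)
    case 0
    then obtain c where "p = [:c:]" by (metis degree_eq_zeroE)
    then have "v = 0" using 0 by (auto simp: pact_def)
    then show ?case by (simp add: vec.span_zero)
  next
    case (Suc d)
    obtain a q where q: "p = [:- a, 1:] * q" "degree q = d" "q \<noteq> 0"
      using complex_poly_root_factor[of p d] Suc.hyps(2) by metis
    have "pact M q (sh M a v) = 0" using Suc.prems(2) unfolding q(1) by (simp only: pact_root_factor)
    then have "sh M a v \<in> ?S" using Suc.hyps(1)[of q "sh M a v"] q(2,3) by simp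
    then show ?case by (rule span_gker_lift)
  qed
  then have "v \<in> ?S" for v by (meson annihilating_poly)
  then show ?thesis by auto
qed

text \<open>The same removal of linear factors, stopped at the first factor that kills the current
  vector.\<close>

lemma eigenvector_in_invariant_subspace:
  fixes M :: "complex^'m^'m"
  assumes S: "vec.subspace S" "S \<noteq> {0}" and inv: "\<And>x. x \<in> S \<Longrightarrow> M *v x \<in> S"
  obtains x l where "x \<in> S" "x \<noteq> 0" "M *v x = l *s x"
proof -
  have "p \<noteq> 0 \<Longrightarrow> pact M p v = 0 \<Longrightarrow> v \<in> S \<Longrightarrow> v \<noteq> 0 \<Longrightarrow> \<exists>x\<in>S. x \<noteq> 0 \<and> (\<exists>l. M *v x = l *s x)" for p v
  proof (induction "degree p" arbitrary: p v)
    case 0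
    then obtain c where "p = [:c:]" by (metis degree_eq_zeroE)
    then have "v = 0" using 0 by (auto simp: pact_def)
    then show ?case using 0 by simp
  next
    case (Suc d)
    obtain a q where q: "p = [:- a, 1:] * q" "degree q = d" "q \<noteq> 0"
      using complex_poly_root_factor[of p d] Suc.hyps(2) by metis
    show ?case
    proof (cases "sh M a v = 0")
      case True
      then show ?thesis using Suc.prems by (auto simp: sh_def)
    next
      case False
      have "sh M a v \<in> S" unfolding sh_def
        using S(1) inv Suc.prems by (simp add: vec.subspace_diff vec.subspace_scale)
      moreover have "pact M q (sh M a v) = 0" using Suc.prems(2) unfolding q(1) by (simp only: pact_root_factor)
      ultimately show ?thesis using Suc.hyps(1)[of q "sh M a v"] q(2,3) False by simp
    qed
  qed
  moreover obtain v where "v \<in> S" "v \<noteq> 0" using S vec.subspace_0 by blast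
  moreover obtain p where "p \<noteq> 0" "pact M p v = 0" by (rule annihilating_poly)
  ultimately show ?thesis using that by metis
qed

text \<open>A power of \<open>sh M b\<close> removes the \<open>b\<close> term and is injective on
  the other generalised eigenspaces.\<close>

lemma gker_independent:
  assumes "finite A" "\<And>a. a \<in> A \<Longrightarrow> x a \<in> gker M a" "(\<Sum>a\<in>A. x a) = 0" "a \<in> A"
  shows "x a = 0"
  using assms
proof (induction A arbitrary: x a rule: finite_induct)
  case (insert b A)
  let ?f = "sh M b ^^ CARD('a)"
  have fs: "?f (\<Sum>a\<in>A. x a) = (\<Sum>a\<in>A. ?f (x a))"
    using insert.hyps(1) by (induction A rule: finite_induct) (simp_all add: sh_pow_add)
  have "?f (x b) = 0" using insert.prems(1)[of b] by (simp add: gker_def)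
  then have "(\<Sum>a\<in>A. ?f (x a)) = ?f (\<Sum>a\<in>insert b A. x a)"
    using insert.hyps by (simp add: sh_pow_add fs)
  also have "\<dots> = 0" using insert.prems(2) by simp
  finally have z: "(\<Sum>a\<in>A. ?f (x a)) = 0" .
  have A0: "x c = 0" if "c \<in> A" for c
  proof -
    have "?f (x c) = 0"
      by (rule insert.IH[OF _ z that]) (use insert.prems(1) in \<open>auto intro: gker_sh_pow\<close>)
    then show ?thesis using gker_sh_pow_inj[where x = "x c" and M = M and m = c and a = b] insert.prems(1)[of c] that insert.hyps(2) by auto
  qed
  then have "x b = 0" using insert.prems(2) insert.hyps by simp
  then show ?case using A0 insert.prems(3) by auto
qed simp

lemma span_UN_sum:
  fixes x :: "complex^'m"
  assumes "finite A" "\<And>a. a \<in> A \<Longrightarrow> vec.subspace (S a)" "x \<in> vec.span (\<Union>a\<in>A. S a)"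
  shows "\<exists>y. (\<forall>a\<in>A. y a \<in> S a) \<and> x = (\<Sum>a\<in>A. y a)"
  using assms
proof (induction A arbitrary: x rule: finite_induct)
  case (insert b A)
  have "x \<in> {u + v | u v. u \<in> vec.span (S b) \<and> v \<in> vec.span (\<Union>a\<in>A. S a)}"
    using insert.prems(2) by (simp add: vec.span_Un)
  then obtain u v where uv: "x = u + v" "u \<in> S b" "v \<in> vec.span (\<Union>a\<in>A. S a)"
    using insert.prems(1) by (auto simp: vec.span_eq_iff[THEN iffD2])
  obtain y where y: "\<forall>a\<in>A. y a \<in> S a" "v = (\<Sum>a\<in>A. y a)"
    using insert.IH[OF _ uv(3)] insert.prems(1) by auto
  have "(\<Sum>a\<in>A. (y(b := u)) a) = (\<Sum>a\<in>A. y a)"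
    by (rule sum.cong) (use insert.hyps in auto)
  then show ?case using insert.hyps uv y
    by (intro exI[of _ "y(b := u)"]) (auto simp: fun_upd_def)
qed simp

lemma dim_span_gker:
  assumes "finite A" "\<And>a. a \<in> A \<Longrightarrow> vec.subspace (S a) \<and> S a \<subseteq> gker M a"
  shows "vec.dim (vec.span (\<Union>a\<in>A. S a)) = (\<Sum>a\<in>A. vec.dim (S a))"
  using assms
proof (induction A rule: finite_induct)
  case (insert b A)
  let ?T = "vec.span (\<Union>a\<in>A. S a)"
  have sb: "vec.subspace (S b)" using insert.prems by simp
  have "S b \<inter> ?T = {0}"
  proof -
    have "u = 0" if u: "u \<in> S b" "u \<in> ?T" for u
    proof -
      obtain y where y: "\<forall>a\<in>A. y a \<in> S a" "u = (\<Sum>a\<in>A. y a)"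
        using span_UN_sum[of A S u] insert u(2) by auto
      let ?x = "y(b := - u)"
      have s: "(\<Sum>a\<in>A. ?x a) = (\<Sum>a\<in>A. y a)" by (rule sum.cong) (use insert.hyps in auto)
      have "?x b = 0"
      proof (rule gker_independent[where A = "insert b A" and M = M and x = ?x and a = b])
        show "(\<Sum>a\<in>insert b A. ?x a) = 0" using insert.hyps s y(2) by simp
        fix a assume a: "a \<in> insert b A"
        have "- u \<in> S b" using sb u(1) by (simp add: vec.subspace_neg)
        then show "?x a \<in> gker M a" using a y(1) insert.prems by (cases "a = b") auto
      qed (use insert.hyps in auto)
      then show ?thesis by simp
    qed
    then show ?thesis using sb by (auto simp: vec.subspace_0 vec.span_zero)
  qed
  then have "vec.dim {u + v | u v. u \<in> S b \<and> v \<in> ?T} = vec.dim (S b) + vec.dim ?T"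
    using vec.dim_sums_Int[OF sb vec.subspace_span, of "\<Union>a\<in>A. S a"] by simp
  moreover have "vec.span (\<Union>a\<in>insert b A. S a) = {u + v | u v. u \<in> S b \<and> v \<in> ?T}"
    using sb by (simp add: vec.span_Un vec.span_eq_iff[THEN iffD2])
  ultimately show ?case using insert by simp
qed simp

section \<open>Spectrum, multiplicities and the determinant\<close>

definition eigs :: "complex^'m^'m \<Rightarrow> complex set" where
  "eigs M = {l. gker M l \<noteq> {0}}"

lemma dim_gker_pos: "l \<in> eigs M \<longleftrightarrow> vec.dim (gker M l) \<noteq> 0"
  using gker_subspace[of M l] vec.subspace_0 by (auto simp: eigs_def)

lemma finite_eigs: "finite (eigs M)" and card_eigs: "card (eigs M) \<le> CARD('m)" for M :: "complex^'m^'m"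
proof -
  have *: "card A \<le> CARD('m)" if "finite A" "A \<subseteq> eigs M" for A
  proof -
    have "card A = (\<Sum>a\<in>A. 1)" by simp
    also have "\<dots> \<le> (\<Sum>a\<in>A. vec.dim (gker M a))"
      by (rule sum_mono) (use that dim_gker_pos[of _ M] in \<open>force simp: Suc_le_eq\<close>)
    also have "\<dots> = vec.dim (vec.span (\<Union>a\<in>A. gker M a))"
      by (rule dim_span_gker[symmetric]) (use that gker_subspace in auto)
    also have "\<dots> \<le> CARD('m)"
      using vec.dim_subset_UNIV[of "vec.span (\<Union>a\<in>A. gker M a)"] by (simp add: vec.dimension_def card_cart_basis)
    finally show ?thesis .
  qed
  then show "finite (eigs M)" using infinite_arbitrarily_large[of "eigs M" "Suc CARD('m)"]
    by (metis Suc_n_not_le_n)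
  then show "card (eigs M) \<le> CARD('m)" using * by auto
qed

lemma span_gker_eigs: "vec.span (\<Union>l\<in>eigs M. gker M l) = UNIV"
proof -
  have "(\<Union>l. gker M l) \<subseteq> insert 0 (\<Union>l\<in>eigs M. gker M l)" by (auto simp: eigs_def)
  then have "vec.span (\<Union>l. gker M l) \<subseteq> vec.span (\<Union>l\<in>eigs M. gker M l)"
    using vec.span_mono by (metis vec.span_insert_0)
  then show ?thesis by (auto simp: gker_span)
qed

lemma sum_dim_gker: "(\<Sum>l\<in>eigs M. vec.dim (gker M l)) = CARD('m)" for M :: "complex^'m^'m"
  using dim_span_gker[of "eigs M" "gker M" M] finite_eigs[of M] gker_subspace[of M]
  by (simp add: span_gker_eigs vec.dimension_def card_cart_basis del: vec.dim_span)

lemma eigs_iff_eigenvector: "l \<in> eigs M \<longleftrightarrow> (\<exists>x. x \<noteq> 0 \<and> M *v x = l *s x)"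
proof
  assume "l \<in> eigs M"
  then have "gker M l \<noteq> {0}" by (simp add: eigs_def)
  from eigenvector_in_invariant_subspace[OF gker_subspace this gker_mv]
  obtain x a where x: "x \<in> gker M l" "x \<noteq> 0" "M *v x = a *s x" by metis
  then have "a = l" using gker_sh_inj[of x M l a] by (auto simp: sh_def)
  then show "\<exists>x. x \<noteq> 0 \<and> M *v x = l *s x" using x by blast
next
  assume "\<exists>x. x \<noteq> 0 \<and> M *v x = l *s x"
  then show "l \<in> eigs M" using eigenvector_gker[of M _ l] by (auto simp: eigs_def)
qed

lemma poly_det: "poly (det A) z = det (\<chi> i j. poly (A $ i $ j) z)" for A :: "complex poly^'m^'m"
  by (simp add: det_def poly_sum poly_prod)

text \<open>Let \<open>D\<close> act as the scalar \<open>l\<close> on each generalised eigenspace.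
  Then \<open>det (D + z (M - D))\<close> is a polynomial in \<open>z\<close> without zeros, hence
  constant by the fundamental theorem of algebra, and its values at \<open>0\<close> and
  \<open>1\<close> are \<open>det D\<close> and \<open>det M\<close>. This takes the place of a
  triangular form.\<close>

lemma det_eq_prod_gker:
  fixes M :: "complex^'m^'m"
  assumes nz: "0 \<notin> eigs M"
  shows "det M = (\<Prod>l\<in>eigs M. l ^ vec.dim (gker M l))"
proof -
  have "\<forall>l. \<exists>B. B \<subseteq> gker M l \<and> vec.independent B \<and> gker M l \<subseteq> vec.span B \<and> card B = vec.dim (gker M l)"
    using vec.basis_exists by metis
  then obtain B where B: "\<And>l. B l \<subseteq> gker M l" "\<And>l. vec.independent (B l)" "\<And>l. gker M l \<subseteq> vec.span (B l)"
      "\<And>l. card (B l) = vec.dim (gker M l)" by metis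
  have finB: "finite (B l)" for l using B(2) vec.finiteI_independent by blast
  have disj: "B l \<inter> B m = {}" if "l \<noteq> m" for l m
  proof -
    have "x = 0" if "x \<in> gker M l" "x \<in> gker M m" for x
      using gker_sh_pow_inj[where x = x and M = M and m = m and a = l and k = "CARD('m)"] that \<open>l \<noteq> m\<close> by (simp add: gker_def)
    moreover have "0 \<notin> B l" using B(2) vec.dependent_zero by blast
    ultimately show ?thesis using B(1) by blast
  qed
  define U where "U = (\<Union>l\<in>eigs M. B l)"
  have finU: "finite U" unfolding U_def using finite_eigs finB by blast
  have cardU: "card U = CARD('m)"
    unfolding U_def by (subst card_UN_disjoint) (use finite_eigs finB disj in \<open>auto simp: B(4) sum_dim_gker\<close>)
  have spanU: "vec.span U = UNIV"
  proof -
    have "(\<Union>l\<in>eigs M. gker M l) \<subseteq> vec.span U"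
      using B(3) vec.span_mono[of "B _" U] unfolding U_def by blast
    then show ?thesis using span_gker_eigs[of M] by (metis top.extremum_uniqueI vec.span_mono vec.span_span)
  qed
  obtain e where e: "bij_betw e (UNIV::'m set) U"
    using finU cardU finite_same_card_bij[of "UNIV::'m set" U] by auto
  have "\<forall>i. \<exists>l. l \<in> eigs M \<and> e i \<in> B l" using e unfolding U_def bij_betw_def by blast
  then obtain lam where lam: "\<And>i. lam i \<in> eigs M" "\<And>i. e i \<in> B (lam i)" by metis
  define S where "S = (\<chi> i j. e j $ i)"
  have Sx: "S *v x = (\<Sum>j\<in>UNIV. x $ j *s e j)" for x
    by (simp add: S_def vec_eq_iff matrix_vector_mult_def mult.commute)
  have Sax: "S *v axis j 1 = e j" for j by (simp add: S_def vec_eq_iff matrix_vector_mult_axis)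
  have "invertible S"
  proof -
    have "U \<subseteq> range ((*v) S)" using e Sax unfolding bij_betw_def by (metis image_subsetI rangeI)
    then have "vec.span U \<subseteq> range ((*v) S)"
      by (rule vec.span_minimal) (metis vec.subspace_UNIV vec.subspace_image)
    then have "surj ((*v) S)" using spanU by auto
    then show ?thesis by (metis invertible_right_inverse matrix_right_invertible_surjective)
  qed
  define D where "D = S ** (\<chi> i j. if i = j then lam i else 0) ** matrix_inv S"
  have detD: "det D = (\<Prod>i\<in>UNIV. lam i)"
  proof -
    have "det S * det (matrix_inv S) = 1" using \<open>invertible S\<close> by (metis det_I det_mul matrix_inv_right)
    then show ?thesis by (simp add: D_def det_mul det_diag)
  qed
  have De: "D *v e i = lam i *s e i" for i
  proof -
    have "matrix_inv S *v e i = axis i 1" using matrix_inv_vec(2)[OF \<open>invertible S\<close>, of "axis i 1"] by (simp add: Sax)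
    moreover have "(\<chi> i j. if i = j then lam i else 0) *v axis i 1 = lam i *s axis i 1"
      by (simp add: vec_eq_iff matrix_vector_mult_axis) (simp add: axis_def)
    ultimately show ?thesis
      by (simp add: D_def mv_scale Sax flip: matrix_vector_mul_assoc)
  qed
  have Dl: "D *v x = l *s x" if "x \<in> gker M l" "l \<in> eigs M" for x l
  proof -
    have "x \<in> vec.span (B l)" using B(3) that by blast
    then show ?thesis
    proof (induction rule: vec.span_induct_alt)
      case (step c b y)
      have "b \<in> U" using step that unfolding U_def by blast
      then obtain i where i: "b = e i" using e unfolding bij_betw_def by blast
      then have "lam i = l" using disj lam(2)[of i] step by blast
      then show ?case using step i De[of i] by (simp add: mv_add mv_scale vec.scale_right_distrib mult.commute)
    qed simp
  qed
  have inv: "det (D + (\<chi> i j. z * (M $ i $ j - D $ i $ j))) \<noteq> 0" for z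
    unfolding invertible_det_nz[symmetric] invertible_iff_kernel
  proof (intro allI impI)
    fix x assume x: "(D + (\<chi> i j. z * (M $ i $ j - D $ i $ j))) *v x = 0"
    have ex: "(D + (\<chi> i j. z * (M $ i $ j - D $ i $ j))) *v v = D *v v + z *s (M *v v - D *v v)" for v
      by (simp add: vec_eq_iff matrix_vector_mult_def algebra_simps sum.distrib sum_subtractf sum_distrib_left)
    have "x \<in> vec.span (\<Union>l\<in>eigs M. gker M l)" by (simp add: span_gker_eigs)
    from span_UN_sum[OF finite_eigs gker_subspace this]
    obtain y where y: "\<forall>l\<in>eigs M. y l \<in> gker M l" "x = (\<Sum>l\<in>eigs M. y l)" by blast
    let ?w = "\<lambda>l. l *s y l + z *s sh M l (y l)"
    have "(D + (\<chi> i j. z * (M $ i $ j - D $ i $ j))) *v x = (\<Sum>l\<in>eigs M. (D + (\<chi> i j. z * (M $ i $ j - D $ i $ j))) *v y l)"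
      unfolding y(2) by (rule vec.sum)
    also have "\<dots> = (\<Sum>l\<in>eigs M. ?w l)"
      by (rule sum.cong) (use y(1) in \<open>auto simp: ex Dl sh_def\<close>)
    finally have s0: "(\<Sum>l\<in>eigs M. ?w l) = 0" using x by simp
    have "y l = 0" if l: "l \<in> eigs M" for l
    proof -
      have w0: "?w l = 0"
        by (rule gker_independent[OF finite_eigs[of M] _ s0 l, where M = M])
          (use y(1) gker_subspace[of M] in \<open>auto intro!: vec.subspace_add vec.subspace_scale gker_sh\<close>)
      have l0: "l \<noteq> 0" using nz l by auto
      show ?thesis
      proof (cases "z = 0")
        case False
        \<comment> \<open>For nonzero \<open>z\<close> the equation
          \<open>l y + z (M - l) y = 0\<close> puts \<open>y l\<close> into the kernel of the shift
          by \<open>l - l / z\<close>, which differs from \<open>l\<close> because \<open>l\<close>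
          is nonzero.\<close>
        have "sh M (l - l / z) (y l) = (1 / z) *s ?w l"
          using False by (simp add: sh_def vec.scale_right_distrib vec.scale_right_diff_distrib vec.scale_left_diff_distrib)
        then show ?thesis using gker_sh_inj[of "y l" M l "l - l / z"] y(1) l l0 False w0 by simp
      qed (use w0 l0 in simp)
    qed
    then show "x = 0" using y(2) by simp
  qed
  define p where "p = det (\<chi> i j. [:D $ i $ j, M $ i $ j - D $ i $ j:])"
  have p: "poly p z = det (D + (\<chi> i j. z * (M $ i $ j - D $ i $ j)))" for z
    unfolding p_def poly_det by (rule arg_cong[where f = det]) (simp add: vec_eq_iff)
  have "constant (poly p)"
    using fundamental_theorem_of_algebra[of p] inv by (auto simp: p)
  then have "poly p 0 = poly p 1" by (simp add: constant_def)
  moreover have "poly p 0 = det D" unfolding p by (rule arg_cong[where f = det]) (simp add: vec_eq_iff)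
  moreover have "poly p 1 = det M" unfolding p by (rule arg_cong[where f = det]) (simp add: vec_eq_iff)
  ultimately have "det M = (\<Prod>i\<in>UNIV. lam i)" using detD by simp
  also have "\<dots> = (\<Prod>b\<in>U. THE l. b \<in> B l)"
  proof -
    have "(THE l. e i \<in> B l) = lam i" for i
      by (rule the_equality) (use lam(2) disj in blast)+
    then show ?thesis by (subst prod.reindex_bij_betw[OF e, symmetric]) simp
  qed
  also have "\<dots> = (\<Prod>l\<in>eigs M. \<Prod>b\<in>B l. THE l. b \<in> B l)"
    unfolding U_def by (rule prod.UNION_disjoint) (use finite_eigs finB disj in auto)
  also have "\<dots> = (\<Prod>l\<in>eigs M. l ^ vec.dim (gker M l))"
  proof (rule prod.cong[OF refl])
    fix l
    have "(\<Prod>b\<in>B l. THE l. b \<in> B l) = (\<Prod>b\<in>B l. l)"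
      by (rule prod.cong[OF refl], rule the_equality) (use disj in blast)+
    then show "(\<Prod>b\<in>B l. THE l. b \<in> B l) = l ^ vec.dim (gker M l)" by (simp add: B(4))
  qed
  finally show ?thesis .
qed

section \<open>The Krein form\<close>

definition cv :: "complex^'m \<Rightarrow> complex^'m" where "cv x = (\<chi> i. cnj (x $ i))"
definition rv :: "real^'m \<Rightarrow> complex^'m" where "rv u = (\<chi> i. complex_of_real (u $ i))"

lemma cv_cv [simp]: "cv (cv x) = x" by (simp add: cv_def vec_eq_iff)
lemma cv_add: "cv (x + y) = cv x + cv y" by (simp add: cv_def vec_eq_iff)
lemma cv_scale: "cv (c *s x) = cnj c *s cv x" by (simp add: cv_def vec_eq_iff)
lemma cv_0 [simp]: "cv 0 = 0" by (simp add: cv_def vec_eq_iff)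
lemma cv_eq_0 [simp]: "cv x = 0 \<longleftrightarrow> x = 0" by (simp add: cv_def vec_eq_iff)
lemma cv_diff: "cv (x - y) = cv x - cv y" by (simp add: cv_def vec_eq_iff)

lemma cplx_cv: "cplx W *v cv x = cv (cplx W *v x)"
  by (simp add: cplx_def cv_def vec_eq_iff matrix_vector_mult_def)

lemma cplx_rv: "cplx W *v rv u = rv (W *v u)"
  by (simp add: cplx_def rv_def vec_eq_iff matrix_vector_mult_def)

lemma cvec_decompose: "x = rv (\<chi> i. Re (x $ i)) + \<i> *s rv (\<chi> i. Im (x $ i))"
  by (simp add: rv_def vec_eq_iff complex_eq_iff)

lemma cplx_mult: "cplx (A ** B) = cplx A ** cplx B"
  by (simp add: cplx_def vec_eq_iff matrix_matrix_mult_def)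

lemma cplx_one: "cplx (mat 1) = mat 1"
  by (simp add: cplx_def vec_eq_iff mat_def)

lemma cplx_J0_vec: "(cplx J0 *v x) $ Inl j = - (x $ Inr j)" "(cplx J0 *v x) $ Inr j = x $ Inl j"
  by (simp_all add: cplx_def J0_def matrix_vector_mult_def if_distribR sum_UNIV_Plus if_distrib sum.delta cong: if_cong)

lemma krein_expand: "krein x y = (\<Sum>j\<in>UNIV. \<i> * (x $ Inr j * cnj (y $ Inl j) - x $ Inl j * cnj (y $ Inr j)))"
  by (simp add: krein_def sum_UNIV_Plus cplx_J0_vec algebra_simps flip: sum.distrib)

lemma krein_add_left: "krein (x + y) z = krein x z + krein y z"
  by (simp add: krein_expand algebra_simps flip: sum.distrib)
lemma krein_add_right: "krein x (y + z) = krein x y + krein x z"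
  by (simp add: krein_expand algebra_simps flip: sum.distrib)
lemma krein_scale_left: "krein (c *s x) z = c * krein x z"
  by (simp add: krein_expand algebra_simps sum_distrib_left)
lemma krein_scale_right: "krein x (c *s z) = cnj c * krein x z"
  by (simp add: krein_expand algebra_simps sum_distrib_left)
lemma krein_0 [simp]: "krein 0 z = 0" "krein z 0 = 0"
  by (simp_all add: krein_expand)
lemma krein_diff_left: "krein (x - y) z = krein x z - krein y z"
  using krein_add_left[of "x - y" y z] by simp
lemma krein_diff_right: "krein z (x - y) = krein z x - krein z y"
  using krein_add_right[of z "x - y" y] by simp
lemma krein_sym: "krein y x = cnj (krein x y)"
  by (simp add: krein_expand algebra_simps)
lemma krein_cv: "krein (cv x) (cv y) = - cnj (krein x y)"
  by (simp add: krein_expand cv_def algebra_simps flip: sum_negf)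
lemma krein_rv: "krein (rv u) (rv v) = - \<i> * complex_of_real (omega0 u v)"
  by (simp add: krein_expand rv_def omega0_def sum_distrib_left algebra_simps)

lemma krein_Sp:
  assumes "W \<in> Sp"
  shows "krein (cplx W *v x) (cplx W *v y) = krein x y"
proof -
  have *: "krein (cplx W *v (rv a + \<i> *s rv b)) (cplx W *v (rv c + \<i> *s rv d)) = krein (rv a + \<i> *s rv b) (rv c + \<i> *s rv d)"
    for a b c d
    by (simp add: mv_add mv_scale krein_add_left krein_add_right krein_scale_left krein_scale_right cplx_rv krein_rv
        Sp_omega0[OF assms])
  show ?thesis using *[of "\<chi> i. Re (x $ i)" "\<chi> i. Im (x $ i)" "\<chi> i. Re (y $ i)" "\<chi> i. Im (y $ i)"]
    by (simp flip: cvec_decompose)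
qed

text \<open>Coordinates along the eigenspaces of \<open>J0\<close>: \<open>pp\<close> and
  \<open>mm\<close> are the components for \<open>\<i>\<close> and \<open>-\<i>\<close>, and
  \<open>io\<close> puts them together. They diagonalise the Krein form into the difference of two
  Hermitian norms, up to the factor \<open>2\<close>.\<close>

definition pp :: "'n::finite cvec \<Rightarrow> complex^'n" where "pp x = (\<chi> j. (x $ Inl j + \<i> * x $ Inr j) / 2)"
definition mm :: "'n::finite cvec \<Rightarrow> complex^'n" where "mm x = (\<chi> j. (x $ Inl j - \<i> * x $ Inr j) / 2)"
definition io :: "complex^'n \<Rightarrow> complex^'n \<Rightarrow> 'n::finite cvec" where
  "io a b = (\<chi> k. case k of Inl j \<Rightarrow> a $ j + b $ j | Inr j \<Rightarrow> - \<i> * (a $ j - b $ j))"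

lemma pp_io [simp]: "pp (io a b) = a" and mm_io [simp]: "mm (io a b) = b"
  by (simp_all add: pp_def mm_def io_def vec_eq_iff algebra_simps)

lemma io_pp_mm: "io (pp x) (mm x) = x"
  unfolding vec_eq_iff
proof
  fix i show "io (pp x) (mm x) $ i = x $ i"
    by (cases i) (simp_all add: pp_def mm_def io_def field_simps)
qed

lemma pp_add: "pp (x + y) = pp x + pp y" and mm_add: "mm (x + y) = mm x + mm y"
  and pp_scale: "pp (c *s x) = c *s pp x" and mm_scale: "mm (c *s x) = c *s mm x"
  by (simp_all add: pp_def mm_def vec_eq_iff field_simps)

lemma io_add: "io (a + a') (b + b') = io a b + io a' b'"
  and io_scale: "io (c *s a) (c *s b) = c *s io a b"
  by (simp_all add: io_def vec_eq_iff algebra_simps split: sum.split)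

lemma io_0 [simp]: "io 0 0 = 0" by (simp add: io_def vec_eq_iff split: sum.split)

lemma krein_pm: "krein x y = 2 * (\<Sum>j\<in>UNIV. pp x $ j * cnj (pp y $ j) - mm x $ j * cnj (mm y $ j))"
  unfolding krein_expand sum_distrib_left
  by (rule sum.cong) (simp_all add: pp_def mm_def field_simps)

lemma norm_cvec_sq: "(norm (a::complex^'m))\<^sup>2 = (\<Sum>j\<in>UNIV. (cmod (a $ j))\<^sup>2)"
  by (simp add: norm_vec_def L2_set_def sum_nonneg)

lemma krein_self: "krein x x = complex_of_real (2 * ((norm (pp x))\<^sup>2 - (norm (mm x))\<^sup>2))"
  by (simp add: krein_pm norm_cvec_sq sum_subtractf flip: complex_norm_square)

definition kq :: "'n::finite cvec \<Rightarrow> real" where "kq x = Re (krein x x)"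

lemma kq_eq: "kq x = 2 * ((norm (pp x))\<^sup>2 - (norm (mm x))\<^sup>2)"
  by (simp add: kq_def krein_self)
lemma krein_self_kq: "krein x x = complex_of_real (kq x)"
  by (simp add: kq_eq krein_self)
lemma kq_Sp: "W \<in> Sp \<Longrightarrow> kq (cplx W *v x) = kq x"
  by (simp add: kq_def krein_Sp)
lemma kq_cv: "kq (cv x) = - kq x"
  by (simp add: kq_def krein_cv)
lemma kq_add: "kq (x + y) = kq x + kq y + 2 * Re (krein x y)"
  by (simp add: kq_def krein_add_left krein_add_right krein_sym[of y x])
lemma kq_scale: "kq (c *s x) = (cmod c)\<^sup>2 * kq x"
proof -
  have "krein (c *s x) (c *s x) = (c * cnj c) * krein x x" by (simp add: krein_scale_left krein_scale_right)
  also have "c * cnj c = complex_of_real ((cmod c)\<^sup>2)" by (rule complex_norm_square[symmetric])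
  also have "complex_of_real ((cmod c)\<^sup>2) * krein x x = complex_of_real ((cmod c)\<^sup>2 * kq x)"
    by (simp add: krein_self_kq)
  finally show ?thesis by (simp only: kq_def[of "c *s x"] Re_complex_of_real)
qed

lemma krein_posdef_kq: "krein_posdef_on V \<longleftrightarrow> (\<forall>v\<in>V. v \<noteq> 0 \<longrightarrow> kq v > 0)"
  by (simp add: krein_posdef_on_def krein_self_kq)

text \<open>Reversing the sign of the \<open>mm\<close> component of \<open>x\<close> gives a test
  vector whose pairing with \<open>x\<close> is a positive definite norm.\<close>

lemma krein_nondegenerate: "(\<And>y. krein x y = 0) \<Longrightarrow> x = 0"
proof -
  assume *: "\<And>y. krein x y = 0"
  have "krein x (io (pp x) (- mm x)) = complex_of_real (2 * ((norm (pp x))\<^sup>2 + (norm (mm x))\<^sup>2))"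
    by (simp add: krein_pm norm_cvec_sq sum.distrib flip: complex_norm_square)
  then have "(norm (pp x))\<^sup>2 + (norm (mm x))\<^sup>2 = 0" using * by (metis mult_eq_0_iff of_real_eq_0_iff zero_neq_numeral)
  then have "pp x = 0" "mm x = 0" by (auto simp: add_nonneg_eq_0_iff)
  then show "x = 0" using io_pp_mm[of x] by simp
qed

text \<open>Induction on the total nilpotency order. Invariance of the form under \<open>W\<close>
  multiplies \<open>krein x y\<close> by \<open>l * cnj m\<close>, up to pairings of lower order
  that vanish already.\<close>

lemma krein_gker_orthogonal:
  assumes W: "W \<in> Sp" and x: "x \<in> gker (cplx W) l" and y: "y \<in> gker (cplx W) m" and ne: "l * cnj m \<noteq> 1"
  shows "krein x y = 0"
proof -
  let ?M = "cplx W"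
  have "(sh ?M l ^^ j) x = 0 \<Longrightarrow> (sh ?M m ^^ k) y = 0 \<Longrightarrow> krein x y = 0" for j k x y
  proof (induction "j + k" arbitrary: j k x y rule: less_induct)
    case less
    show ?case
    proof (cases j)
      case 0 then show ?thesis using less.prems by simp
    next
      case (Suc j')
      show ?thesis
      proof (cases k)
        case 0 then show ?thesis using less.prems by simp
      next
        case (Suc k')
        note j = \<open>j = Suc j'\<close> and k = Suc
        define x' where "x' = sh ?M l x"
        define y' where "y' = sh ?M m y"
        have x': "(sh ?M l ^^ j') x' = 0" using less.prems(1) by (simp add: j x'_def sh_pow_comm)
        have y': "(sh ?M m ^^ k') y' = 0" using less.prems(2) by (simp add: k y'_def sh_pow_comm)
        have z: "krein x y' = 0" "krein x' y = 0" "krein x' y' = 0"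
          using less.hyps[of j k' x y'] less.hyps[of j' k x' y] less.hyps[of j' k' x' y'] less.prems x' y' j k by simp_all
        have "krein x y = krein (l *s x + x') (m *s y + y')"
          using krein_Sp[OF W, of x y] by (simp add: x'_def y'_def sh_def)
        also have "\<dots> = l * cnj m * krein x y"
          by (simp add: krein_add_left krein_add_right krein_scale_left krein_scale_right z)
        finally show ?thesis using ne by simp
      qed
    qed
  qed
  then show ?thesis using x y unfolding gker_def by blast
qed

lemma krein_span_zero:
  assumes "\<And>b. b \<in> B \<Longrightarrow> krein x b = 0" "y \<in> vec.span B"
  shows "krein x y = 0"
  using assms(2) by (induction rule: vec.span_induct_alt) (use assms(1) in \<open>auto simp: krein_add_right krein_scale_right\<close>)

section \<open>Orthogonal complements, projections and maximal positive subspaces\<close>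

lemma dim_krein_orthogonal:
  assumes "finite B" "vec.subspace S"
  shows "vec.dim S \<le> vec.dim {x \<in> S. \<forall>b\<in>B. krein x b = 0} + card B"
    and "vec.subspace {x \<in> S. \<forall>b\<in>B. krein x b = 0}"
proof -
  show sub: "vec.subspace {x \<in> S. \<forall>b\<in>B. krein x b = 0}" for B
    using assms(2) by (auto simp: vec.subspace_def krein_add_left krein_scale_left)
  show "vec.dim S \<le> vec.dim {x \<in> S. \<forall>b\<in>B. krein x b = 0} + card B"
    using assms(1)
  proof (induction B rule: finite_induct)
    case (insert b B)
    let ?S = "{x \<in> S. \<forall>b\<in>B. krein x b = 0}"
    let ?T = "{x \<in> S. \<forall>b\<in>insert b B. krein x b = 0}"
    have "vec.dim ?S \<le> vec.dim ?T + 1"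
    proof (cases "\<forall>x\<in>?S. krein x b = 0")
      case True
      then have "?S = ?T" by auto
      then show ?thesis by (metis le_add1)
    next
      case False
      then obtain s where s: "s \<in> ?S" "krein s b \<noteq> 0" by blast
      have "?S \<subseteq> vec.span (insert s ?T)"
      proof
        fix x assume x: "x \<in> ?S"
        define c where "c = krein x b / krein s b"
        have "x - c *s s \<in> ?T"
          using x s vec.subspace_diff[OF sub[of B] x vec.subspace_scale[OF sub[of B] s(1), of c]]
          by (auto simp: krein_diff_left krein_scale_left c_def)
        then have "(x - c *s s) + c *s s \<in> vec.span (insert s ?T)"
          by (intro vec.span_add vec.span_scale vec.span_base) auto
        then show "x \<in> vec.span (insert s ?T)" by simp
      qed
      then have "vec.dim ?S \<le> vec.dim (insert s ?T)" by (rule vec.dim_mono)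
      also have "\<dots> \<le> vec.dim ?T + 1" by (simp add: vec.dim_insert)
      finally show ?thesis .
    qed
    then show ?case using insert by simp
  qed simp
qed

lemma krein_orthogonal_exists:
  assumes "finite B" "vec.subspace S" "card B < vec.dim S"
  obtains x where "x \<in> S" "x \<noteq> 0" "\<And>b. b \<in> B \<Longrightarrow> krein x b = 0"
proof -
  have "vec.dim {x \<in> S. \<forall>b\<in>B. krein x b = 0} \<noteq> 0"
    using dim_krein_orthogonal(1)[OF assms(1,2)] assms(3) by linarith
  then have "\<not> {x \<in> S. \<forall>b\<in>B. krein x b = 0} \<subseteq> {0}" by simp
  then show ?thesis using that by blast
qed

lemma subspace_basis:
  fixes P :: "(complex^'m) set"
  assumes "vec.subspace P"
  obtains B where "finite B" "B \<subseteq> P" "vec.span B = P" "card B = vec.dim P"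
  using vec.basis_subspace_exists[OF assms] vec.finiteI_independent by metis

text \<open>A dimension count gives a nonzero vector orthogonal to \<open>P\<close> in the span of
  \<open>y\<close> and \<open>P\<close>; definiteness keeps it out of \<open>P\<close>, so it can be
  scaled to the form \<open>y - q\<close>.\<close>

lemma krein_projection:
  assumes P: "vec.subspace P" "krein_posdef_on P"
  obtains q where "q \<in> P" "\<And>b. b \<in> P \<Longrightarrow> krein (y - q) b = 0"
proof (cases "y \<in> P")
  case True
  then show ?thesis using that[of y] by simp
next
  case False
  obtain B where B: "finite B" "B \<subseteq> P" "vec.span B = P" "card B = vec.dim P" using subspace_basis[OF P(1)] by metis
  have sp: "vec.span P = P" using P(1) by (simp add: vec.span_eq_iff)
  have "vec.dim (vec.span (insert y P)) = vec.dim P + 1"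
    using False by (simp add: vec.dim_insert sp)
  then obtain x where x: "x \<in> vec.span (insert y P)" "x \<noteq> 0" "\<And>b. b \<in> B \<Longrightarrow> krein x b = 0"
    using krein_orthogonal_exists[OF B(1) vec.subspace_span, of "insert y P"] B(4) by auto
  have orth: "krein x b = 0" if "b \<in> P" for b
    using krein_span_zero[OF x(3)] that B(3) by blast
  obtain k where k: "x - k *s y \<in> P" using x(1) sp by (auto simp: vec.span_breakdown_eq)
  have "k \<noteq> 0"
  proof
    assume "k = 0"
    then have "x \<in> P" using k by simp
    then have "kq x > 0" "krein x x = 0" using P(2) x(2) orth by (auto simp: krein_posdef_kq)
    then show False by (simp add: kq_def)
  qed
  define q where "q = (- 1 / k) *s (x - k *s y)"
  have "q \<in> P" unfolding q_def by (rule vec.subspace_scale[OF P(1) k])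
  moreover have "y - q = (1 / k) *s x" using \<open>k \<noteq> 0\<close> by (simp add: q_def vec_eq_iff field_simps)
  ultimately show ?thesis using that[of q] orth by (simp add: krein_scale_left)
qed

lemma krein_p_attained:
  fixes W :: "'n::finite sqm"
  obtains P where "vec.subspace P" "P \<subseteq> gker (cplx W) l" "krein_posdef_on P" "vec.dim P = krein_p W l"
    "\<And>V. vec.subspace V \<Longrightarrow> V \<subseteq> gker (cplx W) l \<Longrightarrow> krein_posdef_on V \<Longrightarrow> vec.dim V \<le> krein_p W l"
proof -
  let ?D = "{vec.dim V | V. vec.subspace V \<and> V \<subseteq> geneig W l \<and> krein_posdef_on V}"
  have "?D \<subseteq> {..CARD('n + 'n)}"
    using vec.dim_subset_UNIV[where 'a = complex and 'b = "'n + 'n"] by (auto simp: vec.dimension_def card_cart_basis)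
  then have fin: "finite ?D" by (rule finite_subset) simp
  have "vec.dim {0::'n cvec} \<in> ?D"
    using gker_subspace[of "cplx W" l] by (intro CollectI exI[of _ "{0}"])
      (auto simp: krein_posdef_on_def vec.subspace_def geneig_eq_gker)
  then have "Max ?D \<in> ?D" using fin by (intro Max_in) auto
  then obtain P where "vec.subspace P" "P \<subseteq> gker (cplx W) l" "krein_posdef_on P" "vec.dim P = krein_p W l"
    unfolding krein_p_def geneig_eq_gker by force
  moreover have "vec.dim V \<le> krein_p W l" if "vec.subspace V" "V \<subseteq> gker (cplx W) l" "krein_posdef_on V" for V
    unfolding krein_p_def using fin that by (intro Max_ge) (auto simp: geneig_eq_gker)
  ultimately show ?thesis using that by blast
qed

text \<open>On a nonnegative subspace \<open>pp\<close> is injective, since the \<open>mm\<close>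
  component is bounded by the \<open>pp\<close> component.\<close>

lemma nonneg_dim_le:
  fixes V :: "'n::finite cvec set"
  assumes V: "vec.subspace V" and nn: "\<And>x. x \<in> V \<Longrightarrow> kq x \<ge> 0"
  shows "vec.dim V \<le> CARD('n)"
proof -
  have lin: "Vector_Spaces.linear (*s) (*s) (pp :: 'n cvec \<Rightarrow> complex^'n)"
    by (intro Vector_Spaces.linear_iff[THEN iffD2] conjI allI) (auto simp: pp_add pp_scale vec.vector_space_axioms)
  have "x = 0" if "x \<in> V" "pp x = 0" for x
  proof -
    have "norm (mm x) = 0" using nn[OF that(1)] that(2) by (simp add: kq_eq)
    then show ?thesis using io_pp_mm[of x] that(2) by simp
  qed
  then have "inj_on pp (vec.span V)"
    using V vec.linear_inj_on_iff_eq_0[OF lin V] by (simp add: vec.span_eq_iff[THEN iffD2])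
  then have "vec.dim (pp ` V) = vec.dim V" by (rule vec.dim_image_eq[OF lin])
  then show ?thesis using vec.dim_subset_UNIV[of "pp ` V"] by (simp add: vec.dimension_def card_cart_basis)
qed

text \<open>By orthogonality \<open>x\<close> can pair only with the generalised eigenspace of the
  reflected eigenvalue, and the form on the whole space is nondegenerate.\<close>

lemma gker_pairing_nondegenerate:
  assumes W: "W \<in> Sp" and lm: "l * cnj m = 1" and x: "x \<in> gker (cplx W) l"
    and z: "\<And>y. y \<in> gker (cplx W) m \<Longrightarrow> krein x y = 0"
  shows "x = 0"
proof (rule krein_nondegenerate)
  fix y
  have "krein x b = 0" if hb: "b \<in> (\<Union>m. gker (cplx W) m)" for b
  proof -
    obtain m' where m': "b \<in> gker (cplx W) m'" using hb by blast
    show ?thesis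
    proof (cases "m' = m")
      case True then show ?thesis using z m' by simp
    next
      case False
      have "l \<noteq> 0" using lm by auto
      have "l * cnj m' \<noteq> 1" using False lm \<open>l \<noteq> 0\<close> by (metis complex_cnj_cancel_iff mult_left_cancel)
      then show ?thesis using krein_gker_orthogonal[OF W x m'] by simp
    qed
  qed
  then show "krein x y = 0" by (rule krein_span_zero[where B = "\<Union>m. gker (cplx W) m"]) (simp_all add: gker_span)
qed

lemma dim_gker_dual:
  assumes W: "W \<in> Sp" and lm: "l * cnj m = 1"
  shows "vec.dim (gker (cplx W) l) = vec.dim (gker (cplx W) m)"
proof -
  have le: "vec.dim (gker (cplx W) l) \<le> vec.dim (gker (cplx W) m)" if lm: "l * cnj m = 1" for l m
  proof (rule ccontr)
    assume "\<not> ?thesis"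
    then have lt: "vec.dim (gker (cplx W) m) < vec.dim (gker (cplx W) l)" by simp
    obtain B where B: "finite B" "vec.span B = gker (cplx W) m" "card B = vec.dim (gker (cplx W) m)"
      using subspace_basis[OF gker_subspace[of "cplx W" m]] by metis
    obtain x where x: "x \<in> gker (cplx W) l" "x \<noteq> 0" "\<And>b. b \<in> B \<Longrightarrow> krein x b = 0"
      using krein_orthogonal_exists[OF B(1) gker_subspace[of "cplx W" l]] lt B(3) by metis
    then show False using gker_pairing_nondegenerate[OF W lm x(1)] krein_span_zero[OF x(3)] B(2) by blast
  qed
  have "m * cnj l = 1" using lm by (metis complex_cnj_cnj complex_cnj_mult complex_cnj_one mult.commute)
  then show ?thesis using le lm by (intro antisym) auto
qed

lemma sh_cv: "sh (cplx W) (cnj l) (cv x) = cv (sh (cplx W) l x)"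
  by (simp add: sh_def cplx_cv cv_diff cv_scale)

lemma gker_cv: "x \<in> gker (cplx W) l \<Longrightarrow> cv x \<in> gker (cplx W) (cnj l)"
proof -
  have "(sh (cplx W) (cnj l) ^^ k) (cv x) = cv ((sh (cplx W) l ^^ k) x)" for k
    by (induct k) (simp_all add: sh_cv)
  then show "x \<in> gker (cplx W) l \<Longrightarrow> cv x \<in> gker (cplx W) (cnj l)" by (simp add: gker_def)
qed

lemma subspace_cv: "vec.subspace S \<Longrightarrow> vec.subspace (cv ` S)"
proof -
  assume S: "vec.subspace S"
  have sc: "c *s cv x = cv (cnj c *s x)" for c and x :: "complex^'a" by (simp add: cv_scale)
  have "0 \<in> cv ` S" using vec.subspace_0[OF S] by (metis cv_0 image_eqI)
  moreover have "cv x + cv y \<in> cv ` S" if "x \<in> S" "y \<in> S" for x y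
    using vec.subspace_add[OF S that] by (simp flip: cv_add)
  moreover have "c *s cv x \<in> cv ` S" if "x \<in> S" for c x
    unfolding sc using vec.subspace_scale[OF S that] by blast
  ultimately show ?thesis unfolding vec.subspace_def by blast
qed

lemma dim_cv: assumes "vec.subspace S" shows "vec.dim (cv ` S) = vec.dim S"
proof -
  have le: "vec.dim (cv ` S) \<le> vec.dim S" if S: "vec.subspace S" for S :: "(complex^'a) set"
  proof -
    obtain B where B: "finite B" "vec.span B = S" "card B = vec.dim S" using subspace_basis[OF S] by metis
    have "cv x \<in> vec.span (cv ` B)" if "x \<in> vec.span B" for x
      using that
    proof (induction rule: vec.span_induct_alt)
      case (step c x y)
      have "cv x \<in> vec.span (cv ` B)" using step by (intro vec.span_base) auto
      then show ?case using step by (simp add: cv_add cv_scale vec.span_add vec.span_scale)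
    qed (simp add: vec.span_zero)
    then have "cv ` S \<subseteq> vec.span (cv ` B)" using B(2) by blast
    then have "vec.dim (cv ` S) \<le> card (cv ` B)" by (rule vec.dim_le_card) (simp add: B)
    also have "\<dots> \<le> card B" using B(1) by (rule card_image_le)
    finally show ?thesis using B by simp
  qed
  have "cv ` (cv ` S) = S" by (simp add: image_image)
  then show ?thesis using le[OF assms] le[OF subspace_cv[OF assms]] by simp
qed

lemma gker_cv_image: "cv ` gker (cplx W) l = gker (cplx W) (cnj l)"
proof
  show "cv ` gker (cplx W) l \<subseteq> gker (cplx W) (cnj l)" using gker_cv by blast
  show "gker (cplx W) (cnj l) \<subseteq> cv ` gker (cplx W) l"
  proof
    fix x assume "x \<in> gker (cplx W) (cnj l)"
    then have "cv x \<in> gker (cplx W) l" using gker_cv[of x W "cnj l"] by simp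
    then show "x \<in> cv ` gker (cplx W) l" by (metis cv_cv image_eqI)
  qed
qed

lemma dim_gker_cnj: "vec.dim (gker (cplx W) (cnj l)) = vec.dim (gker (cplx W) l)"
  using dim_cv[OF gker_subspace[of "cplx W" l]] by (simp add: gker_cv_image)

text \<open>A vector of positive norm orthogonal to \<open>P\<close> could be adjoined to
  \<open>P\<close>, against maximality of the dimension.\<close>

lemma krein_p_orthogonal_nonpos:
  assumes P: "vec.subspace P" "P \<subseteq> gker (cplx W) l" "krein_posdef_on P" "vec.dim P = krein_p W l"
    and max: "\<And>V. vec.subspace V \<Longrightarrow> V \<subseteq> gker (cplx W) l \<Longrightarrow> krein_posdef_on V \<Longrightarrow> vec.dim V \<le> krein_p W l"
    and z: "z \<in> gker (cplx W) l" "\<And>b. b \<in> P \<Longrightarrow> krein z b = 0"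
  shows "kq z \<le> 0"
proof (rule ccontr)
  assume "\<not> ?thesis"
  then have pos: "kq z > 0" by simp
  have "z \<notin> P" using z(2)[of z] pos by (auto simp: kq_def)
  moreover have sp: "vec.span P = P" using P(1) by (simp add: vec.span_eq_iff)
  ultimately have "vec.dim (vec.span (insert z P)) = krein_p W l + 1" using P(4) by (simp add: vec.dim_insert sp)
  moreover have "vec.dim (vec.span (insert z P)) \<le> krein_p W l"
  proof (rule max[OF vec.subspace_span])
    show "vec.span (insert z P) \<subseteq> gker (cplx W) l"
      by (rule vec.span_minimal) (use z P gker_subspace in auto)
    show "krein_posdef_on (vec.span (insert z P))"
      unfolding krein_posdef_kq
    proof (intro ballI impI)
      fix v assume v: "v \<in> vec.span (insert z P)" "v \<noteq> 0"
      obtain k where k: "v - k *s z \<in> P" using v(1) sp by (auto simp: vec.span_breakdown_eq)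
      define b where "b = v - k *s z"
      have vb: "v = k *s z + b" by (simp add: b_def)
      have "kq v = (cmod k)\<^sup>2 * kq z + kq b"
      proof -
        have "krein z b = 0" using z(2) k by (simp add: b_def)
        then show ?thesis by (subst vb) (simp add: kq_add kq_scale krein_scale_left)
      qed
      moreover have "kq b \<ge> 0" "b \<noteq> 0 \<Longrightarrow> kq b > 0"
        using P(3) k unfolding krein_posdef_kq b_def[symmetric]
        by (cases "b = 0"; force simp: kq_def intro: less_imp_le)+
      ultimately show "kq v > 0"
        using pos v(2) by (cases "k = 0") (auto simp: vb add_pos_nonneg)
    qed
  qed
  ultimately show False by simp
qed

text \<open>On the unit circle the form is nondegenerate on the generalised eigenspace, so the bound
  by the positive index extends to nonnegative subspaces. Too large a subspace contains a null
  vector \<open>x\<close> orthogonal to \<open>P\<close>; a large multiple of \<open>x\<close> added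
  to a vector pairing with it has positive norm while still orthogonal to \<open>P\<close>.\<close>

lemma nonneg_in_gker_dim_le:
  assumes W: "W \<in> Sp" and l: "cmod l = 1"
    and F: "vec.subspace F" "F \<subseteq> gker (cplx W) l" "\<And>x. x \<in> F \<Longrightarrow> kq x \<ge> 0"
  shows "vec.dim F \<le> krein_p W l"
proof (rule ccontr)
  assume nle: "\<not> ?thesis"
  obtain P where P: "vec.subspace P" "P \<subseteq> gker (cplx W) l" "krein_posdef_on P" "vec.dim P = krein_p W l"
    and max: "\<And>V. vec.subspace V \<Longrightarrow> V \<subseteq> gker (cplx W) l \<Longrightarrow> krein_posdef_on V \<Longrightarrow> vec.dim V \<le> krein_p W l"
    by (rule krein_p_attained[of W l]) (rule that)
  obtain B where B: "finite B" "vec.span B = P" "card B = vec.dim P" using subspace_basis[OF P(1)] by metis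
  obtain x where x: "x \<in> F" "x \<noteq> 0" "\<And>b. b \<in> B \<Longrightarrow> krein x b = 0"
    using krein_orthogonal_exists[OF B(1) F(1)] nle B(3) P(4) by (metis not_le)
  have xP: "krein x b = 0" if "b \<in> P" for b using krein_span_zero[OF x(3)] B(2) that by blast
  have xE: "x \<in> gker (cplx W) l" using x(1) F(2) by blast
  have ll: "l * cnj l = 1" using l by (simp add: complex_norm_square[symmetric])
  have "kq x \<le> 0" using krein_p_orthogonal_nonpos[OF P max xE xP] by simp
  then have kx: "kq x = 0" using F(3)[OF x(1)] by simp
  obtain y where y: "y \<in> gker (cplx W) l" "krein x y \<noteq> 0"
    using gker_pairing_nondegenerate[OF W ll xE] x(2) by blast
  obtain q where q: "q \<in> P" "\<And>b. b \<in> P \<Longrightarrow> krein (y - q) b = 0" using krein_projection[OF P(1,3)] by metis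
  define c where "c = krein x (y - q)"
  have "c \<noteq> 0" using y(2) xP[OF q(1)] by (simp add: c_def krein_diff_right)
  \<comment> \<open>The scalar \<open>s\<close> turns the pairing \<open>c\<close> into the positive
    real number \<open>R\<close>, and \<open>2 * R\<close> outweighs a possibly negative norm of
    \<open>y - q\<close>.\<close>
  define R where "R = \<bar>kq (y - q)\<bar> + 1"
  define s where "s = complex_of_real R / c"
  define z where "z = s *s x + (y - q)"
  have yq: "y - q \<in> gker (cplx W) l" using y(1) q(1) P(2) gker_subspace by (intro vec.subspace_diff) auto
  have "z \<in> gker (cplx W) l"
    unfolding z_def using yq xE gker_subspace[of "cplx W" l] by (intro vec.subspace_add vec.subspace_scale) auto
  moreover have "krein z b = 0" if "b \<in> P" for b
    using xP that q(2) by (simp add: z_def krein_add_left krein_scale_left)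
  ultimately have "kq z \<le> 0" using krein_p_orthogonal_nonpos[OF P max] by blast
  moreover have "kq z = kq (y - q) + 2 * R"
    using \<open>c \<noteq> 0\<close> by (simp add: z_def kq_add kq_scale kx krein_scale_left c_def[symmetric] s_def)
  ultimately show False by (simp add: R_def)
qed

text \<open>Complex conjugation maps this space to itself and reverses the sign of the form, so the
  signature is balanced. The product in \<open>upsilon\<close> omits the eigenvalue
  \<open>-1\<close> while \<open>neg_mult\<close> counts it; this lemma reconciles the two.\<close>

lemma dim_gker_minus_one:
  assumes W: "W \<in> Sp"
  shows "vec.dim (gker (cplx W) (-1)) = 2 * krein_p W (-1)"
proof (rule antisym)
  let ?E = "gker (cplx W) (-1)"
  obtain P where P: "vec.subspace P" "P \<subseteq> ?E" "krein_posdef_on P" "vec.dim P = krein_p W (-1)"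
    and max: "\<And>V. vec.subspace V \<Longrightarrow> V \<subseteq> ?E \<Longrightarrow> krein_posdef_on V \<Longrightarrow> vec.dim V \<le> krein_p W (-1)"
    by (rule krein_p_attained[of W "-1"]) (rule that)
  have cvE: "cv ` ?E = ?E" using gker_cv_image[of W "-1"] by simp
  obtain B where B: "finite B" "B \<subseteq> P" "vec.span B = P" "card B = vec.dim P" using subspace_basis[OF P(1)] by metis
  let ?Q = "{x \<in> ?E. \<forall>b\<in>B. krein x b = 0}"
  have Q: "vec.dim ?E \<le> vec.dim ?Q + krein_p W (-1)" "vec.subspace ?Q"
    using dim_krein_orthogonal[OF B(1) gker_subspace[of "cplx W" "-1"]] B(4) P(4) by simp_all
  have "vec.dim (cv ` ?Q) \<le> krein_p W (-1)"
  proof (rule nonneg_in_gker_dim_le[OF W])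
    show "vec.subspace (cv ` ?Q)" by (rule subspace_cv[OF Q(2)])
    show "cv ` ?Q \<subseteq> ?E" using cvE by blast
    fix x assume "x \<in> cv ` ?Q"
    then obtain z where z: "x = cv z" "z \<in> ?Q" by blast
    then have "krein z b = 0" if "b \<in> P" for b using krein_span_zero[of B z b] B(3) that by auto
    then have "kq z \<le> 0" using krein_p_orthogonal_nonpos[OF P max] z(2) by blast
    then show "kq x \<ge> 0" by (simp add: z kq_cv)
  qed simp
  then show "vec.dim ?E \<le> 2 * krein_p W (-1)" using Q dim_cv[OF Q(2)] by simp
  have "P \<inter> cv ` P = {0}"
  proof -
    have "x = 0" if "x \<in> P" "x = cv z" "z \<in> P" for x z
      using P(3) that kq_cv[of z] unfolding krein_posdef_kq by (metis cv_eq_0 less_asym neg_0_less_iff_less)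
    then show ?thesis using vec.subspace_0[OF P(1)] by (auto simp: image_iff intro!: bexI[of _ 0])
  qed
  then have "vec.dim {x + y | x y. x \<in> P \<and> y \<in> cv ` P} = 2 * krein_p W (-1)"
    using vec.dim_sums_Int[OF P(1) subspace_cv[OF P(1)]] dim_cv[OF P(1)] P(4) by simp
  moreover have "{x + y | x y. x \<in> P \<and> y \<in> cv ` P} \<subseteq> ?E"
    using P(2) cvE gker_subspace[of "cplx W" "-1"] by (auto intro!: vec.subspace_add)
  then have "vec.dim {x + y | x y. x \<in> P \<and> y \<in> cv ` P} \<le> vec.dim ?E" by (rule vec.dim_subset)
  ultimately show "2 * krein_p W (-1) \<le> vec.dim ?E" by simp
qed

section \<open>Continuity of the rotation function\<close>

text \<open>A subspace that is a graph over the \<open>pp\<close> component is described by a matrix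
  \<open>K\<close>, and \<open>emb K a\<close> is its point over \<open>a\<close>. \<open>TK\<close>
  and \<open>SK\<close> are the two components of \<open>W\<close> on the graph; the graph is
  invariant iff \<open>SK W K = K ** TK W K\<close>, and then \<open>TK W K\<close> is the
  restriction of \<open>W\<close>.\<close>

definition emb :: "complex^'n^'n \<Rightarrow> complex^'n \<Rightarrow> 'n::finite cvec" where
  "emb K a = io a (K *v a)"
definition TK :: "'n::finite sqm \<Rightarrow> complex^'n^'n \<Rightarrow> complex^'n^'n" where
  "TK W K = matrix (\<lambda>a. pp (cplx W *v emb K a))"
definition SK :: "'n::finite sqm \<Rightarrow> complex^'n^'n \<Rightarrow> complex^'n^'n" where
  "SK W K = matrix (\<lambda>a. mm (cplx W *v emb K a))"

lemma emb_add: "emb K (a + b) = emb K a + emb K b"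
  by (simp add: emb_def mv_add io_add)
lemma emb_scale: "emb K (c *s a) = c *s emb K a"
  by (simp add: emb_def mv_scale io_scale)
lemma pp_emb [simp]: "pp (emb K a) = a" and mm_emb [simp]: "mm (emb K a) = K *v a"
  by (simp_all add: emb_def)
lemma emb_0 [simp]: "emb K 0 = 0" by (simp add: emb_def)
lemma emb_eq_0 [simp]: "emb K a = 0 \<longleftrightarrow> a = 0"
proof
  assume "emb K a = 0"
  then have "pp (emb K a) = pp 0" by simp
  also have "pp 0 = (0 :: complex^'a)" by (simp add: pp_def vec_eq_iff)
  finally show "a = 0" by simp
qed simp
lemma emb_linear: "Vector_Spaces.linear (*s) (*s) (emb K)"
  by (intro Vector_Spaces.linear_iff[THEN iffD2] conjI allI) (auto simp: emb_add emb_scale vec.vector_space_axioms)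

lemma TK_vec: "TK W K *v a = pp (cplx W *v emb K a)"
  unfolding TK_def by (rule matrix_works)
    (intro Vector_Spaces.linear_iff[THEN iffD2] conjI allI, auto simp: emb_add emb_scale mv_add mv_scale pp_add pp_scale vec.vector_space_axioms)
lemma SK_vec: "SK W K *v a = mm (cplx W *v emb K a)"
  unfolding SK_def by (rule matrix_works)
    (intro Vector_Spaces.linear_iff[THEN iffD2] conjI allI, auto simp: emb_add emb_scale mv_add mv_scale mm_add mm_scale vec.vector_space_axioms)

lemma emb_axis_continuous: "continuous_on UNIV (\<lambda>p. emb (snd p) (axis j 1) $ k)"
  by (cases k) (auto simp: emb_def io_def matrix_vector_mult_axis intro!: continuous_intros)

lemma TK_continuous: "continuous_on UNIV (\<lambda>p. TK (fst p) (snd p))"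
  and SK_continuous: "continuous_on UNIV (\<lambda>p. SK (fst p) (snd p))"
  unfolding TK_def SK_def matrix_def pp_def mm_def matrix_vector_mult_def cplx_def
  by (auto intro!: continuous_on_vec_lambda continuous_intros emb_axis_continuous)

text \<open>Contractions are exactly the matrices whose graphs are nonnegative, and they form the
  compact convex set to which Brouwer's theorem is applied.\<close>

definition contr :: "(complex^'n^'n) set" where
  "contr = {K. \<forall>a. norm (K *v a) \<le> norm a}"

lemma kq_emb: "K \<in> contr \<Longrightarrow> kq (emb K a) \<ge> 0"
  by (simp add: kq_eq contr_def power_mono)

lemma SK_le_TK:
  assumes "W \<in> Sp" "K \<in> contr"
  shows "norm (SK W K *v a) \<le> norm (TK W K *v a)"
proof -
  have "kq (cplx W *v emb K a) \<ge> 0" using kq_emb[OF assms(2)] kq_Sp[OF assms(1)] by simp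
  then show ?thesis by (simp add: kq_eq TK_vec SK_vec power2_le_iff_abs_le)
qed

lemma cplx_Sp_kernel:
  assumes "W \<in> Sp" "cplx W *v x = 0" shows "x = 0"
  using krein_nondegenerate[of x] krein_Sp[OF assms(1), of x] assms(2) by simp

lemma TK_invertible:
  assumes W: "W \<in> Sp" and K: "K \<in> contr"
  shows "invertible (TK W K)"
  unfolding invertible_iff_kernel
proof (intro allI impI)
  fix a assume a: "TK W K *v a = 0"
  then have "SK W K *v a = 0" using SK_le_TK[OF W K, of a] by simp
  then have "cplx W *v emb K a = 0"
    using io_pp_mm[of "cplx W *v emb K a"] a by (simp add: TK_vec SK_vec)
  then have "emb K a = 0" by (rule cplx_Sp_kernel[OF W])
  then show "a = 0" by simp
qed

lemma contr_compact: "compact (contr :: (complex^'n^'n) set)"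
proof -
  have "contr = (\<Inter>a. {K :: complex^'n^'n. norm (K *v a) \<le> norm a})" by (auto simp: contr_def)
  also have "closed \<dots>"
    by (intro closed_INT ballI closed_Collect_le continuous_on_norm matrix_vec_mult.continuous_on
        continuous_on_id continuous_on_const)
  finally have "closed (contr :: (complex^'n^'n) set)" .
  moreover have "norm K \<le> real CARD('n) * real CARD('n)" if K: "K \<in> contr" for K :: "complex^'n^'n"
  proof -
    have e: "cmod (K $ i $ j) \<le> 1" for i j
    proof -
      have "cmod (K $ i $ j) \<le> norm (K *v axis j 1)"
        using Finite_Cartesian_Product.norm_nth_le[of "K *v axis j 1" i] by (simp add: matrix_vector_mult_axis)
      also have "\<dots> \<le> norm (axis j (1::complex))" using K unfolding contr_def by blast
      finally show ?thesis by simp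
    qed
    have "norm K \<le> (\<Sum>i\<in>UNIV. norm (K $ i))" unfolding norm_vec_def by (rule L2_set_le_sum) simp
    also have "\<dots> \<le> (\<Sum>i\<in>(UNIV::'n set). real CARD('n))"
    proof (rule sum_mono)
      fix i
      have "norm (K $ i) \<le> (\<Sum>j\<in>UNIV. cmod (K $ i $ j))" unfolding norm_vec_def by (rule L2_set_le_sum) simp
      also have "\<dots> \<le> (\<Sum>j\<in>(UNIV::'n set). 1)" by (intro sum_mono e)
      finally show "norm (K $ i) \<le> real CARD('n)" by simp
    qed
    finally show ?thesis by simp
  qed
  then have "bounded (contr :: (complex^'n^'n) set)" by (auto simp: bounded_iff)
  ultimately show ?thesis by (simp add: compact_eq_bounded_closed)
qed

lemma contr_convex: "convex contr"
  unfolding convex_def contr_def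
proof (intro ballI allI impI CollectI, elim CollectE)
  fix K L :: "complex^'n^'n" and u v :: real and a
  assume K: "\<forall>a. norm (K *v a) \<le> norm a" and L: "\<forall>a. norm (L *v a) \<le> norm a" and uv: "0 \<le> u" "0 \<le> v" "u + v = 1"
  have "norm ((u *\<^sub>R K + v *\<^sub>R L) *v a) \<le> norm (u *\<^sub>R (K *v a)) + norm (v *\<^sub>R (L *v a))"
    unfolding matrix_vec_mult.add_left matrix_vec_mult.scaleR_left by (rule norm_triangle_ineq)
  also have "\<dots> \<le> u * norm a + v * norm a" using K L uv by (auto intro!: add_mono mult_left_mono)
  finally show "norm ((u *\<^sub>R K + v *\<^sub>R L) *v a) \<le> norm a" using uv by (simp flip: distrib_right)
qed

text \<open>The map \<open>f\<close> sends the graph of \<open>K\<close> to its image under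
  \<open>W\<close>, which is again a nonnegative graph, so a fixed point is an invariant
  subspace.\<close>

lemma invariant_contraction_exists:
  assumes W: "W \<in> Sp"
  obtains K where "K \<in> contr" "SK W K = K ** TK W K"
proof -
  define f where "f K = SK W K ** matrix_inv (TK W K)" for K
  have cT: "continuous_on contr (\<lambda>K. TK W K)"
    using continuous_on_compose2[OF TK_continuous, of contr "\<lambda>K. (W, K)"] by (simp add: continuous_intros)
  have cS: "continuous_on contr (\<lambda>K. SK W K)"
    using continuous_on_compose2[OF SK_continuous, of contr "\<lambda>K. (W, K)"] by (simp add: continuous_intros)
  have cf: "continuous_on contr f"
    unfolding f_def by (intro matrix_mult.continuous_on continuous_on_matrix_inv cS cT TK_invertible W)
  have "f K \<in> contr" if K: "K \<in> contr" for K
    unfolding contr_def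
  proof (intro CollectI allI)
    fix a
    show "norm (f K *v a) \<le> norm a"
      using SK_le_TK[OF W K, of "matrix_inv (TK W K) *v a"]
      by (simp add: f_def matrix_inv_vec[OF TK_invertible[OF W K]] flip: matrix_vector_mul_assoc)
  qed
  moreover have "(0 :: complex^'n^'n) \<in> contr" by (simp add: contr_def)
  ultimately obtain K where K: "K \<in> contr" "f K = K"
    using brouwer[OF contr_compact contr_convex _ cf] by blast
  have "SK W K = f K ** TK W K"
    by (simp add: f_def matrix_mul_assoc[symmetric] matrix_inv_left TK_invertible[OF W K(1)])
  then show ?thesis using that K by simp
qed

section \<open>The rotation function as the phase of a determinant\<close>

lemma eigenvalues_eq_eigs: "eigenvalues W = eigs (cplx W)"
proof -
  have "charpoly W z = 0 \<longleftrightarrow> z \<in> eigs (cplx W)" for z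
  proof -
    have e: "((\<chi> i k. if i = k then z else 0) - cplx W) *v x = z *s x - cplx W *v x" for x
    proof -
      have "(\<chi> i k. if i = k then z else 0) *v x = z *s x"
        by (simp add: vec_eq_iff matrix_vector_mult_def if_distrib if_distribR cong: if_cong)
      then show ?thesis by (simp add: matrix_vector_mult_diff_rdistrib)
    qed
    have "charpoly W z = 0 \<longleftrightarrow> \<not> invertible ((\<chi> i k. if i = k then z else 0) - cplx W)"
      by (simp add: charpoly_def invertible_det_nz)
    also have "\<dots> \<longleftrightarrow> (\<exists>x. x \<noteq> 0 \<and> z *s x - cplx W *v x = 0)"
      unfolding invertible_iff_kernel e by auto
    also have "\<dots> \<longleftrightarrow> z \<in> eigs (cplx W)"
    proof -
      have "z *s x - cplx W *v x = 0 \<longleftrightarrow> cplx W *v x = z *s x" for x by (simp only: right_minus_eq) (rule eq_commute)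
      then show ?thesis unfolding eigs_iff_eigenvector by simp
    qed
    finally show ?thesis .
  qed
  then show ?thesis by (auto simp: eigenvalues_def)
qed

lemma krein_sum_left: "krein (\<Sum>a\<in>A. x a) y = (\<Sum>a\<in>A. krein (x a) y)"
  by (induction A rule: infinite_finite_induct) (simp_all add: krein_add_left)
lemma krein_sum_right: "krein y (\<Sum>a\<in>A. x a) = (\<Sum>a\<in>A. krein y (x a))"
  by (induction A rule: infinite_finite_induct) (simp_all add: krein_add_right)

lemma sgn_prod_complex: "sgn (\<Prod>a\<in>A. f a) = (\<Prod>a\<in>A. sgn (f a :: complex))"
  by (induction A rule: infinite_finite_induct) (simp_all add: sgn_mult)
lemma sgn_power_complex: "sgn (z ^ k) = sgn (z::complex) ^ k"
  by (induction k) (simp_all add: sgn_mult)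

text \<open>The maximal positive subspaces at unimodular eigenvalues and the whole generalised
  eigenspaces outside the disc are mutually orthogonal, the latter isotropic. Their sum is
  nonnegative, which bounds its dimension.\<close>

lemma krein_index_bound:
  fixes W :: "'n::finite sqm"
  assumes W: "W \<in> Sp"
  shows "(\<Sum>l\<in>{l\<in>eigs (cplx W). cmod l = 1}. krein_p W l)
    + (\<Sum>l\<in>{l\<in>eigs (cplx W). cmod l > 1}. vec.dim (gker (cplx W) l)) \<le> CARD('n)"
proof -
  let ?M = "cplx W"
  let ?L1 = "{l\<in>eigs ?M. cmod l = 1}" and ?Lg = "{l\<in>eigs ?M. cmod l > 1}"
  let ?A = "?L1 \<union> ?Lg"
  have fin: "finite ?A" "finite ?L1" "finite ?Lg" using finite_eigs[of ?M] by auto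
  have "\<forall>l. \<exists>P. vec.subspace P \<and> P \<subseteq> gker ?M l \<and> krein_posdef_on P \<and> vec.dim P = krein_p W l"
    by (metis krein_p_attained[of W])
  then obtain P where P: "\<And>l. vec.subspace (P l)" "\<And>l. P l \<subseteq> gker ?M l" "\<And>l. krein_posdef_on (P l)"
      "\<And>l. vec.dim (P l) = krein_p W l" by metis
  define S where "S l = (if cmod l = 1 then P l else gker ?M l)" for l
  have S: "vec.subspace (S l) \<and> S l \<subseteq> gker ?M l" for l using P gker_subspace by (auto simp: S_def)
  have "vec.dim (vec.span (\<Union>l\<in>?A. S l)) = (\<Sum>l\<in>?A. vec.dim (S l))"
    by (rule dim_span_gker[OF fin(1)]) (use S in auto)
  also have "\<dots> = (\<Sum>l\<in>?L1. vec.dim (S l)) + (\<Sum>l\<in>?Lg. vec.dim (S l))"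
    by (rule sum.union_disjoint) (use fin in auto)
  also have "(\<Sum>l\<in>?L1. vec.dim (S l)) = (\<Sum>l\<in>?L1. krein_p W l)"
    by (rule sum.cong) (auto simp: S_def P)
  also have "(\<Sum>l\<in>?Lg. vec.dim (S l)) = (\<Sum>l\<in>?Lg. vec.dim (gker ?M l))"
    by (rule sum.cong) (auto simp: S_def)
  finally have dim: "vec.dim (vec.span (\<Union>l\<in>?A. S l)) = (\<Sum>l\<in>?L1. krein_p W l) + (\<Sum>l\<in>?Lg. vec.dim (gker ?M l))" .
  have "vec.dim (vec.span (\<Union>l\<in>?A. S l)) \<le> CARD('n)"
  proof (rule nonneg_dim_le[OF vec.subspace_span])
    fix x assume "x \<in> vec.span (\<Union>l\<in>?A. S l)"
    then obtain y where y: "\<forall>l\<in>?A. y l \<in> S l" "x = (\<Sum>l\<in>?A. y l)"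
      using span_UN_sum[OF fin(1), of S x] S by blast
    have yg: "y l \<in> gker ?M l" if "l \<in> ?A" for l using y(1) S that by blast
    have z: "krein (y l) (y m) = (if l = m then krein (y l) (y l) else 0)" if lm: "l \<in> ?A" "m \<in> ?A" for l m
    proof (cases "l * cnj m = 1")
      case True
      then have "cmod l * cmod m = 1" by (metis complex_mod_cnj norm_mult norm_one)
      moreover have "cmod l \<ge> 1" "cmod m \<ge> 1" using lm by auto
      ultimately have "cmod m = 1" by (smt (verit, best) mult_le_cancel_right1 mult_cancel_right1)
      then have "m * cnj m = 1" by (simp add: complex_norm_square[symmetric])
      then have "l = m" using True by (metis mult_right_cancel mult_zero_right zero_neq_one)
      then show ?thesis by simp
    next
      case False
      then show ?thesis using krein_gker_orthogonal[OF W yg[OF lm(1)] yg[OF lm(2)]] by auto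
    qed
    have "krein x x = (\<Sum>l\<in>?A. \<Sum>m\<in>?A. krein (y l) (y m))"
      unfolding y(2) krein_sum_left krein_sum_right by (rule sum.swap)
    also have "\<dots> = (\<Sum>l\<in>?A. \<Sum>m\<in>?A. if l = m then krein (y l) (y l) else 0)"
      by (intro sum.cong z) auto
    also have "\<dots> = (\<Sum>l\<in>?A. krein (y l) (y l))" using fin by simp
    finally have "kq x = (\<Sum>l\<in>?A. kq (y l))" by (simp add: kq_def)
    moreover have "kq (y l) \<ge> 0" if l: "l \<in> ?A" for l
    proof (cases "cmod l = 1")
      case True
      have "y l \<in> S l" using y(1) l by blast
      then have "y l \<in> P l" using True by (simp add: S_def)
      then show ?thesis using P(3)[of l] by (cases "y l = 0") (auto simp: krein_posdef_kq kq_def intro: less_imp_le)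
    next
      case False
      have "l * cnj l \<noteq> 1"
      proof
        assume "l * cnj l = 1"
        then have "complex_of_real ((cmod l)\<^sup>2) = 1" by (simp only: complex_norm_square)
        then have "(cmod l)\<^sup>2 = 1" by (metis of_real_eq_1_iff)
        then show False using False power2_eq_imp_eq[of "cmod l" 1] by simp
      qed
      then show ?thesis using krein_gker_orthogonal[OF W yg[OF l] yg[OF l]] by (simp add: kq_def)
    qed
    ultimately show "kq x \<ge> 0" by (simp only: sum_nonneg)
  qed
  then show ?thesis using dim by simp
qed

text \<open>The graph is nonnegative, so its part at a unimodular eigenvalue is bounded by the
  positive index. Off the circle the spaces for \<open>l\<close> and \<open>1 / cnj l\<close> are
  isotropic and dual to each other; the parts of the graph in them must be orthogonal, which bounds
  the sum of their dimensions.\<close>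

lemma invariant_graph_dims:
  fixes W :: "'n::finite sqm"
  assumes W: "W \<in> Sp" and K: "K \<in> contr" and fx: "SK W K = K ** TK W K"
  defines "f \<equiv> \<lambda>l. vec.dim (gker (TK W K) l)"
  shows "cmod l = 1 \<Longrightarrow> f l \<le> krein_p W l"
    and "cmod l > 1 \<Longrightarrow> f l + f (1 / cnj l) \<le> vec.dim (gker (cplx W) l)"
    and "eigs (TK W K) \<subseteq> eigs (cplx W)"
proof -
  let ?M = "cplx W" and ?T = "TK W K"
  have inter: "?M *v emb K a = emb K (?T *v a)" for a
  proof -
    have "mm (?M *v emb K a) = K *v (?T *v a)"
      using fx SK_vec[of W K a] by (simp add: matrix_vector_mul_assoc)
    then show ?thesis using io_pp_mm[of "?M *v emb K a"] by (simp add: emb_def[of K "pp (?M *v emb K a)"] TK_vec)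
  qed
  have shi: "sh ?M l (emb K a) = emb K (sh ?T l a)" for l a
  proof -
    have "emb K (?T *v a) = emb K (sh ?T l a + l *s a)" by (simp add: sh_def)
    then show ?thesis by (simp add: sh_def[of ?M] inter emb_add emb_scale)
  qed
  have shp: "(sh ?M l ^^ k) (emb K a) = emb K ((sh ?T l ^^ k) a)" for l k a
    by (induct k) (simp_all add: shi)
  define F where "F l = emb K ` gker ?T l" for l
  have Fsub: "F l \<subseteq> gker ?M l" for l
    unfolding F_def
  proof
    fix x assume "x \<in> emb K ` gker ?T l"
    then obtain a where a: "x = emb K a" "a \<in> gker ?T l" by blast
    then have "(sh ?M l ^^ CARD('n)) x = 0" using shp[where k = "CARD('n)" and a = a and l = l] by (simp add: gker_def)
    then show "x \<in> gker ?M l" by (rule sh_kernel_stable)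
  qed
  have Fs: "vec.subspace (F l)" for l
    unfolding F_def by (rule vec.linear_subspace_image[OF emb_linear gker_subspace])
  have Fd: "vec.dim (F l) = f l" for l
    unfolding F_def f_def
    by (rule vec.dim_image_eq[OF emb_linear])
      (use gker_subspace[of ?T l] vec.linear_inj_on_iff_eq_0[OF emb_linear gker_subspace[of ?T l]] in \<open>simp add: vec.span_eq_iff[THEN iffD2]\<close>)
  have nn: "kq (emb K a) \<ge> 0" for a using kq_emb[OF K] .
  have Fnn: "kq x \<ge> 0" if "x \<in> F l" for x l using that nn by (auto simp: F_def)
  show "f l \<le> krein_p W l" if "cmod l = 1" for l
    using nonneg_in_gker_dim_le[OF W that Fs Fsub Fnn] Fd by simp
  show "eigs ?T \<subseteq> eigs ?M"
  proof
    fix l assume "l \<in> eigs ?T"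
    then have "vec.dim (F l) \<noteq> 0" unfolding Fd f_def dim_gker_pos .
    then have "vec.dim (gker ?M l) \<noteq> 0" using vec.dim_subset[OF Fsub[of l]] by (simp del: vec.dim_eq_0)
    then show "l \<in> eigs ?M" by (simp only: dim_gker_pos not_False_eq_True)
  qed
  show "f l + f (1 / cnj l) \<le> vec.dim (gker ?M l)" if l: "cmod l > 1" for l
  proof (rule ccontr)
    assume nle: "\<not> ?thesis"
    define m where "m = 1 / cnj l"
    have l0: "l \<noteq> 0" using l by auto
    have ml: "m * cnj l = 1" using l0 by (simp add: m_def)
    have lm: "l * cnj m = 1" using l0 by (simp add: m_def)
    have isoF: "kq x = 0" if "x \<in> gker ?M l" for x
    proof -
      have "l * cnj l \<noteq> 1"
      proof
        assume "l * cnj l = 1"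
        then have "cmod l * cmod l = 1" by (metis complex_mod_cnj norm_mult norm_one)
        then show False using l by (metis less_1_mult less_irrefl)
      qed
      then show ?thesis using krein_gker_orthogonal[OF W that that] by (simp add: kq_def)
    qed
    have isoM: "kq x = 0" if "x \<in> gker ?M m" for x
    proof -
      have "m * cnj m \<noteq> 1"
      proof
        assume "m * cnj m = 1"
        then have "m * cnj l = m * cnj m" using ml by simp
        then have "l = m" using ml by (metis complex_cnj_cancel_iff mult_left_cancel mult_zero_left zero_neq_one)
        then have "cmod l * cmod l = 1" using lm by (metis complex_mod_cnj norm_mult norm_one)
        then show False using l by (metis less_1_mult less_irrefl)
      qed
      then show ?thesis using krein_gker_orthogonal[OF W that that] by (simp add: kq_def)
    qed
    have orth: "krein y x = 0" if xy: "x \<in> F l" "y \<in> F m" for x y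
    proof (rule ccontr)
      assume ne: "krein y x \<noteq> 0"
      \<comment> \<open>With both vectors isotropic, the norm of \<open>c *s y + x\<close> is twice
        the real part of \<open>c\<close> times the pairing, so this \<open>c\<close> makes it
        \<open>-2\<close>.\<close>
      define c where "c = - 1 / krein y x"
      obtain a b where ab: "x = emb K a" "y = emb K b" using xy by (auto simp: F_def)
      have "kq (c *s y + x) \<ge> 0" unfolding ab by (simp add: nn flip: emb_scale emb_add)
      moreover have "kq (c *s y + x) = - 2"
      proof -
        have "kq x = 0" "kq y = 0" using isoF[of x] isoM[of y] xy Fsub by auto
        then show ?thesis by (simp only: kq_add kq_scale krein_scale_left) (simp add: c_def ne)
      qed
      ultimately show False by simp
    qed
    obtain BF where BF: "finite BF" "BF \<subseteq> F l" "vec.span BF = F l" "card BF = vec.dim (F l)" "vec.independent BF"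
      using vec.basis_subspace_exists[OF Fs[of l]] vec.finiteI_independent by metis
    \<comment> \<open>A basis extending one of \<open>F l\<close>: a vector of \<open>F m\<close> is
      orthogonal to the first part automatically, so only the additional basis vectors impose
      conditions.\<close>
    obtain B where B: "BF \<subseteq> B" "B \<subseteq> gker ?M l" "vec.independent B" "gker ?M l \<subseteq> vec.span B"
      using vec.maximal_independent_subset_extend[of BF "gker ?M l"] BF Fsub by (metis subset_trans)
    have finB: "finite B" using B(3) vec.finiteI_independent by blast
    have cB: "card B = vec.dim (gker ?M l)" using vec.basis_card_eq_dim[OF B(2,4,3)] .
    have "card (B - BF) = card B - card BF" by (rule card_Diff_subset[OF BF(1) B(1)])
    then have "card (B - BF) < vec.dim (F m)"
      using nle cB BF(4) card_mono[OF finB B(1)] unfolding Fd m_def by simp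
    then obtain y where y: "y \<in> F m" "y \<noteq> 0" "\<And>b. b \<in> B - BF \<Longrightarrow> krein y b = 0"
      using krein_orthogonal_exists[OF _ Fs[of m], of "B - BF"] finB by (metis finite_Diff)
    have "krein y b = 0" if "b \<in> B" for b using y orth[of b y] BF(2) that by blast
    then have "krein y x = 0" if "x \<in> gker ?M l" for x using krein_span_zero[of B y x] B(4) that by blast
    then have "y = 0" using gker_pairing_nondegenerate[OF W ml] Fsub y(1) by blast
    then show False using y(2) by simp
  qed
qed

text \<open>The bounds for the parts of the graph add up to at most \<open>CARD('n)\<close>, which
  is its dimension, so all of them are equalities. A pair \<open>l\<close>, \<open>1 / cnj l\<close>
  has a common phase and contributes it to the full multiplicity; outside the disc nonreal phases
  cancel in conjugate pairs and positive ones are \<open>1\<close>, which leaves the sign counted by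
  \<open>neg_mult\<close>. The essential point is that the phase is the same for every invariant
  \<open>K\<close>.\<close>

theorem upsilon_eq_sgn_det:
  fixes W :: "'n::finite sqm"
  assumes W: "W \<in> Sp" and K: "K \<in> contr" and fx: "SK W K = K ** TK W K"
  shows "upsilon W = sgn (det (TK W K))"
proof -
  let ?M = "cplx W" and ?T = "TK W K"
  define f where "f l = vec.dim (gker ?T l)" for l
  define d where "d l = vec.dim (gker ?M l)" for l
  define p where "p l = krein_p W l" for l
  define s where "s l = 1 / cnj l" for l :: complex
  define L where "L = eigs ?M"
  define L1 where "L1 = {l\<in>L. cmod l = 1}"
  define Lg where "Lg = {l\<in>L. cmod l > 1}"
  define Ll where "Ll = {l\<in>L. cmod l < 1}"
  have finL: "finite L" "finite L1" "finite Lg" "finite Ll"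
    unfolding L_def L1_def Lg_def Ll_def using finite_eigs[of ?M] by auto
  have Lun: "L = L1 \<union> (Lg \<union> Ll)" by (auto simp: L1_def Lg_def Ll_def)
  have disj: "L1 \<inter> (Lg \<union> Ll) = {}" "Lg \<inter> Ll = {}" by (auto simp: L1_def Lg_def Ll_def)
  have L0: "l \<noteq> 0" if "l \<in> L" for l
    using that cplx_Sp_kernel[OF W] unfolding L_def eigs_iff_eigenvector by auto
  have memL: "l \<in> L \<longleftrightarrow> d l \<noteq> 0" for l by (simp only: L_def d_def dim_gker_pos)
  have ds: "d (s l) = d l" if "l \<noteq> 0" for l
    unfolding d_def by (rule dim_gker_dual[OF W]) (use that in \<open>simp add: s_def\<close>)
  have dc: "d (cnj l) = d l" for l by (simp add: d_def dim_gker_cnj)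
  have cs: "cmod (s l) = 1 / cmod l" for l by (simp add: s_def norm_divide)
  have ss: "s (s l) = l" for l by (simp add: s_def)
  have bij: "bij_betw s Lg Ll"
    by (rule bij_betw_byWitness[where f' = s])
      (use L0 in \<open>auto simp: ss Lg_def Ll_def memL ds cs\<close>)
  note dims = invariant_graph_dims[OF W K fx, folded f_def d_def p_def s_def]
  have Tn0: "0 \<notin> eigs ?T"
    using TK_invertible[OF W K] unfolding eigs_iff_eigenvector invertible_iff_kernel by auto
  have f0: "f l = 0" if "l \<notin> eigs ?T" for l using that dim_gker_pos[of l ?T] by (simp add: f_def)
  have subL: "eigs ?T \<subseteq> L" using dims(3) by (simp add: L_def)
  have detT: "det ?T = (\<Prod>l\<in>L. l ^ f l)"
    unfolding det_eq_prod_gker[OF Tn0] f_def[symmetric]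
    by (rule prod.mono_neutral_left[OF finL(1) subL]) (simp add: f0)
  have sumf: "(\<Sum>l\<in>L. f l) = CARD('n)"
    unfolding sum_dim_gker[of ?T, symmetric] f_def[symmetric]
    by (rule sum.mono_neutral_right[OF finL(1) subL]) (simp add: f0)
  have split_sum: "(\<Sum>l\<in>L. g l) = (\<Sum>l\<in>L1. g l) + (\<Sum>l\<in>Lg. g l + g (s l))" for g :: "complex \<Rightarrow> nat"
  proof -
    have "(\<Sum>l\<in>L. g l) = (\<Sum>l\<in>L1. g l) + ((\<Sum>l\<in>Lg. g l) + (\<Sum>l\<in>Ll. g l))"
      unfolding Lun by (simp add: sum.union_disjoint finL disj)
    also have "(\<Sum>l\<in>Ll. g l) = (\<Sum>l\<in>Lg. g (s l))"
      by (rule sum.reindex_bij_betw[OF bij, symmetric])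
    finally show ?thesis by (simp add: sum.distrib)
  qed
  have fp: "f l \<le> p l" if "l \<in> L1" for l using dims(1)[of l] that by (simp add: L1_def)
  have fd: "f l + f (s l) \<le> d l" if "l \<in> Lg" for l using dims(2)[of l] that by (simp add: Lg_def)
  have le: "(\<Sum>l\<in>L1. p l) + (\<Sum>l\<in>Lg. d l) \<le> CARD('n)"
    using krein_index_bound[OF W] by (simp add: p_def d_def L1_def Lg_def L_def)
  have n: "(\<Sum>l\<in>L1. f l) + (\<Sum>l\<in>Lg. f l + f (s l)) = CARD('n)" using sumf split_sum[of f] by simp
  have m1: "(\<Sum>l\<in>L1. f l) \<le> (\<Sum>l\<in>L1. p l)" by (intro sum_mono fp)
  have m2: "(\<Sum>l\<in>Lg. f l + f (s l)) \<le> (\<Sum>l\<in>Lg. d l)" by (intro sum_mono fd)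
  \<comment> \<open>Each sum is at most its bound, while the bounds together do not exceed the total
    of the sums; so both are attained, and then termwise.\<close>
  have e1: "(\<Sum>l\<in>L1. f l) = (\<Sum>l\<in>L1. p l)" and e2: "(\<Sum>l\<in>Lg. f l + f (s l)) = (\<Sum>l\<in>Lg. d l)"
    using le n m1 m2 by linarith+
  have fp': "f l = p l" if "l \<in> L1" for l using sum_mono_inv[OF e1 fp that finL(2)] .
  have fd': "f l + f (s l) = d l" if "l \<in> Lg" for l using sum_mono_inv[OF e2 fd that finL(3)] .
  have sgns: "sgn (s l) = sgn l" for l
  proof (cases "l = 0")
    case False
    have "l * cnj l = complex_of_real (cmod l) * complex_of_real (cmod l)"
      using complex_norm_square[of l] by (simp add: power2_eq_square)
    then have "l / complex_of_real (cmod l) = complex_of_real (cmod l) / cnj l"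
      using False by (simp add: frac_eq_eq)
    moreover have "sgn (s l) = complex_of_real (cmod l) / cnj l" by (simp add: s_def sgn_eq norm_divide)
    ultimately show ?thesis by (simp add: sgn_eq)
  qed (simp add: s_def)
  have "sgn (det ?T) = (\<Prod>l\<in>L. sgn l ^ f l)" unfolding detT by (simp add: sgn_prod_complex sgn_power_complex)
  also have "\<dots> = (\<Prod>l\<in>L1. sgn l ^ f l) * ((\<Prod>l\<in>Lg. sgn l ^ f l) * (\<Prod>l\<in>Ll. sgn l ^ f l))"
    unfolding Lun by (simp add: prod.union_disjoint finL disj)
  also have "(\<Prod>l\<in>Ll. sgn l ^ f l) = (\<Prod>l\<in>Lg. sgn l ^ f (s l))"
    by (subst prod.reindex_bij_betw[OF bij, symmetric]) (simp add: sgns)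
  also have "(\<Prod>l\<in>Lg. sgn l ^ f l) * (\<Prod>l\<in>Lg. sgn l ^ f (s l)) = (\<Prod>l\<in>Lg. sgn l ^ d l)"
    unfolding prod.distrib[symmetric] by (rule prod.cong) (simp_all add: fd' flip: power_add)
  also have "(\<Prod>l\<in>L1. sgn l ^ f l) = (\<Prod>l\<in>L1. l ^ p l)"
    by (rule prod.cong) (auto simp: fp' L1_def sgn_div_norm)
  finally have sgnT: "sgn (det ?T) = (\<Prod>l\<in>L1. l ^ p l) * (\<Prod>l\<in>Lg. sgn l ^ d l)" .

  define U where "U = {l\<in>L. cmod l = 1 \<and> l \<noteq> 1 \<and> l \<noteq> -1}"
  have dm1: "d (-1) = 2 * p (-1)" using dim_gker_minus_one[OF W] by (simp add: d_def p_def)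
  \<comment> \<open>The point \<open>1\<close> contributes the factor \<open>1\<close>, and if
    \<open>-1\<close> is not an eigenvalue then \<open>p (-1) = 0\<close>; so both points may be
    adjoined to \<open>U\<close>.\<close>
  have "(\<Prod>l\<in>L1. l ^ p l) = (\<Prod>l\<in>U \<union> {1, -1}. l ^ p l)"
  proof (rule prod.mono_neutral_left)
    show "\<forall>i\<in>U \<union> {1, - 1} - L1. i ^ p i = 1"
      using dm1 by (cases "p (-1) = 0") (auto simp: U_def L1_def memL)
  qed (use finL in \<open>auto simp: U_def L1_def\<close>)
  also have "\<dots> = (\<Prod>l\<in>U. l ^ p l) * (\<Prod>l\<in>{1, -1}. l ^ p l)"
    by (rule prod.union_disjoint) (use finL in \<open>auto simp: U_def\<close>)
  finally have prodL1: "(\<Prod>l\<in>L1. l ^ p l) = (\<Prod>l\<in>U. l ^ p l) * (-1) ^ p (-1)" by simp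

  define Ln where "Ln = {l\<in>Lg. l \<in> \<real> \<and> Re l < 0}"
  define Lp where "Lp = {l\<in>Lg. l \<in> \<real> \<and> Re l > 0}"
  define Lu where "Lu = {l\<in>Lg. Im l > 0}"
  define Lw where "Lw = {l\<in>Lg. Im l < 0}"
  have finG: "finite Ln" "finite Lp" "finite Lu" "finite Lw" using finL by (auto simp: Ln_def Lp_def Lu_def Lw_def)
  have Lgun: "Lg = Ln \<union> (Lp \<union> (Lu \<union> Lw))"
  proof -
    have "l \<in> Ln \<union> (Lp \<union> (Lu \<union> Lw))" if l: "l \<in> Lg" for l
    proof (cases "Im l = 0")
      case True
      moreover have "Re l \<noteq> 0"
      proof
        assume "Re l = 0"
        then have "l = 0" using True by (simp add: complex_eq_iff)
        then show False using l L0 by (auto simp: Lg_def)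
      qed
      ultimately show ?thesis using l by (auto simp: Ln_def Lp_def complex_is_Real_iff)
    qed (use l in \<open>auto simp: Lu_def Lw_def\<close>)
    then show ?thesis by (auto simp: Ln_def Lp_def Lu_def Lw_def)
  qed
  have disj2: "Ln \<inter> (Lp \<union> (Lu \<union> Lw)) = {}" "Lp \<inter> (Lu \<union> Lw) = {}" "Lu \<inter> Lw = {}"
    by (auto simp: Ln_def Lp_def Lu_def Lw_def complex_is_Real_iff)
  have bijc: "bij_betw cnj Lu Lw"
    by (rule bij_betw_byWitness[where f' = cnj]) (auto simp: Lu_def Lw_def Lg_def memL dc)
  have "(\<Prod>l\<in>Lg. sgn l ^ d l) = (\<Prod>l\<in>Ln. sgn l ^ d l) * ((\<Prod>l\<in>Lp. sgn l ^ d l) * ((\<Prod>l\<in>Lu. sgn l ^ d l) * (\<Prod>l\<in>Lw. sgn l ^ d l)))"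
    unfolding Lgun by (simp add: prod.union_disjoint finG disj2)
  also have "(\<Prod>l\<in>Lw. sgn l ^ d l) = (\<Prod>l\<in>Lu. sgn (cnj l) ^ d l)"
    by (subst prod.reindex_bij_betw[OF bijc, symmetric]) (simp add: dc)
  also have "(\<Prod>l\<in>Lu. sgn l ^ d l) * (\<Prod>l\<in>Lu. sgn (cnj l) ^ d l) = 1"
    unfolding prod.distrib[symmetric] power_mult_distrib[symmetric]
  proof (rule prod.neutral, rule ballI)
    fix l assume "l \<in> Lu"
    then have "l \<noteq> 0" by (auto simp: Lu_def)
    have "sgn l * sgn (cnj l) = sgn (l * cnj l)" by (simp add: sgn_mult)
    also have "\<dots> = sgn (complex_of_real ((cmod l)\<^sup>2))" by (simp only: complex_norm_square)
    also have "\<dots> = 1" using \<open>l \<noteq> 0\<close> by (simp add: sgn_of_real del: of_real_power)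
    finally show "(sgn l * sgn (cnj l)) ^ d l = 1" by simp
  qed
  also have "(\<Prod>l\<in>Lp. sgn l ^ d l) = 1"
    by (rule prod.neutral) (auto simp: Lp_def elim!: Reals_cases simp: sgn_of_real)
  also have "(\<Prod>l\<in>Ln. sgn l ^ d l) = (\<Prod>l\<in>Ln. (-1) ^ d l)"
    by (rule prod.cong) (auto simp: Ln_def elim!: Reals_cases simp: sgn_of_real)
  also have "\<dots> = (-1) ^ (\<Sum>l\<in>Ln. d l)" by (simp add: power_sum)
  finally have prodLg: "(\<Prod>l\<in>Lg. sgn l ^ d l) = (-1) ^ (\<Sum>l\<in>Ln. d l)" by simp

  \<comment> \<open>Negative real eigenvalues come in pairs \<open>l\<close>, \<open>1 / l\<close>
    apart from \<open>-1\<close>, whose multiplicity is \<open>2 * p (-1)\<close>; hence the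
    division by \<open>2\<close> in \<open>upsilon\<close> is exact.\<close>
  define N where "N = {l\<in>L. l \<in> \<real> \<and> Re l < 0}"
  have "neg_mult W = (\<Sum>l\<in>N. d l)"
    by (simp add: neg_mult_def N_def L_def eigenvalues_eq_eigs d_def geneig_eq_gker)
  also have "\<dots> = (\<Sum>l\<in>L. if l \<in> N then d l else 0)"
    using finL by (simp add: sum.If_cases N_def Int_def)
  also have "\<dots> = (\<Sum>l\<in>L1. if l \<in> N then d l else 0) + (\<Sum>l\<in>Lg. (if l \<in> N then d l else 0) + (if s l \<in> N then d (s l) else 0))"
    by (rule split_sum)
  also have "(\<Sum>l\<in>L1. if l \<in> N then d l else 0) = d (-1)"
  proof -
    have "(\<Sum>l\<in>L1. if l \<in> N then d l else 0) = (\<Sum>l\<in>{-1}. d l)"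
    proof (rule sum.mono_neutral_cong)
      show "\<And>i. i \<in> {- 1} - L1 \<Longrightarrow> d i = 0" by (auto simp: L1_def memL)
      show "(if i \<in> N then d i else 0) = 0" if "i \<in> L1 - {-1}" for i
        using that by (auto simp: L1_def N_def elim!: Reals_cases)
      show "(if x \<in> N then d x else 0) = d x" if "x \<in> L1 \<inter> {-1}" for x
        using that by (auto simp: L1_def N_def)
    qed (use finL in auto)
    then show ?thesis by simp
  qed
  also have "(\<Sum>l\<in>Lg. (if l \<in> N then d l else 0) + (if s l \<in> N then d (s l) else 0)) = (\<Sum>l\<in>Lg. if l \<in> Ln then 2 * d l else 0)"
  proof (rule sum.cong[OF refl])
    fix l assume l: "l \<in> Lg"
    then have l0: "l \<noteq> 0" using L0 by (auto simp: Lg_def)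
    have sL: "s l \<in> L" using l l0 by (simp add: memL ds Lg_def)
    have "s l \<in> \<real> \<and> Re (s l) < 0 \<longleftrightarrow> l \<in> \<real> \<and> Re l < 0"
      using l0 by (auto simp: s_def complex_is_Real_iff Re_divide Im_divide divide_less_0_iff sum_power2_eq_zero_iff complex_eq_iff)
    then show "(if l \<in> N then d l else 0) + (if s l \<in> N then d (s l) else 0) = (if l \<in> Ln then 2 * d l else 0)"
      using l sL ds[OF l0] by (auto simp: N_def Ln_def Lg_def)
  qed
  also have "\<dots> = 2 * (\<Sum>l\<in>Ln. d l)"
    using finL by (simp add: sum.If_cases Ln_def Int_def sum_distrib_left)
  finally have "neg_mult W div 2 = p (-1) + (\<Sum>l\<in>Ln. d l)" by (simp add: dm1)
  then show ?thesis
    unfolding upsilon_def eigenvalues_eq_eigs L_def[symmetric] U_def[symmetric] p_def[symmetric] sgnT prodL1 prodLg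
    by (simp add: power_add mult_ac)
qed

text \<open>With a compact target it is enough that every limit of values is the right one. This
  suits functions known only through a choice, here \<open>upsilon\<close> and the sum of the
  angles.\<close>

lemma continuous_on_closed_graph:
  fixes f :: "'a::metric_space \<Rightarrow> 'b::metric_space"
  assumes T: "compact T" "f ` S \<subseteq> T"
    and graph: "\<And>X x y. (\<And>k::nat. X k \<in> S) \<Longrightarrow> X \<longlonglongrightarrow> x \<Longrightarrow> x \<in> S \<Longrightarrow> (\<lambda>k. f (X k)) \<longlonglongrightarrow> y \<Longrightarrow> y = f x"
  shows "continuous_on S f"
  unfolding continuous_on_sequentially
proof (intro allI ballI impI, elim conjE)
  fix X x assume x: "x \<in> S" and X: "\<forall>n. X n \<in> S" "X \<longlonglongrightarrow> x"
  show "(f \<circ> X) \<longlonglongrightarrow> f x"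
  proof (rule ccontr)
    assume "\<not> ?thesis"
    then obtain e where e: "e > 0" "\<forall>N. \<exists>n\<ge>N. dist (f (X n)) (f x) \<ge> e"
      by (auto simp: lim_sequentially not_less)
    then have "infinite {n. dist (f (X n)) (f x) \<ge> e}"
      unfolding infinite_nat_iff_unbounded_le by auto
    then obtain r :: "nat \<Rightarrow> nat" where r: "strict_mono r" "\<And>n. dist (f (X (r n))) (f x) \<ge> e"
      using infinite_enumerate by blast
    have "\<forall>n. (f \<circ> X \<circ> r) n \<in> T" using T(2) X(1) by auto
    then obtain l r' where l: "strict_mono r'" "((f \<circ> X \<circ> r) \<circ> r') \<longlonglongrightarrow> l"
      using T(1) unfolding compact_def by blast
    have "(\<lambda>k. X (r (r' k))) \<longlonglongrightarrow> x"
      using LIMSEQ_subseq_LIMSEQ[OF X(2), of "r \<circ> r'"] strict_mono_o[OF r(1) l(1)] by (simp add: o_def)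
    then have "l = f x" using graph[of "\<lambda>k. X (r (r' k))" x l] X(1) x l(2) by (simp add: o_def)
    then have "(\<lambda>k. dist (f (X (r (r' k)))) (f x)) \<longlonglongrightarrow> 0"
      using l(2) by (simp add: o_def tendsto_dist_iff[symmetric])
    then have "e \<le> 0" by (rule LIMSEQ_le_const) (use r(2) in auto)
    then show False using e(1) by simp
  qed
qed

lemma norm_upsilon:
  assumes "W \<in> Sp" shows "cmod (upsilon W) = 1"
proof -
  obtain K where K: "K \<in> contr" "SK W K = K ** TK W K" by (rule invariant_contraction_exists[OF assms])
  have "det (TK W K) \<noteq> 0" using TK_invertible[OF assms K(1)] invertible_det_nz by blast
  then show ?thesis using upsilon_eq_sgn_det[OF assms K] by (simp add: norm_sgn)
qed

text \<open>Invariant contractions for \<open>X k\<close> subconverge to an invariant contraction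
  for the limit, and the phase of the determinant does not depend on which contraction is
  taken.\<close>

lemma continuous_on_upsilon: "continuous_on Sp (upsilon :: 'n::finite sqm \<Rightarrow> complex)"
proof (rule continuous_on_closed_graph)
  show "compact (sphere (0::complex) 1)" by simp
  show "upsilon ` Sp \<subseteq> sphere (0::complex) 1" using norm_upsilon by auto
  fix X :: "nat \<Rightarrow> 'n sqm" and x y
  assume X: "\<And>k. X k \<in> Sp" "X \<longlonglongrightarrow> x" and x: "x \<in> Sp" and y: "(\<lambda>k. upsilon (X k)) \<longlonglongrightarrow> y"
  have "\<forall>k. \<exists>K. K \<in> contr \<and> SK (X k) K = K ** TK (X k) K"
    using invariant_contraction_exists[OF X(1)] by metis
  then obtain K where K: "\<And>k. K k \<in> contr" "\<And>k. SK (X k) (K k) = K k ** TK (X k) (K k)" by metis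
  obtain K' r where r: "K' \<in> contr" "strict_mono r" "(K \<circ> r) \<longlonglongrightarrow> K'"
    using contr_compact K(1) unfolding compact_def by metis
  have Xr: "(\<lambda>k. X (r k)) \<longlonglongrightarrow> x" using LIMSEQ_subseq_LIMSEQ[OF X(2) r(2)] by (simp add: o_def)
  have pr: "(\<lambda>k. (X (r k), K (r k))) \<longlonglongrightarrow> (x, K')" using r(3) Xr by (intro tendsto_Pair) (simp_all add: o_def)
  have T: "(\<lambda>k. TK (X (r k)) (K (r k))) \<longlonglongrightarrow> TK x K'"
    using continuous_on_tendsto_compose[OF TK_continuous pr] by simp
  have S: "(\<lambda>k. SK (X (r k)) (K (r k))) \<longlonglongrightarrow> SK x K'"
    using continuous_on_tendsto_compose[OF SK_continuous pr] by simp
  have "(\<lambda>k. K (r k) ** TK (X (r k)) (K (r k))) \<longlonglongrightarrow> K' ** TK x K'"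
    using r(3) T by (intro matrix_mult.tendsto) (simp_all add: o_def)
  then have fx: "SK x K' = K' ** TK x K'" using S unfolding K(2) by (rule LIMSEQ_unique[rotated])
  have "det (TK x K') \<noteq> 0" using TK_invertible[OF x r(1)] invertible_det_nz by blast
  then have "(\<lambda>k. sgn (det (TK (X (r k)) (K (r k))))) \<longlonglongrightarrow> sgn (det (TK x K'))"
    by (intro tendsto_sgn tendsto_det T)
  then have "(\<lambda>k. upsilon (X (r k))) \<longlonglongrightarrow> upsilon x"
    using upsilon_eq_sgn_det[OF X(1) K] upsilon_eq_sgn_det[OF x r(1) fx] by simp
  moreover have "(\<lambda>k. upsilon (X (r k))) \<longlonglongrightarrow> y"
    using LIMSEQ_subseq_LIMSEQ[OF y r(2)] by (simp add: o_def)
  ultimately show "y = upsilon x" by (rule LIMSEQ_unique[THEN sym])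
qed

section \<open>The universal cover and lifts\<close>

lemma sp_path_D:
  assumes "sp_path g"
  shows "path g" "path_image g \<subseteq> Sp" "pathstart g = mat 1" "g 0 = mat 1" "\<And>t. t \<in> {0..1} \<Longrightarrow> g t \<in> Sp"
    "continuous_on {0..1} g"
  using assms by (auto simp: sp_path_def path_image_def pathstart_def path_def)

lemma cls_self: "sp_path g \<Longrightarrow> g \<in> cls g"
  by (simp add: cls_def sp_path_def)

lemma sp_path_homotopic: "sp_path g \<Longrightarrow> homotopic_paths Sp g h \<Longrightarrow> sp_path h"
  by (metis homotopic_paths_imp_path homotopic_paths_imp_pathstart homotopic_paths_imp_subset sp_path_def)

lemma cls_eqI:
  assumes "homotopic_paths Sp g h"
  shows "cls g = cls h"
  using assms homotopic_paths_sym homotopic_paths_trans unfolding cls_def by blast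

lemma SpT_mem:
  assumes "w \<in> SpT" "g \<in> w"
  shows "w = cls g" "sp_path g"
proof -
  obtain h where h: "w = cls h" "sp_path h" using assms(1) by (auto simp: SpT_def)
  then have "homotopic_paths Sp h g" "sp_path g" using assms(2) by (auto simp: cls_def)
  then show "w = cls g" "sp_path g" using h cls_eqI by blast+
qed

lemma cls_in_SpT: "sp_path g \<Longrightarrow> cls g \<in> SpT"
  by (auto simp: SpT_def)

lemma SpT_nonempty: "w \<in> SpT \<Longrightarrow> \<exists>g. g \<in> w"
  using cls_self by (auto simp: SpT_def)

lemma proj_eq:
  assumes "w \<in> SpT" "g \<in> w"
  shows "proj w = pathfinish g"
proof -
  have "(SOME g. g \<in> w) \<in> w" using assms(2) by (rule someI[of "\<lambda>g. g \<in> w"])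
  then have "homotopic_paths Sp g (SOME g. g \<in> w)" using SpT_mem[OF assms] by (auto simp: cls_def)
  then show ?thesis by (simp add: proj_def homotopic_paths_imp_pathfinish)
qed

lemma proj_cls: "sp_path g \<Longrightarrow> proj (cls g) = g 1"
  using proj_eq[OF cls_in_SpT cls_self] by (simp add: pathfinish_def)

lemma proj_in_Sp: "w \<in> SpT \<Longrightarrow> proj w \<in> Sp"
  using SpT_nonempty[of w] proj_eq[of w] SpT_mem(2)[of w] sp_path_D(5) by (fastforce simp: pathfinish_def)

lemma sp_path_join:
  assumes "sp_path g" "path d" "path_image d \<subseteq> Sp" "pathstart d = pathfinish g"
  shows "sp_path (g +++ d)"
  using assms by (auto simp: sp_path_def path_image_join)

lemma sp_path_const: "sp_path (\<lambda>t. mat 1)"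
  by (auto simp: sp_path_def path_def path_image_def pathstart_def)

lemma idT_in_SpT: "idT \<in> SpT"
  unfolding idT_def by (rule cls_in_SpT[OF sp_path_const])

lemma nbhd_mono: "V \<subseteq> V' \<Longrightarrow> nbhd w V \<subseteq> nbhd w V'"
  unfolding nbhd_def by blast

lemma nbhd_subset: "w \<in> SpT \<Longrightarrow> nbhd w V \<subseteq> SpT"
  unfolding nbhd_def using SpT_mem(2) by (auto intro!: cls_in_SpT sp_path_join)

lemma openin_SpT_top:
  fixes U :: "(real \<Rightarrow> 'n::finite sqm) set set"
  shows "openin SpT_top U \<longleftrightarrow> U \<subseteq> SpT \<and> (\<forall>w\<in>U. \<exists>V. open V \<and> proj w \<in> V \<and> nbhd w V \<subseteq> U)"
proof -
  let ?P = "\<lambda>U :: (real \<Rightarrow> 'n sqm) set set. U \<subseteq> SpT \<and> (\<forall>w\<in>U. \<exists>V. open V \<and> proj w \<in> V \<and> nbhd w V \<subseteq> U)"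
  have "istopology ?P"
    unfolding istopology_def
  proof (intro conjI allI impI)
    fix S T
    assume S: "?P S" and T: "?P T"
    show "S \<inter> T \<subseteq> SpT" using S by blast
    show "\<forall>w\<in>S \<inter> T. \<exists>V. open V \<and> proj w \<in> V \<and> nbhd w V \<subseteq> S \<inter> T"
    proof
      fix w assume "w \<in> S \<inter> T"
      then obtain V V' where "open V" "proj w \<in> V" "nbhd w V \<subseteq> S" "open V'" "proj w \<in> V'" "nbhd w V' \<subseteq> T"
        using S T by blast
      then show "\<exists>V. open V \<and> proj w \<in> V \<and> nbhd w V \<subseteq> S \<inter> T"
        using nbhd_mono[of "V \<inter> V'" V w] nbhd_mono[of "V \<inter> V'" V' w]
        by (intro exI[of _ "V \<inter> V'"]) auto
    qed
  next
    fix K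
    assume K: "\<forall>S\<in>K. ?P S"
    show "\<Union> K \<subseteq> SpT" using K by blast
    show "\<forall>w\<in>\<Union> K. \<exists>V. open V \<and> proj w \<in> V \<and> nbhd w V \<subseteq> \<Union> K" using K by (meson Union_iff Union_upper subset_trans)
  qed
  then show ?thesis unfolding SpT_top_def by (simp add: topology_inverse')
qed

lemma topspace_SpT_top [simp]: "topspace (SpT_top :: (real \<Rightarrow> 'n::finite sqm) set topology) = SpT"
proof -
  have "\<forall>w\<in>(SpT :: (real \<Rightarrow> 'n sqm) set set). \<exists>V. open V \<and> proj w \<in> V \<and> nbhd w V \<subseteq> SpT"
    by (intro ballI exI[of _ UNIV]) (simp add: nbhd_subset)
  then have "openin SpT_top (SpT :: (real \<Rightarrow> 'n sqm) set set)" unfolding openin_SpT_top by simp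
  then have "(SpT :: (real \<Rightarrow> 'n sqm) set set) \<subseteq> topspace SpT_top" by (rule openin_subset)
  moreover have "topspace SpT_top \<subseteq> (SpT :: (real \<Rightarrow> 'n sqm) set set)"
    using openin_topspace[of "SpT_top :: (real \<Rightarrow> 'n sqm) set topology"] unfolding openin_SpT_top by simp
  ultimately show ?thesis by simp
qed

lemma continuous_map_SpT_top:
  assumes "\<And>w Q. w \<in> SpT \<Longrightarrow> open Q \<Longrightarrow> f w \<in> Q \<Longrightarrow> \<exists>V. open V \<and> proj w \<in> V \<and> (\<forall>v\<in>nbhd w V. f v \<in> Q)"
  shows "continuous_map SpT_top euclidean f"
  unfolding continuous_map_def
proof (intro conjI allI impI)
  fix U :: "'b set" assume U: "openin euclidean U"
  show "openin SpT_top {x \<in> topspace SpT_top. f x \<in> U}"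
    unfolding openin_SpT_top topspace_SpT_top
  proof (intro conjI ballI)
    fix w assume w: "w \<in> {x \<in> SpT. f x \<in> U}"
    then obtain V where "open V" "proj w \<in> V" "\<forall>v\<in>nbhd w V. f v \<in> U" using assms[of w U] U by auto
    then show "\<exists>V. open V \<and> proj w \<in> V \<and> nbhd w V \<subseteq> {x \<in> SpT. f x \<in> U}"
      using nbhd_subset[of w V] w by blast
  qed auto
qed simp

lemma nbhd_cls:
  assumes "w \<in> SpT" "v \<in> nbhd w V"
  obtains g d where "g \<in> w" "sp_path g" "path d" "path_image d \<subseteq> V \<inter> Sp" "pathstart d = pathfinish g"
    "v = cls (g +++ d)" "sp_path (g +++ d)" "v \<in> SpT"
proof -
  obtain g d where *: "g \<in> w" "path d" "path_image d \<subseteq> V \<inter> Sp" "pathstart d = pathfinish g" "v = cls (g +++ d)"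
    using assms(2) unfolding nbhd_def by blast
  moreover have "sp_path g" using SpT_mem(2)[OF assms(1) *(1)] .
  moreover have "sp_path (g +++ d)" using sp_path_join[OF \<open>sp_path g\<close>] * by blast
  ultimately show ?thesis using that cls_in_SpT by blast
qed

lemma continuous_map_proj: "continuous_map SpT_top euclidean proj"
proof (rule continuous_map_SpT_top)
  fix w :: "(real \<Rightarrow> 'a sqm) set" and Q assume w: "w \<in> SpT" "open Q" "proj w \<in> Q"
  have "proj v \<in> Q" if v: "v \<in> nbhd w Q" for v
  proof -
    obtain g d where "path_image d \<subseteq> Q \<inter> Sp" "v = cls (g +++ d)" "sp_path (g +++ d)"
      using nbhd_cls[OF w(1) v] by metis
    then show ?thesis by (auto simp: proj_cls joinpaths_def path_image_def)
  qed
  then show "\<exists>V. open V \<and> proj w \<in> V \<and> (\<forall>v\<in>nbhd w V. proj v \<in> Q)" using w by blast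
qed

section \<open>Continuous logarithms and lifts to the universal cover\<close>

lemma exp_eq_1_norm:
  fixes a b :: complex
  assumes "exp a = 1" "exp b = 1" "a \<noteq> b"
  shows "2 * pi \<le> norm (a - b)"
proof -
  obtain m n :: int where "Re a = 0" "Im a = of_int (2 * m) * pi" "Re b = 0" "Im b = of_int (2 * n) * pi"
    using assms(1,2) by (auto simp: exp_eq_1)
  then have d: "Re (a - b) = 0" "Im (a - b) = 2 * pi * of_int (m - n)" by (auto simp: algebra_simps)
  have "m \<noteq> n" using assms(3) \<open>Re a = 0\<close> \<open>Re b = 0\<close> \<open>Im a = _\<close> \<open>Im b = _\<close> by (auto simp: complex_eq_iff)
  then have "\<bar>real_of_int (m - n)\<bar> \<ge> 1" by linarith
  then have "2 * pi * 1 \<le> 2 * pi * \<bar>real_of_int (m - n)\<bar>" by (intro mult_left_mono) auto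
  also have "\<dots> = \<bar>Im (a - b)\<bar>" unfolding d(2) by (simp add: abs_mult)
  also have "\<dots> \<le> norm (a - b)" by (rule abs_Im_le_cmod)
  finally show ?thesis by simp
qed

lemma exp_eq_1_const:
  fixes f :: "'a::topological_space \<Rightarrow> complex"
  assumes "connected S" "continuous_on S f" "\<And>x. x \<in> S \<Longrightarrow> exp (f x) = 1" "x \<in> S" "y \<in> S"
  shows "f x = f y"
proof -
  have "f constant_on S"
    by (rule continuous_discrete_range_constant[OF assms(1,2)])
      (use exp_eq_1_norm assms(3) in \<open>metis pi_gt_zero mult_pos_pos zero_less_numeral\<close>)
  then show ?thesis using assms(4,5) by (auto simp: constant_on_def)
qed

lemma exp_eq_1_const_aux:
  fixes f g :: "'a::topological_space \<Rightarrow> complex"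
  assumes "connected S" "continuous_on S f" "continuous_on S g" "\<And>x. x \<in> S \<Longrightarrow> exp (f x) = c * exp (g x)"
    "c \<noteq> 0" "x \<in> S" "y \<in> S"
  shows "f x - g x = f y - g y"
proof -
  have "f x - g x - Ln c = f y - g y - Ln c"
    by (rule exp_eq_1_const[OF assms(1), where f = "\<lambda>x. f x - g x - Ln c"])
      (use assms in \<open>auto intro!: continuous_intros simp: exp_diff\<close>)
  then show ?thesis by simp
qed

lemma log_unique:
  fixes f g :: "'a::topological_space \<Rightarrow> complex"
  assumes "connected S" "continuous_on S f" "continuous_on S g" "\<And>x. x \<in> S \<Longrightarrow> exp (f x) = exp (g x)"
    "x \<in> S" "y \<in> S"
  shows "f x - g x = f y - g y"
  by (rule exp_eq_1_const[OF assms(1), where f = "\<lambda>x. f x - g x"])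
    (use assms in \<open>auto intro!: continuous_intros simp: exp_diff\<close>)

definition is_log :: "('n::finite sqm \<Rightarrow> complex) \<Rightarrow> (real \<Rightarrow> 'n sqm) \<Rightarrow> (real \<Rightarrow> complex) \<Rightarrow> bool" where
  "is_log F g l \<longleftrightarrow> continuous_on {0..1} l \<and> (\<forall>t\<in>{0..1}. exp (l t) = F (g t)) \<and> l 0 = 0"

text \<open>The end value of a logarithm of \<open>F\<close> started at \<open>0\<close> along a
  representative; \<open>log_homotopy\<close> makes it independent of the choice.\<close>

definition liftv :: "('n::finite sqm \<Rightarrow> complex) \<Rightarrow> (real \<Rightarrow> 'n sqm) set \<Rightarrow> complex" where
  "liftv F w = (SOME z. \<exists>g\<in>w. \<exists>l. is_log F g l \<and> z = l 1)"

text \<open>Instantiated with \<open>upsilon\<close>, which yields the Maslov quasimorphism, and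
  with the normalised determinants \<open>rotq a\<close>, which control causal curves.\<close>

locale Sp_fun =
  fixes F :: "'n::finite sqm \<Rightarrow> complex"
  assumes cont: "continuous_on Sp F" and nz: "\<And>W. W \<in> Sp \<Longrightarrow> F W \<noteq> 0" and one: "F (mat 1) = 1"
begin

lemma log_exists:
  assumes "sp_path g" obtains l where "is_log F g l"
proof -
  note g = sp_path_D[OF assms]
  have "continuous_on {0..1} (\<lambda>t. F (g t))"
    by (rule continuous_on_compose2[OF cont g(6)]) (use g(5) in auto)
  then obtain l where l: "continuous_on {0..1} l" "\<And>t. t \<in> {0..1} \<Longrightarrow> F (g t) = exp (l t)"
    using continuous_logarithm_on_contractible[of "{0..1::real}" "\<lambda>t. F (g t)"] nz g(5)
    by (metis convex_imp_contractible convex_real_interval(5))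
  have "exp (l 0) = 1" using l(2)[of 0] g(4) one by simp
  then have "is_log F g (\<lambda>t. l t - l 0)"
    unfolding is_log_def using l by (auto intro!: continuous_intros simp: exp_diff)
  then show ?thesis by (rule that)
qed

text \<open>A logarithm on the whole square of the homotopy is constant on the two edges along which
  the end points of the paths stay fixed.\<close>

lemma log_homotopy:
  assumes hom: "homotopic_paths Sp g h" and g: "sp_path g" and lg: "is_log F g lg" and lh: "is_log F h lh"
  shows "lg 1 = lh 1"
proof -
  obtain H where H: "continuous_on ({0..1} \<times> {0..1}) H" "H ` ({0..1} \<times> {0..1}) \<subseteq> Sp"
      "\<forall>x\<in>{0..1}. H (0, x) = g x" "\<forall>x\<in>{0..1}. H (1, x) = h x"
      "\<forall>t\<in>{0..1::real}. pathstart (H \<circ> Pair t) = pathstart g \<and> pathfinish (H \<circ> Pair t) = pathfinish g"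
    using hom unfolding homotopic_paths by (auto simp: image_subset_iff_funcset)
  have cF: "continuous_on ({0..1} \<times> {0..1}) (\<lambda>p. F (H p))"
    by (rule continuous_on_compose2[OF cont H(1) H(2)])
  have ct: "contractible ({0..1::real} \<times> {0..1::real})"
    by (intro convex_imp_contractible convex_Times convex_real_interval)
  have nzH: "F (H p) \<noteq> 0" if "p \<in> {0..1} \<times> {0..1}" for p using H(2) nz that by blast
  obtain L where L: "continuous_on ({0..1} \<times> {0..1}) L" "\<And>p. p \<in> {0..1} \<times> {0..1} \<Longrightarrow> F (H p) = exp (L p)"
    by (rule continuous_logarithm_on_contractible[OF cF ct nzH]) (assumption, rule that)
  have c1: "continuous_on {0..1} (\<lambda>x. L (s, x))" if "s \<in> {0..1}" for s
    by (rule continuous_on_compose2[OF L(1)]) (use that in \<open>auto intro!: continuous_intros\<close>)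
  have c2: "continuous_on {0..1} (\<lambda>s. L (s, x))" if "x \<in> {0..1}" for x
    by (rule continuous_on_compose2[OF L(1)]) (use that in \<open>auto intro!: continuous_intros\<close>)
  have H0: "H (s, 0) = g 0" "H (s, 1) = g 1" if "s \<in> {0..1}" for s
    using H(5) that by (auto simp: pathstart_def pathfinish_def)
  have e0: "L (0, 0) = L (1, 0)"
    using log_unique[of "{0..1::real}" "\<lambda>s. L (s, 0)" "\<lambda>s. L (0, 0)" 0 1] c2[of 0] L(2) H0(1)
    by (auto intro!: continuous_intros) (metis H0(1) L(2) atLeastAtMost_iff mem_Sigma_iff order_refl zero_le_one)
  have e1: "L (0, 1) = L (1, 1)"
    using log_unique[of "{0..1::real}" "\<lambda>s. L (s, 1)" "\<lambda>s. L (0, 1)" 0 1] c2[of 1]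
    by (auto intro!: continuous_intros) (metis H0(2) L(2) atLeastAtMost_iff mem_Sigma_iff order_refl zero_le_one)
  have g: "L (0, 0) - lg 0 = L (0, 1) - lg 1"
    by (rule log_unique[of "{0..1::real}" "\<lambda>x. L (0, x)" lg])
      (use c1[of 0] lg H(3) L(2)[of "(0, _)"] in \<open>auto simp: is_log_def\<close>)
  have h: "L (1, 0) - lh 0 = L (1, 1) - lh 1"
    by (rule log_unique[of "{0..1::real}" "\<lambda>x. L (1, x)" lh])
      (use c1[of 1] lh H(4) L(2)[of "(1, _)"] in \<open>auto simp: is_log_def\<close>)
  show ?thesis using g h e0 e1 lg lh by (simp add: is_log_def)
qed

lemma liftv_eq:
  assumes w: "w \<in> SpT" "g \<in> w" and l: "is_log F g l"
  shows "liftv F w = l 1"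
proof -
  have "\<exists>z. \<exists>g\<in>w. \<exists>l. is_log F g l \<and> z = l 1" using w l by blast
  from someI_ex[OF this] obtain h l' where h: "h \<in> w" "is_log F h l'" "liftv F w = l' 1"
    unfolding liftv_def by blast
  have "homotopic_paths Sp g h" "sp_path g" using SpT_mem[OF w] h(1) by (auto simp: cls_def)
  then show ?thesis using log_homotopy[OF _ _ l h(2)] h(3) by simp
qed

lemma exp_liftv: "w \<in> SpT \<Longrightarrow> exp (liftv F w) = F (proj w)"
proof -
  assume w: "w \<in> SpT"
  then obtain g where g: "g \<in> w" using SpT_nonempty by blast
  have sp: "sp_path g" by (rule SpT_mem(2)[OF w g])
  obtain l where l: "is_log F g l" using log_exists[OF sp] .
  show ?thesis using liftv_eq[OF w g l] proj_eq[OF w g] l by (simp add: is_log_def pathfinish_def)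
qed

lemma liftv_idT: "liftv F idT = 0"
proof -
  have "is_log F (\<lambda>t. mat 1) (\<lambda>t. 0)" by (simp add: is_log_def one)
  then show ?thesis using liftv_eq[OF idT_in_SpT _] cls_self[OF sp_path_const] by (simp add: idT_def)
qed

lemma continuous_liftv: "continuous_map SpT_top euclidean (liftv F)"
proof (rule continuous_map_SpT_top)
  fix w Q assume w: "w \<in> SpT" and Q: "open Q" "liftv F w \<in> Q"
  obtain e where e: "e > 0" "ball (liftv F w) e \<subseteq> Q" by (rule openE[OF Q])
  have "isCont Ln (1::complex)" by (rule continuous_at_Ln) simp
  then obtain d where "d > 0" "\<forall>z. dist z 1 < d \<longrightarrow> dist (Ln z) (Ln 1) < e"
    unfolding continuous_at_eps_delta using e(1) by blast
  then have d: "d > 0" "\<And>z. dist z 1 < d \<Longrightarrow> dist (Ln z) 0 < e" by simp_all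
  define x0 where "x0 = proj w"
  have x0: "x0 \<in> Sp" "F x0 \<noteq> 0" using proj_in_Sp[OF w] nz by (auto simp: x0_def)
  have "continuous_on Sp (\<lambda>x. F x / F x0)" using cont x0 by (intro continuous_intros) auto
  \<comment> \<open>The bound \<open>1\<close> keeps the quotient in the right half plane, where
    \<open>Ln\<close> is continuous; the bound \<open>d\<close> makes its logarithm small.\<close>
  moreover have "min d 1 > 0" using d(1) by simp
  ultimately obtain r where r: "r > 0" "\<forall>x\<in>Sp. dist x x0 < r \<longrightarrow> dist (F x / F x0) (F x0 / F x0) < min d 1"
    using x0(1) unfolding continuous_on_iff by blast
  define T where "T = ball x0 r"
  have T: "open T" "x0 \<in> T" "\<And>x. x \<in> Sp \<Longrightarrow> x \<in> T \<Longrightarrow> F x / F x0 \<in> ball 1 (min d 1)"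
    using r x0(2) by (auto simp: T_def dist_commute)
  have "liftv F v \<in> Q" if v: "v \<in> nbhd w T" for v
  proof -
    obtain g p where gp: "g \<in> w" "sp_path g" "path p" "path_image p \<subseteq> T \<inter> Sp" "pathstart p = pathfinish g"
      "v = cls (g +++ p)" "sp_path (g +++ p)" "v \<in> SpT" by (rule nbhd_cls[OF w v])
    obtain l where l: "is_log F (g +++ p) l" using log_exists[OF gp(7)] .
    have lv: "liftv F v = l 1" using liftv_eq[OF gp(8) _ l] cls_self[OF gp(7)] gp(6) by simp
    have lc: "continuous_on {0..1} l" "\<And>t. t \<in> {0..1} \<Longrightarrow> exp (l t) = F ((g +++ p) t)" "l 0 = 0" using l by (auto simp: is_log_def)
    have "is_log F g (\<lambda>t. l (t / 2))"
      unfolding is_log_def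
    proof (intro conjI ballI)
      show "continuous_on {0..1} (\<lambda>t. l (t / 2))"
        by (rule continuous_on_compose2[OF lc(1)]) (auto intro!: continuous_intros)
      show "exp (l (t / 2)) = F (g t)" if "t \<in> {0..1}" for t
        using lc(2)[of "t / 2"] that by (auto simp: joinpaths_def)
    qed (simp add: lc)
    then have lw: "liftv F w = l (1 / 2)" using liftv_eq[OF w gp(1)] by simp
    have pT: "p s \<in> T \<inter> Sp" if "s \<in> {0..1}" for s using gp(4) that by (auto simp: path_image_def)
    have p0: "p 0 = x0" using gp(5) proj_eq[OF w gp(1)] by (simp add: pathstart_def x0_def)
    have ball: "F (p s) / F x0 \<in> ball 1 (min d 1)" if "s \<in> {0..1}" for s using T(3) pT[OF that] by auto
    have re: "F (p s) / F x0 \<notin> \<real>\<^sub>\<le>\<^sub>0" if "s \<in> {0..1}" for s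
    proof
      assume "F (p s) / F x0 \<in> \<real>\<^sub>\<le>\<^sub>0"
      then have "Re (F (p s) / F x0) \<le> 0" by (simp add: complex_nonpos_Reals_iff)
      moreover have "\<bar>Re (1 - F (p s) / F x0)\<bar> \<le> cmod (1 - F (p s) / F x0)" by (rule abs_Re_le_cmod)
      ultimately show False using ball[OF that] by (simp add: dist_norm)
    qed
    \<comment> \<open>On the second half of \<open>g +++ p\<close> the lifted logarithm and the
      principal branch differ by a constant; the first half computes
      \<open>liftv F w\<close>.\<close>
    have "l ((1 + 0) / 2) - Ln (F (p 0) / F x0) = l ((1 + 1) / 2) - Ln (F (p 1) / F x0)"
    proof (rule exp_eq_1_const_aux[of "{0..1::real}" "\<lambda>s. l ((1 + s) / 2)" "\<lambda>s. Ln (F (p s) / F x0)" "F x0"])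
      show "continuous_on {0..1} (\<lambda>s. l ((1 + s) / 2))"
        by (rule continuous_on_compose2[OF lc(1)]) (auto intro!: continuous_intros)
      have "continuous_on {0..1} (\<lambda>s. F (p s))"
        by (rule continuous_on_compose2[OF cont]) (use gp(3) pT in \<open>auto simp: path_def\<close>)
      then show "continuous_on {0..1} (\<lambda>s. Ln (F (p s) / F x0))"
        using re x0 by (intro continuous_intros) auto
      fix s :: real assume s: "s \<in> {0..1}"
      have "(g +++ p) ((1 + s) / 2) = p s"
      proof (cases "s = 0")
        case True
        then show ?thesis using gp(5) by (simp add: joinpaths_def pathstart_def pathfinish_def)
      next
        case False
        then have "\<not> (1 + s) / 2 \<le> 1 / 2" using s by simp
        moreover have "2 * ((1 + s) / 2) - 1 = s" by (simp add: field_simps)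
        ultimately show ?thesis unfolding joinpaths_def by presburger
      qed
      then have "exp (l ((1 + s) / 2)) = F (p s)" using lc(2)[of "(1 + s) / 2"] s by simp
      moreover have "exp (Ln (F (p s) / F x0)) = F (p s) / F x0" using nz pT[OF s] x0 by simp
      ultimately show "exp (l ((1 + s) / 2)) = F x0 * exp (Ln (F (p s) / F x0))" using x0 by simp
    qed (use x0 in auto)
    then have "l 1 = liftv F w + Ln (F (p 1) / F x0)" using p0 x0 by (simp add: lw)
    moreover have "cmod (Ln (F (p 1) / F x0)) < e" using d(2)[of "F (p 1) / F x0"] ball[of 1] by (simp add: dist_commute)
    ultimately have "liftv F v \<in> ball (liftv F w) e" by (simp add: lv dist_norm)
    then show ?thesis using e(2) by blast
  qed
  then show "\<exists>V. open V \<and> proj w \<in> V \<and> (\<forall>v\<in>nbhd w V. liftv F v \<in> Q)" using T(1,2) x0_def by blast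
qed

end

lemma sp_path_subpath:
  assumes g: "sp_path g" and t: "t \<in> {0..1}"
  shows "sp_path (subpath 0 t g)"
proof -
  have "path_image (subpath 0 t g) \<subseteq> path_image g" using t by (intro path_image_subpath_subset) auto
  moreover have "path (subpath 0 t g)" using sp_path_D(1)[OF g] t by (intro path_subpath) auto
  moreover have "pathstart (subpath 0 t g) = mat 1" using sp_path_D(4)[OF g] by (simp add: pathstart_def subpath_def)
  ultimately show ?thesis using sp_path_D(2)[OF g] unfolding sp_path_def by blast
qed

text \<open>Initial segments of \<open>g\<close> trace the lift of \<open>g\<close> to the cover,
  and neighbouring segments differ by a short piece inside a given neighbourhood. Continuity on the
  cover thus becomes continuity in a real parameter.\<close>

lemma continuous_along_path:
  fixes f :: "(real \<Rightarrow> 'n::finite sqm) set \<Rightarrow> 'b::topological_space"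
  assumes f: "continuous_map SpT_top euclidean f" and g: "sp_path g"
  shows "continuous_on {0..1} (\<lambda>t. f (cls (subpath 0 t g)))"
  unfolding continuous_on_topological
proof (intro ballI allI impI)
  fix t B assume t: "t \<in> {0..1::real}" and B: "open B" "f (cls (subpath 0 t g)) \<in> B"
  let ?w = "cls (subpath 0 t g)"
  have w: "?w \<in> SpT" using cls_in_SpT[OF sp_path_subpath[OF g t]] .
  have "openin SpT_top {x \<in> SpT. f x \<in> B}" using f B(1) by (auto simp: continuous_map_def)
  then obtain V where V: "open V" "proj ?w \<in> V" "nbhd ?w V \<subseteq> {x \<in> SpT. f x \<in> B}"
    using w B(2) unfolding openin_SpT_top by auto
  have pw: "proj ?w = g t" using proj_cls[OF sp_path_subpath[OF g t]] by (simp add: subpath_def)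
  have cg: "continuous_on {0..1} g" using sp_path_D[OF g] by blast
  obtain d where d: "d > 0" "\<And>s. s \<in> {0..1} \<Longrightarrow> dist s t < d \<Longrightarrow> g s \<in> V"
  proof -
    obtain e where e: "e > 0" "ball (g t) e \<subseteq> V" using openE[OF V(1,2)] unfolding pw by blast
    then obtain d where "d > 0" "\<And>s. s \<in> {0..1} \<Longrightarrow> dist s t < d \<Longrightarrow> dist (g s) (g t) < e"
      using cg t unfolding continuous_on_iff by metis
    then show ?thesis using that e(2) by (metis dist_commute mem_ball subsetD)
  qed
  have "f (cls (subpath 0 s g)) \<in> B" if s: "s \<in> {0..1}" "s \<in> ball t d" for s
  proof -
    let ?p = "subpath t s g"
    have "path_image ?p \<subseteq> V \<inter> Sp"
    proof
      fix x assume "x \<in> path_image ?p"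
      then obtain r where r: "r \<in> closed_segment t s" "x = g r" by (auto simp: path_image_subpath_gen)
      have "r \<in> {0..1}" using r(1) s(1) t by (auto simp: closed_segment_eq_real_ivl split: if_splits)
      moreover have "dist r t < d" using r(1) s(2) by (auto simp: dist_real_def closed_segment_eq_real_ivl split: if_splits)
      ultimately show "x \<in> V \<inter> Sp" using d(2) r(2) sp_path_D(5)[OF g] by auto
    qed
    moreover have "path ?p" using s(1) t sp_path_D[OF g] by (auto intro: path_subpath)
    moreover have "subpath 0 t g \<in> ?w" by (rule cls_self[OF sp_path_subpath[OF g t]])
    ultimately have "cls (subpath 0 t g +++ ?p) \<in> nbhd ?w V"
      unfolding nbhd_def by (intro CollectI exI[of _ "subpath 0 t g"] exI[of _ ?p] conjI refl) auto
    moreover have "cls (subpath 0 t g +++ ?p) = cls (subpath 0 s g)"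
      by (rule cls_eqI, rule homotopic_join_subpaths) (use sp_path_D[OF g] s t in auto)
    ultimately show ?thesis using V(3) by auto
  qed
  then show "\<exists>A. open A \<and> t \<in> A \<and> (\<forall>y\<in>{0..1}. y \<in> A \<longrightarrow> f (cls (subpath 0 y g)) \<in> B)"
    using d(1) by (intro exI[of _ "ball t d"]) auto
qed

lemma cls_subpath_0: "sp_path g \<Longrightarrow> cls (subpath 0 0 g) = idT"
  using sp_path_D(4)[of g] by (simp add: subpath_def idT_def)

lemma cls_subpath_1: "cls (subpath 0 1 g) = cls g"
  by (simp add: subpath_def)

lemma upsilon_one: "upsilon (mat 1 :: 'a::finite sqm) = 1"
proof -
  have e: "eigs (cplx (mat 1 :: 'a sqm)) \<subseteq> {1}"
  proof
    fix l :: complex assume "l \<in> eigs (cplx (mat 1 :: 'a sqm))"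
    then obtain x :: "'a cvec" where x: "x \<noteq> 0" "x = l *s x" unfolding eigs_iff_eigenvector cplx_one by auto
    then have "1 *s x = l *s x" by simp
    then show "l \<in> {1}" using x(1) vec.scale_cancel_right[of 1 x l] by simp
  qed
  then have e1: "{l \<in> eigenvalues (mat 1 :: 'a sqm). l \<in> \<real> \<and> Re l < 0} = {}"
    and e2: "{l \<in> eigenvalues (mat 1 :: 'a sqm). cmod l = 1 \<and> l \<noteq> 1 \<and> l \<noteq> -1} = {}"
    unfolding eigenvalues_eq_eigs by auto
  show ?thesis unfolding upsilon_def neg_mult_def e1 e2 by simp
qed

interpretation ups: Sp_fun "upsilon :: 'n::finite sqm \<Rightarrow> complex"
proof
  show "upsilon W \<noteq> 0" if "W \<in> Sp" for W :: "'n sqm" using norm_upsilon[OF that] by auto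
qed (simp_all add: continuous_on_upsilon upsilon_one)

text \<open>Existence comes from the lift of \<open>upsilon\<close>, which is purely imaginary
  because \<open>upsilon\<close> is unimodular. For uniqueness two candidates are compared along
  initial segments of a representative, starting at the identity class.\<close>

lemma maslov_ex1:
  "\<exists>!f. continuous_map SpT_top euclideanreal f
      \<and> (\<forall>w\<in>(SpT :: (real \<Rightarrow> 'n::finite sqm) set set). exp (2 * pi * \<i> * complex_of_real (f w)) = upsilon (proj w))
      \<and> f idT = 0 \<and> (\<forall>w. w \<notin> SpT \<longrightarrow> f w = 0)"
proof (rule ex1I)
  let ?f = "\<lambda>w. if w \<in> (SpT :: (real \<Rightarrow> 'n sqm) set set) then Im (liftv upsilon w) / (2 * pi) else 0"
  have "continuous_map SpT_top euclideanreal (\<lambda>w. Im (liftv upsilon w) / (2 * pi))"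
  proof -
    have "continuous_on UNIV (\<lambda>z. Im z / (2 * pi))" by (intro continuous_intros) auto
    then have c: "continuous_map euclidean euclideanreal (\<lambda>z. Im z / (2 * pi))" by (simp only: continuous_map_iff_continuous2)
    show ?thesis using continuous_map_compose[OF ups.continuous_liftv c] unfolding o_def .
  qed
  then have "continuous_map SpT_top euclideanreal ?f"
    by (rule continuous_map_eq) simp
  moreover have "exp (2 * pi * \<i> * complex_of_real (?f w)) = upsilon (proj w)" if w: "w \<in> SpT" for w
  proof -
    have "cmod (exp (liftv upsilon w)) = 1" unfolding ups.exp_liftv[OF w] by (rule norm_upsilon[OF proj_in_Sp[OF w]])
    then have "Re (liftv upsilon w) = 0" by (simp add: norm_exp_eq_Re)
    then have "liftv upsilon w = 2 * pi * \<i> * complex_of_real (?f w)" using w by (simp add: complex_eq_iff)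
    then show ?thesis using ups.exp_liftv[OF w] by simp
  qed
  moreover have "?f idT = 0" by (simp add: ups.liftv_idT)
  ultimately show f: "continuous_map SpT_top euclideanreal ?f
      \<and> (\<forall>w\<in>SpT. exp (2 * pi * \<i> * complex_of_real (?f w)) = upsilon (proj w))
      \<and> ?f idT = 0 \<and> (\<forall>w. w \<notin> SpT \<longrightarrow> ?f w = 0)" by simp
  fix h :: "(real \<Rightarrow> 'n sqm) set \<Rightarrow> real"
  assume h: "continuous_map SpT_top euclideanreal h
      \<and> (\<forall>w\<in>SpT. exp (2 * pi * \<i> * complex_of_real (h w)) = upsilon (proj w))
      \<and> h idT = 0 \<and> (\<forall>w. w \<notin> SpT \<longrightarrow> h w = 0)"
  have f2: "exp (2 * pi * \<i> * complex_of_real (?f v)) = upsilon (proj v)" if "v \<in> SpT" for v using f that by blast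
  have h2: "exp (2 * pi * \<i> * complex_of_real (h v)) = upsilon (proj v)" if "v \<in> SpT" for v using h that by blast
  have "h w = ?f w" if w: "w \<in> SpT" for w
  proof -
    obtain g where g: "g \<in> w" using SpT_nonempty[OF w] by blast
    have sg: "sp_path g" "w = cls g" using SpT_mem[OF w g] by auto
    define F where "F v = ?f v" for v
    let ?w = "\<lambda>t. cls (subpath 0 t g)"
    have cF: "continuous_on {0..1} (\<lambda>t. F (?w t))" unfolding F_def using continuous_along_path[OF _ sg(1), of ?f] f by blast
    have ch: "continuous_on {0..1} (\<lambda>t. h (?w t))" using continuous_along_path[OF _ sg(1), of h] h by blast
    have "2 * pi * \<i> * complex_of_real (h (?w 1)) - 2 * pi * \<i> * complex_of_real (F (?w 1))
      = 2 * pi * \<i> * complex_of_real (h (?w 0)) - 2 * pi * \<i> * complex_of_real (F (?w 0))"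
    proof (rule log_unique[of "{0..1::real}"])
      fix t :: real assume "t \<in> {0..1}"
      then have wS: "?w t \<in> SpT" using cls_in_SpT sp_path_subpath[OF sg(1)] by blast
      show "exp (2 * pi * \<i> * complex_of_real (h (?w t))) = exp (2 * pi * \<i> * complex_of_real (F (?w t)))"
        unfolding F_def by (rule trans[OF h2[OF wS] f2[OF wS, symmetric]])
    qed (auto intro!: continuous_intros ch cF)
    moreover have "h (?w 0) = 0" "F (?w 0) = 0" using h f by (auto simp: cls_subpath_0[OF sg(1)] F_def)
    ultimately have "2 * pi * \<i> * (complex_of_real (h (?w 1)) - complex_of_real (F (?w 1))) = 0"
      by (simp add: right_diff_distrib)
    then have "h (?w 1) = F (?w 1)" by simp
    then show ?thesis by (simp add: cls_subpath_1 sg(2) F_def)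
  qed
  moreover have "h w = ?f w" if "w \<notin> SpT" for w using h that by simp
  ultimately show "h = ?f" by blast
qed

lemma maslov_props:
  fixes w :: "(real \<Rightarrow> 'n::finite sqm) set"
  shows "continuous_map SpT_top euclideanreal (maslov :: (real \<Rightarrow> 'n sqm) set \<Rightarrow> real)"
  "w \<in> SpT \<Longrightarrow> exp (2 * pi * \<i> * complex_of_real (maslov w)) = upsilon (proj w)"
  "maslov (idT :: (real \<Rightarrow> 'n sqm) set) = 0"
  using theI'[OF maslov_ex1[where 'n = 'n]] unfolding maslov_def by blast+

lemma curve_from_idT_iff:
  assumes w: "w \<in> SpT" and c: "path c" "path_image c \<subseteq> Sp"
  shows "curve_from_to c idT w \<longleftrightarrow> c \<in> w"
proof
  assume "curve_from_to c idT w"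
  then obtain g where g: "g \<in> idT" "c 0 = pathfinish g" "g +++ c \<in> w" by (auto simp: curve_from_to_def)
  have gh: "homotopic_paths Sp (\<lambda>t. mat 1) g" "sp_path g" using g(1) by (auto simp: idT_def cls_def)
  have c0: "c 0 = mat 1" using g(2) homotopic_paths_imp_pathfinish[OF gh(1)] by (simp add: pathfinish_def)
  have sc: "sp_path c" using c c0 by (simp add: sp_path_def pathstart_def)
  have "homotopic_paths Sp (g +++ c) ((\<lambda>t. mat 1) +++ c)"
    by (intro homotopic_paths_join) (use gh c g(2) in \<open>auto simp: homotopic_paths_sym pathstart_def\<close>)
  moreover have "homotopic_paths Sp ((\<lambda>t. mat 1) +++ c) c"
    using homotopic_paths_lid[OF c] by (simp add: pathstart_def c0 linepath_refl)
  ultimately have "homotopic_paths Sp (g +++ c) c" by (rule homotopic_paths_trans)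
  then show "c \<in> w" using SpT_mem[OF w g(3)] sc by (auto simp: cls_def)
next
  assume cw: "c \<in> w"
  have sc: "sp_path c" "w = cls c" using SpT_mem[OF w cw] by auto
  have c0: "c 0 = mat 1" using sp_path_D[OF sc(1)] by simp
  have h: "homotopic_paths Sp ((\<lambda>t. mat 1) +++ c) c"
    using homotopic_paths_lid[OF c] by (simp add: pathstart_def c0 linepath_refl)
  have "(\<lambda>t. mat 1) +++ c \<in> w"
    unfolding sc(2) cls_def using h sp_path_homotopic[OF sc(1)] homotopic_paths_sym by blast
  then show "curve_from_to c idT w"
    unfolding curve_from_to_def using cls_self[OF sp_path_const] c0
    by (intro bexI[of _ "\<lambda>t. mat 1"]) (auto simp: idT_def pathfinish_def)
qed

section \<open>Normal form of positive elliptic matrices\<close>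

definition rpart :: "complex^'m \<Rightarrow> real^'m" where "rpart x = (\<chi> i. Re (x $ i))"
definition ipart :: "complex^'m \<Rightarrow> real^'m" where "ipart x = (\<chi> i. Im (x $ i))"

lemma cvec_parts: "x = rv (rpart x) + \<i> *s rv (ipart x)"
  unfolding rpart_def ipart_def by (rule cvec_decompose)

lemma krein_parts:
  "krein x y = Complex (omega0 (ipart x) (rpart y) - omega0 (rpart x) (ipart y))
     (- (omega0 (rpart x) (rpart y) + omega0 (ipart x) (ipart y)))"
proof -
  have "krein x y = krein (rv (rpart x) + \<i> *s rv (ipart x)) (rv (rpart y) + \<i> *s rv (ipart y))"
    by (simp flip: cvec_parts)
  also have "\<dots> = Complex (omega0 (ipart x) (rpart y) - omega0 (rpart x) (ipart y))
     (- (omega0 (rpart x) (rpart y) + omega0 (ipart x) (ipart y)))"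
    by (simp only: krein_add_left krein_add_right krein_scale_left krein_scale_right krein_rv)
      (simp add: complex_eq_iff)
  finally show ?thesis .
qed

lemma rpart_cv [simp]: "rpart (cv x) = rpart x" and ipart_cv [simp]: "ipart (cv x) = - ipart x"
  by (simp_all add: rpart_def ipart_def cv_def vec_eq_iff)

lemma rpart_cplx: "rpart (cplx W *v x) = W *v rpart x" and ipart_cplx: "ipart (cplx W *v x) = W *v ipart x"
  by (simp_all add: rpart_def ipart_def cplx_def vec_eq_iff matrix_vector_mult_def)

lemma parts_eq_0: "rpart x = 0 \<Longrightarrow> ipart x = 0 \<Longrightarrow> x = 0"
  by (simp add: rpart_def ipart_def vec_eq_iff complex_eq_iff)

lemma rpart_rv [simp]: "rpart (rv u) = u" and ipart_rv [simp]: "ipart (rv u) = 0"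
  by (simp_all add: rpart_def ipart_def rv_def vec_eq_iff)

definition Spos :: "'n::finite sqm set" where
  "Spos = {W \<in> Sp. \<forall>v. v \<noteq> 0 \<longrightarrow> omega0 v (W *v v) > 0}"

definition Snn :: "'n::finite sqm set" where
  "Snn = {W \<in> Sp. \<forall>v. omega0 v (W *v v) \<ge> 0}"

lemma Spos_subset_Snn: "Spos \<subseteq> Snn"
proof
  fix W :: "'n::finite sqm" assume W: "W \<in> Spos"
  have "omega0 v (W *v v) \<ge> 0" for v
    using W by (cases "v = 0") (auto simp: Spos_def omega.zero_left less_imp_le)
  then show "W \<in> Snn" using W by (simp add: Spos_def Snn_def)
qed

text \<open>The common ground of \<open>Spos\<close> and \<open>Sp_ell_plus\<close>: no eigenvector
  is isotropic, and the sign of its norm is that of \<open>Im l\<close>. Only eigenvectors are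
  mentioned; diagonalisability is derived from it.\<close>

definition krpos :: "'n::finite sqm \<Rightarrow> bool" where
  "krpos W \<longleftrightarrow> W \<in> Sp \<and> (\<forall>x l. x \<noteq> 0 \<longrightarrow> cplx W *v x = l *s x \<longrightarrow> Im l * kq x > 0)"

lemma Spos_krpos:
  assumes "W \<in> Spos" shows "krpos W"
  unfolding krpos_def
proof (intro conjI allI impI)
  show "W \<in> Sp" using assms by (simp add: Spos_def)
  fix x l assume x: "x \<noteq> 0" "cplx W *v x = l *s x"
  \<comment> \<open>The imaginary part of the pairing of \<open>x\<close> with \<open>W x\<close> is
    computed twice, from the eigenvalue and from the real and imaginary parts of
    \<open>x\<close>.\<close>
  have "krein x (cplx W *v x) = cnj l * complex_of_real (kq x)"
    by (simp add: x(2) krein_scale_right krein_self_kq)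
  then have "Im (krein x (cplx W *v x)) = - (Im l * kq x)" by simp
  moreover have "Im (krein x (cplx W *v x)) = - (omega0 (rpart x) (W *v rpart x) + omega0 (ipart x) (W *v ipart x))"
    by (simp add: krein_parts rpart_cplx ipart_cplx)
  ultimately have e: "Im l * kq x = omega0 (rpart x) (W *v rpart x) + omega0 (ipart x) (W *v ipart x)" by simp
  have p: "omega0 v (W *v v) \<ge> 0" "v \<noteq> 0 \<Longrightarrow> omega0 v (W *v v) > 0" for v
    using assms Spos_subset_Snn by (auto simp: Spos_def Snn_def)
  show "Im l * kq x > 0"
  proof (cases "rpart x = 0")
    case True
    then have "ipart x \<noteq> 0" using parts_eq_0 x(1) by blast
    then show ?thesis unfolding e using p by (intro add_nonneg_pos) auto
  next
    case False
    then show ?thesis unfolding e using p by (intro add_pos_nonneg) auto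
  qed
qed

lemma Sp_ell_plus_krpos:
  assumes "W \<in> Sp_ell_plus" shows "krpos W"
  unfolding krpos_def
proof (intro conjI allI impI)
  show "W \<in> Sp" using assms by (simp add: Sp_ell_plus_def)
  have ev: "cmod l = 1 \<and> l \<noteq> 1 \<and> l \<noteq> -1 \<and> (Im l > 0 \<longrightarrow> krein_positive W l)" if "l \<in> eigs (cplx W)" for l
    using assms that unfolding Sp_ell_plus_def eigenvalues_eq_eigs by blast
  have up: "kq x > 0" if x: "x \<noteq> 0" "cplx W *v x = l *s x" and l: "Im l > 0" for x l
  proof -
    have "l \<in> eigs (cplx W)" using x eigs_iff_eigenvector by blast
    then have "krein_posdef_on (gker (cplx W) l)" using ev l by (auto simp: krein_positive_def geneig_eq_gker)
    then show ?thesis using x eigenvector_gker by (auto simp: krein_posdef_kq)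
  qed
  fix x l assume x: "x \<noteq> 0" "cplx W *v x = l *s x"
  have l: "l \<in> eigs (cplx W)" using x eigs_iff_eigenvector by blast
  have "Im l \<noteq> 0"
  proof
    assume i: "Im l = 0"
    then have "\<bar>Re l\<bar> = 1" using ev[OF l] by (simp add: cmod_def)
    then show False using ev[OF l] i by (auto simp: complex_eq_iff abs_if split: if_splits)
  qed
  then consider "Im l > 0" | "Im l < 0" by linarith
  then show "Im l * kq x > 0"
  proof cases
    case 1 then show ?thesis using up[OF x] by simp
  next
    case 2
    have "cplx W *v cv x = cnj l *s cv x" using x(2) by (simp add: cplx_cv cv_scale)
    then have "kq (cv x) > 0" using up[of "cv x" "cnj l"] x(1) 2 by simp
    then show ?thesis using 2 by (simp add: kq_cv mult_neg_neg)
  qed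
qed

lemma krpos_eigenvalue:
  assumes W: "krpos W" and x: "x \<noteq> 0" "cplx W *v x = l *s x"
  shows "cmod l = 1" "Im l * kq x > 0" "kq x \<noteq> 0"
proof -
  show i: "Im l * kq x > 0" using assms unfolding krpos_def by blast
  then show k: "kq x \<noteq> 0" by auto
  have "kq (l *s x) = kq x" using kq_Sp[of W x] W x(2) by (simp add: krpos_def)
  then have "(cmod l)\<^sup>2 = 1" using k by (simp add: kq_scale)
  then show "cmod l = 1" using power2_eq_imp_eq[of "cmod l" 1] by simp
qed

text \<open>Since no eigenvector is isotropic, the orthogonal complement of one is a proper
  invariant subspace, and induction on the dimension diagonalises \<open>W\<close>.\<close>

lemma orthogonal_eigenbasis:
  fixes W :: "'n::finite sqm"
  assumes W: "krpos W"
  shows "vec.subspace V \<Longrightarrow> (\<And>x. x \<in> V \<Longrightarrow> cplx W *v x \<in> V) \<Longrightarrow>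
    \<exists>B. finite B \<and> B \<subseteq> V \<and> V \<subseteq> vec.span B \<and> (\<forall>b\<in>B. b \<noteq> 0 \<and> (\<exists>l. cplx W *v b = l *s b))
      \<and> (\<forall>b\<in>B. \<forall>c\<in>B. b \<noteq> c \<longrightarrow> krein b c = 0)"
proof (induction "vec.dim V" arbitrary: V rule: less_induct)
  case less
  show ?case
  proof (cases "V = {0}")
    case True
    then show ?thesis by (intro exI[of _ "{}"]) auto
  next
    case False
    obtain x l where x: "x \<in> V" "x \<noteq> 0" "cplx W *v x = l *s x"
      by (rule eigenvector_in_invariant_subspace[OF less.prems(1) False less.prems(2)]) (assumption, rule that)
    have WS: "W \<in> Sp" using W by (simp add: krpos_def)
    have kx: "krein x x \<noteq> 0" using krpos_eigenvalue(3)[OF W x(2,3)] by (simp add: krein_self_kq)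
    have l0: "l \<noteq> 0" using krpos_eigenvalue(1)[OF W x(2,3)] by auto
    define V' where "V' = {y \<in> V. krein y x = 0}"
    have sV': "vec.subspace V'"
      using less.prems(1) unfolding V'_def vec.subspace_def by (simp add: krein_add_left krein_scale_left)
    have iV': "cplx W *v y \<in> V'" if "y \<in> V'" for y
    proof -
      have "cnj l * krein (cplx W *v y) x = krein (cplx W *v y) (cplx W *v x)"
        by (simp add: x(3) krein_scale_right)
      also have "\<dots> = 0" using that by (simp add: krein_Sp[OF WS] V'_def)
      finally show ?thesis using l0 that less.prems(2) by (simp add: V'_def)
    qed
    have "V' \<subset> V" using x(1) kx unfolding V'_def by blast
    then have "vec.dim V' < vec.dim V"
      by (intro vec.dim_psubset) (simp add: vec.span_eq_iff[THEN iffD2] sV' less.prems(1))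
    from less.hyps[OF this sV' iV'] obtain B where B: "finite B" "B \<subseteq> V'" "V' \<subseteq> vec.span B"
      "\<forall>b\<in>B. b \<noteq> 0 \<and> (\<exists>l. cplx W *v b = l *s b)" "\<forall>b\<in>B. \<forall>c\<in>B. b \<noteq> c \<longrightarrow> krein b c = 0" by blast
    have Bx: "krein b x = 0" "krein x b = 0" if "b \<in> B" for b
      using B(2) that krein_sym[of x b] by (auto simp: V'_def)
    have "V \<subseteq> vec.span (insert x B)"
    proof
      fix y assume y: "y \<in> V"
      define c where "c = krein y x / krein x x"
      have "y - c *s x \<in> V'"
        using y x(1) less.prems(1) kx by (simp add: V'_def vec.subspace_diff vec.subspace_scale krein_diff_left krein_scale_left c_def)
      then have "y - c *s x \<in> vec.span (insert x B)" using B(3) vec.span_mono[of B "insert x B"] by blast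
      moreover have "x \<in> vec.span (insert x B)" by (simp add: vec.span_base)
      ultimately have "(y - c *s x) + c *s x \<in> vec.span (insert x B)"
        by (intro vec.span_add vec.span_scale)
      then show "y \<in> vec.span (insert x B)" by simp
    qed
    moreover have "insert x B \<subseteq> V" using x(1) B(2) by (auto simp: V'_def)
    moreover have "\<forall>b\<in>insert x B. b \<noteq> 0 \<and> (\<exists>l. cplx W *v b = l *s b)" using x B(4) by blast
    moreover have "\<forall>b\<in>insert x B. \<forall>c\<in>insert x B. b \<noteq> c \<longrightarrow> krein b c = 0" using Bx B(5) by auto
    ultimately show ?thesis using B(1) by (intro exI[of _ "insert x B"]) simp
  qed
qed

lemma mult_cnj_norm: "z * cnj z = complex_of_real ((cmod z)\<^sup>2)"
  by (rule complex_norm_square[symmetric])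

lemma orthogonal_kq_sum:
  assumes "finite B" "\<forall>b\<in>B. \<forall>c\<in>B. b \<noteq> c \<longrightarrow> krein b c = 0"
  shows "krein (\<Sum>b\<in>B. u b *s b) (\<Sum>b\<in>B. v b *s b) = (\<Sum>b\<in>B. u b * cnj (v b) * complex_of_real (kq b))"
proof -
  have "krein (\<Sum>b\<in>B. u b *s b) (\<Sum>b\<in>B. v b *s b) = (\<Sum>b\<in>B. \<Sum>c\<in>B. krein (u b *s b) (v c *s c))"
    unfolding krein_sum_left krein_sum_right by (rule sum.swap)
  also have "\<dots> = (\<Sum>b\<in>B. \<Sum>c\<in>B. u b * cnj (v c) * krein b c)"
    by (simp add: krein_scale_left krein_scale_right mult_ac)
  also have "\<dots> = (\<Sum>b\<in>B. \<Sum>c\<in>B. if c = b then u b * cnj (v b) * complex_of_real (kq b) else 0)"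
    by (intro sum.cong) (use assms(2) in \<open>auto simp: krein_self_kq\<close>)
  also have "\<dots> = (\<Sum>b\<in>B. u b * cnj (v b) * complex_of_real (kq b))"
    by (simp add: sum.delta assms(1))
  finally show ?thesis .
qed

lemma orthogonal_independent:
  assumes B: "finite B" "\<forall>b\<in>B. \<forall>c\<in>B. b \<noteq> c \<longrightarrow> krein b c = 0" and nz: "\<And>b. b \<in> B \<Longrightarrow> kq b \<noteq> 0"
  shows "vec.independent B"
proof (rule vec.independent_if_scalars_zero[OF B(1)])
  fix f x assume f: "(\<Sum>x\<in>B. f x *s x) = 0" and x: "x \<in> B"
  have "(\<Sum>b\<in>B. (if b = x then 1 else 0) *s b) = (\<Sum>b\<in>B. if b = x then x else 0)"
    by (rule sum.cong) auto
  also have "\<dots> = x" using x B(1) by simp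
  finally have xs: "(\<Sum>b\<in>B. (if b = x then 1 else 0) *s b) = x" .
  have "krein (\<Sum>b\<in>B. f b *s b) (\<Sum>b\<in>B. (if b = x then 1 else 0) *s b)
      = (\<Sum>b\<in>B. f b * cnj (if b = x then 1 else 0) * complex_of_real (kq b))"
    by (rule orthogonal_kq_sum[OF B])
  also have "\<dots> = (\<Sum>b\<in>B. if b = x then f x * complex_of_real (kq x) else 0)"
    by (rule sum.cong) auto
  also have "\<dots> = f x * complex_of_real (kq x)" using x B(1) by simp
  finally show "f x = 0" using nz[OF x] by (simp add: f)
qed

text \<open>Of the orthogonal eigenvectors at most \<open>CARD('n)\<close> have positive norm and,
  after conjugation, at most as many have negative norm; as they span, both numbers are attained.
  The norm \<open>2\<close> makes the imaginary and real parts of the vectors a symplectic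
  basis.\<close>

lemma krein_frame:
  fixes W :: "'n::finite sqm"
  assumes W: "krpos W"
  obtains x l where "\<And>j::'n. cplx W *v x j = l j *s x j" "\<And>j. cmod (l j) = 1" "\<And>j. Im (l j) > 0"
    "\<And>i j. krein (x i) (x j) = (if i = j then 2 else 0)" "W \<in> Spos"
proof -
  have WS: "W \<in> Sp" using W by (simp add: krpos_def)
  obtain B where B: "finite B" "(UNIV :: 'n cvec set) \<subseteq> vec.span B"
      "\<forall>b\<in>B. b \<noteq> 0 \<and> (\<exists>l. cplx W *v b = l *s b)" "\<forall>b\<in>B. \<forall>c\<in>B. b \<noteq> c \<longrightarrow> krein b c = 0"
    using orthogonal_eigenbasis[OF W vec.subspace_UNIV] by auto
  obtain m where m: "\<And>b. b \<in> B \<Longrightarrow> cplx W *v b = m b *s b" using B(3) by metis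
  have mb: "cmod (m b) = 1" "Im (m b) * kq b > 0" "kq b \<noteq> 0" if "b \<in> B" for b
    using krpos_eigenvalue[OF W _ m[OF that]] B(3) that by auto
  have sub: "card C \<le> CARD('n)" if C: "finite C" "\<forall>b\<in>C. \<forall>c\<in>C. b \<noteq> c \<longrightarrow> krein b c = 0" "\<And>b. b \<in> C \<Longrightarrow> kq b > 0"
    for C :: "'n cvec set"
  proof -
    have "vec.independent C" by (rule orthogonal_independent[OF C(1,2)]) (use C(3) in force)
    then have "card C = vec.dim (vec.span C)" by (rule vec.dim_span_eq_card_independent[symmetric])
    also have "\<dots> \<le> CARD('n)"
    proof (rule nonneg_dim_le[OF vec.subspace_span])
      fix x assume "x \<in> vec.span C"
      then obtain u where u: "x = (\<Sum>b\<in>C. u b *s b)" unfolding vec.span_finite[OF C(1)] by auto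
      have "krein x x = (\<Sum>b\<in>C. u b * cnj (u b) * complex_of_real (kq b))"
        unfolding u by (rule orthogonal_kq_sum[OF C(1,2)])
      also have "\<dots> = (\<Sum>b\<in>C. complex_of_real ((cmod (u b))\<^sup>2 * kq b))"
        by (rule sum.cong) (simp_all add: mult_cnj_norm)
      finally have "kq x = (\<Sum>b\<in>C. (cmod (u b))\<^sup>2 * kq b)" by (simp add: kq_def)
      also have "\<dots> \<ge> 0" by (intro sum_nonneg mult_nonneg_nonneg) (use C(3) in \<open>auto simp: less_imp_le\<close>)
      finally show "kq x \<ge> 0" .
    qed
    finally show ?thesis .
  qed
  define Bp where "Bp = {b \<in> B. kq b > 0}"
  define Bm where "Bm = {b \<in> B. kq b < 0}"
  have "kq b > 0 \<or> kq b < 0" if "b \<in> B" for b using mb(3)[OF that] by linarith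
  then have BB: "B = Bp \<union> Bm" "Bp \<inter> Bm = {}" by (auto simp: Bp_def Bm_def)
  have fin: "finite Bp" "finite Bm" using B(1) by (auto simp: Bp_def Bm_def)
  have p: "card Bp \<le> CARD('n)" by (rule sub[OF fin(1)]) (use B(4) in \<open>auto simp: Bp_def\<close>)
  have "card (cv ` Bm) \<le> CARD('n)"
    by (rule sub) (use fin(2) B(4) in \<open>auto simp: Bm_def krein_cv kq_cv\<close>)
  moreover have "card (cv ` Bm) = card Bm" by (rule card_image) (metis cv_cv inj_on_inverseI)
  ultimately have q: "card Bm \<le> CARD('n)" by simp
  have "vec.dim (UNIV :: 'n cvec set) \<le> card B" by (rule vec.dim_le_card[OF B(2,1)])
  then have "CARD('n) + CARD('n) \<le> card B" by (simp add: card_cart_basis)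
  also have "card B = card Bp + card Bm" unfolding BB(1) by (rule card_Un_disjoint[OF fin BB(2)])
  finally have "card Bp = CARD('n)" using p q by linarith
  then obtain e where e: "bij_betw e (UNIV::'n set) Bp"
    using fin finite_same_card_bij[of "UNIV::'n set" Bp] by auto
  have eB: "e j \<in> B" "kq (e j) > 0" for j using e by (auto simp: bij_betw_def Bp_def)
  have inj: "e i = e j \<longleftrightarrow> i = j" for i j using e by (auto simp: bij_betw_def dest: injD)
  define s where "s j = sqrt (2 / kq (e j))" for j
  define x where "x j = complex_of_real (s j) *s e j" for j
  define l where "l j = m (e j)" for j
  have "cplx W *v x j = l j *s x j" for j
    by (simp add: x_def mv_scale m[OF eB(1)] l_def mult.commute)
  moreover have "cmod (l j) = 1" for j using mb(1)[OF eB(1)] by (simp add: l_def)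
  moreover have "Im (l j) > 0" for j using mb(2)[OF eB(1), of j] eB(2)[of j] by (simp add: l_def zero_less_mult_iff)
  moreover have "krein (x i) (x j) = (if i = j then 2 else 0)" for i j
  proof (cases "i = j")
    case True
    have "kq (x j) = (s j)\<^sup>2 * kq (e j)" by (simp add: x_def kq_scale)
    also have "\<dots> = 2" using eB(2)[of j] by (simp add: s_def)
    finally show ?thesis using True by (simp add: krein_self_kq)
  next
    case False
    then have "krein (e i) (e j) = 0" using B(4) eB(1) inj by blast
    then show ?thesis using False by (simp add: x_def krein_scale_left krein_scale_right)
  qed
  moreover have "W \<in> Spos"
    unfolding Spos_def
  proof (intro CollectI conjI WS allI impI)
    fix v :: "real^('n + 'n)" assume v: "v \<noteq> 0"
    obtain u where u: "rv v = (\<Sum>b\<in>B. u b *s b)" using B(2) unfolding vec.span_finite[OF B(1)] by blast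
    have Wu: "cplx W *v rv v = (\<Sum>b\<in>B. (u b * m b) *s b)"
      unfolding u vec.sum by (rule sum.cong) (simp_all add: mv_scale m)
    have "krein (rv v) (cplx W *v rv v) = (\<Sum>b\<in>B. u b * cnj (u b * m b) * complex_of_real (kq b))"
      unfolding Wu unfolding u by (rule orthogonal_kq_sum[OF B(1,4)])
    also have "\<dots> = (\<Sum>b\<in>B. complex_of_real ((cmod (u b))\<^sup>2 * kq b) * cnj (m b))"
    proof (rule sum.cong[OF refl])
      fix b
      have "u b * cnj (u b * m b) * complex_of_real (kq b) = (u b * cnj (u b)) * complex_of_real (kq b) * cnj (m b)"
        by (simp add: mult_ac)
      also have "u b * cnj (u b) = complex_of_real ((cmod (u b))\<^sup>2)" by (rule complex_norm_square[symmetric])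
      finally show "u b * cnj (u b * m b) * complex_of_real (kq b) = complex_of_real ((cmod (u b))\<^sup>2 * kq b) * cnj (m b)" by simp
    qed
    finally have "Im (krein (rv v) (cplx W *v rv v)) = - (\<Sum>b\<in>B. (cmod (u b))\<^sup>2 * (Im (m b) * kq b))"
      by (simp add: sum_negf mult_ac)
    moreover have "Im (krein (rv v) (cplx W *v rv v)) = - omega0 v (W *v v)" by (simp add: cplx_rv krein_rv)
    ultimately have "omega0 v (W *v v) = (\<Sum>b\<in>B. (cmod (u b))\<^sup>2 * (Im (m b) * kq b))" by simp
    also have "\<dots> > 0"
    proof (rule ccontr)
      assume n: "\<not> ?thesis"
      have nn: "(cmod (u b))\<^sup>2 * (Im (m b) * kq b) \<ge> 0" if "b \<in> B" for b using mb(2)[OF that] by (simp add: less_imp_le)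
      have "(\<Sum>b\<in>B. (cmod (u b))\<^sup>2 * (Im (m b) * kq b)) = 0"
      proof -
        have "(\<Sum>b\<in>B. (cmod (u b))\<^sup>2 * (Im (m b) * kq b)) \<ge> 0" by (rule sum_nonneg) (rule nn)
        then show ?thesis using n by linarith
      qed
      then have "(cmod (u b))\<^sup>2 * (Im (m b) * kq b) = 0" if "b \<in> B" for b
        using sum_nonneg_eq_0_iff[of B "\<lambda>b. (cmod (u b))\<^sup>2 * (Im (m b) * kq b)"] B(1) nn that by simp
      then have "u b = 0" if "b \<in> B" for b using mb(2)[OF that] that by fastforce
      then have "rv v = 0" unfolding u by simp
      then have "rpart (rv v) = rpart 0" by simp
      then show False using v by (simp add: rpart_def rv_def vec_eq_iff)
    qed
    finally show "omega0 v (W *v v) > 0" .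
  qed
  ultimately show ?thesis by (rule that)
qed

lemma Spos_eq: "Spos = (Sp_ell_plus :: 'n::finite sqm set)"
proof
  show "(Sp_ell_plus :: 'n sqm set) \<subseteq> Spos"
  proof
    fix W :: "'n sqm" assume "W \<in> Sp_ell_plus"
    then have "krpos W" by (rule Sp_ell_plus_krpos)
    then show "W \<in> Spos" by (rule krein_frame) simp
  qed
  show "Spos \<subseteq> (Sp_ell_plus :: 'n sqm set)"
  proof
    fix W :: "'n sqm" assume WP: "W \<in> Spos"
    then have W: "krpos W" by (rule Spos_krpos)
    have WS: "W \<in> Sp" using WP by (simp add: Spos_def)
    have "cmod l = 1 \<and> l \<noteq> 1 \<and> l \<noteq> -1 \<and> (Im l > 0 \<longrightarrow> krein_positive W l)" if l: "l \<in> eigs (cplx W)" for l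
    proof -
      obtain x where x: "x \<noteq> 0" "cplx W *v x = l *s x" using l eigs_iff_eigenvector by blast
      note ev = krpos_eigenvalue[OF W x]
      have ll: "cnj l * l = 1" using ev(1) complex_norm_square[of l] by (simp add: mult.commute)
      \<comment> \<open>A chain vector \<open>z = (W - l) y\<close> that is an eigenvector would be
        isotropic by invariance of the form, which \<open>krpos\<close> forbids; so there are no
        Jordan blocks.\<close>
      have semi: "(sh (cplx W) l ^^ k) y = 0 \<Longrightarrow> y = 0 \<or> sh (cplx W) l y = 0" for k y
      proof (induction k arbitrary: y)
        case (Suc k)
        have "(sh (cplx W) l ^^ k) (sh (cplx W) l y) = 0" using Suc.prems by (simp add: sh_pow_comm)
        from Suc.IH[OF this] have z: "sh (cplx W) l (sh (cplx W) l y) = 0" by auto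
        define z where "z = sh (cplx W) l y"
        have "sh (cplx W) l z = 0" using z by (simp only: z_def)
        then have zz: "cplx W *v z = l *s z" by (simp add: sh_def)
        have Wy: "cplx W *v y = l *s y + z" by (simp add: z_def sh_def)
        have "krein y z = krein (l *s y + z) (l *s z)" using krein_Sp[OF WS, of y z] by (simp add: Wy zz)
        also have "\<dots> = (cnj l * l) * krein y z + cnj l * krein z z"
          by (simp add: krein_add_left krein_scale_left krein_scale_right algebra_simps)
        finally have "cnj l * krein z z = 0" using ll by simp
        then have "kq z = 0" using ll by (auto simp: krein_self_kq)
        then have "z = 0" using krpos_eigenvalue(3)[OF W _ zz] by blast
        then show ?case by (simp add: z_def)
      qed simp
      have "krein_positive W l" if "Im l > 0"
        unfolding krein_positive_def krein_posdef_kq geneig_eq_gker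
      proof (intro ballI impI)
        fix y assume y: "y \<in> gker (cplx W) l" "y \<noteq> 0"
        then have "sh (cplx W) l y = 0" using semi[of "CARD('n + 'n)" y] by (simp add: gker_def)
        then have "cplx W *v y = l *s y" by (simp add: sh_def)
        then have "Im l * kq y > 0" by (rule krpos_eigenvalue(2)[OF W y(2)])
        then show "kq y > 0" using that by (simp add: zero_less_mult_iff)
      qed
      then show ?thesis using ev by auto
    qed
    then show "W \<in> Sp_ell_plus" using WS unfolding Sp_ell_plus_def eigenvalues_eq_eigs by blast
  qed
qed

section \<open>Rotations and characteristic polynomials\<close>

definition Rot :: "('n::finite \<Rightarrow> real) \<Rightarrow> 'n sqm" where
  "Rot \<theta> = (\<chi> i k. case i of
      Inl j \<Rightarrow> (if k = Inl j then cos (\<theta> j) else if k = Inr j then - sin (\<theta> j) else 0)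
    | Inr j \<Rightarrow> (if k = Inl j then sin (\<theta> j) else if k = Inr j then cos (\<theta> j) else 0))"

lemma Rot_vec:
  "(Rot \<theta> *v u) $ Inl j = cos (\<theta> j) * u $ Inl j - sin (\<theta> j) * u $ Inr j"
  "(Rot \<theta> *v u) $ Inr j = sin (\<theta> j) * u $ Inl j + cos (\<theta> j) * u $ Inr j"
  by (simp_all add: Rot_def matrix_vector_mult_def sum_UNIV_Plus if_distrib if_distribR cong: if_cong)

lemma cplx_Rot_vec:
  "(cplx (Rot \<theta>) *v u) $ Inl j = complex_of_real (cos (\<theta> j)) * u $ Inl j - complex_of_real (sin (\<theta> j)) * u $ Inr j"
  "(cplx (Rot \<theta>) *v u) $ Inr j = complex_of_real (sin (\<theta> j)) * u $ Inl j + complex_of_real (cos (\<theta> j)) * u $ Inr j"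
  by (simp_all add: cplx_def Rot_def matrix_vector_mult_def sum_UNIV_Plus if_distrib if_distribR cong: if_cong)


lemma charpoly_mat: "charpoly W z = det (mat z - cplx W)"
  by (simp add: charpoly_def mat_def)

lemma det_shift_similar:
  fixes A D F :: "complex^'m^'m"
  assumes F: "invertible F" and eq: "A ** F = F ** D"
  shows "det (mat z - A) = det (mat z - D)"
proof -
  have "mat z ** F = F ** mat z"
    by (simp add: vec_eq_iff matrix_matrix_mult_def mat_def if_distrib if_distribR mult.commute cong: if_cong)
  then have "(mat z - A) ** F = F ** (mat z - D)"
    by (simp add: matrix_mult.diff_left matrix_mult.diff_right eq)
  then have "det (mat z - A) * det F = det F * det (mat z - D)" by (metis det_mul)
  moreover have "det F \<noteq> 0" using F invertible_det_nz by blast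
  ultimately show ?thesis by simp
qed

lemma cplx_invertible: "invertible M \<Longrightarrow> invertible (cplx M)"
  by (metis cplx_mult cplx_one invertible_right_inverse)

lemma charpoly_Rot:
  fixes \<theta> :: "'n::finite \<Rightarrow> real"
  shows "charpoly (Rot \<theta>) z = (\<Prod>j\<in>UNIV. (z - exp (\<i> * complex_of_real (\<theta> j))) * (z - exp (- \<i> * complex_of_real (\<theta> j))))"
proof -
  define d where "d k = (case k of Inl j \<Rightarrow> exp (\<i> * complex_of_real (\<theta> j)) | Inr j \<Rightarrow> exp (- \<i> * complex_of_real (\<theta> j)))" for k :: "'n + 'n"
  \<comment> \<open>The columns are eigenvectors of \<open>J0\<close>, which diagonalise all these
    rotations at once.\<close>
  define F :: "complex^('n + 'n)^('n + 'n)"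
    where "F = (\<chi> r k. case k of Inl j \<Rightarrow> io (axis j 1) 0 $ r | Inr j \<Rightarrow> io 0 (axis j 1) $ r)"
  have Fl: "(F *v u) $ Inl j = u $ Inl j + u $ Inr j" and Fr: "(F *v u) $ Inr j = - \<i> * (u $ Inl j - u $ Inr j)" for u j
    by (simp_all add: F_def io_def matrix_vector_mult_def sum_UNIV_Plus axis_def if_distrib if_distribR algebra_simps cong: if_cong)
  have inv: "invertible F"
    unfolding invertible_iff_kernel
  proof (intro allI impI)
    fix u assume u: "F *v u = 0"
    have "u $ Inl j = 0 \<and> u $ Inr j = 0" for j
    proof -
      have "u $ Inl j + u $ Inr j = 0" "u $ Inl j - u $ Inr j = 0"
        using Fl[of u j] Fr[of u j] by (simp_all add: u)
      then show ?thesis by (simp add: complex_eq_iff)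
    qed
    then have "u $ k = 0" for k by (cases k) auto
    then show "u = 0" by (simp add: vec_eq_iff)
  qed
  have dv: "(\<chi> i j. if i = j then d i else 0) *v u = (\<chi> i. d i * u $ i)" for u
    by (simp add: vec_eq_iff matrix_vector_mult_def if_distrib if_distribR cong: if_cong)
  have ee: "exp (\<i> * complex_of_real t) = complex_of_real (cos t) + \<i> * complex_of_real (sin t)"
    "exp (- \<i> * complex_of_real t) = complex_of_real (cos t) - \<i> * complex_of_real (sin t)"
    "exp (- (\<i> * complex_of_real t)) = complex_of_real (cos t) - \<i> * complex_of_real (sin t)" for t
    using cis_conv_exp[of t] cis_conv_exp[of "- t"] by (auto simp: complex_eq_iff)
  have eq: "cplx (Rot \<theta>) ** F = F ** (\<chi> i j. if i = j then d i else 0)"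
    unfolding matrix_eq
  proof
    fix u
    have "(cplx (Rot \<theta>) *v (F *v u)) $ k = (F *v (\<chi> i. d i * u $ i)) $ k" for k
      by (cases k) (simp_all add: cplx_Rot_vec Fl Fr d_def ee, simp_all add: algebra_simps)
    then show "(cplx (Rot \<theta>) ** F) *v u = (F ** (\<chi> i j. if i = j then d i else 0)) *v u"
      by (simp add: vec_eq_iff dv flip: matrix_vector_mul_assoc)
  qed
  have "charpoly (Rot \<theta>) z = det (mat z - (\<chi> i j. if i = j then d i else 0))"
    unfolding charpoly_mat by (rule det_shift_similar[OF inv eq])
  also have "mat z - (\<chi> i j. if i = j then d i else 0) = (\<chi> i j. if i = j then z - d i else 0)"
    by (simp add: vec_eq_iff mat_def)
  also have "det \<dots> = (\<Prod>k\<in>UNIV. z - d k)" by (rule det_diag)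
  finally show ?thesis by (simp add: prod_UNIV_Plus d_def prod.distrib)
qed

lemma charpoly_normal_form:
  fixes W M :: "'n::finite sqm"
  assumes "M \<in> Sp" "W ** M = M ** Rot \<theta>"
  shows "charpoly W z = (\<Prod>j\<in>UNIV. (z - exp (\<i> * complex_of_real (\<theta> j))) * (z - exp (- \<i> * complex_of_real (\<theta> j))))"
proof -
  have "cplx W ** cplx M = cplx M ** cplx (Rot \<theta>)" using assms(2) by (simp flip: cplx_mult)
  then have "charpoly W z = charpoly (Rot \<theta>) z"
    unfolding charpoly_mat by (rule det_shift_similar[OF cplx_invertible[OF Sp_invertible[OF assms(1)]]])
  then show ?thesis by (simp only: charpoly_Rot)
qed

text \<open>The span of the \<open>x j\<close> is an invariant maximal nonnegative subspace, so it
  is the graph of a contraction \<open>K\<close>, and \<open>TK W K\<close> is conjugate to the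
  diagonal matrix of the \<open>l j\<close>.\<close>

lemma upsilon_frame:
  fixes W :: "'n::finite sqm"
  assumes W: "W \<in> Sp" and x: "\<And>j::'n. cplx W *v x j = l j *s x j" and l: "\<And>j. cmod (l j) = 1"
    and kr: "\<And>i j. krein (x i) (x j) = (if i = j then 2 else 0)"
  shows "upsilon W = (\<Prod>j\<in>UNIV. l j)"
proof -
  define X where "X c = (\<Sum>j\<in>UNIV. c $ j *s x j)" for c :: "complex^'n"
  define P where "P = (\<chi> r j. pp (x j) $ r)"
  define Q where "Q = (\<chi> r j. mm (x j) $ r)"
  have ppsum: "pp (\<Sum>j\<in>A. f j) = (\<Sum>j\<in>A. pp (f j))" for A :: "'n set" and f :: "'n \<Rightarrow> 'n cvec"
    by (simp add: pp_def vec_eq_iff sum.distrib sum_divide_distrib sum_distrib_left add_divide_distrib)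
  have mmsum: "mm (\<Sum>j\<in>A. f j) = (\<Sum>j\<in>A. mm (f j))" for A :: "'n set" and f :: "'n \<Rightarrow> 'n cvec"
    by (simp add: mm_def vec_eq_iff sum_subtractf sum_divide_distrib sum_distrib_left diff_divide_distrib)
  have Pc: "P *v c = pp (X c)" and Qc: "Q *v c = mm (X c)" for c
    by (simp_all add: X_def ppsum mmsum pp_scale mm_scale P_def Q_def vec_eq_iff matrix_vector_mult_def mult.commute)
  have kX: "kq (X c) = 2 * (\<Sum>j\<in>UNIV. (cmod (c $ j))\<^sup>2)" for c
  proof -
    have "krein (X c) (X c) = (\<Sum>i\<in>UNIV. \<Sum>j\<in>UNIV. krein (c $ i *s x i) (c $ j *s x j))"
      unfolding X_def krein_sum_left krein_sum_right by (rule sum.swap)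
    also have "\<dots> = (\<Sum>i\<in>UNIV. \<Sum>j\<in>UNIV. if j = i then 2 * (c $ i * cnj (c $ i)) else 0)"
      by (intro sum.cong refl) (simp add: krein_scale_left krein_scale_right kr)
    also have "\<dots> = (\<Sum>i\<in>UNIV. complex_of_real (2 * (cmod (c $ i))\<^sup>2))"
      by (simp add: mult_cnj_norm)
    finally show ?thesis by (simp add: kq_def sum_distrib_left)
  qed
  have kXn: "kq (X c) \<ge> 0" for c unfolding kX by (intro mult_nonneg_nonneg sum_nonneg) auto
  have le: "norm (Q *v c) \<le> norm (P *v c)" for c
    using kXn[of c] by (simp add: kq_eq Pc Qc power2_le_iff_abs_le)
  have invP: "invertible P"
    unfolding invertible_iff_kernel
  proof (intro allI impI)
    fix c assume c: "P *v c = 0"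
    then have "kq (X c) \<le> 0" by (simp add: kq_eq Pc)
    then have "(\<Sum>j\<in>UNIV. (cmod (c $ j))\<^sup>2) \<le> 0" by (simp add: kX)
    moreover have "(\<Sum>j\<in>UNIV. (cmod (c $ j))\<^sup>2) \<ge> 0" by (intro sum_nonneg) auto
    ultimately have "(\<Sum>j\<in>UNIV. (cmod (c $ j))\<^sup>2) = 0" by linarith
    then have "\<forall>j\<in>UNIV. (cmod (c $ j))\<^sup>2 = 0" by (subst (asm) sum_nonneg_eq_0_iff) auto
    then show "c = 0" by (simp add: vec_eq_iff)
  qed
  define K where "K = Q ** matrix_inv P"
  have KP: "K *v (P *v c) = Q *v c" for c
    by (simp add: K_def matrix_inv_vec[OF invP] flip: matrix_vector_mul_assoc)
  have surj: "\<exists>c. a = P *v c" for a using matrix_inv_vec(1)[OF invP, of a] by metis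
  have K: "K \<in> contr"
    unfolding contr_def
  proof (intro CollectI allI)
    fix a
    obtain c where "a = P *v c" using surj by blast
    then show "norm (K *v a) \<le> norm a" using le[of c] by (simp add: KP)
  qed
  have em: "emb K (P *v c) = X c" for c
    unfolding emb_def KP unfolding Pc Qc by (rule io_pp_mm)
  define D where "D = (\<chi> i j. if i = j then l i else 0 :: complex^'n^'n)"
  have Dc: "(D *v c) $ j = l j * c $ j" for c j
    by (simp add: D_def matrix_vector_mult_def if_distrib if_distribR cong: if_cong)
  have WX: "cplx W *v X c = X (D *v c)" for c
    unfolding X_def vec.sum by (rule sum.cong) (simp_all add: mv_scale x Dc mult.commute)
  have T: "TK W K *v (P *v c) = P *v (D *v c)" and S: "SK W K *v (P *v c) = Q *v (D *v c)" for c
    unfolding TK_vec SK_vec em WX by (simp_all only: Pc Qc)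
  have "SK W K = K ** TK W K"
    unfolding matrix_eq
  proof
    fix a
    obtain c where "a = P *v c" using surj by blast
    then show "SK W K *v a = (K ** TK W K) *v a" by (simp add: S T KP flip: matrix_vector_mul_assoc)
  qed
  then have "upsilon W = sgn (det (TK W K))" by (rule upsilon_eq_sgn_det[OF W K])
  moreover have "TK W K ** P = P ** D" unfolding matrix_eq by (simp add: T flip: matrix_vector_mul_assoc)
  then have "det (TK W K) * det P = det P * det D" by (metis det_mul)
  then have "det (TK W K) = det D" using invP invertible_det_nz[of P] by auto
  then have "det (TK W K) = (\<Prod>j\<in>UNIV. l j)" by (simp only: D_def det_diag)
  ultimately show ?thesis by (simp add: sgn_prod_complex) (intro prod.cong refl, simp add: sgn_eq l)
qed

lemma normal_form:
  fixes W :: "'n::finite sqm"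
  assumes WP: "W \<in> Spos"
  obtains M \<theta> where "M \<in> Sp" "\<And>j::'n. 0 < \<theta> j \<and> \<theta> j < pi" "W ** M = M ** Rot \<theta>"
    "upsilon W = exp (\<i> * complex_of_real (\<Sum>j\<in>UNIV. \<theta> j))"
proof -
  have WS: "W \<in> Sp" using WP by (simp add: Spos_def)
  obtain x l where x: "\<And>j::'n. cplx W *v x j = l j *s x j" and l: "\<And>j. cmod (l j) = 1" "\<And>j. Im (l j) > 0"
    and kr: "\<And>i j. krein (x i) (x j) = (if i = j then 2 else 0)"
    by (rule krein_frame[OF Spos_krpos[OF WP]]) (rule that)
  define a where "a j = rpart (x j)" for j
  define b where "b j = ipart (x j)" for j
  define \<theta> where "\<theta> j = arccos (Re (l j))" for j
  have sq: "(Re (l j))\<^sup>2 + (Im (l j))\<^sup>2 = 1" for j using l(1)[of j] by (simp add: cmod_def)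
  have re: "-1 < Re (l j)" "Re (l j) < 1" for j
  proof -
    have "(Re (l j))\<^sup>2 < 1\<^sup>2" using sq[of j] l(2)[of j] by (smt (verit) zero_less_power one_power2)
    then have "\<bar>Re (l j)\<bar> < 1" by (metis abs_square_less_1 one_power2)
    then show "-1 < Re (l j)" "Re (l j) < 1" by auto
  qed
  have th: "0 < \<theta> j \<and> \<theta> j < pi" for j unfolding \<theta>_def using arccos_lt_bounded[of "Re (l j)"] re[of j] by auto
  have co: "cos (\<theta> j) = Re (l j)" for j unfolding \<theta>_def using re[of j] by simp
  have si: "sin (\<theta> j) = Im (l j)" for j
  proof -
    have "sin (\<theta> j) = sqrt (1 - (Re (l j))\<^sup>2)" unfolding \<theta>_def using re[of j] by (intro sin_arccos) auto
    also have "1 - (Re (l j))\<^sup>2 = (Im (l j))\<^sup>2" using sq[of j] by simp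
    finally show ?thesis using l(2)[of j] by simp
  qed
  have lexp: "l j = exp (\<i> * complex_of_real (\<theta> j))" for j
    using co[of j] si[of j] cis_conv_exp[of "\<theta> j"] by (simp add: complex_eq_iff)
  \<comment> \<open>Both \<open>l i\<close> and \<open>l j\<close> lie on the open upper half of the
    unit circle, so their product is not \<open>1\<close> and invariance of the form makes the
    pairing vanish.\<close>
  have krc: "krein (x i) (cv (x j)) = 0" for i j
  proof -
    have "krein (x i) (cv (x j)) = krein (cplx W *v x i) (cplx W *v cv (x j))" by (simp add: krein_Sp[OF WS])
    also have "\<dots> = l i * l j * krein (x i) (cv (x j))"
      by (simp add: cplx_cv x cv_scale krein_scale_left krein_scale_right mult.assoc)
    finally have "(1 - l i * l j) * krein (x i) (cv (x j)) = 0" by (simp add: algebra_simps)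
    moreover have "l i * l j \<noteq> 1"
    proof
      assume 1: "l i * l j = 1"
      have "l i * cnj (l i) = 1" using l(1)[of i] complex_norm_square[of "l i"] by simp
      then have "l i * l j = l i * cnj (l i)" using 1 by simp
      then have "l j = cnj (l i)" using 1 by (metis mult_left_cancel mult_zero_left zero_neq_one)
      then show False using l(2)[of i] l(2)[of j] by simp
    qed
    ultimately show ?thesis by simp
  qed
  have om: "omega0 (b i) (a j) = (if i = j then 1 else 0)" "omega0 (a i) (b j) = (if i = j then -1 else 0)"
    "omega0 (a i) (a j) = 0" "omega0 (b i) (b j) = 0" for i j
    using kr[of i j] krc[of i j]
    by (auto simp: krein_parts a_def[symmetric] b_def[symmetric] complex_eq_iff omega.minus_right split: if_splits)
  \<comment> \<open>The imaginary parts \<open>b j\<close> take the places of the \<open>x_j\<close>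
    because \<open>omega0 (b j) (a j) = 1\<close>.\<close>
  define M where "M = (\<chi> r k. case k of Inl j \<Rightarrow> b j $ r | Inr j \<Rightarrow> a j $ r)"
  have Mu: "M *v u = (\<Sum>j\<in>UNIV. u $ Inl j *\<^sub>R b j + u $ Inr j *\<^sub>R a j)" for u
    by (simp add: M_def vec_eq_iff matrix_vector_mult_def sum_UNIV_Plus sum.distrib mult.commute)
  have MS: "M \<in> Sp"
    unfolding Sp_def
  proof (intro CollectI allI)
    fix u v
    have "omega0 (M *v u) (M *v v) = (\<Sum>i\<in>UNIV. \<Sum>j\<in>UNIV.
        omega0 (u $ Inl i *\<^sub>R b i + u $ Inr i *\<^sub>R a i) (v $ Inl j *\<^sub>R b j + v $ Inr j *\<^sub>R a j))"
      unfolding Mu omega.sum_left omega.sum_right by (rule sum.swap)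
    also have "\<dots> = (\<Sum>i\<in>UNIV. \<Sum>j\<in>UNIV. if j = i then u $ Inl i * v $ Inr i - u $ Inr i * v $ Inl i else 0)"
      by (intro sum.cong refl)
        (simp add: omega.add_left omega.add_right omega.scaleR_left omega.scaleR_right om)
    also have "\<dots> = omega0 u v" by (simp add: omega0_def)
    finally show "omega0 (M *v u) (M *v v) = omega0 u v" .
  qed
  have Wa: "W *v a j = cos (\<theta> j) *\<^sub>R a j - sin (\<theta> j) *\<^sub>R b j" and Wb: "W *v b j = sin (\<theta> j) *\<^sub>R a j + cos (\<theta> j) *\<^sub>R b j" for j
  proof -
    have "rpart (cplx W *v x j) = Re (l j) *\<^sub>R a j - Im (l j) *\<^sub>R b j" "ipart (cplx W *v x j) = Im (l j) *\<^sub>R a j + Re (l j) *\<^sub>R b j"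
      unfolding x by (simp_all add: a_def b_def rpart_def ipart_def vec_eq_iff)
    then show "W *v a j = cos (\<theta> j) *\<^sub>R a j - sin (\<theta> j) *\<^sub>R b j" "W *v b j = sin (\<theta> j) *\<^sub>R a j + cos (\<theta> j) *\<^sub>R b j"
      by (simp_all add: rpart_cplx ipart_cplx a_def b_def co si)
  qed
  have "W ** M = M ** Rot \<theta>"
    unfolding matrix_eq
  proof
    fix u
    have "W *v (M *v u) = (\<Sum>j\<in>UNIV. W *v (u $ Inl j *\<^sub>R b j + u $ Inr j *\<^sub>R a j))"
      unfolding Mu by (rule matrix_vec_mult.sum_right)
    also have "\<dots> = M *v (Rot \<theta> *v u)"
      unfolding Mu by (intro sum.cong refl)
        (simp add: matrix_vec_mult.add_right matrix_vec_mult.scaleR_right Wa Wb Rot_vec algebra_simps)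
    finally show "(W ** M) *v u = (M ** Rot \<theta>) *v u" by (simp flip: matrix_vector_mul_assoc)
  qed
  moreover have "upsilon W = exp (\<i> * complex_of_real (\<Sum>j\<in>UNIV. \<theta> j))"
    using upsilon_frame[OF WS x l(1) kr] by (simp add: lexp exp_sum sum_distrib_left)
  ultimately show ?thesis by (rule that[OF MS th])
qed

section \<open>The Maslov quasimorphism on the closure\<close>

text \<open>The required description of the spectrum, with the angles as a vector so that
  compactness of a box can be used; the closed bounds let the property pass to limits.\<close>

definition good :: "'n::finite sqm \<Rightarrow> (real^'n) \<Rightarrow> bool" where
  "good W \<theta> \<longleftrightarrow> (\<forall>j. 0 \<le> \<theta> $ j \<and> \<theta> $ j \<le> pi) \<and>
     (\<forall>z. charpoly W z = (\<Prod>j\<in>UNIV. (z - exp (\<i> * complex_of_real (\<theta> $ j))) * (z - exp (- \<i> * complex_of_real (\<theta> $ j)))))"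

lemma quadratic_factor:
  "(z - exp (\<i> * complex_of_real t)) * (z - exp (- \<i> * complex_of_real t)) = z\<^sup>2 - 2 * complex_of_real (cos t) * z + 1"
proof -
  have "exp (\<i> * complex_of_real t) * exp (- \<i> * complex_of_real t) = 1" by (simp flip: exp_add)
  moreover have "exp (\<i> * complex_of_real t) + exp (- \<i> * complex_of_real t) = 2 * complex_of_real (cos t)"
    using cis_conv_exp[of t] cis_conv_exp[of "- t"] by (simp add: complex_eq_iff)
  moreover have "(z - exp (\<i> * complex_of_real t)) * (z - exp (- \<i> * complex_of_real t))
     = z\<^sup>2 - (exp (\<i> * complex_of_real t) + exp (- \<i> * complex_of_real t)) * z + exp (\<i> * complex_of_real t) * exp (- \<i> * complex_of_real t)"
    by (simp add: algebra_simps power2_eq_square)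
  ultimately show ?thesis by simp
qed

lemma good_sum_unique:
  fixes \<theta> \<phi> :: "real^'n::finite"
  assumes "good W \<theta>" "good W \<phi>"
  shows "(\<Sum>j\<in>UNIV. \<theta> $ j) = (\<Sum>j\<in>UNIV. \<phi> $ j)"
proof -
  have q: "(\<Prod>j\<in>UNIV. z\<^sup>2 - 2 * complex_of_real (cos (\<theta> $ j)) * z + 1) = (\<Prod>j\<in>UNIV. z\<^sup>2 - 2 * complex_of_real (cos (\<phi> $ j)) * z + 1)" for z
    using assms unfolding good_def quadratic_factor by metis
  have p: "(\<Prod>j\<in>UNIV. y - cos (\<theta> $ j)) = (\<Prod>j\<in>UNIV. y - cos (\<phi> $ j))" for y :: real
  proof -
    \<comment> \<open>A solution of \<open>z + 1 / z = 2 y\<close>. It turns each quadratic factor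
      of the characteristic polynomial into \<open>2 z (y - cos)\<close> and so recovers the cosines
      as the roots of one real polynomial.\<close>
    define z where "z = complex_of_real y + csqrt ((complex_of_real y)\<^sup>2 - 1)"
    have z2: "z\<^sup>2 + 1 = 2 * complex_of_real y * z"
      by (simp add: z_def power2_sum) (simp add: algebra_simps power2_eq_square)
    have z0: "z \<noteq> 0" using z2 by auto
    have f: "z\<^sup>2 - 2 * complex_of_real c * z + 1 = (2 * z) * complex_of_real (y - c)" for c
    proof -
      have "z\<^sup>2 - 2 * complex_of_real c * z + 1 = (z\<^sup>2 + 1) - 2 * complex_of_real c * z" by simp
      also have "\<dots> = (2 * z) * complex_of_real (y - c)" unfolding z2 by (simp add: algebra_simps)
      finally show ?thesis .
    qed
    have "(2 * z) ^ CARD('n) * complex_of_real (\<Prod>j\<in>UNIV. y - cos (\<theta> $ j)) = (2 * z) ^ CARD('n) * complex_of_real (\<Prod>j\<in>UNIV. y - cos (\<phi> $ j))"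
      using q[of z] unfolding f prod.distrib by (simp del: of_real_diff)
    then show ?thesis using z0 by (simp only: mult_cancel_left power_eq_0_iff of_real_eq_iff) simp
  qed
  define P where "P \<psi> = (\<Prod>j\<in>UNIV. [:- cos (\<psi> $ j), 1:])" for \<psi> :: "real^'n"
  have "poly (P \<theta>) y = poly (P \<phi>) y" for y using p[of y] by (simp add: P_def poly_prod algebra_simps)
  then have "P \<theta> = P \<phi>" by (simp add: poly_eq_poly_eq_iff[symmetric] fun_eq_iff)
  then have "proots (P \<theta>) = proots (P \<phi>)" by simp
  moreover have "proots (P \<psi>) = (\<Sum>j\<in>UNIV. {#cos (\<psi> $ j)#})" for \<psi>
    unfolding P_def by (subst proots_prod) auto
  ultimately have m: "(\<Sum>j\<in>UNIV. {#cos (\<theta> $ j)#}) = (\<Sum>j\<in>UNIV. {#cos (\<phi> $ j)#})" by simp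
  have im: "sum_mset (image_mset arccos (\<Sum>j\<in>A. {#cos (\<psi> $ j)#})) = (\<Sum>j\<in>A. arccos (cos (\<psi> $ j)))" for A :: "'n set" and \<psi> :: "real^'n"
    by (induction A rule: infinite_finite_induct) simp_all
  have ac: "arccos (cos (\<theta> $ j)) = \<theta> $ j" "arccos (cos (\<phi> $ j)) = \<phi> $ j" for j
    using assms by (simp_all add: good_def arccos_cos)
  show ?thesis using im[of \<theta> UNIV] im[of \<phi> UNIV] m by (simp add: ac)
qed

lemma charpoly_tendsto:
  assumes "X \<longlonglongrightarrow> W"
  shows "(\<lambda>k. charpoly (X k) z) \<longlonglongrightarrow> charpoly W z"
proof -
  have "(\<lambda>k. cplx (X k)) \<longlonglongrightarrow> cplx W"
    unfolding cplx_def by (intro tendsto_intros assms)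
  then show ?thesis unfolding charpoly_mat by (intro tendsto_det tendsto_intros)
qed

lemma good_limit:
  fixes T :: "nat \<Rightarrow> real^'n::finite"
  assumes X: "X \<longlonglongrightarrow> W" and g: "\<And>k. good (X k) (T k)" and m: "(\<lambda>k. \<Sum>j\<in>UNIV. T k $ j) \<longlonglongrightarrow> m"
  obtains \<theta> where "good W \<theta>" "(\<Sum>j\<in>UNIV. \<theta> $ j) = m"
proof -
  have "compact (cbox (0 :: real^'n) (\<chi> j. pi))" by (rule compact_cbox)
  moreover have "T k \<in> cbox 0 (\<chi> j. pi)" for k using g[of k] by (simp add: good_def mem_box_cart)
  ultimately obtain \<theta> r where r: "\<theta> \<in> cbox 0 (\<chi> j. pi)" "strict_mono r" "(T \<circ> r) \<longlonglongrightarrow> \<theta>"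
    unfolding compact_def by metis
  have Tj: "(\<lambda>k. T (r k) $ j) \<longlonglongrightarrow> \<theta> $ j" for j using tendsto_vec_nth[OF r(3)] by (simp add: o_def)
  have Xr: "(\<lambda>k. X (r k)) \<longlonglongrightarrow> W" using LIMSEQ_subseq_LIMSEQ[OF X r(2)] by (simp add: o_def)
  have "charpoly W z = (\<Prod>j\<in>UNIV. (z - exp (\<i> * complex_of_real (\<theta> $ j))) * (z - exp (- \<i> * complex_of_real (\<theta> $ j))))" for z
  proof (rule LIMSEQ_unique[OF charpoly_tendsto[OF Xr]])
    have "(\<lambda>k. \<Prod>j\<in>UNIV. (z - exp (\<i> * complex_of_real (T (r k) $ j))) * (z - exp (- \<i> * complex_of_real (T (r k) $ j))))
      \<longlonglongrightarrow> (\<Prod>j\<in>UNIV. (z - exp (\<i> * complex_of_real (\<theta> $ j))) * (z - exp (- \<i> * complex_of_real (\<theta> $ j))))"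
      by (intro tendsto_intros Tj)
    then show "(\<lambda>k. charpoly (X (r k)) z) \<longlonglongrightarrow> (\<Prod>j\<in>UNIV. (z - exp (\<i> * complex_of_real (\<theta> $ j))) * (z - exp (- \<i> * complex_of_real (\<theta> $ j))))"
      using g unfolding good_def by simp
  qed
  then have "good W \<theta>" using r(1) by (simp add: good_def mem_box_cart)
  moreover have "(\<Sum>j\<in>UNIV. \<theta> $ j) = m"
  proof (rule LIMSEQ_unique)
    show "(\<lambda>k. \<Sum>j\<in>UNIV. T (r k) $ j) \<longlonglongrightarrow> (\<Sum>j\<in>UNIV. \<theta> $ j)" by (intro tendsto_sum Tj)
    show "(\<lambda>k. \<Sum>j\<in>UNIV. T (r k) $ j) \<longlonglongrightarrow> m" using LIMSEQ_subseq_LIMSEQ[OF m r(2)] by (simp add: o_def)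
  qed
  ultimately show ?thesis by (rule that)
qed

lemma good_Spos:
  fixes W :: "'n::finite sqm"
  assumes "W \<in> Spos"
  obtains \<theta> where "good W \<theta>" "upsilon W = exp (\<i> * complex_of_real (\<Sum>j\<in>UNIV. \<theta> $ j))"
proof -
  obtain M \<theta> where M: "M \<in> Sp" "\<And>j::'n. 0 < \<theta> j \<and> \<theta> j < pi" "W ** M = M ** Rot \<theta>"
    "upsilon W = exp (\<i> * complex_of_real (\<Sum>j\<in>UNIV. \<theta> j))" by (rule normal_form[OF assms]) (rule that)
  have "good W (\<chi> j. \<theta> j)"
    unfolding good_def using M(2) charpoly_normal_form[OF M(1,3)] by (auto simp: less_imp_le)
  then show ?thesis using that[of "\<chi> j. \<theta> j"] M(4) by simp
qed

lemma good_one: "good (mat 1 :: 'n::finite sqm) 0"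
proof -
  have "Rot (\<lambda>j::'n. 0) = mat 1"
    unfolding matrix_eq
  proof
    fix u :: "real^('n+'n)"
    have "(Rot (\<lambda>j. 0) *v u) $ k = u $ k" for k by (cases k) (simp_all add: Rot_vec)
    then show "Rot (\<lambda>j. 0) *v u = mat 1 *v u" by (simp add: vec_eq_iff)
  qed
  then show ?thesis using charpoly_Rot[of "\<lambda>j::'n. 0"] by (simp add: good_def)
qed

text \<open>Angles chosen separately at each time may jump, but their sum depends only on the matrix
  and is continuous by compactness. It lifts the argument of \<open>upsilon\<close>, as
  \<open>2 * pi * maslov\<close> does, with the same initial value.\<close>

lemma maslov_SpT_ell_plus:
  fixes w :: "(real \<Rightarrow> 'n::finite sqm) set"
  assumes "w \<in> SpT_ell_plus"
  obtains \<theta> where "good (proj w) \<theta>" "2 * pi * maslov w = (\<Sum>j\<in>UNIV. \<theta> $ j)"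
proof -
  obtain g where w: "w \<in> SpT" "g \<in> w" and gp: "\<And>t. t \<in> {0<..1} \<Longrightarrow> g t \<in> Spos"
    using assms unfolding SpT_ell_plus_def Spos_eq by blast
  have sg: "sp_path g" "w = cls g" using SpT_mem[OF w] by auto
  have "\<exists>\<theta>. good (g t) \<theta> \<and> upsilon (g t) = exp (\<i> * complex_of_real (\<Sum>j\<in>UNIV. \<theta> $ j))" if "t \<in> {0..1}" for t
  proof (cases "t = 0")
    case True
    then show ?thesis using good_one upsilon_one sp_path_D(4)[OF sg(1)] by (intro exI[of _ 0]) simp
  next
    case False
    then have "g t \<in> Spos" using gp that by simp
    then show ?thesis by (rule good_Spos) blast
  qed
  then obtain T where T: "\<And>t. t \<in> {0..1} \<Longrightarrow> good (g t) (T t)"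
     "\<And>t. t \<in> {0..1} \<Longrightarrow> upsilon (g t) = exp (\<i> * complex_of_real (\<Sum>j\<in>UNIV. T t $ j))" by metis
  define S where "S t = (\<Sum>j\<in>UNIV. T t $ j)" for t
  have cS: "continuous_on {0..1} S"
  proof (rule continuous_on_closed_graph)
    show "compact {0..real CARD('n) * pi}" by simp
    have "0 \<le> S t \<and> S t \<le> real CARD('n) * pi" if "t \<in> {0..1}" for t
    proof
      show "0 \<le> S t" unfolding S_def using T(1)[OF that] by (intro sum_nonneg) (simp add: good_def)
      have "S t \<le> (\<Sum>j\<in>(UNIV::'n set). pi)" unfolding S_def using T(1)[OF that] by (intro sum_mono) (simp add: good_def)
      then show "S t \<le> real CARD('n) * pi" by simp
    qed
    then show "S ` {0..1} \<subseteq> {0..real CARD('n) * pi}" by auto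
    fix X x y assume X: "\<And>k::nat. X k \<in> {0..1::real}" "X \<longlonglongrightarrow> x" and x: "x \<in> {0..1}" and y: "(\<lambda>k. S (X k)) \<longlonglongrightarrow> y"
    have "(\<lambda>k. g (X k)) \<longlonglongrightarrow> g x"
      using continuous_on_tendsto_compose[OF sp_path_D(6)[OF sg(1)] X(2) x] X(1) by simp
    from good_limit[OF this T(1)[OF X(1)] y[unfolded S_def]] obtain \<theta> where "good (g x) \<theta>" "(\<Sum>j\<in>UNIV. \<theta> $ j) = y" .
    then show "y = S x" using good_sum_unique[OF _ T(1)[OF x]] by (simp add: S_def)
  qed
  have cm: "continuous_on {0..1} (\<lambda>t. maslov (cls (subpath 0 t g)))"
    by (rule continuous_along_path[OF maslov_props(1) sg(1)])
  have "2 * pi * \<i> * complex_of_real (maslov (cls (subpath 0 1 g))) - \<i> * complex_of_real (S 1)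
     = 2 * pi * \<i> * complex_of_real (maslov (cls (subpath 0 0 g))) - \<i> * complex_of_real (S 0)"
  proof (rule log_unique[of "{0..1::real}"])
    fix t :: real assume t: "t \<in> {0..1}"
    have sp: "sp_path (subpath 0 t g)" by (rule sp_path_subpath[OF sg(1) t])
    have "proj (cls (subpath 0 t g)) = g t" using proj_cls[OF sp] by (simp add: subpath_def)
    then show "exp (2 * pi * \<i> * complex_of_real (maslov (cls (subpath 0 t g)))) = exp (\<i> * complex_of_real (S t))"
      using maslov_props(2)[OF cls_in_SpT[OF sp]] T(2)[OF t] by (simp add: S_def)
  qed (auto intro!: continuous_intros cm cS)
  moreover have "S 0 = 0"
    using good_sum_unique[OF T(1)[of 0], of 0] good_one sp_path_D(4)[OF sg(1)] by (simp add: S_def)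
  moreover have "maslov (cls (subpath 0 0 g)) = 0" by (simp add: cls_subpath_0[OF sg(1)] maslov_props(3))
  ultimately have "\<i> * complex_of_real (2 * pi * maslov w) = \<i> * complex_of_real (S 1)"
    by (simp add: cls_subpath_1 sg(2) mult_ac)
  then have "2 * pi * maslov w = S 1" by (simp only: mult_cancel_left of_real_eq_iff) simp
  moreover have "proj w = g 1" using proj_cls[OF sg(1)] sg(2) by simp
  ultimately show ?thesis using that[of "T 1"] T(1)[of 1] by (simp add: S_def)
qed

text \<open>Closeness of projections alone does not distinguish the sheets of the cover, so a second
  continuous function is approximated by the same element.\<close>

lemma closure_approx:
  fixes w :: "(real \<Rightarrow> 'n::finite sqm) set" and f :: "(real \<Rightarrow> 'n sqm) set \<Rightarrow> 'b::metric_space"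
  assumes w: "w \<in> SpT_top closure_of A" and f: "continuous_map SpT_top euclidean f" and e: "e > 0"
  obtains v where "v \<in> A" "v \<in> SpT" "dist (proj v) (proj w) < e" "dist (f v) (f w) < e"
proof -
  have w1: "w \<in> topspace SpT_top" and w2: "\<forall>T. w \<in> T \<and> openin SpT_top T \<longrightarrow> (\<exists>y. y \<in> A \<and> y \<in> T)"
    by (rule conjunct1[OF w[unfolded in_closure_of]], rule conjunct2[OF w[unfolded in_closure_of]])
  define U1 where "U1 = {x \<in> topspace SpT_top. proj x \<in> ball (proj w) e}"
  define U2 where "U2 = {x \<in> topspace SpT_top. f x \<in> ball (f w) e}"
  have "openin SpT_top U1" unfolding U1_def
    by (rule openin_continuous_map_preimage[OF continuous_map_proj]) simp
  moreover have "openin SpT_top U2" unfolding U2_def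
    by (rule openin_continuous_map_preimage[OF f]) simp
  ultimately have "openin SpT_top (U1 \<inter> U2)" by (rule openin_Int)
  moreover have "w \<in> U1 \<inter> U2" using w1 e by (simp add: U1_def U2_def)
  ultimately have "\<exists>y. y \<in> A \<and> y \<in> U1 \<inter> U2" by (intro w2[THEN spec, THEN mp] conjI)
  then obtain v where v: "v \<in> A" "v \<in> U1 \<inter> U2" by (elim exE conjE)
  show ?thesis
  proof (rule that[of v])
    show "v \<in> A" by (rule v(1))
    show "v \<in> SpT" using v(2) by (simp add: U1_def topspace_SpT_top)
    show "dist (proj v) (proj w) < e" using v(2) by (simp add: U1_def dist_commute)
    show "dist (f v) (f w) < e" using v(2) by (simp add: U2_def dist_commute)
  qed
qed

theorem maslov_closure:
  fixes w :: "(real \<Rightarrow> 'n::finite sqm) set"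
  assumes w: "w \<in> SpT_top closure_of SpT_ell_plus"
  obtains \<theta> where "good (proj w) \<theta>" "2 * pi * maslov w = (\<Sum>j\<in>UNIV. \<theta> $ j)"
proof -
  have "\<exists>v. v \<in> SpT_ell_plus \<and> dist (proj v) (proj w) < 1 / real (Suc k) \<and> dist (maslov v) (maslov w) < 1 / real (Suc k)" for k
    by (rule closure_approx[OF w maslov_props(1), of "1 / real (Suc k)"], simp, intro exI conjI)
  then obtain v where v: "\<And>k. v k \<in> SpT_ell_plus" "\<And>k. dist (proj (v k)) (proj w) < 1 / real (Suc k)"
    "\<And>k. dist (maslov (v k)) (maslov w) < 1 / real (Suc k)" by metis
  have l: "(\<lambda>k. 1 / real (Suc k)) \<longlonglongrightarrow> 0" by (rule LIMSEQ_Suc[OF lim_1_over_n])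
  have P: "(\<lambda>k. proj (v k)) \<longlonglongrightarrow> proj w"
    by (rule tendsto_dist_iff[THEN iffD2], rule tendsto_sandwich[where f = "\<lambda>_. 0" and h = "\<lambda>k. 1 / real (Suc k)"])
      (simp_all only: l tendsto_const zero_le_dist eventually_True less_imp_le[OF v(2)])
  have Q: "(\<lambda>k. maslov (v k)) \<longlonglongrightarrow> maslov w"
    by (rule tendsto_dist_iff[THEN iffD2], rule tendsto_sandwich[where f = "\<lambda>_. 0" and h = "\<lambda>k. 1 / real (Suc k)"])
      (simp_all only: l tendsto_const zero_le_dist eventually_True less_imp_le[OF v(3)])
  have "\<exists>\<theta>. good (proj (v k)) \<theta> \<and> 2 * pi * maslov (v k) = (\<Sum>j\<in>UNIV. \<theta> $ j)" for k
    by (rule maslov_SpT_ell_plus[OF v(1)[of k]]) blast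
  then obtain T where T: "\<And>k. good (proj (v k)) (T k)" "\<And>k. 2 * pi * maslov (v k) = (\<Sum>j\<in>UNIV. T k $ j)" by metis
  have "(\<lambda>k. \<Sum>j\<in>UNIV. T k $ j) \<longlonglongrightarrow> 2 * pi * maslov w"
    unfolding T(2)[symmetric] by (intro tendsto_intros Q)
  from good_limit[OF P T(1) this] obtain \<theta> where "good (proj w) \<theta>" "(\<Sum>j\<in>UNIV. \<theta> $ j) = 2 * pi * maslov w" .
  then show ?thesis using that[of \<theta>] by simp
qed

lemma closed_Snn: "closed (Snn :: 'n::finite sqm set)"
proof -
  have "(Snn :: 'n sqm set) = Sp \<inter> (\<Inter>v. {W. 0 \<le> omega0 v (W *v v)})" by (auto simp: Snn_def)
  also have "closed \<dots>"
    by (intro closed_Int closed_Sp closed_INT ballI closed_Collect_le continuous_on_const omega.continuous_on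
        matrix_vec_mult.continuous_on continuous_on_id)
  finally show ?thesis .
qed

lemma closure_proj_Snn:
  assumes w: "w \<in> SpT_top closure_of SpT_ell_plus"
  shows "proj w \<in> Snn"
proof -
  have "\<exists>x\<in>Snn. dist x (proj w) < e" if e: "e > 0" for e
  proof -
    obtain v where v: "v \<in> SpT_ell_plus" "dist (proj v) (proj w) < e"
      by (rule closure_approx[OF w continuous_map_proj e]) (rule that)
    obtain g where g: "v \<in> SpT" "g \<in> v" "\<forall>t\<in>{0<..1}. g t \<in> Sp_ell_plus" using v(1) unfolding SpT_ell_plus_def by blast
    have "g 1 \<in> Spos" using g(3) by (simp add: Spos_eq)
    then have "proj v \<in> Snn" using proj_eq[OF g(1,2)] Spos_subset_Snn by (auto simp: pathfinish_def)
    then show ?thesis using v(2) by (intro bexI[of _ "proj v"])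
  qed
  then have "proj w \<in> closure Snn" by (simp add: closure_approachable)
  then show ?thesis by (simp only: closure_closed[OF closed_Snn])
qed

section \<open>Complex rotations and monotonicity\<close>

definition rotc :: "complex \<Rightarrow> complex^('n::finite + 'n)^('n + 'n)" where
  "rotc a = mat (cos a) + mat (sin a) ** cplx J0"

definition rotdet :: "complex \<Rightarrow> 'n::finite sqm \<Rightarrow> complex" where
  "rotdet a W = det (cplx W - rotc a)"

lemma mat_vec: "mat k *v (x::complex^'m) = k *s x"
  by (simp add: mat_def matrix_vector_mult_def vec_eq_iff if_distrib if_distribR cong: if_cong)

lemma bounded_linear_mat: "bounded_linear (mat :: complex \<Rightarrow> complex^'m^'m)"
  unfolding linear_conv_bounded_linear[symmetric] by (rule linearI) (simp_all add: mat_def vec_eq_iff)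

lemma bounded_linear_cplx: "bounded_linear (cplx :: 'n::finite sqm \<Rightarrow> _)"
  unfolding linear_conv_bounded_linear[symmetric] by (rule linearI) (simp_all add: cplx_def vec_eq_iff scaleR_conv_of_real[where 'a = complex])

lemma cplx_diff: "cplx (A - B) = cplx A - cplx B"
  by (simp add: cplx_def vec_eq_iff)

lemma det_cplx: "det (cplx A) = complex_of_real (det A)"
  by (simp add: det_def cplx_def)

text \<open>A complex angle multiplies the two eigenspaces of \<open>J0\<close> by reciprocal
  factors, of modulus \<open>exp (- Im a)\<close> on the positive one and \<open>exp (Im a)\<close>
  on the negative one; for \<open>Im a > 0\<close> this lowers the Krein form strictly.\<close>

lemma rotc_vec: "rotc a *v x = io (exp (\<i> * a) *s pp x) (exp (- (\<i> * a)) *s mm x)"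
proof -
  have c: "cos a = (exp (\<i> * a) + exp (- (\<i> * a))) / 2" and s: "sin a = (exp (\<i> * a) - exp (- (\<i> * a))) / (2 * \<i>)"
    by (simp_all add: cos_exp_eq sin_exp_eq)
  have v: "rotc a *v x = cos a *s x + sin a *s (cplx J0 *v x)"
    by (simp add: rotc_def matrix_vec_mult.add_left mat_vec flip: matrix_vector_mul_assoc)
  show ?thesis unfolding vec_eq_iff v
  proof
    fix i show "(cos a *s x + sin a *s (cplx J0 *v x)) $ i = io (exp (\<i> * a) *s pp x) (exp (- (\<i> * a)) *s mm x) $ i"
      by (cases i) (simp_all add: cplx_J0_vec io_def pp_def mm_def c s field_simps)
  qed
qed

lemma norm_pp_mm: "(norm x)\<^sup>2 = 2 * ((norm (pp x))\<^sup>2 + (norm (mm x))\<^sup>2)"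
proof -
  have *: "(cmod (p + m))\<^sup>2 + (cmod (\<i> * (p - m)))\<^sup>2 = 2 * (cmod p)\<^sup>2 + 2 * (cmod m)\<^sup>2" for p m
    unfolding cmod_power2 by (simp add: power2_eq_square algebra_simps)
  have "(norm (io p m))\<^sup>2 = 2 * ((norm p)\<^sup>2 + (norm m)\<^sup>2)" for p m
    unfolding norm_cvec_sq sum_UNIV_Plus
    by (simp add: io_def * sum_distrib_left flip: sum.distrib)
  from this[of "pp x" "mm x"] show ?thesis by (simp add: io_pp_mm)
qed

lemma norm_scale_cvec: "norm (k *s (x::complex^'m)) = cmod k * norm x"
proof -
  have "(norm (k *s x))\<^sup>2 = (cmod k * norm x)\<^sup>2"
    by (simp add: norm_cvec_sq norm_mult power_mult_distrib sum_distrib_left)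
  then show ?thesis by simp
qed

lemma kq_rotc:
  assumes "Im a \<ge> 0"
  shows "(1 - exp (- (2 * Im a))) * (norm x)\<^sup>2 \<le> kq x - kq (rotc a *v x)"
proof -
  define e where "e = exp (2 * Im a)"
  have e: "e \<ge> 1" "exp (- (2 * Im a)) = 1 / e" using assms by (simp_all add: e_def exp_minus field_simps)
  have 1: "(cmod (exp (\<i> * a)))\<^sup>2 = 1 / e" "(cmod (exp (- (\<i> * a))))\<^sup>2 = e"
    unfolding e(2)[symmetric] by (simp_all add: e_def flip: exp_of_nat_mult)
  have "kq x - kq (rotc a *v x) = 2 * ((1 - 1 / e) * (norm (pp x))\<^sup>2 + (e - 1) * (norm (mm x))\<^sup>2)"
    by (simp only: kq_eq rotc_vec pp_io mm_io norm_scale_cvec power_mult_distrib 1) (simp add: algebra_simps)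
  moreover have "1 - 1 / e \<le> e - 1"
  proof -
    have "0 \<le> (e - 1)\<^sup>2 / e" using e(1) by simp
    also have "\<dots> = (e - 1) - (1 - 1 / e)" using e(1) by (simp add: field_simps power2_eq_square)
    finally show ?thesis by simp
  qed
  then have "(1 - 1 / e) * (norm (mm x))\<^sup>2 \<le> (e - 1) * (norm (mm x))\<^sup>2" by (rule mult_right_mono) simp
  ultimately show ?thesis unfolding norm_pp_mm[of x] e(2) by (simp add: algebra_simps)
qed

text \<open>\<open>W\<close> preserves the Krein form and \<open>rotc a\<close> strictly decreases
  it, so they agree on no nonzero vector.\<close>

lemma rotdet_nonzero:
  assumes W: "W \<in> Sp" and a: "Im a > 0"
  shows "invertible (cplx W - rotc a)" "rotdet a W \<noteq> 0"
proof -
  show i: "invertible (cplx W - rotc a)"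
    unfolding invertible_iff_kernel
  proof (intro allI impI)
    fix x assume "(cplx W - rotc a) *v x = 0"
    then have "cplx W *v x = rotc a *v x" by (simp add: matrix_vec_mult.diff_left)
    then have "kq x = kq (rotc a *v x)" using kq_Sp[OF W, of x] by simp
    then have "(1 - exp (- (2 * Im a))) * (norm x)\<^sup>2 \<le> 0" using kq_rotc[of a x] a by simp
    moreover have "1 - exp (- (2 * Im a)) > 0" using a by simp
    ultimately show "x = 0" by (simp add: mult_le_0_iff)
  qed
  show "rotdet a W \<noteq> 0" using i by (simp add: rotdet_def invertible_det_nz)
qed

text \<open>With \<open>y = (W - R)\<^sup>-\<^sup>1 J p\<close> one has \<open>W y = J p + R y\<close>, and \<open>W\<close> preserves the Krein form.\<close>
lemma Im_rot_resolvent: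
  fixes W :: "'n::finite sqm"
  assumes W: "W \<in> Sp" and a: "Im a > 0"
  defines "Mi \<equiv> matrix_inv (cplx W - rotc a)"
  shows "(1 - exp (- (2 * Im a))) / 2 * (norm (Mi *v (cplx J0 *v rv p)))\<^sup>2
     \<le> Im (\<Sum>k\<in>UNIV. complex_of_real (p $ k) * ((cplx W ** Mi ** cplx J0) *v rv p) $ k)"
proof -
  define y where "y = Mi *v (cplx J0 *v rv p)"
  define z where "z = cplx W *v y"
  have "(cplx W - rotc a) *v y = cplx J0 *v rv p"
    unfolding y_def Mi_def by (rule matrix_inv_vec(1)[OF rotdet_nonzero(1)[OF W a]])
  then have zy: "z = rotc a *v y + rv (J0 *v p)" by (simp add: z_def matrix_vec_mult.diff_left cplx_rv algebra_simps)
  have q0: "krein (rv (J0 *v p)) (rv (J0 *v p)) = 0" by (simp add: krein_rv omega0_self)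
  have "kq y = kq z" using kq_Sp[OF W] by (simp add: z_def)
  also have "\<dots> = kq (rotc a *v y) + 2 * Re (krein (rotc a *v y) (rv (J0 *v p)))"
    unfolding zy kq_add by (simp add: kq_def q0)
  also have "krein (rotc a *v y) (rv (J0 *v p)) = krein z (rv (J0 *v p))"
    unfolding zy krein_add_left q0 by simp
  also have "krein z (rv (J0 *v p)) = - \<i> * (\<Sum>k\<in>UNIV. complex_of_real (p $ k) * z $ k)"
    unfolding krein_expand sum_UNIV_Plus sum.distrib[symmetric] sum_distrib_left
    by (rule sum.cong) (simp_all add: rv_def J0_mult_vec algebra_simps)
  finally have "Im (\<Sum>k\<in>UNIV. complex_of_real (p $ k) * z $ k) = (kq y - kq (rotc a *v y)) / 2" by simp
  moreover have "z = (cplx W ** Mi ** cplx J0) *v rv p" by (simp add: z_def y_def matrix_vector_mul_assoc matrix_mul_assoc)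
  ultimately show ?thesis using kq_rotc[of a y] a by (simp add: y_def)
qed

definition imM :: "complex^'m^'m \<Rightarrow> real^'m^'m" where "imM B = (\<chi> i k. Im (B $ i $ k))"

lemma imM_inner: "p \<bullet> (imM B *v p) = Im (\<Sum>k\<in>UNIV. complex_of_real (p $ k) * (B *v rv p) $ k)"
  by (simp add: imM_def inner_vec_def matrix_vector_mult_def rv_def sum_distrib_left Im_sum)

lemma Im_trace_cplx: "Im (trace (B ** cplx S)) = trace (imM B ** S)"
  by (simp add: imM_def trace_def matrix_matrix_mult_def cplx_def Im_sum)

text \<open>The trace is the logarithmic derivative of \<open>rotdet a\<close> along a curve with
  derivative \<open>J0 ** S ** W\<close>. Cyclicity brings it to the product of \<open>S\<close>
  with the matrix whose form \<open>Im_rot_resolvent\<close> shows to be nonnegative.\<close>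

lemma Im_trace_rot_nonneg:
  fixes W S :: "'n::finite sqm"
  assumes W: "W \<in> Sp" and a: "Im a > 0"
    and sym: "\<And>u v. u \<bullet> (S *v v) = v \<bullet> (S *v u)" and psd: "\<And>u. u \<bullet> (S *v u) \<ge> 0"
  shows "0 \<le> Im (trace (matrix_inv (cplx W - rotc a) ** cplx (J0 ** S ** W)))"
proof -
  let ?Mi = "matrix_inv (cplx W - rotc a)"
  have "trace (?Mi ** cplx (J0 ** S ** W)) = trace ((cplx J0 ** cplx S) ** (cplx W ** ?Mi))"
    using trace_mul_sym[of ?Mi "cplx (J0 ** S ** W)"] by (simp add: cplx_mult matrix_mul_assoc)
  also have "\<dots> = trace ((cplx W ** ?Mi) ** cplx J0 ** cplx S)"
    using trace_mul_sym[of "cplx J0 ** cplx S" "cplx W ** ?Mi"] by (simp add: matrix_mul_assoc)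
  finally have "Im (trace (?Mi ** cplx (J0 ** S ** W))) = trace (imM (cplx W ** ?Mi ** cplx J0) ** S)"
    by (simp add: Im_trace_cplx)
  moreover have "0 \<le> p \<bullet> (imM (cplx W ** ?Mi ** cplx J0) *v p)" for p
  proof -
    have "0 \<le> (1 - exp (- (2 * Im a))) / 2 * (norm (?Mi *v (cplx J0 *v rv p)))\<^sup>2" using a by simp
    also note Im_rot_resolvent[OF W a, of p]
    finally show ?thesis by (simp only: imM_inner)
  qed
  ultimately show ?thesis using trace_psd_mult_nonneg[OF sym psd] by simp
qed

text \<open>Near \<open>t\<close> the continuous logarithm varies by less than \<open>pi\<close> and
  so coincides with a translate of the principal branch.\<close>

lemma log_has_vector_derivative:
  assumes l: "continuous_on S l" and t: "t \<in> S"
    and d: "((\<lambda>s. exp (l s)) has_vector_derivative exp (l t) * \<tau>) (at t within S)"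
  shows "(l has_vector_derivative (\<tau>::complex)) (at t within (S::real set))"
proof -
  have "(l \<longlongrightarrow> l t) (at t within S)" using l t by (simp add: continuous_on_def)
  then obtain r where r: "r > 0" "\<And>s. s \<in> S \<Longrightarrow> s \<noteq> t \<Longrightarrow> dist s t < r \<Longrightarrow> dist (l s) (l t) < pi"
    unfolding Lim_within using pi_gt_zero by (metis zero_less_dist_iff)
  have eq: "l t + Ln (exp (l s) * exp (- l t)) = l s" if "s \<in> S" "dist s t < r" for s
  proof -
    have "norm (l s - l t) < pi" using r(2)[OF that(1) _ that(2)] by (cases "s = t") (simp_all add: dist_norm)
    then have "\<bar>Im (l s - l t)\<bar> < pi" using abs_Im_le_cmod[of "l s - l t"] by linarith
    then have "Ln (exp (l s - l t)) = l s - l t" by (intro Ln_exp) auto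
    then show ?thesis by (simp add: exp_diff exp_minus field_simps)
  qed
  have "((\<lambda>s. exp (l s) * exp (- l t)) has_vector_derivative exp (l t) * \<tau> * exp (- l t)) (at t within S)"
    by (intro derivative_intros d)
  then have "((\<lambda>s. exp (l s) * exp (- l t)) has_vector_derivative \<tau>) (at t within S)"
    by (simp add: exp_minus mult_ac)
  note d1 = this
  have "(Ln has_field_derivative inverse 1) (at (exp (l t) * exp (- l t)))"
    by (simp add: exp_minus) (rule has_field_derivative_Ln[of 1, simplified])
  then have d2: "(Ln has_field_derivative 1) (at (exp (l t) * exp (- l t)) within (\<lambda>s. exp (l s) * exp (- l t)) ` S)"
    unfolding inverse_1 by (rule has_field_derivative_at_within)
  have "((Ln \<circ> (\<lambda>s. exp (l s) * exp (- l t))) has_vector_derivative \<tau> * 1) (at t within S)"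
    by (rule field_vector_diff_chain_within[OF d1 d2])
  then have d3: "((\<lambda>s. Ln (exp (l s) * exp (- l t))) has_vector_derivative \<tau>) (at t within S)" by (simp only: o_def mult_1_right)
  have "((\<lambda>s. l t + Ln (exp (l s) * exp (- l t))) has_vector_derivative 0 + \<tau>) (at t within S)"
    by (rule has_vector_derivative_add[OF has_vector_derivative_const d3])
  then have "((\<lambda>s. l t + Ln (exp (l s) * exp (- l t))) has_vector_derivative \<tau>) (at t within S)" by (simp only: add_0_left)
  then show ?thesis by (rule has_vector_derivative_transform_within[OF _ r(1) t]) (use eq in auto)
qed

lemma Im_log_growth:
  assumes l: "continuous_on {x..y} l" and xy: "x \<le> y"
    and d: "\<And>t. t \<in> {x..y} \<Longrightarrow> ((\<lambda>s. exp (l s)) has_vector_derivative exp (l t) * \<tau> t) (at t within {x..y})"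
    and K: "\<And>t. t \<in> {x..y} \<Longrightarrow> K \<le> Im (\<tau> t)"
  shows "K * (y - x) \<le> Im (l y) - Im (l x)"
proof -
  have "((\<lambda>s. Im (l s)) has_vector_derivative Im (\<tau> t)) (at t within {x..y})" if t: "t \<in> {x..y}" for t
    by (rule bounded_linear.has_vector_derivative[OF bounded_linear_Im log_has_vector_derivative[OF l t d[OF t]]])
  then obtain t where t: "t \<in> {x..y}" "Im (l y) - Im (l x) = (y - x) * Im (\<tau> t)"
    using mvt_very_simple[OF xy, of "\<lambda>s. Im (l s)" "\<lambda>t h. h * Im (\<tau> t)"] by (auto simp: has_vector_derivative_def)
  show ?thesis unfolding t(2) using mult_right_mono[OF K[OF t(1)], of "y - x"] xy by (simp add: mult.commute)
qed

lemma rotdet_mono: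
  assumes c: "wcausal c D" and a: "Im a > 0" and l: "continuous_on {0..1} l"
    and e: "\<And>t. t \<in> {0..1} \<Longrightarrow> exp (l t) = k * rotdet a (c t)" and st: "0 \<le> s" "s \<le> t" "t \<le> 1"
  shows "Im (l s) \<le> Im (l t)"
proof -
  have c1: "c1sp c D" using c by (simp add: wcausal_def)
  define \<tau> where "\<tau> t = trace (matrix_inv (cplx (c t) - rotc a) ** cplx (D t))" for t
  have d: "((\<lambda>s. exp (l s)) has_vector_derivative exp (l r) * \<tau> r) (at r within {s..t})" if r: "r \<in> {s..t}" for r
  proof -
    have r1: "r \<in> {0..1}" using r st by auto
    have W: "c r \<in> Sp" using c1 r1 by (auto simp: c1sp_def)
    have "(c has_vector_derivative D r) (at r within {s..t})"
    proof (rule has_vector_derivative_within_subset)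
      show "(c has_vector_derivative D r) (at r within {0..1})" using c1 r1 by (simp add: c1sp_def)
      show "{s..t} \<subseteq> {0..1}" using st by simp
    qed
    from has_vector_derivative_diff[OF bounded_linear.has_vector_derivative[OF bounded_linear_cplx this] has_vector_derivative_const, of "rotc a"]
    have "((\<lambda>s. cplx (c s) - rotc a) has_vector_derivative cplx (D r)) (at r within {s..t})" by (simp only: diff_zero)
    from has_vector_derivative_det[OF this rotdet_nonzero(1)[OF W a]]
    have "((\<lambda>s. k * rotdet a (c s)) has_vector_derivative k * (rotdet a (c r) * \<tau> r)) (at r within {s..t})"
      unfolding rotdet_def \<tau>_def by (intro derivative_intros)
    moreover have "k * (rotdet a (c r) * \<tau> r) = exp (l r) * \<tau> r" using e[OF r1] by simp
    ultimately have "((\<lambda>s. k * rotdet a (c s)) has_vector_derivative exp (l r) * \<tau> r) (at r within {s..t})" by simp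
    then show ?thesis by (rule has_vector_derivative_transform[OF r, rotated]) (use e st in auto)
  qed
  have "0 * (t - s) \<le> Im (l t) - Im (l s)"
  proof (rule Im_log_growth[OF _ st(2) d])
    show "continuous_on {s..t} l" using continuous_on_subset[OF l] st by simp
    fix r assume "r \<in> {s..t}"
    then have r1: "r \<in> {0..1}" using st by auto
    have W: "c r \<in> Sp" using c1 r1 by (auto simp: c1sp_def)
    let ?X = "logder c r"
    have X: "?X \<in> sp" "\<And>u. omega0 u (?X *v u) \<ge> 0" using wcausal_logder[OF c1] c r1 by (auto simp: closure_sp_plus)
    have "J0 ** sform ?X = ?X" by (simp add: sform_def matrix_mult.minus_right matrix_mul_assoc J0_mult_J0 matrix_mult.minus_left)
    moreover have "?X ** c r = D r"
      using c1sp_C1[OF c1] r1 matrix_inv_left[OF Sp_invertible[OF W]] by (simp add: logder_def flip: matrix_mul_assoc)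
    ultimately have "D r = J0 ** sform ?X ** c r" by simp
    then show "0 \<le> Im (\<tau> r)" unfolding \<tau>_def
      using Im_trace_rot_nonneg[OF W a, of "sform ?X"] sp_sform_sym[OF X(1)] X(2) by (simp add: sform_inner)
  qed
  then show ?thesis by simp
qed


lemma norm_exp_minus_one:
  assumes "\<bar>Re z\<bar> \<le> 1 / 4" shows "cmod (exp z - 1) \<le> 2 * cmod z"
proof -
  have "cmod (exp z - 1) \<le> exp \<bar>Re z\<bar> * cmod z" using Taylor_exp[of z 0] by simp
  also have "exp \<bar>Re z\<bar> \<le> 2" using real_exp_bound_lemma[of "\<bar>Re z\<bar>"] assms by linarith
  finally show ?thesis by (simp add: mult_right_mono)
qed

text \<open>If \<open>W\<close> agrees on \<open>x\<close> with the real rotation by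
  \<open>b\<close>, this bounds the image of \<open>x\<close> under
  \<open>W - rotc (Complex \<beta> e)\<close>. The \<open>4\<close> collects a factor
  \<open>2\<close> from the exponential and the distance \<open>2 * e\<close> of the angles.\<close>

lemma norm_rotc_diff:
  fixes x :: "'n::finite cvec"
  assumes "\<bar>\<beta> - b\<bar> \<le> e" "0 < e" "e \<le> 1 / 4"
  shows "norm (rotc (complex_of_real b) *v x - rotc (Complex \<beta> e) *v x) \<le> 4 * e * norm x"
proof -
  let ?a = "Complex \<beta> e" and ?b = "complex_of_real b"
  have *: "cmod (exp (s * (\<i> * ?b)) - exp (s * (\<i> * ?a))) \<le> 4 * e" if s: "s = 1 \<or> s = -1" for s
  proof -
    define z where "z = s * (\<i> * (?a - ?b))"
    have "cmod z \<le> \<bar>\<beta> - b\<bar> + e" using s cmod_le[of "?a - ?b"] assms(2) by (auto simp: z_def norm_mult)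
    then have z: "cmod z \<le> 2 * e" using assms(1) by linarith
    have "\<bar>Re z\<bar> = e" using s assms(2) by (auto simp: z_def)
    then have b1: "cmod (exp z - 1) \<le> 4 * e" using norm_exp_minus_one[of z] z assms(3) by linarith
    have b2: "exp (s * (\<i> * ?b)) - exp (s * (\<i> * ?a)) = - exp (s * (\<i> * ?b)) * (exp z - 1)"
      by (simp add: z_def ring_distribs exp_add exp_diff)
    have b3: "cmod (exp (s * (\<i> * ?b))) = 1" using s by auto
    show ?thesis unfolding b2 norm_mult norm_minus_cancel b3 using b1 by simp
  qed
  have "rotc ?b *v x - rotc ?a *v x = io ((exp (\<i> * ?b) - exp (\<i> * ?a)) *s pp x) ((exp (- (\<i> * ?b)) - exp (- (\<i> * ?a))) *s mm x)"
    unfolding rotc_vec by (simp add: io_def vec_eq_iff algebra_simps split: sum.split)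
  then have "(norm (rotc ?b *v x - rotc ?a *v x))\<^sup>2
     = 2 * ((cmod (exp (\<i> * ?b) - exp (\<i> * ?a)) * norm (pp x))\<^sup>2 + (cmod (exp (- (\<i> * ?b)) - exp (- (\<i> * ?a))) * norm (mm x))\<^sup>2)"
    by (simp only: norm_pp_mm[of "io _ _"] pp_io mm_io norm_scale_cvec)
  also have "\<dots> \<le> 2 * ((4 * e * norm (pp x))\<^sup>2 + (4 * e * norm (mm x))\<^sup>2)"
    using *[of 1] *[of "-1"] by (intro mult_left_mono add_mono power_mono mult_right_mono) simp_all
  also have "\<dots> = (4 * e * norm x)\<^sup>2" by (simp only: power_mult_distrib norm_pp_mm[of x]) (simp add: algebra_simps)
  finally show ?thesis by (rule power2_le_imp_le) (use assms in simp)
qed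

lemma norm_matrix_vec_columns:
  fixes A :: "complex^'m^'k"
  shows "(norm (A *v z))\<^sup>2 \<le> (\<Sum>k\<in>UNIV. (norm (A *v axis k 1))\<^sup>2) * (norm z)\<^sup>2"
proof -
  have "norm (A *v z) = norm (\<Sum>k\<in>UNIV. z $ k *s (A *v axis k 1))"
    by (rule arg_cong[where f = norm]) (simp add: vec_eq_iff matrix_vector_mult_axis matrix_vector_mult_def[of A z] mult.commute)
  also have "\<dots> \<le> (\<Sum>k\<in>UNIV. norm (A *v axis k 1) * cmod (z $ k))"
    by (rule order_trans[OF norm_sum]) (simp add: norm_scale_cvec mult.commute)
  finally have "(norm (A *v z))\<^sup>2 \<le> (\<Sum>k\<in>UNIV. norm (A *v axis k 1) * cmod (z $ k))\<^sup>2" by (rule power_mono) simp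
  also have "\<dots> \<le> (\<Sum>k\<in>UNIV. (norm (A *v axis k 1))\<^sup>2) * (\<Sum>k\<in>UNIV. (cmod (z $ k))\<^sup>2)" by (rule Cauchy_Schwarz_ineq_sum)
  finally show ?thesis by (simp only: norm_cvec_sq[of z])
qed

text \<open>The resolvent inverts a matrix that shrinks \<open>x\<close> by a factor at most
  \<open>4 * e\<close>, so the squared column norms sum to at least
  \<open>1 / (16 * e\<^sup>2)\<close>. The lower bound of \<open>Im_rot_resolvent\<close> carries a
  factor of at least \<open>e / 2\<close>, and the product is \<open>1 / (32 * e)\<close>.\<close>

lemma trace_imM_rot:
  fixes W :: "'n::finite sqm"
  assumes W: "W \<in> Sp" and x: "cplx W *v x = rotc (complex_of_real b) *v x" "x \<noteq> 0"
    and e: "\<bar>\<beta> - b\<bar> \<le> e" "0 < e" "e \<le> 1 / 4"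
  defines "Mi \<equiv> matrix_inv (cplx W - rotc (Complex \<beta> e))"
  shows "1 / (32 * e) \<le> Im (trace (cplx W ** Mi ** cplx J0))"
proof -
  let ?M = "cplx W - rotc (Complex \<beta> e)"
  have a: "Im (Complex \<beta> e) > 0" using e by simp
  define T where "T = (\<Sum>k\<in>UNIV. (norm ((Mi ** cplx J0) *v axis k 1))\<^sup>2)"
  define z where "z = - (cplx J0 *v (?M *v x))"
  have JJ: "cplx J0 *v (cplx J0 *v v) = - v" for v :: "'n cvec"
    unfolding vec_eq_iff
  proof
    fix i show "(cplx J0 *v (cplx J0 *v v)) $ i = (- v) $ i" by (cases i) (simp_all add: cplx_J0_vec)
  qed
  have Jn: "norm (cplx J0 *v v) = norm v" for v :: "'n cvec"
    by (rule power2_eq_imp_eq) (simp_all add: norm_cvec_sq sum_UNIV_Plus cplx_J0_vec add.commute)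
  have "(Mi ** cplx J0) *v z = x"
    unfolding z_def Mi_def using matrix_inv_vec(2)[OF rotdet_nonzero(1)[OF W a], of x]
    by (simp add: matrix_vec_mult.minus_right JJ flip: matrix_vector_mul_assoc)
  then have "(norm x)\<^sup>2 \<le> T * (norm z)\<^sup>2" using norm_matrix_vec_columns[of "Mi ** cplx J0" z] by (simp add: T_def)
  also have "norm z = norm (rotc (complex_of_real b) *v x - rotc (Complex \<beta> e) *v x)"
    by (simp add: z_def Jn matrix_vec_mult.diff_left x)
  also have "T * (norm (rotc (complex_of_real b) *v x - rotc (Complex \<beta> e) *v x))\<^sup>2 \<le> T * (4 * e * norm x)\<^sup>2"
    using norm_rotc_diff[OF e, of x] by (intro mult_left_mono power_mono) (simp_all add: T_def sum_nonneg)
  finally have "1 * (norm x)\<^sup>2 \<le> (T * (16 * e\<^sup>2)) * (norm x)\<^sup>2" by (simp add: power_mult_distrib mult_ac)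
  then have T: "1 \<le> T * (16 * e\<^sup>2)" by (rule mult_right_le_imp_le) (use x in simp)
  have "e \<le> 1 - exp (- (2 * e))"
  proof -
    have "1 + 2 * e \<le> exp (2 * e)" by (rule exp_ge_add_one_self)
    then have "exp (- (2 * e)) \<le> 1 / (1 + 2 * e)" using e by (simp add: exp_minus field_simps)
    also have "\<dots> \<le> 1 - e"
    proof -
      have "1 \<le> (1 - e) * (1 + 2 * e)" using e mult_right_mono[of e "1/2" e] by (simp add: algebra_simps)
      then show ?thesis using e by (simp add: pos_divide_le_eq)
    qed
    finally show ?thesis by simp
  qed
  then have "e * T \<le> (1 - exp (- (2 * e))) * T" by (rule mult_right_mono) (simp add: T_def sum_nonneg)
  moreover have "(1 - exp (- (2 * e))) / 2 * T \<le> Im (trace (cplx W ** Mi ** cplx J0))"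
  proof -
    have "(1 - exp (- (2 * e))) / 2 * (norm ((Mi ** cplx J0) *v axis k 1))\<^sup>2 \<le> Im ((cplx W ** Mi ** cplx J0) $ k $ k)" for k
    proof -
      have r: "rv (axis k 1) = axis k 1" by (simp add: rv_def axis_def vec_eq_iff)
      have "(\<Sum>j\<in>UNIV. complex_of_real (axis k 1 $ j) * (B *v axis k 1) $ j) = B $ k $ k" for B :: "complex^('n + 'n)^('n + 'n)"
        unfolding matrix_vector_mult_axis by (simp add: axis_def if_distrib if_distribR cong: if_cong)
      then show ?thesis using Im_rot_resolvent[OF W a, of "axis k 1"] unfolding Mi_def[symmetric] r
        by (simp add: matrix_vector_mul_assoc)
    qed
    then show ?thesis unfolding T_def trace_def Im_sum sum_distrib_left by (intro sum_mono)
  qed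
  moreover have "1 / (32 * e) \<le> e * T / 2" using T e by (simp add: field_simps power2_eq_square)
  ultimately show ?thesis by linarith
qed

lemma has_vector_derivative_rotc:
  "((\<lambda>\<beta>. rotc (Complex \<beta> e)) has_vector_derivative cplx (J0 :: 'n::finite sqm) ** rotc (Complex \<beta> e)) (at \<beta> within S)"
proof -
  have C: "((\<lambda>\<beta>. Complex \<beta> e) has_vector_derivative 1) (at \<beta> within S)"
  proof -
    have "((\<lambda>\<beta>. complex_of_real \<beta> + \<i> * complex_of_real e) has_vector_derivative complex_of_real 1 + 0) (at \<beta> within S)"
      by (intro has_vector_derivative_add has_vector_derivative_const
          bounded_linear.has_vector_derivative[OF bounded_linear_of_real has_vector_derivative_id])
    then show ?thesis by (simp add: Complex_eq)
  qed
  have "((\<lambda>\<beta>. cos (Complex \<beta> e)) has_vector_derivative - sin (Complex \<beta> e)) (at \<beta> within S)"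
    using field_vector_diff_chain_within[OF C, of cos "- sin (Complex \<beta> e)"] by (simp add: o_def DERIV_cos has_field_derivative_at_within)
  moreover have "((\<lambda>\<beta>. sin (Complex \<beta> e)) has_vector_derivative cos (Complex \<beta> e)) (at \<beta> within S)"
    using field_vector_diff_chain_within[OF C, of sin "cos (Complex \<beta> e)"] by (simp add: o_def DERIV_sin has_field_derivative_at_within)
  ultimately have d: "((\<lambda>\<beta>. rotc (Complex \<beta> e)) has_vector_derivative mat (- sin (Complex \<beta> e)) + mat (cos (Complex \<beta> e)) ** cplx (J0 :: 'n sqm)) (at \<beta> within S)"
    unfolding rotc_def
    by (intro has_vector_derivative_add bounded_linear.has_vector_derivative[OF bounded_linear_mat]
        bounded_linear.has_vector_derivative[OF matrix_mult.bounded_linear_left])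
  have eq: "mat (- s) + mat k ** cplx (J0 :: 'n sqm) = cplx J0 ** (mat k + mat s ** cplx J0)" for k s
  proof (rule matrix_eq[THEN iffD2], rule allI)
    fix x :: "'n cvec"
    show "(mat (- s) + mat k ** cplx J0) *v x = (cplx J0 ** (mat k + mat s ** cplx J0)) *v x"
      unfolding vec_eq_iff
    proof
      fix i show "((mat (- s) + mat k ** cplx J0) *v x) $ i = ((cplx J0 ** (mat k + mat s ** cplx J0)) *v x) $ i"
        by (cases i) (simp_all add: matrix_vec_mult.add_left mat_vec cplx_J0_vec flip: matrix_vector_mul_assoc)
    qed
  qed
  have "mat (- sin (Complex \<beta> e)) + mat (cos (Complex \<beta> e)) ** cplx (J0 :: 'n sqm) = cplx J0 ** rotc (Complex \<beta> e)"
    unfolding rotc_def by (rule eq)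
  then show ?thesis using d by (simp only:)
qed

text \<open>A rate of \<open>1 / (32 * e)\<close> over an interval of length \<open>2 * e\<close>
  gives a decrease of \<open>1 / 16\<close> however small \<open>e\<close> is: the jump of the
  argument across the singular angle survives in the limit.\<close>

lemma rotdet_drop:
  fixes W :: "'n::finite sqm"
  assumes W: "W \<in> Sp" and x: "cplx W *v x = rotc (complex_of_real b) *v x" "x \<noteq> 0" and e: "0 < e" "e \<le> 1 / 4"
    and l: "continuous_on {b - e..b + e} l" and el: "\<And>\<beta>. \<beta> \<in> {b - e..b + e} \<Longrightarrow> exp (l \<beta>) = rotdet (Complex \<beta> e) W"
  shows "Im (l (b + e)) + 1 / 16 \<le> Im (l (b - e))"
proof -
  define M where "M \<beta> = cplx W - rotc (Complex \<beta> e)" for \<beta>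
  define \<tau> where "\<tau> \<beta> = trace (matrix_inv (M \<beta>) ** (0 - cplx J0 ** rotc (Complex \<beta> e)))" for \<beta>
  have inv: "invertible (M \<beta>)" for \<beta> unfolding M_def using rotdet_nonzero(1)[OF W] e by simp
  have "1 / (32 * e) * ((b + e) - (b - e)) \<le> Im (- l (b + e)) - Im (- l (b - e))"
  proof (rule Im_log_growth[where l = "\<lambda>\<beta>. - l \<beta>" and \<tau> = "\<lambda>\<beta>. - \<tau> \<beta>"])
    show "continuous_on {b - e..b + e} (\<lambda>\<beta>. - l \<beta>)" by (intro continuous_intros l)
    show "b - e \<le> b + e" using e by simp
    fix \<beta> assume \<beta>: "\<beta> \<in> {b - e..b + e}"
    have "(M has_vector_derivative (0 - cplx J0 ** rotc (Complex \<beta> e))) (at \<beta> within {b - e..b + e})"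
      unfolding M_def by (intro has_vector_derivative_diff has_vector_derivative_const has_vector_derivative_rotc)
    from has_vector_derivative_det[OF this inv]
    have "((\<lambda>\<beta>. det (M \<beta>)) has_vector_derivative det (M \<beta>) * \<tau> \<beta>) (at \<beta> within {b - e..b + e})" by (simp add: \<tau>_def)
    then have "((\<lambda>\<beta>. exp (l \<beta>)) has_vector_derivative det (M \<beta>) * \<tau> \<beta>) (at \<beta> within {b - e..b + e})"
      by (rule has_vector_derivative_transform[OF \<beta>, rotated]) (simp add: el rotdet_def M_def)
    then have "((\<lambda>\<beta>. exp (l \<beta>)) has_vector_derivative exp (l \<beta>) * \<tau> \<beta>) (at \<beta> within {b - e..b + e})"
      by (simp only: el[OF \<beta>] rotdet_def M_def)
    from bounded_linear.has_vector_derivative[OF bounded_linear_minus[OF bounded_linear_ident] log_has_vector_derivative[OF l \<beta> this]]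
    have "((\<lambda>\<beta>. - l \<beta>) has_vector_derivative - \<tau> \<beta>) (at \<beta> within {b - e..b + e})" .
    from field_vector_diff_chain_within[OF this has_field_derivative_at_within[OF DERIV_exp]]
    show "((\<lambda>\<beta>. exp (- l \<beta>)) has_vector_derivative exp (- l \<beta>) * - \<tau> \<beta>) (at \<beta> within {b - e..b + e})"
      by (simp only: o_def mult.commute)
    \<comment> \<open>Writing the rotation as \<open>W\<close> minus the matrix
      \<open>M \<beta>\<close> splits the trace; the second part is the trace of \<open>J0\<close>,
      which is zero.\<close>
    have "- \<tau> \<beta> = trace (matrix_inv (M \<beta>) ** (cplx J0 ** rotc (Complex \<beta> e)))"
      by (simp add: \<tau>_def matrix_mult.minus_right) (simp add: trace_def sum_negf)
    also have "\<dots> = trace (matrix_inv (M \<beta>) ** (cplx J0 ** cplx W)) - trace (matrix_inv (M \<beta>) ** (cplx J0 ** M \<beta>))"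
      by (simp add: M_def matrix_mult.diff_right trace_sub)
    also have "trace (matrix_inv (M \<beta>) ** (cplx J0 ** M \<beta>)) = trace (cplx (J0 :: 'n sqm))"
      using trace_mul_sym[of "matrix_inv (M \<beta>)" "cplx J0 ** M \<beta>"] matrix_inv_right[OF inv] by (simp flip: matrix_mul_assoc)
    also have "\<dots> = 0" by (simp add: trace_def cplx_def J0_def sum_UNIV_Plus)
    also have "trace (matrix_inv (M \<beta>) ** (cplx J0 ** cplx W)) = trace (cplx W ** (matrix_inv (M \<beta>) ** cplx J0))"
      using trace_mul_sym[of "matrix_inv (M \<beta>) ** cplx J0" "cplx W"] by (simp add: matrix_mul_assoc)
    finally show "1 / (32 * e) \<le> Im (- \<tau> \<beta>)"
      using trace_imM_rot[OF W x, of \<beta> e] \<beta> e by (simp add: M_def matrix_mul_assoc abs_le_iff)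
  qed
  then show ?thesis using e by simp
qed

section \<open>Causal curves below an elliptic point\<close>

lemma continuous_on_rotdet:
  assumes "continuous_on S f" "continuous_on S g"
  shows "continuous_on S (\<lambda>x. rotdet (f x) (g x))"
  unfolding rotdet_def rotc_def
  by (intro continuous_on_det continuous_on_diff continuous_on_add matrix_mult.continuous_on continuous_on_const
      bounded_linear.continuous_on[OF bounded_linear_cplx] bounded_linear.continuous_on[OF bounded_linear_mat]
      continuous_on_compose2[OF continuous_at_imp_continuous_on[of UNIV cos] assms(1)]
      continuous_on_compose2[OF continuous_at_imp_continuous_on[of UNIV sin] assms(1)] assms(2)) auto

definition rotr :: "real \<Rightarrow> 'n::finite sqm" where "rotr \<beta> = cos \<beta> *\<^sub>R mat 1 + sin \<beta> *\<^sub>R J0"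

lemma rotr_vec: "rotr \<beta> *v x = cos \<beta> *\<^sub>R x + sin \<beta> *\<^sub>R (J0 *v x)"
  by (simp add: rotr_def matrix_vec_mult.add_left matrix_vec_mult.scaleR_left)

lemma rotc_of_real: "rotc (complex_of_real \<beta>) = cplx (rotr \<beta>)"
proof (rule matrix_eq[THEN iffD2], rule allI)
  fix x :: "'a cvec"
  have "cplx (rotr \<beta>) *v x = cos \<beta> *\<^sub>R x + sin \<beta> *\<^sub>R (cplx J0 *v x)"
    unfolding rotr_def bounded_linear.linear[OF bounded_linear_cplx, THEN linear_add]
    by (simp add: bounded_linear.linear[OF bounded_linear_cplx, THEN linear_scale] cplx_one matrix_vec_mult.add_left matrix_vec_mult.scaleR_left)
  moreover have "rotc (complex_of_real \<beta>) *v x = complex_of_real (cos \<beta>) *s x + complex_of_real (sin \<beta>) *s (cplx J0 *v x)"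
    by (simp add: rotc_def matrix_vec_mult.add_left mat_vec cos_of_real sin_of_real flip: matrix_vector_mul_assoc)
  ultimately show "rotc (complex_of_real \<beta>) *v x = cplx (rotr \<beta>) *v x"
    by (simp add: vec_eq_iff scaleR_conv_of_real[where 'a = complex])
qed

lemma rotdet_of_real: "rotdet (complex_of_real \<beta>) W = complex_of_real (det (W - rotr \<beta>))"
  by (simp add: rotdet_def rotc_of_real det_cplx flip: cplx_diff)

text \<open>For these angles a real rotation has the negative definite form
  \<open>sin \<beta> * (x \<bullet> x)\<close>, so no element of \<open>Snn\<close> agrees with it
  on a nonzero vector.\<close>

lemma Snn_det_rotr:
  assumes W: "W \<in> Snn" and \<beta>: "\<beta> \<in> {pi<..<2 * pi}"
  shows "det (W - rotr \<beta>) \<noteq> 0"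
proof -
  have "invertible (W - rotr \<beta>)"
    unfolding invertible_iff_kernel
  proof (intro allI impI)
    fix x assume "(W - rotr \<beta>) *v x = 0"
    then have "W *v x = rotr \<beta> *v x" by (simp add: matrix_vec_mult.diff_left)
    then have "omega0 x (W *v x) = sin \<beta> * (x \<bullet> x)"
      by (simp add: rotr_vec omega.add_right omega.scaleR_right omega0_J0_right omega0_self)
    moreover have "omega0 x (W *v x) \<ge> 0" using W by (simp add: Snn_def)
    moreover have "sin \<beta> < 0" using \<beta> by (intro sin_lt_zero) auto
    ultimately have "x \<bullet> x \<le> 0" by (simp add: zero_le_mult_iff)
    then show "x = 0" using inner_ge_zero[of x] by (metis inner_eq_zero_iff order_antisym)
  qed
  then show ?thesis by (simp add: invertible_det_nz)
qed

text \<open>Normalised to \<open>1\<close> at the identity, so that logarithms along paths from the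
  identity start at \<open>0\<close>.\<close>

definition rotq :: "complex \<Rightarrow> 'n::finite sqm \<Rightarrow> complex" where
  "rotq a W = rotdet a W / rotdet a (mat 1 :: 'n sqm)"

lemma Snn_one: "mat 1 \<in> Snn"
  by (simp add: Snn_def Sp_one omega0_self)

lemma rotdet_nonzero_Snn:
  assumes "W \<in> Snn" "Re a \<in> {pi<..<2 * pi}" "Im a \<ge> 0"
  shows "rotdet a W \<noteq> 0"
proof (cases "Im a = 0")
  case True
  then have "a = complex_of_real (Re a)" by (simp add: complex_eq_iff)
  then show ?thesis using rotdet_of_real[of "Re a" W] Snn_det_rotr[OF assms(1,2)] by simp
next
  case False
  then show ?thesis using rotdet_nonzero(2)[of W a] assms by (simp add: Snn_def)
qed

lemma Sp_fun_rotq: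
  assumes "Im a > 0" shows "Sp_fun (rotq a :: 'n::finite sqm \<Rightarrow> complex)"
proof
  have n1: "rotdet a (mat 1 :: 'n sqm) \<noteq> 0" by (rule rotdet_nonzero(2)[OF Sp_one assms])
  show "continuous_on Sp (rotq a :: 'n sqm \<Rightarrow> complex)" unfolding rotq_def
    using n1 by (intro continuous_on_divide continuous_on_rotdet continuous_on_const continuous_on_id) auto
  show "rotq a W \<noteq> 0" if "W \<in> Sp" for W :: "'n sqm"
    using n1 rotdet_nonzero(2)[OF that assms] by (simp add: rotq_def)
  show "rotq a (mat 1 :: 'n sqm) = 1" using n1 by (simp add: rotq_def)
qed

lemma rotq_real: "rotq (complex_of_real \<beta>) (W :: 'n sqm) = complex_of_real (det (W - rotr \<beta>) / det (mat 1 - rotr \<beta> :: 'n::finite sqm))"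
  by (simp add: rotq_def rotdet_of_real)

lemma rotq_pos_path:
  fixes g :: "real \<Rightarrow> 'n::finite sqm"
  assumes g: "continuous_on {0..1} g" "\<And>s. s \<in> {0..1} \<Longrightarrow> g s \<in> Snn" "g 0 = mat 1" and \<beta>: "\<beta> \<in> {pi<..<2 * pi}"
    and s: "s \<in> {0..1}"
  shows "det (g s - rotr \<beta>) / det (mat 1 - rotr \<beta> :: 'n sqm) > 0"
proof (rule ccontr)
  let ?f = "\<lambda>s. det (g s - rotr \<beta>) / det (mat 1 - rotr \<beta> :: 'n sqm)"
  have n1: "det (mat 1 - rotr \<beta> :: 'n sqm) \<noteq> 0" by (rule Snn_det_rotr[OF Snn_one \<beta>])
  assume "\<not> ?f s > 0"
  moreover have "?f 0 = 1" using n1 by (simp add: g(3))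
  moreover have "continuous_on {0..s} ?f"
    using s n1
    by (intro continuous_on_divide continuous_on_det continuous_on_diff continuous_on_const continuous_on_subset[OF g(1)]) auto
  ultimately obtain x where "0 \<le> x" "x \<le> s" "?f x = 0" using IVT2'[of ?f s 0 0] s by auto
  then show False using Snn_det_rotr[OF g(2) \<beta>, of x] n1 s by auto
qed

text \<open>Deforming the spectral parameter to the real axis, where \<open>rotq\<close> is positive along the path,
  shows that the lift agrees with the principal branch.\<close>
lemma liftv_rotq_Spos:
  fixes g :: "real \<Rightarrow> 'n::finite sqm"
  assumes v: "v \<in> SpT" "g \<in> v" and gS: "\<And>s. s \<in> {0..1} \<Longrightarrow> g s \<in> Snn"
    and a: "Im a > 0" "Re a \<in> {pi<..<2 * pi}" and \<beta>: "\<beta> \<in> {pi<..<2 * pi}"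
    and re: "\<And>\<tau>. \<tau> \<in> {0..1} \<Longrightarrow> Re (rotq (complex_of_real \<beta> + of_real \<tau> * (a - complex_of_real \<beta>)) (g 1)) > 0"
  shows "liftv (rotq a) v = Ln (rotq a (g 1))"
proof -
  have sg: "sp_path g" using SpT_mem[OF v(1,2)] by auto
  define b where "b \<tau> = complex_of_real \<beta> + of_real \<tau> * (a - complex_of_real \<beta>)" for \<tau>
  have b: "Re (b \<tau>) \<in> {pi<..<2 * pi}" "Im (b \<tau>) \<ge> 0" if t: "\<tau> \<in> {0..1}" for \<tau>
  proof -
    have "Re (b \<tau>) = (1 - \<tau>) * \<beta> + \<tau> * Re a" by (simp add: b_def algebra_simps)
    moreover have "(1 - \<tau>) *\<^sub>R \<beta> + \<tau> *\<^sub>R Re a \<in> {pi<..<2 * pi}"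
      by (rule convexD[OF _ \<beta> a(2)]) (use t in auto)
    ultimately show "Re (b \<tau>) \<in> {pi<..<2 * pi}" by simp
    show "Im (b \<tau>) \<ge> 0" using a(1) t by (simp add: b_def)
  qed
  have n1: "det (mat 1 - rotr \<beta> :: 'n sqm) \<noteq> 0" by (rule Snn_det_rotr[OF Snn_one \<beta>])
  have n2: "rotdet (b \<tau>) (mat 1 :: 'n sqm) \<noteq> 0" if t: "\<tau> \<in> {0..1}" for \<tau>
    by (rule rotdet_nonzero_Snn[OF Snn_one b[OF t]])
  have b01: "b 0 = complex_of_real \<beta>" "b 1 = a" by (simp_all add: b_def)
  let ?Q = "{0..1::real} \<times> {0..1::real}"
  have cb: "continuous_on S b" for S unfolding b_def by (intro continuous_intros)
  have cg: "continuous_on ?Q (\<lambda>p. g (fst p))"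
    by (rule continuous_on_compose2[OF sp_path_D(6)[OF sg] continuous_on_fst[OF continuous_on_id]]) auto
  have cq: "continuous_on ?Q (\<lambda>p. rotq (b (snd p)) (g (fst p)))"
    unfolding rotq_def
    by (intro continuous_on_divide continuous_on_rotdet cg continuous_on_compose2[OF cb continuous_on_snd[OF continuous_on_id] subset_UNIV] continuous_on_const)
      (use n2 in auto)
  have nz: "rotq (b (snd p)) (g (fst p)) \<noteq> 0" if "p \<in> ?Q" for p
    using n2[of "snd p"] rotdet_nonzero_Snn[OF gS b, of "fst p" "snd p"] that
    by (auto simp: rotq_def)
  obtain h where h: "continuous_on ?Q h" "\<And>p. p \<in> ?Q \<Longrightarrow> rotq (b (snd p)) (g (fst p)) = exp (h p)"
    by (rule continuous_logarithm_on_contractible[OF cq convex_imp_contractible nz]) (auto intro: convex_Times)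
  define l where "l s \<tau> = h (s, \<tau>) - h (0, \<tau>)" for s \<tau>
  have el: "exp (l s \<tau>) = rotq (b \<tau>) (g s)" if "s \<in> {0..1}" "\<tau> \<in> {0..1}" for s \<tau>
  proof -
    have "exp (h (0, \<tau>)) = 1"
      using h(2)[of "(0, \<tau>)"] that n2[OF that(2)] sp_path_D(4)[OF sg] by (simp add: rotq_def)
    then show ?thesis using h(2)[of "(s, \<tau>)"] that by (simp add: l_def exp_diff)
  qed
  have ch: "continuous_on {0..1} (\<lambda>s. h (s, \<tau>))" "continuous_on {0..1} (\<lambda>\<sigma>. h (s, \<sigma>))" if "s \<in> {0..1}" "\<tau> \<in> {0..1}" for s \<tau>
    using that by (auto intro!: continuous_on_compose2[OF h(1)] continuous_intros)
  have "is_log (rotq a) g (\<lambda>s. l s 1)"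
    unfolding is_log_def using el[of _ 1] b01 ch(1)[of 0 1] by (auto simp: l_def intro!: continuous_intros)
  then have 1: "liftv (rotq a) v = l 1 1" by (rule Sp_fun.liftv_eq[OF Sp_fun_rotq[OF a(1)] v])
  define f where "f s = det (g s - rotr \<beta>) / det (mat 1 - rotr \<beta> :: 'n sqm)" for s
  have f: "f s > 0" if "s \<in> {0..1}" for s
    unfolding f_def by (rule rotq_pos_path[OF sp_path_D(6)[OF sg] gS sp_path_D(4)[OF sg] \<beta> that])
  have f0: "f 0 = 1" using n1 by (simp add: f_def sp_path_D(4)[OF sg])
  have "l 1 0 - complex_of_real (ln (f 1)) = l 0 0 - complex_of_real (ln (f 0))"
  proof (rule log_unique[of "{0..1::real}"])
    show "continuous_on {0..1} (\<lambda>s. l s 0)" unfolding l_def using ch(1)[of 0 0] by (intro continuous_intros) auto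
    have "continuous_on {0..1} f" unfolding f_def using n1
      by (intro continuous_on_divide continuous_on_det continuous_on_diff continuous_on_const sp_path_D(6)[OF sg]) auto
    then show "continuous_on {0..1} (\<lambda>s. complex_of_real (ln (f s)))"
      using f by (intro continuous_on_of_real continuous_on_ln) (auto simp: less_le)
    fix s :: real assume s: "s \<in> {0..1}"
    show "exp (l s 0) = exp (complex_of_real (ln (f s)))"
      using el[OF s, of 0] f[OF s] by (simp add: b01 rotq_real f_def[symmetric] exp_of_real)
  qed auto
  then have 2: "l 1 0 = complex_of_real (ln (f 1))" by (simp add: f0) (simp add: l_def)
  have "l 1 1 - Ln (rotq (b 1) (g 1)) = l 1 0 - Ln (rotq (b 0) (g 1))"
  proof (rule log_unique[of "{0..1::real}"])
    show "continuous_on {0..1} (l 1)" unfolding l_def using ch(2)[of 1 0] ch(2)[of 0 0] by (intro continuous_intros) auto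
    have "continuous_on {0..1} (\<lambda>\<tau>. rotq (b \<tau>) (g 1))"
      unfolding rotq_def using n2 by (intro continuous_on_divide continuous_on_rotdet cb continuous_on_const) auto
    moreover have "rotq (b \<tau>) (g 1) \<notin> \<real>\<^sub>\<le>\<^sub>0" if "\<tau> \<in> {0..1}" for \<tau>
      using re[OF that] by (auto simp: b_def complex_nonpos_Reals_iff)
    ultimately show "continuous_on {0..1} (\<lambda>\<tau>. Ln (rotq (b \<tau>) (g 1)))" by (intro continuous_on_Ln') auto
    fix \<tau> :: real assume t: "\<tau> \<in> {0..1}"
    have "rotq (b \<tau>) (g 1) \<noteq> 0" using re[OF t] by (auto simp: b_def)
    then show "exp (l 1 \<tau>) = exp (Ln (rotq (b \<tau>) (g 1)))" using el[OF _ t, of 1] by simp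
  qed auto
  moreover have "Ln (rotq (b 0) (g 1)) = complex_of_real (ln (f 1))"
    using f[of 1] by (simp add: b01 rotq_real f_def[symmetric] Ln_of_real)
  ultimately show ?thesis using 1 2 by (simp add: b01)
qed


lemma SpT_ell_plus_path:
  assumes "v \<in> SpT_ell_plus"
  obtains g where "v \<in> SpT" "g \<in> v" "\<And>s. s \<in> {0..1} \<Longrightarrow> g s \<in> Snn" "\<And>s. s \<in> {0<..1} \<Longrightarrow> g s \<in> Spos"
proof -
  obtain g where g: "v \<in> SpT" "g \<in> v" "\<And>s. s \<in> {0<..1} \<Longrightarrow> g s \<in> Spos"
    using assms unfolding SpT_ell_plus_def Spos_eq by blast
  have "g s \<in> Snn" if "s \<in> {0..1}" for s
  proof (cases "s = 0")
    case True
    then show ?thesis using sp_path_D(4)[of g] SpT_mem[OF g(1,2)] Snn_one by simp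
  next
    case False
    then show ?thesis using g(3)[of s] that Spos_subset_Snn by auto
  qed
  with g show ?thesis using that by blast
qed

text \<open>At the projection of \<open>w\<close> the real value of \<open>rotq\<close> at
  \<open>\<beta>\<close> is positive, being a nonzero limit of positive ones, so nearby values have
  principal logarithms of small imaginary part. On elliptic elements the lift is that logarithm, and
  continuity of the lift carries the estimate to \<open>w\<close>.\<close>

lemma liftv_rotq_small:
  fixes w :: "(real \<Rightarrow> 'n::finite sqm) set"
  assumes w: "w \<in> SpT_top closure_of SpT_ell_plus" and \<beta>: "\<beta> \<in> {pi<..<2 * pi}" and \<eta>: "\<eta> > 0"
  obtains d where "d > 0" "\<And>a. Im a > 0 \<Longrightarrow> dist a (complex_of_real \<beta>) < d \<Longrightarrow> \<bar>Im (liftv (rotq a) w)\<bar> < \<eta>"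
proof -
  let ?W = "proj w" and ?\<beta> = "complex_of_real \<beta>"
  have W: "?W \<in> Snn" by (rule closure_proj_Snn[OF w])
  define f where "f V = det (V - rotr \<beta>) / det (mat 1 - rotr \<beta> :: 'n sqm)" for V :: "'n sqm"
  define r where "r = f ?W"
  have n1: "det (mat 1 - rotr \<beta> :: 'n sqm) \<noteq> 0" by (rule Snn_det_rotr[OF Snn_one \<beta>])
  have r0: "r \<noteq> 0" using n1 Snn_det_rotr[OF W \<beta>] by (simp add: r_def f_def)
  have r: "r > 0"
  proof -
    have "continuous_on UNIV f" unfolding f_def using n1
      by (intro continuous_on_divide continuous_on_det continuous_on_diff continuous_on_const continuous_on_id) auto
    then have "isCont f ?W" by (simp add: continuous_on_eq_continuous_at)
    then obtain d where d: "d > 0" "\<And>V. dist V ?W < d \<Longrightarrow> dist (f V) r < \<bar>r\<bar>"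
      unfolding continuous_at_eps_delta r_def[symmetric] using r0 by (meson zero_less_abs_iff)
    obtain v where v: "v \<in> SpT_ell_plus" "dist (proj v) ?W < d"
      by (rule closure_approx[OF w continuous_map_proj d(1)]) (rule that)
    obtain g where g: "v \<in> SpT" "g \<in> v" "\<And>s. s \<in> {0..1} \<Longrightarrow> g s \<in> Snn"
      by (rule SpT_ell_plus_path[OF v(1)]) (rule that)
    have sg: "sp_path g" using SpT_mem[OF g(1,2)] by auto
    have "f (g 1) > 0" unfolding f_def by (rule rotq_pos_path[OF sp_path_D(6)[OF sg] g(3) sp_path_D(4)[OF sg] \<beta>]) auto
    then have "f (proj v) > 0" using proj_eq[OF g(1,2)] by (simp add: pathfinish_def)
    then show ?thesis using d(2)[OF v(2)] by (simp add: dist_real_def)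
  qed
  define \<Phi> where "\<Phi> p = rotq (snd p) (fst p)" for p :: "'n sqm \<times> complex"
  have "isCont (\<lambda>p :: 'n sqm \<times> complex. rotdet (snd p) (fst p)) (?W, ?\<beta>)" "isCont (\<lambda>p :: 'n sqm \<times> complex. rotdet (snd p) (mat 1 :: 'n sqm)) (?W, ?\<beta>)"
    by (rule continuous_on_eq_continuous_at[THEN iffD1, rule_format, OF open_UNIV];
        intro UNIV_I continuous_on_rotdet continuous_on_fst continuous_on_snd continuous_on_id continuous_on_const)+
  moreover have "rotdet ?\<beta> (mat 1 :: 'n sqm) \<noteq> 0" using n1 by (simp add: rotdet_of_real)
  ultimately have c\<Phi>: "isCont \<Phi> (?W, ?\<beta>)" unfolding \<Phi>_def rotq_def by (intro continuous_divide) simp_all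
  have \<Phi>0: "\<Phi> (?W, ?\<beta>) = complex_of_real r" by (simp add: \<Phi>_def rotq_real r_def f_def)
  have "isCont (\<lambda>p. Re (\<Phi> p)) (?W, ?\<beta>)" by (intro continuous_Re c\<Phi>)
  then obtain d1 where d1: "d1 > 0" "\<And>p. dist p (?W, ?\<beta>) < d1 \<Longrightarrow> dist (Re (\<Phi> p)) r < r"
    unfolding continuous_at_eps_delta \<Phi>0 Re_complex_of_real using r by meson
  have "isCont Ln (\<Phi> (?W, ?\<beta>))" unfolding \<Phi>0 by (rule continuous_at_Ln) (use r in \<open>simp add: complex_nonpos_Reals_iff\<close>)
  then have "isCont (\<lambda>p. Im (Ln (\<Phi> p))) (?W, ?\<beta>)" by (intro continuous_Im isCont_o2[OF c\<Phi>])
  moreover have "Im (Ln (\<Phi> (?W, ?\<beta>))) = 0" unfolding \<Phi>0 using r by (simp add: Ln_of_real)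
  ultimately obtain d2 where d2: "d2 > 0" "\<And>p. dist p (?W, ?\<beta>) < d2 \<Longrightarrow> dist (Im (Ln (\<Phi> p))) 0 < \<eta> / 2"
    unfolding continuous_at_eps_delta using \<eta> by (metis half_gt_zero)
  define d where "d = min d1 d2"
  have d: "d > 0" "d \<le> d1" "d \<le> d2" using d1 d2 by (auto simp: d_def)
  define \<delta> where "\<delta> = min (d / 2) (min (\<beta> - pi) (2 * pi - \<beta>))"
  show ?thesis
  proof (rule that[of \<delta>])
    show "\<delta> > 0" using d \<beta> by (simp add: \<delta>_def)
    fix a assume a: "Im a > 0" "dist a ?\<beta> < \<delta>"
    have "\<bar>Re a - \<beta>\<bar> < \<delta>" using a(2) abs_Re_le_cmod[of "a - ?\<beta>"] by (simp add: dist_norm)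
    then have Ra: "Re a \<in> {pi<..<2 * pi}" by (auto simp: \<delta>_def)
    have ec: "0 < min (d / 2) (\<eta> / 2)" using d \<eta> by simp
    \<comment> \<open>The approximant depends on \<open>a\<close>, because continuity of
      \<open>liftv (rotq a)\<close> is available for one \<open>a\<close> at a time; the radius
      \<open>\<delta>\<close> does not depend on it.\<close>
    obtain v where v: "v \<in> SpT_ell_plus" "dist (proj v) ?W < min (d / 2) (\<eta> / 2)"
       "dist (liftv (rotq a) v) (liftv (rotq a) w) < min (d / 2) (\<eta> / 2)"
      by (rule closure_approx[OF w Sp_fun.continuous_liftv[OF Sp_fun_rotq[OF a(1)]] ec]) (rule that)
    obtain g where g: "v \<in> SpT" "g \<in> v" "\<And>s. s \<in> {0..1} \<Longrightarrow> g s \<in> Snn"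
      by (rule SpT_ell_plus_path[OF v(1)]) (rule that)
    have g1: "proj v = g 1" using proj_eq[OF g(1,2)] by (simp add: pathfinish_def)
    have near: "dist (g 1, b) (?W, ?\<beta>) < d" if "dist b ?\<beta> < \<delta>" for b
    proof -
      have "dist (g 1, b) (?W, ?\<beta>) \<le> dist (g 1) ?W + dist b ?\<beta>"
        unfolding dist_Pair_Pair by (rule sqrt_sum_squares_le_sum) auto
      then show ?thesis using v(2) that by (simp add: g1 \<delta>_def)
    qed
    have "liftv (rotq a) v = Ln (rotq a (g 1))"
    proof (rule liftv_rotq_Spos[OF g a(1) Ra \<beta>])
      fix \<tau> :: real assume t: "\<tau> \<in> {0..1}"
      let ?b = "?\<beta> + of_real \<tau> * (a - ?\<beta>)"
      have "dist ?b ?\<beta> = \<tau> * dist a ?\<beta>" using t by (simp add: dist_norm norm_mult)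
      also have "\<dots> \<le> 1 * dist a ?\<beta>" by (rule mult_right_mono) (use t in auto)
      finally have "dist (g 1, ?b) (?W, ?\<beta>) < d1" using near[of ?b] a(2) d(2) by simp
      from d1(2)[OF this] show "Re (rotq ?b (g 1)) > 0" by (simp add: \<Phi>_def dist_real_def)
    qed
    moreover have "\<bar>Im (Ln (rotq a (g 1)))\<bar> < \<eta> / 2"
      using d2(2)[of "(g 1, a)"] near[OF a(2)] d(3) by (simp add: \<Phi>_def dist_real_def)
    moreover have "\<bar>Im (liftv (rotq a) v - liftv (rotq a) w)\<bar> < \<eta> / 2"
      using v(3) abs_Im_le_cmod[of "liftv (rotq a) v - liftv (rotq a) w"] by (simp add: dist_norm)
    ultimately show "\<bar>Im (liftv (rotq a) w)\<bar> < \<eta>" by (simp add: abs_if split: if_splits)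
  qed
qed

text \<open>At a minimum \<open>- c\<close> of \<open>\<omega>(v, W v) / (|v|\<^sup>2 + |W v|\<^sup>2)\<close> the Euler--Lagrange equation reads
  \<open>(W + 2 c J)\<^sup>2 v = (1 - 4 c\<^sup>2) v\<close>, which factorises.\<close>
lemma not_Snn_singular:
  fixes W :: "'n::finite sqm"
  assumes W: "W \<in> Sp" "W \<notin> Snn"
  obtains \<beta> x where "\<beta> \<in> {pi<..<2 * pi}" "x \<noteq> 0" "W *v x = rotr \<beta> *v x"
proof -
  note result = that
  obtain v0 where v0: "omega0 v0 (W *v v0) < 0" using W by (auto simp: Snn_def not_le)
  define n where "n v = v \<bullet> v + (W *v v) \<bullet> (W *v v)" for v
  define f where "f v = omega0 v (W *v v)" for v
  have n: "n v > 0" if "v \<noteq> 0" for v using that by (simp add: n_def add_pos_nonneg)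
  have sc: "f (k *\<^sub>R v) = k\<^sup>2 * f v" "n (k *\<^sub>R v) = k\<^sup>2 * n v" for k v
    by (simp_all add: f_def n_def matrix_vec_mult.scaleR_right omega.scaleR_left omega.scaleR_right power2_eq_square algebra_simps)
  let ?S = "sphere 0 1 :: (real^('n + 'n)) set"
  have cn: "continuous_on ?S (\<lambda>v. f v / n v)"
    unfolding f_def n_def
    by (intro continuous_on_divide omega.continuous_on matrix_vec_mult.continuous_on continuous_on_const continuous_on_id
        continuous_on_add continuous_on_inner) (simp add: add_nonneg_eq_0_iff, force)
  have v00: "v0 \<noteq> 0" using v0 by auto
  then have ne: "?S \<noteq> {}" by (intro ex_in_conv[THEN iffD1] exI[of _ "(1 / norm v0) *\<^sub>R v0"]) simp
  obtain v where v: "v \<in> ?S" "\<And>u. u \<in> ?S \<Longrightarrow> f v / n v \<le> f u / n u"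
    using continuous_attains_inf[OF compact_sphere ne cn] by blast
  define c where "c = - (f v / n v)"
  have vn: "v \<noteq> 0" using v(1) by auto
  have ge: "f u + c * n u \<ge> 0" for u
  proof (cases "u = 0")
    case True
    then show ?thesis by (simp add: f_def n_def)
  next
    case False
    have "f v / n v \<le> f ((1 / norm u) *\<^sub>R u) / n ((1 / norm u) *\<^sub>R u)" using False by (intro v(2)) simp
    also have "\<dots> = f u / n u" unfolding sc using False by simp
    finally have "- c \<le> f u / n u" by (simp add: c_def)
    then show ?thesis using n[OF False] by (simp add: pos_le_divide_eq)
  qed
  have eq0: "f v + c * n v = 0" using n[OF vn] by (simp add: c_def)
  have c0: "c > 0"
  proof (rule ccontr)
    assume "\<not> c > 0"
    then have "c * n v0 \<le> 0" using n[OF v00] by (simp add: mult_le_0_iff)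
    then show False using ge[of v0] v0 by (simp add: f_def)
  qed
  \<comment> \<open>The Cauchy-Schwarz inequality bounds the quotient by one half, which makes the
    square root \<open>s\<close> below real.\<close>
  have "c \<le> 1 / 2"
  proof -
    have "- f v \<le> norm v * norm (W *v v)" using omega0_le_norm[of v "W *v v"] by (simp add: f_def)
    also have "\<dots> \<le> n v / 2" using sum_squares_bound[of "norm v" "norm (W *v v)"] by (simp add: n_def dot_square_norm)
    finally have "c * n v \<le> 1 / 2 * n v" using eq0 by simp
    then show ?thesis by (rule mult_right_le_imp_le) (rule n[OF vn])
  qed
  then have c2: "(2 * c)\<^sup>2 \<le> 1" using c0 power_le_one[of "2 * c" 2] by simp
  define B where "B u x = omega0 u (W *v x) + c * (u \<bullet> x + (W *v u) \<bullet> (W *v x))" for u x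
  have Bf: "B u u = f u + c * n u" for u by (simp add: B_def f_def n_def)
  have ker: "B v u + B u v = 0" for u
  proof (rule psd_kernel[where f = B])
    show "B (u + s *\<^sub>R x) (u + s *\<^sub>R x) = B u u + s * (B u x + B x u) + s\<^sup>2 * B x x" for u x s
      by (simp add: B_def matrix_vec_mult.add_right matrix_vec_mult.scaleR_right omega.add_left omega.add_right
          omega.scaleR_left omega.scaleR_right inner_add_left inner_add_right power2_eq_square algebra_simps)
  qed (simp_all add: Bf ge eq0)
  define Z where "Z = W *v (W *v v) - v + (2 * c) *\<^sub>R (W *v (J0 *v v) + J0 *v (W *v v))"
  have "omega0 (W *v u) Z = 0" for u
  proof -
    have "omega0 (W *v u) Z = omega0 u (W *v v) + omega0 v (W *v u) + 2 * c * (u \<bullet> v + (W *v u) \<bullet> (W *v v))"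
      using omega0_antisym[of "W *v u" v]
      by (simp add: Z_def omega.add_right omega.diff_right omega.scaleR_right Sp_omega0[OF W(1)] omega0_J0_right)
    also have "\<dots> = B v u + B u v" by (simp add: B_def inner_commute algebra_simps)
    finally show ?thesis by (simp add: ker)
  qed
  from this[of "matrix_inv W *v (J0 *v Z)"] have "omega0 (J0 *v Z) Z = 0"
    by (simp add: matrix_inv_vec[OF Sp_invertible[OF W(1)]])
  then have "Z = 0" by (simp add: omega0_J0_left)
  then have WW: "W *v (W *v v) = v - (2 * c) *\<^sub>R (W *v (J0 *v v)) - (2 * c) *\<^sub>R (J0 *v (W *v v))"
    by (simp add: Z_def algebra_simps)
  define s where "s = sqrt (1 - (2 * c)\<^sup>2)"
  have s2: "s\<^sup>2 = 1 - (2 * c)\<^sup>2" using c2 by (simp add: s_def)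
  have fin: thesis if x: "x \<noteq> 0" and e: "k\<^sup>2 + (2 * c)\<^sup>2 = 1" and eq: "W *v x = k *\<^sub>R x - (2 * c) *\<^sub>R (J0 *v x)" for k x
  proof -
    have "k\<^sup>2 + (- (2 * c))\<^sup>2 = 1" using e by simp
    then obtain t where t: "0 \<le> t" "t < 2 * pi" "k = cos t" "- (2 * c) = sin t" by (rule sincos_total_2pi)
    have "pi < t"
    proof (rule ccontr)
      assume "\<not> pi < t"
      then have "0 \<le> sin t" using t(1) by (intro sin_ge_zero) auto
      then show False using t(4) c0 by linarith
    qed
    moreover have "W *v x = rotr t *v x" by (simp add: eq rotr_vec t(3)) (simp add: t(4)[symmetric])
    ultimately show thesis using result[of t x] x t(2) by simp
  qed
  \<comment> \<open>The factor \<open>W + 2 c J0 + s\<close> applied to \<open>v\<close>: if the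
    result vanishes, \<open>v\<close> itself solves the equation with \<open>- s\<close>; otherwise
    \<open>z\<close> solves it with \<open>s\<close>.\<close>
  define z where "z = W *v v + (2 * c) *\<^sub>R (J0 *v v) + s *\<^sub>R v"
  show thesis
  proof (cases "z = 0")
    case True
    then have "W *v v = (- s) *\<^sub>R v - (2 * c) *\<^sub>R (J0 *v v)" by (simp add: z_def algebra_simps eq_neg_iff_add_eq_0)
    then show thesis using fin[OF vn, of "- s"] s2 by simp
  next
    case False
    have "W *v z + (2 * c) *\<^sub>R (J0 *v z) - s *\<^sub>R z = (1 - (2 * c)\<^sup>2 - s\<^sup>2) *\<^sub>R v"
      by (simp add: z_def matrix_vec_mult.add_right matrix_vec_mult.scaleR_right WW J0_J0 algebra_simps power2_eq_square)
    then have "W *v z = s *\<^sub>R z - (2 * c) *\<^sub>R (J0 *v z)" by (simp add: s2 algebra_simps)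
    then show thesis using fin[OF False, of s] s2 by simp
  qed
qed

text \<open>If \<open>c t\<close> were outside \<open>Snn\<close>, the argument of the determinant
  at time \<open>t\<close> would drop by at least \<open>1 / 16\<close> across the singular angle
  \<open>b\<close>. At time \<open>0\<close> it changes by less than \<open>1 / 32\<close>, it does
  not decrease in time at \<open>b + e\<close>, and at \<open>b - e\<close> it grows by less than
  \<open>1 / 64\<close> in total; these are incompatible.\<close>

theorem wcausal_in_Snn:
  fixes w :: "(real \<Rightarrow> 'n::finite sqm) set"
  assumes w: "w \<in> SpT_top closure_of SpT_ell_plus" and c: "wcausal c D" "c \<in> w" and t: "t \<in> {0..1}"
  shows "c t \<in> Snn"
proof (rule ccontr)
  assume nS: "c t \<notin> Snn"
  have wT: "w \<in> SpT" using w by (simp add: in_closure_of topspace_SpT_top)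
  have sc: "sp_path c" using SpT_mem[OF wT c(2)] by auto
  obtain b x where b: "b \<in> {pi<..<2 * pi}" "x \<noteq> 0" "c t *v x = rotr b *v x"
    by (rule not_Snn_singular[OF sp_path_D(5)[OF sc t] nS])
  let ?b = "complex_of_real b"
  have rx: "cplx (c t) *v rv x = rotc ?b *v rv x" "rv x \<noteq> 0"
    using b(2,3) by (simp_all add: rotc_of_real cplx_rv) (simp add: rv_def vec_eq_iff)
  obtain d1 where d1: "d1 > 0" "\<And>a. Im a > 0 \<Longrightarrow> dist a ?b < d1 \<Longrightarrow> \<bar>Im (liftv (rotq a) w)\<bar> < 1 / 64"
    by (rule liftv_rotq_small[OF w b(1), of "1 / 64"]) simp_all
  let ?one = "mat 1 :: 'n sqm"
  define f where "f a = rotdet a ?one / rotdet ?b ?one" for a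
  have nb: "rotdet ?b ?one \<noteq> 0" using Snn_det_rotr[OF Snn_one b(1), where 'a = 'n] by (simp add: rotdet_of_real)
  have "continuous_on UNIV f" unfolding f_def using nb
    by (intro continuous_on_divide continuous_on_rotdet continuous_on_const continuous_on_id) auto
  then have cf: "isCont f ?b" by (simp add: continuous_on_eq_continuous_at)
  have f1: "f ?b = 1" using nb by (simp add: f_def)
  obtain d2 where d2: "d2 > 0" "\<And>a. dist a ?b < d2 \<Longrightarrow> dist (f a) 1 < 1 / 2"
    using cf unfolding continuous_at_eps_delta f1 by (meson half_gt_zero zero_less_one)
  have "isCont (\<lambda>a. Ln (f a)) ?b" by (rule isCont_o2[OF cf]) (simp add: f1 continuous_at_Ln)
  then obtain d3 where d3: "d3 > 0" "\<And>a. dist a ?b < d3 \<Longrightarrow> dist (Ln (f a)) 0 < 1 / 64"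
    unfolding continuous_at_eps_delta f1 Ln_1 by (meson divide_pos_pos zero_less_one zero_less_numeral)
  \<comment> \<open>The points \<open>Complex \<beta> e\<close> with \<open>\<beta>\<close> within
    \<open>e\<close> of \<open>b\<close> are closer than \<open>3 * e\<close> to \<open>b\<close>,
    so this choice keeps them inside all three radii; the bound \<open>1 / 4\<close> is the one in
    \<open>rotdet_drop\<close>.\<close>
  define e where "e = min (1 / 4) (min d1 (min d2 d3) / 3)"
  have e: "0 < e" "e \<le> 1 / 4" "3 * e \<le> d1" "3 * e \<le> d2" "3 * e \<le> d3" using d1 d2 d3 by (auto simp: e_def min_def)
  let ?a = "\<lambda>\<beta>. Complex \<beta> e"
  have near: "dist (?a \<beta>) ?b < 3 * e" if "\<beta> \<in> {b - e..b + e}" for \<beta>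
  proof -
    have "cmod (?a \<beta> - ?b) \<le> \<bar>\<beta> - b\<bar> + \<bar>e\<bar>" using cmod_le[of "?a \<beta> - ?b"] by simp
    then show ?thesis using that e(1) by (auto simp: dist_norm)
  qed
  let ?Q = "{0..1::real} \<times> {b - e..b + e}"
  have cC: "continuous_on S ?a" for S unfolding Complex_eq by (intro continuous_intros)
  have cg: "continuous_on ?Q (\<lambda>p. c (fst p))"
    by (rule continuous_on_compose2[OF sp_path_D(6)[OF sc] continuous_on_fst[OF continuous_on_id]]) auto
  have cq: "continuous_on ?Q (\<lambda>p. rotdet (?a (snd p)) (c (fst p)))"
    by (intro continuous_on_rotdet cg continuous_on_compose2[OF cC continuous_on_snd[OF continuous_on_id] subset_UNIV])
  have nz: "rotdet (?a (snd p)) (c (fst p)) \<noteq> 0" if "p \<in> ?Q" for p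
    by (rule rotdet_nonzero(2)) (use that sp_path_D(5)[OF sc] e(1) in auto)
  obtain H where H: "continuous_on ?Q H" "\<And>p. p \<in> ?Q \<Longrightarrow> rotdet (?a (snd p)) (c (fst p)) = exp (H p)"
    by (rule continuous_logarithm_on_contractible[OF cq convex_imp_contractible nz]) (auto intro: convex_Times)
  have cH: "continuous_on {0..1} (\<lambda>s. H (s, \<beta>))" if "\<beta> \<in> {b - e..b + e}" for \<beta>
    by (rule continuous_on_compose2[OF H(1)]) (use that in \<open>auto intro!: continuous_intros\<close>)
  have cH': "continuous_on {b - e..b + e} (\<lambda>\<beta>. H (s, \<beta>))" if "s \<in> {0..1}" for s
    by (rule continuous_on_compose2[OF H(1)]) (use that in \<open>auto intro!: continuous_intros\<close>)
  have drop: "Im (H (t, b + e)) + 1 / 16 \<le> Im (H (t, b - e))"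
    by (rule rotdet_drop[OF sp_path_D(5)[OF sc t] rx e(1,2), where l = "\<lambda>\<beta>. H (t, \<beta>)"])
      (use cH'[OF t] H(2) t in auto)
  have mono: "Im (H (s, \<beta>)) \<le> Im (H (s', \<beta>))" if "0 \<le> s" "s \<le> s'" "s' \<le> 1" "\<beta> \<in> {b - e..b + e}" for s s' \<beta>
    by (rule rotdet_mono[OF c(1) _ cH[OF that(4)], where k = 1 and a = "?a \<beta>"]) (use that H(2) e(1) in auto)
  have bm: "b - e \<in> {b - e..b + e}" and bp: "b + e \<in> {b - e..b + e}" using e(1) by auto
  have up: "Im (H (1, b - e)) - Im (H (0, b - e)) < 1 / 64"
  proof -
    have "is_log (rotq (?a (b - e))) c (\<lambda>s. H (s, b - e) - H (0, b - e))"
      unfolding is_log_def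
    proof (intro conjI ballI)
      show "continuous_on {0..1} (\<lambda>s. H (s, b - e) - H (0, b - e))" by (intro continuous_intros cH[OF bm])
      fix s :: real assume s: "s \<in> {0..1}"
      show "exp (H (s, b - e) - H (0, b - e)) = rotq (?a (b - e)) (c s)"
        using H(2)[of "(s, b - e)"] H(2)[of "(0, b - e)"] s bm sp_path_D(4)[OF sc] by (simp add: rotq_def exp_diff)
    qed simp
    from Sp_fun.liftv_eq[OF Sp_fun_rotq wT c(2) this] have "liftv (rotq (?a (b - e))) w = H (1, b - e) - H (0, b - e)"
      using e(1) by simp
    moreover have "dist (?a (b - e)) ?b < d1" using near[OF bm] e(3) by linarith
    ultimately show ?thesis using d1(2)[of "?a (b - e)"] e(1) by (simp add: abs_if split: if_splits)
  qed
  have base: "H (0, b - e) - Ln (f (?a (b - e))) = H (0, b + e) - Ln (f (?a (b + e)))"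
  proof (rule exp_eq_1_const_aux[where c = "rotdet ?b ?one" and S = "{b - e..b + e}"])
    show "continuous_on {b - e..b + e} (\<lambda>\<beta>. H (0, \<beta>))" by (rule cH') simp
    have re: "Re (f (?a \<beta>)) > 0" if "\<beta> \<in> {b - e..b + e}" for \<beta>
      using d2(2)[of "?a \<beta>"] near[OF that] e(4) abs_Re_le_cmod[of "f (?a \<beta>) - 1"] by (simp add: dist_norm)
    have "continuous_on {b - e..b + e} (\<lambda>\<beta>. f (?a \<beta>))"
      unfolding f_def using nb by (intro continuous_on_divide continuous_on_rotdet cC continuous_on_const) auto
    then show "continuous_on {b - e..b + e} (\<lambda>\<beta>. Ln (f (?a \<beta>)))"
      using re by (intro continuous_on_Ln') (auto simp: complex_nonpos_Reals_iff not_le)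
    fix \<beta> assume \<beta>: "\<beta> \<in> {b - e..b + e}"
    have "f (?a \<beta>) \<noteq> 0" using re[OF \<beta>] by auto
    then show "exp (H (0, \<beta>)) = rotdet ?b ?one * exp (Ln (f (?a \<beta>)))"
      using H(2)[of "(0, \<beta>)"] \<beta> nb sp_path_D(4)[OF sc] by (simp add: f_def)
  qed (use nb bm bp in auto)
  have "\<bar>Im (Ln (f (?a \<beta>)))\<bar> < 1 / 64" if "\<beta> \<in> {b - e..b + e}" for \<beta>
    using d3(2)[of "?a \<beta>"] near[OF that] e(5) abs_Im_le_cmod[of "Ln (f (?a \<beta>))"] by simp
  from this[OF bm] this[OF bp] have "\<bar>Im (H (0, b - e)) - Im (H (0, b + e))\<bar> < 1 / 32"
    using arg_cong[OF base, of Im] by (simp add: abs_if split: if_splits)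
  then show False using drop up mono[of 0 t "b + e"] mono[of t 1 "b - e"] t bm bp by (simp add: abs_if split: if_splits)
qed

section \<open>Length bound for positive elliptic curves\<close>

primrec mp :: "real^'m^'m \<Rightarrow> nat \<Rightarrow> real^'m^'m" where
  "mp Y 0 = mat 1"
| "mp Y (Suc k) = Y ** mp Y k"

lemma mp_commute: "Z ** Y = Y ** Z \<Longrightarrow> Z ** mp Y k = mp Y k ** Z"
proof (induction k)
  case (Suc k)
  have "Z ** mp Y (Suc k) = (Z ** Y) ** mp Y k" by (simp add: matrix_mul_assoc)
  also have "\<dots> = Y ** (Z ** mp Y k)" by (simp add: Suc.prems matrix_mul_assoc)
  also have "\<dots> = mp Y (Suc k) ** Z" by (simp add: Suc.IH[OF Suc.prems] matrix_mul_assoc)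
  finally show ?case .
qed simp

text \<open>\<open>Y\<close> and its derivative need not commute, but the trace of the derivative of
  a power against any \<open>Z\<close> commuting with \<open>Y t\<close> has a simple form. This
  stronger statement goes through the induction with \<open>Z ** Y t\<close> in place of
  \<open>Z\<close>.\<close>

lemma has_vector_derivative_trace_mp_aux:
  fixes Y :: "real \<Rightarrow> real^'m^'m"
  assumes Y: "(Y has_vector_derivative Y') (at t within S)"
  shows "\<exists>D. ((\<lambda>s. mp (Y s) k) has_vector_derivative D) (at t within S) \<and>
     (\<forall>Z. Z ** Y t = Y t ** Z \<longrightarrow> trace (Z ** D) = real k * trace (Z ** mp (Y t) (k - 1) ** Y'))"
proof (induction k)
  case 0
  show ?case by (intro exI[of _ 0]) (simp add: trace_def)
next
  case (Suc k)
  then obtain D where D: "((\<lambda>s. mp (Y s) k) has_vector_derivative D) (at t within S)"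
    "\<And>Z. Z ** Y t = Y t ** Z \<Longrightarrow> trace (Z ** D) = real k * trace (Z ** mp (Y t) (k - 1) ** Y')" by blast
  have "trace (Z ** (Y t ** D + Y' ** mp (Y t) k)) = real (Suc k) * trace (Z ** mp (Y t) k ** Y')"
    if Z: "Z ** Y t = Y t ** Z" for Z
  proof -
    have "(Z ** Y t) ** Y t = Y t ** (Z ** Y t)" by (simp only: Z matrix_mul_assoc[symmetric])
    then have "trace (Z ** (Y t ** D)) = real k * trace ((Z ** Y t) ** mp (Y t) (k - 1) ** Y')"
      using D(2) by (simp add: matrix_mul_assoc)
    also have "\<dots> = real k * trace (Z ** mp (Y t) k ** Y')"
      by (cases k) (simp_all add: matrix_mul_assoc)
    finally have 1: "trace (Z ** (Y t ** D)) = real k * trace (Z ** mp (Y t) k ** Y')" .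
    have "trace (Z ** (Y' ** mp (Y t) k)) = trace (mp (Y t) k ** (Z ** Y'))"
      using trace_mul_sym[of "Z ** Y'" "mp (Y t) k"] by (simp add: matrix_mul_assoc)
    also have "\<dots> = trace (Z ** mp (Y t) k ** Y')" by (simp add: matrix_mul_assoc mp_commute[OF Z])
    finally show ?thesis using 1 by (simp add: matrix_mult.add_right trace_add algebra_simps)
  qed
  moreover have "((\<lambda>s. mp (Y s) (Suc k)) has_vector_derivative Y t ** D + Y' ** mp (Y t) k) (at t within S)"
    unfolding mp.simps by (rule matrix_mult.has_vector_derivative[OF Y D(1)])
  ultimately show ?case by (intro exI[of _ "Y t ** D + Y' ** mp (Y t) k"] conjI allI impI) simp_all
qed

lemma bounded_linear_trace: "bounded_linear (trace :: real^'m^'m \<Rightarrow> real)"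
  unfolding linear_conv_bounded_linear[symmetric] by (rule linearI) (simp_all add: trace_def sum.distrib sum_distrib_left)

lemma has_vector_derivative_trace_mp:
  fixes Y :: "real \<Rightarrow> real^'m^'m"
  assumes Y: "(Y has_vector_derivative Y') (at t within S)"
  shows "((\<lambda>s. trace (mp (Y s) k)) has_vector_derivative real k * trace (mp (Y t) (k - 1) ** Y')) (at t within S)"
proof -
  obtain D where D: "((\<lambda>s. mp (Y s) k) has_vector_derivative D) (at t within S)"
    "\<And>Z. Z ** Y t = Y t ** Z \<Longrightarrow> trace (Z ** D) = real k * trace (Z ** mp (Y t) (k - 1) ** Y')"
    using has_vector_derivative_trace_mp_aux[OF Y, of k] by blast
  show ?thesis using bounded_linear.has_vector_derivative[OF bounded_linear_trace D(1)] D(2)[of "mat 1"] by simp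
qed

definition dg :: "('m \<Rightarrow> real) \<Rightarrow> real^'m^'m" where "dg d = (\<chi> i j. if i = j then d i else 0)"

lemma dg_vec: "(dg d *v u) $ i = d i * u $ i"
  by (simp add: dg_def matrix_vector_mult_def if_distrib if_distribR cong: if_cong)

lemma dg_mult: "dg a ** dg b = dg (\<lambda>i. a i * b i)"
  unfolding matrix_eq by (simp add: vec_eq_iff dg_vec mult.assoc flip: matrix_vector_mul_assoc)

lemma dg_1: "dg (\<lambda>i. 1) = mat 1"
  by (simp add: dg_def mat_def)

lemma trace_dg_mult: "trace (dg d ** Q) = (\<Sum>i\<in>UNIV. d i * Q $ i $ i)"
  by (simp add: dg_def trace_def matrix_matrix_mult_def if_distrib if_distribR cong: if_cong)

definition sumfun :: "('n \<Rightarrow> 'b) \<Rightarrow> 'n + 'n \<Rightarrow> 'b" where "sumfun f k = (case k of Inl j \<Rightarrow> f j | Inr j \<Rightarrow> f j)"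

lemma sumfun_simps [simp]: "sumfun f (Inl j) = f j" "sumfun f (Inr j) = f j"
  by (simp_all add: sumfun_def)

text \<open>In the normal form its eigenvalues are the cosines of the angles, each twice. It depends
  smoothly on \<open>W\<close> even where the angles do not.\<close>

definition cosm :: "'n::finite sqm \<Rightarrow> 'n sqm" where "cosm W = (1 / 2) *\<^sub>R (W + matrix_inv W)"

lemma Sp_transpose_J0: "M \<in> Sp \<Longrightarrow> J0 ** matrix_inv M = transpose M ** J0"
proof -
  assume M: "M \<in> Sp"
  have "transpose M ** J0 ** M = J0"
  proof (rule matrix_eqI_inner)
    fix u v
    have "u \<bullet> ((transpose M ** J0 ** M) *v v) = (M *v u) \<bullet> (J0 *v (M *v v))"
      unfolding matrix_vector_mul_assoc[symmetric] by (simp only: inner_transpose)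
    also have "\<dots> = - omega0 (M *v u) (M *v v)"
      using omega0_antisym[of "M *v u" "M *v v"] by (simp add: omega0_inner[of "M *v v"] inner_commute)
    also have "\<dots> = u \<bullet> (J0 *v v)"
      using omega0_antisym[of u v] by (simp add: Sp_omega0[OF M] omega0_inner[of v] inner_commute)
    finally show "u \<bullet> ((transpose M ** J0 ** M) *v v) = u \<bullet> (J0 *v v)" .
  qed
  note eq = this
  have "transpose M ** J0 = transpose M ** J0 ** (M ** matrix_inv M)"
    by (simp only: matrix_inv_right[OF Sp_invertible[OF M]] matrix_mul_rid)
  also have "\<dots> = J0 ** matrix_inv M" by (simp only: matrix_mul_assoc eq)
  finally show ?thesis by simp
qed

context
  fixes W M :: "'n::finite sqm" and \<theta> :: "'n \<Rightarrow> real"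
  assumes W: "W \<in> Sp" and M: "M \<in> Sp" and nf: "W ** M = M ** Rot \<theta>"
begin

lemma nf_inv: "matrix_inv W ** M = M ** Rot (\<lambda>j. - \<theta> j)"
proof -
  have R: "Rot \<theta> ** Rot (\<lambda>j. - \<theta> j) = mat 1"
    unfolding matrix_eq
  proof
    fix u :: "real^('n+'n)"
    have p: "cos x * (cos x * y) + sin x * (sin x * y) = y" for x y :: real
      by (metis distrib_right mult.assoc mult_1 sin_cos_squared_add3)
    have "((Rot \<theta> ** Rot (\<lambda>j. - \<theta> j)) *v u) $ k = u $ k" for k
      by (cases k) (simp_all add: Rot_vec algebra_simps p flip: matrix_vector_mul_assoc)
    then show "(Rot \<theta> ** Rot (\<lambda>j. - \<theta> j)) *v u = mat 1 *v u" by (simp add: vec_eq_iff)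
  qed
  have "matrix_inv W ** M = matrix_inv W ** (M ** Rot \<theta>) ** Rot (\<lambda>j. - \<theta> j)"
    by (simp add: R flip: matrix_mul_assoc)
  also have "\<dots> = M ** Rot (\<lambda>j. - \<theta> j)"
    unfolding nf[symmetric] using matrix_inv_left[OF Sp_invertible[OF W]] by (simp add: matrix_mul_assoc)
  finally show ?thesis .
qed

lemma nf_cosm: "cosm W ** M = M ** dg (sumfun (\<lambda>j. cos (\<theta> j)))"
proof -
  have "(1 / 2) *\<^sub>R (Rot \<theta> + Rot (\<lambda>j. - \<theta> j)) = dg (sumfun (\<lambda>j. cos (\<theta> j)))"
    unfolding matrix_eq
  proof
    fix u :: "real^('n+'n)"
    have "(((1 / 2) *\<^sub>R (Rot \<theta> + Rot (\<lambda>j. - \<theta> j))) *v u) $ k = (dg (sumfun (\<lambda>j. cos (\<theta> j))) *v u) $ k" for k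
      by (cases k) (simp_all add: matrix_vec_mult.scaleR_left matrix_vec_mult.add_left Rot_vec dg_vec)
    then show "((1 / 2) *\<^sub>R (Rot \<theta> + Rot (\<lambda>j. - \<theta> j))) *v u = dg (sumfun (\<lambda>j. cos (\<theta> j))) *v u" by (simp add: vec_eq_iff)
  qed
  then show ?thesis
    by (simp add: cosm_def matrix_mult.scaleR_left matrix_mult.add_left nf nf_inv
        matrix_mult.scaleR_right[symmetric] matrix_mult.add_right[symmetric])
qed

lemma nf_sin: "(W - matrix_inv W) ** M = M ** (dg (sumfun (\<lambda>j. 2 * sin (\<theta> j))) ** J0)"
proof -
  have "Rot \<theta> - Rot (\<lambda>j. - \<theta> j) = dg (sumfun (\<lambda>j. 2 * sin (\<theta> j))) ** J0"
    unfolding matrix_eq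
  proof
    fix u :: "real^('n+'n)"
    have "((Rot \<theta> - Rot (\<lambda>j. - \<theta> j)) *v u) $ k = ((dg (sumfun (\<lambda>j. 2 * sin (\<theta> j))) ** J0) *v u) $ k" for k
      by (cases k) (simp_all add: matrix_vec_mult.diff_left Rot_vec dg_vec J0_mult_vec flip: matrix_vector_mul_assoc)
    then show "(Rot \<theta> - Rot (\<lambda>j. - \<theta> j)) *v u = (dg (sumfun (\<lambda>j. 2 * sin (\<theta> j))) ** J0) *v u" by (simp add: vec_eq_iff)
  qed
  then show ?thesis
    by (simp add: matrix_mult.diff_left nf nf_inv matrix_mult.diff_right[symmetric])
qed

lemma nf_mp: "mp (cosm W) k ** M = M ** dg (sumfun (\<lambda>j. cos (\<theta> j) ^ k))"
proof (induction k)
  case 0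
  have "sumfun (\<lambda>j::'n. 1::real) = (\<lambda>i. 1)" by (auto simp: sumfun_def fun_eq_iff split: sum.split)
  then show ?case by (simp add: dg_1)
next
  case (Suc k)
  have "mp (cosm W) (Suc k) ** M = cosm W ** (mp (cosm W) k ** M)" by (simp add: matrix_mul_assoc)
  also have "\<dots> = (cosm W ** M) ** dg (sumfun (\<lambda>j. cos (\<theta> j) ^ k))" by (simp add: Suc.IH matrix_mul_assoc)
  also have "\<dots> = M ** dg (sumfun (\<lambda>j. cos (\<theta> j) ^ Suc k))"
    unfolding nf_cosm matrix_mul_assoc[symmetric] dg_mult
    by (rule arg_cong[where f = "\<lambda>f. M ** dg f"]) (auto simp: sumfun_def fun_eq_iff split: sum.split)
  finally show ?case .
qed

lemma trace_conj_Sp: "trace A = trace (matrix_inv M ** (A ** M))"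
  using trace_mul_sym[of "matrix_inv M" "A ** M"] matrix_inv_right[OF Sp_invertible[OF M]]
  by (simp flip: matrix_mul_assoc)

lemma nf_cancel: "matrix_inv M ** (M ** A) = A"
  using matrix_inv_left[OF Sp_invertible[OF M]] by (simp add: matrix_mul_assoc)

lemma trace_mp_cosm: "trace (mp (cosm W) k) = 2 * (\<Sum>j\<in>UNIV. cos (\<theta> j) ^ k)"
  using trace_dg_mult[of "sumfun (\<lambda>j. cos (\<theta> j) ^ k)" "mat 1 :: 'n sqm"]
  by (simp add: trace_conj_Sp[of "mp (cosm W) k"] nf_mp nf_cancel sum_UNIV_Plus) (simp add: mat_def)

text \<open>In the normal frame \<open>W - matrix_inv W\<close> is twice the sines times
  \<open>J0\<close>, and this \<open>J0\<close> turns \<open>X\<close> into its symmetric form; the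
  trace becomes a weighted sum of diagonal entries.\<close>

lemma trace_mp_sin:
  "trace (mp (cosm W) k ** (W - matrix_inv W) ** X)
    = - (\<Sum>i\<in>UNIV. sumfun (\<lambda>j. 2 * (cos (\<theta> j) ^ k * sin (\<theta> j))) i * (transpose M ** sform X ** M) $ i $ i)"
proof -
  let ?K = "mp (cosm W) k ** (W - matrix_inv W)" and ?d = "sumfun (\<lambda>j. 2 * (cos (\<theta> j) ^ k * sin (\<theta> j)))"
  have "dg (sumfun (\<lambda>j. cos (\<theta> j) ^ k)) ** dg (sumfun (\<lambda>j. 2 * sin (\<theta> j))) = dg ?d"
    unfolding dg_mult by (rule arg_cong[where f = dg]) (auto simp: sumfun_def fun_eq_iff split: sum.split)
  note d = this
  have "?K ** M = (mp (cosm W) k ** M) ** (dg (sumfun (\<lambda>j. 2 * sin (\<theta> j))) ** J0)"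
    by (simp only: matrix_mul_assoc[symmetric] nf_sin)
  also have "\<dots> = M ** (dg ?d ** J0)" unfolding nf_mp d[symmetric] by (simp only: matrix_mul_assoc)
  finally have K: "?K ** M = M ** (dg ?d ** J0)" .
  have "?K = ?K ** (M ** matrix_inv M)" by (simp only: matrix_inv_right[OF Sp_invertible[OF M]] matrix_mul_rid)
  also have "\<dots> = ?K ** M ** matrix_inv M" by (simp only: matrix_mul_assoc)
  finally have "?K = M ** (dg ?d ** J0) ** matrix_inv M" by (simp only: K)
  then have "trace (?K ** X) = trace (matrix_inv M ** (M ** (dg ?d ** (J0 ** matrix_inv M ** X ** M))))"
    using trace_conj_Sp[of "?K ** X"] by (simp add: matrix_mul_assoc)
  also have "\<dots> = trace (dg ?d ** (transpose M ** J0 ** X ** M))" by (simp only: nf_cancel Sp_transpose_J0[OF M])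
  also have "transpose M ** J0 ** X ** M = - (transpose M ** sform X ** M)"
    by (simp add: sform_def matrix_mult.minus_left matrix_mult.minus_right matrix_mul_assoc)
  finally show ?thesis by (simp add: trace_dg_mult sum_negf)
qed

end

lemma cosm_commute: "W \<in> Sp \<Longrightarrow> W ** cosm W = cosm W ** W"
  using matrix_inv_left[OF Sp_invertible, of W] matrix_inv_right[OF Sp_invertible, of W]
  by (simp add: cosm_def matrix_mult.scaleR_left matrix_mult.scaleR_right matrix_mult.add_left matrix_mult.add_right)

text \<open>The two terms of the derivative of \<open>cosm\<close> combine by cyclicity of the
  trace, since powers of \<open>cosm W\<close> commute with \<open>W\<close>.\<close>

lemma has_vector_derivative_trace_mp_cosm:
  assumes c: "c1sp c D" and t: "t \<in> {0..1}"
  shows "((\<lambda>s. trace (mp (cosm (c s)) (Suc k))) has_vector_derivative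
     real (Suc k) / 2 * trace (mp (cosm (c t)) k ** (c t - matrix_inv (c t)) ** logder c t)) (at t within {0..1})"
proof -
  note C = c1sp_C1[OF c]
  let ?X = "logder c t" and ?W = "c t" and ?Q = "mp (cosm (c t)) k"
  have W: "?W \<in> Sp" using c t by (simp add: c1sp_def)
  have inv: "\<And>s. s \<in> {0..1} \<Longrightarrow> invertible (c s)" using c by (simp add: c1sp_def Sp_invertible)
  have cc: "continuous_on {0..1} c" using c by (meson c1sp_def continuous_on_eq_continuous_within has_vector_derivative_continuous)
  have X1: "D t ** matrix_inv ?W = ?X" using C t by simp
  have X2: "?X ** ?W = D t" using matrix_inv_left[OF inv[OF t]] by (simp add: X1[symmetric] flip: matrix_mul_assoc)
  have d: "(c has_vector_derivative D t) (at t within {0..1})" using c t by (simp add: c1sp_def)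
  have "((\<lambda>s. cosm (c s)) has_vector_derivative (1 / 2) *\<^sub>R (D t + - (matrix_inv ?W ** D t ** matrix_inv ?W))) (at t within {0..1})"
    unfolding cosm_def
    by (rule bounded_linear.has_vector_derivative[OF bounded_linear_scaleR_right])
      (intro has_vector_derivative_add d has_vector_derivative_matrix_inv[OF d t inv cc])
  from has_vector_derivative_trace_mp[OF this, of "Suc k"]
  have d2: "((\<lambda>s. trace (mp (cosm (c s)) (Suc k))) has_vector_derivative
     real (Suc k) * trace (?Q ** ((1 / 2) *\<^sub>R (D t + - (matrix_inv ?W ** D t ** matrix_inv ?W))))) (at t within {0..1})" by (simp only: diff_Suc_1)
  have e1: "trace (?Q ** ((1 / 2) *\<^sub>R (D t + - (matrix_inv ?W ** D t ** matrix_inv ?W))))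
     = (trace (?Q ** D t) - trace (?Q ** (matrix_inv ?W ** D t ** matrix_inv ?W))) / 2"
    by (simp add: matrix_mult.scaleR_right matrix_mult.add_right matrix_mult.minus_right matrix_mult.diff_right trace_sub
        linear_scale[OF bounded_linear.linear[OF bounded_linear_trace]])
  have e2: "trace (?Q ** D t) = trace (?Q ** ?W ** ?X)"
    using trace_mul_sym[of "?Q ** ?X" ?W] mp_commute[OF cosm_commute[OF W], of k] by (simp add: X2[symmetric] matrix_mul_assoc)
  have e3: "?Q ** (matrix_inv ?W ** D t ** matrix_inv ?W) = ?Q ** matrix_inv ?W ** ?X"
    by (simp add: X1[symmetric] matrix_mul_assoc)
  have "real (Suc k) * trace (?Q ** ((1 / 2) *\<^sub>R (D t + - (matrix_inv ?W ** D t ** matrix_inv ?W))))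
    = real (Suc k) / 2 * trace (?Q ** (?W - matrix_inv ?W) ** ?X)"
    unfolding e1 e2 e3 by (simp add: matrix_mult.diff_right matrix_mult.diff_left trace_sub del: of_nat_Suc)
  then show ?thesis using d2 by (simp only:)
qed


text \<open>The derivative of \<open>arccos\<close> is approximated rather than the function,
  because the growth rate has to be controlled; integration from \<open>0\<close>, where
  \<open>arccos\<close> is \<open>pi / 2\<close>, gives the second estimate. The derivative is
  bounded only away from \<open>1\<close> and \<open>-1\<close>, hence \<open>r < 1\<close>.\<close>

lemma Weierstrass_arccos:
  assumes r: "0 \<le> r" "r < 1" and e: "e > 0"
  obtains a m where "\<And>x. \<bar>x\<bar> \<le> r \<Longrightarrow> 1 - e \<le> - (\<Sum>k\<le>m. a k * x ^ k) * sqrt (1 - x\<^sup>2)"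
    "\<And>x. \<bar>x\<bar> \<le> r \<Longrightarrow> \<bar>(\<Sum>k\<le>m. a k / real (Suc k) * x ^ Suc k) - (arccos x - pi / 2)\<bar> \<le> e"
proof -
  have x1: "x\<^sup>2 < 1" "- 1 < x" "x < 1" if "\<bar>x\<bar> \<le> r" for x
  proof -
    show "x\<^sup>2 < 1" using that r by (simp add: abs_square_less_1)
    show "- 1 < x" "x < 1" using that r by auto
  qed
  define f where "f x = - (1 / sqrt (1 - x\<^sup>2))" for x :: real
  have "continuous_on {-r..r} f" unfolding f_def
    by (intro continuous_intros ballI) (use x1(1) in \<open>force simp: abs_le_iff\<close>)
  then obtain g where g: "real_polynomial_function g" "\<And>x. x \<in> {-r..r} \<Longrightarrow> \<bar>f x - g x\<bar> < e"
    using Stone_Weierstrass_real_polynomial_function[OF compact_Icc _ e] by metis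
  obtain a m where am: "g = (\<lambda>x. \<Sum>k\<le>m. a k * x ^ k)" using g(1) unfolding real_polynomial_function_iff_sum by blast
  show ?thesis
  proof (rule that[where a = a and m = m])
    fix x assume x: "\<bar>x\<bar> \<le> r"
    have s: "0 < sqrt (1 - x\<^sup>2)" "sqrt (1 - x\<^sup>2) \<le> 1" using x1[OF x] by simp_all
    have "- g x \<ge> 1 / sqrt (1 - x\<^sup>2) - e" using g(2)[of x] x by (auto simp: f_def abs_le_iff abs_less_iff)
    then have "(1 / sqrt (1 - x\<^sup>2) - e) * sqrt (1 - x\<^sup>2) \<le> - g x * sqrt (1 - x\<^sup>2)" by (rule mult_right_mono) (use s in simp)
    moreover have "(1 / sqrt (1 - x\<^sup>2) - e) * sqrt (1 - x\<^sup>2) = 1 - e * sqrt (1 - x\<^sup>2)" using s by (simp add: field_simps)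
    moreover have "e * sqrt (1 - x\<^sup>2) \<le> e * 1" using s e by (intro mult_left_mono) auto
    ultimately show "1 - e \<le> - (\<Sum>k\<le>m. a k * x ^ k) * sqrt (1 - x\<^sup>2)" by (simp add: am)
    define h where "h x = (\<Sum>k\<le>m. a k / real (Suc k) * x ^ Suc k) - (arccos x - pi / 2)" for x
    have "norm (h x - h 0) \<le> e * norm (x - 0)"
    proof (rule field_differentiable_bound[of "{-r..r}" h "\<lambda>y. g y - f y"])
      fix y assume y: "y \<in> {-r..r}"
      then have y': "\<bar>y\<bar> \<le> r" by auto
      have dp: "((\<lambda>x. x ^ Suc n) has_real_derivative real (Suc n) * y ^ n) (at y)" for n
        using DERIV_pow[of "Suc n" y UNIV] by (simp del: power_Suc of_nat_Suc)
      have "((\<lambda>x. (\<Sum>k\<le>m. a k / real (Suc k) * x ^ Suc k) - (arccos x - pi / 2)) has_real_derivative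
         (\<Sum>k\<le>m. a k / real (Suc k) * (real (Suc k) * y ^ k)) - (inverse (- sqrt (1 - y\<^sup>2)) - 0)) (at y)"
        by (intro DERIV_diff DERIV_sum DERIV_cmult DERIV_const DERIV_arccos x1[OF y'] dp)
      moreover have "(\<Sum>k\<le>m. a k / real (Suc k) * (real (Suc k) * y ^ k)) = g y" by (simp add: am)
      ultimately have "(h has_real_derivative g y - f y) (at y)" unfolding h_def f_def by (simp add: inverse_eq_divide)
      then show "(h has_field_derivative g y - f y) (at y within {-r..r})" by (rule has_field_derivative_at_within)
      show "norm (g y - f y) \<le> e" using g(2)[OF y] by (simp add: abs_minus_commute)
    qed (use x r in auto)
    also have "\<dots> \<le> e * 1" using x r e by (intro mult_left_mono) auto
    finally show "\<bar>(\<Sum>k\<le>m. a k / real (Suc k) * x ^ Suc k) - (arccos x - pi / 2)\<bar> \<le> e" by (simp add: h_def)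
  qed
qed

text \<open>The values of the characteristic polynomial at \<open>1\<close> and \<open>-1\<close>
  multiply to the product of the \<open>4 * (sin (\<theta> j))\<^sup>2\<close>, each at most
  \<open>4\<close>. A lower bound for a continuous function of \<open>W\<close> thus keeps all sines
  away from zero.\<close>

lemma cos_bound_of_charpoly:
  fixes W :: "'n::finite sqm" and \<theta> :: "'n \<Rightarrow> real"
  assumes g: "\<And>z. charpoly W z = (\<Prod>j\<in>UNIV. (z - exp (\<i> * complex_of_real (\<theta> j))) * (z - exp (- \<i> * complex_of_real (\<theta> j))))"
    and m: "m \<le> cmod (charpoly W 1 * charpoly W (-1))"
  shows "m / 4 ^ CARD('n) \<le> (sin (\<theta> j))\<^sup>2"
proof -
  have "charpoly W 1 * charpoly W (-1) = complex_of_real (\<Prod>j\<in>UNIV. 4 * (sin (\<theta> j))\<^sup>2)"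
    unfolding g quadratic_factor prod.distrib[symmetric] of_real_prod
  proof (rule prod.cong)
    fix j
    have "(1\<^sup>2 - 2 * x * 1 + 1) * ((- 1)\<^sup>2 - 2 * x * - 1 + 1) = 4 * (1 - x\<^sup>2)" for x :: complex by (simp add: algebra_simps power2_eq_square)
    then show "(1\<^sup>2 - 2 * complex_of_real (cos (\<theta> j)) * 1 + 1) * ((- 1)\<^sup>2 - 2 * complex_of_real (cos (\<theta> j)) * - 1 + 1)
       = complex_of_real (4 * (sin (\<theta> j))\<^sup>2)"
      by (simp only: sin_squared_eq) simp
  qed simp
  then have "m \<le> \<bar>\<Prod>j\<in>UNIV. 4 * (sin (\<theta> j))\<^sup>2\<bar>" using m by (simp only: norm_of_real)
  also have "\<dots> = (\<Prod>j\<in>UNIV. 4 * (sin (\<theta> j))\<^sup>2)" by (intro abs_of_nonneg prod_nonneg) simp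
  also have "\<dots> = 4 * (sin (\<theta> j))\<^sup>2 * (\<Prod>i\<in>UNIV - {j}. 4 * (sin (\<theta> i))\<^sup>2)" by (rule prod.remove) auto
  also have "\<dots> \<le> 4 * (sin (\<theta> j))\<^sup>2 * (\<Prod>i\<in>UNIV - {j}. 4)"
    by (intro mult_left_mono prod_mono) (auto simp: abs_square_le_1)
  also have "\<dots> = 4 ^ CARD('n) * (sin (\<theta> j))\<^sup>2"
    using prod.remove[of "UNIV :: 'n set" j "\<lambda>_. 4 :: real"] by (simp add: algebra_simps)
  finally show ?thesis by (simp add: divide_le_eq mult.commute)
qed

lemma continuous_on_charpoly: "continuous_on S f \<Longrightarrow> continuous_on S (\<lambda>x. charpoly (f x) z)"
  unfolding charpoly_mat
  by (intro continuous_on_det continuous_on_diff continuous_on_const bounded_linear.continuous_on[OF bounded_linear_cplx])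

text \<open>Normal frames are chosen at each time without continuity; only the traces in
  \<open>F\<close> are differentiated, and a frame enters through values at a single time.\<close>

theorem length_le_Spos:
  fixes c :: "real \<Rightarrow> 'n::finite sqm"
  assumes c: "wcausal c D" and pos: "\<And>t. t \<in> {0..1} \<Longrightarrow> c t \<in> Spos" and \<theta>: "good (c 1) \<theta>"
  shows "real CARD('n) * lengthG c \<le> (\<Sum>j\<in>UNIV. \<theta> $ j)"
proof -
  have c1: "c1sp c D" using c by (simp add: wcausal_def)
  have cc: "continuous_on {0..1} c" using c1 by (meson c1sp_def continuous_on_eq_continuous_within has_vector_derivative_continuous)
  have S: "c t \<in> Sp" if "t \<in> {0..1}" for t using c1 that by (simp add: c1sp_def)
  have "\<exists>M \<phi>. M \<in> Sp \<and> (\<forall>j::'n. 0 < \<phi> j \<and> \<phi> j < pi) \<and> c t ** M = M ** Rot \<phi>" if "t \<in> {0..1}" for t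
    by (rule normal_form[OF pos[OF that]]) blast
  then obtain M \<phi> where M: "\<And>t. t \<in> {0..1} \<Longrightarrow> M t \<in> Sp"
     and \<phi>: "\<And>t j. t \<in> {0..1} \<Longrightarrow> 0 < \<phi> t j \<and> \<phi> t j < pi"
     and nf: "\<And>t. t \<in> {0..1} \<Longrightarrow> c t ** M t = M t ** Rot (\<phi> t :: 'n \<Rightarrow> real)" by metis
  note cp = charpoly_normal_form[OF M nf]
  define q where "q t = cmod (charpoly (c t) 1 * charpoly (c t) (-1))" for t
  have "continuous_on {0..1} q" unfolding q_def
    by (intro continuous_intros continuous_on_charpoly cc)
  then obtain t0 where t0: "t0 \<in> {0..1}" "\<And>t. t \<in> {0..1} \<Longrightarrow> q t0 \<le> q t"
    using continuous_attains_inf[of "{0..1::real}" q] by auto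
  have q0: "q t0 > 0"
  proof -
    have "(z - exp (\<i> * complex_of_real x)) * (z - exp (- \<i> * complex_of_real x)) \<noteq> 0" if "0 < x" "x < pi" "z = 1 \<or> z = -1" for x z
    proof -
      have "sin x > 0" using that by (intro sin_gt_zero)
      then have "Im (exp (\<i> * complex_of_real x)) \<noteq> 0" "Im (exp (- \<i> * complex_of_real x)) \<noteq> 0" by (simp_all add: Im_exp)
      moreover have "Im z = 0" using that(3) by auto
      ultimately have "z \<noteq> exp (\<i> * complex_of_real x)" "z \<noteq> exp (- \<i> * complex_of_real x)" by metis+
      then show ?thesis by simp
    qed
    then show ?thesis unfolding q_def using \<phi>[OF t0(1)] by (simp add: cp[OF t0(1) t0(1)] norm_mult)
  qed
  define m where "m = q t0 / 4 ^ CARD('n)"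
  have m: "m > 0" "\<And>t j. t \<in> {0..1} \<Longrightarrow> m \<le> (sin (\<phi> t j))\<^sup>2"
    using q0 cos_bound_of_charpoly[OF cp] t0(2) by (auto simp: m_def q_def)
  have "(sin (\<phi> 0 undefined))\<^sup>2 \<le> 1" by (simp add: abs_square_le_1)
  then have m1: "m \<le> 1" using m(2)[of 0 undefined] by simp
  define r where "r = sqrt (1 - m)"
  have r: "0 \<le> r" "r < 1" using m(1) m1 by (simp_all add: r_def)
  have cb: "\<bar>cos (\<phi> t j)\<bar> \<le> r" if "t \<in> {0..1}" for t j
    unfolding r_def by (rule real_le_rsqrt) (use m(2)[OF that, of j] in \<open>simp add: sin_squared_eq\<close>)
  have main: "(1 - e) * (real CARD('n) * lengthG c) \<le> (\<Sum>j\<in>UNIV. \<phi> 1 j) + real CARD('n) * (2 * e)" if e: "0 < e" and e1: "e \<le> 1" for e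
  proof -
    \<comment> \<open>This \<open>m\<close> is the degree of the polynomial and shadows the bound on
      the sines above.\<close>
    obtain a m where a: "\<And>x. \<bar>x\<bar> \<le> r \<Longrightarrow> 1 - e \<le> - (\<Sum>k\<le>m. a k * x ^ k) * sqrt (1 - x\<^sup>2)"
      "\<And>x. \<bar>x\<bar> \<le> r \<Longrightarrow> \<bar>(\<Sum>k\<le>m. a k / real (Suc k) * x ^ Suc k) - (arccos x - pi / 2)\<bar> \<le> e"
      by (rule Weierstrass_arccos[OF r e]) (rule that)
    define P where "P x = (\<Sum>k\<le>m. a k / real (Suc k) * x ^ Suc k)" for x :: real
    \<comment> \<open>The trace counts every angle twice, hence the division by
      \<open>2\<close>.\<close>
    define F where "F t = (\<Sum>k\<le>m. a k / real (Suc k) * trace (mp (cosm (c t)) (Suc k))) / 2" for t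
    define F' where "F' t = (\<Sum>k\<le>m. a k / real (Suc k) * (real (Suc k) / 2 * trace (mp (cosm (c t)) k ** (c t - matrix_inv (c t)) ** logder c t))) / 2" for t
    have dF: "(F has_vector_derivative F' t) (at t within {0..1})" if t: "t \<in> {0..1}" for t
      unfolding F_def F'_def
      by (intro has_vector_derivative_divide has_vector_derivative_sum has_vector_derivative_mult_right
          has_vector_derivative_trace_mp_cosm[OF c1 t])
    have F: "F t = (\<Sum>j\<in>UNIV. P (cos (\<phi> t j)))" if t: "t \<in> {0..1}" for t
      unfolding F_def P_def trace_mp_cosm[OF S[OF t] M[OF t] nf[OF t]]
      by (subst sum.swap) (simp add: sum_divide_distrib sum_distrib_left del: of_nat_Suc power_Suc)
    have F'_ge: "(1 - e) * (real CARD('n) * G (logder c t)) \<le> F' t" if t: "t \<in> {0..1}" for t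
    proof -
      let ?X = "logder c t"
      define Q where "Q = transpose (M t) ** sform ?X ** M t"
      have X: "?X \<in> closure sp_plus" using wcausal_logder[OF c1] c t by simp
      have Qii: "Q $ i $ i \<ge> 0" for i
      proof -
        have "Q $ i $ i = axis i 1 \<bullet> (Q *v axis i 1)" by (simp add: inner_axis' matrix_vector_mult_axis)
        also have "\<dots> = omega0 (M t *v axis i 1) (?X *v (M t *v axis i 1))"
          unfolding Q_def matrix_vector_mul_assoc[symmetric] by (simp only: inner_transpose sform_inner)
        finally show ?thesis using X by (simp add: closure_sp_plus)
      qed
      define p where "p x = (\<Sum>k\<le>m. a k * x ^ k)" for x :: real
      have "F' t = (\<Sum>k\<le>m. a k * trace (mp (cosm (c t)) k ** (c t - matrix_inv (c t)) ** ?X)) / 4"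
        by (simp add: F'_def sum_divide_distrib del: of_nat_Suc)
      also have "\<dots> = (\<Sum>i\<in>UNIV. sumfun (\<lambda>j. - (p (cos (\<phi> t j)) * sin (\<phi> t j))) i * Q $ i $ i) / 2"
        unfolding trace_mp_sin[OF S[OF t] M[OF t] nf[OF t]] Q_def[symmetric]
      proof -
        have "(\<Sum>k\<le>m. a k * - (\<Sum>i\<in>UNIV. sumfun (\<lambda>j. 2 * (cos (\<phi> t j) ^ k * sin (\<phi> t j))) i * Q $ i $ i))
           = (\<Sum>i\<in>UNIV. \<Sum>k\<le>m. a k * - (sumfun (\<lambda>j. 2 * (cos (\<phi> t j) ^ k * sin (\<phi> t j))) i * Q $ i $ i))"
          by (subst sum.swap) (simp add: sum_distrib_left sum_negf)
        also have "\<dots> = (\<Sum>i\<in>UNIV. 2 * (sumfun (\<lambda>j. - (p (cos (\<phi> t j)) * sin (\<phi> t j))) i * Q $ i $ i))"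
        proof (rule sum.cong)
          fix i :: "'n + 'n"
          show "(\<Sum>k\<le>m. a k * - (sumfun (\<lambda>j. 2 * (cos (\<phi> t j) ^ k * sin (\<phi> t j))) i * Q $ i $ i))
            = 2 * (sumfun (\<lambda>j. - (p (cos (\<phi> t j)) * sin (\<phi> t j))) i * Q $ i $ i)"
            by (cases i) (simp_all add: p_def sum_distrib_left sum_distrib_right sum_negf mult_ac)
        qed simp
        finally show "(\<Sum>k\<le>m. a k * - (\<Sum>i\<in>UNIV. sumfun (\<lambda>j. 2 * (cos (\<phi> t j) ^ k * sin (\<phi> t j))) i * Q $ i $ i)) / 4
           = (\<Sum>i\<in>UNIV. sumfun (\<lambda>j. - (p (cos (\<phi> t j)) * sin (\<phi> t j))) i * Q $ i $ i) / 2"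
          by (simp add: sum_distrib_left[symmetric])
      qed
      also have "\<dots> \<ge> (\<Sum>i\<in>UNIV. (1 - e) * Q $ i $ i) / 2"
      proof (intro divide_right_mono sum_mono mult_right_mono Qii)
        fix i :: "'n + 'n"
        have "1 - e \<le> - (p (cos (\<phi> t j)) * sin (\<phi> t j))" for j
        proof -
          have "sqrt (1 - (cos (\<phi> t j))\<^sup>2) = sin (\<phi> t j)"
            using \<phi>[OF t, of j] sin_ge_zero[of "\<phi> t j"] by (simp add: sin_squared_eq[symmetric])
          then show ?thesis using a(1)[OF cb[OF t, of j]] by (simp add: p_def)
        qed
        then show "1 - e \<le> sumfun (\<lambda>j. - (p (cos (\<phi> t j)) * sin (\<phi> t j))) i" by (cases i) simp_all
      qed simp
      finally have A: "(1 - e) * trace Q / 2 \<le> F' t" by (simp add: trace_def sum_distrib_left)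
      have B: "2 * real CARD('n) * G ?X \<le> trace Q" using G_le_trace[OF X M[OF t]] by (simp add: Q_def)
      show ?thesis
      proof -
        have "(1 - e) * (2 * real CARD('n) * G ?X) \<le> (1 - e) * trace Q" using B e1 by (intro mult_left_mono) auto
        then show ?thesis using A by (simp add: algebra_simps)
      qed
    qed
    have i1: "(F' has_integral F 1 - F 0) {0..1}"
      by (rule fundamental_theorem_of_calculus) (use dF in auto)
    have i2: "((\<lambda>t. (1 - e) * (real CARD('n) * G (logder c t))) has_integral (1 - e) * (real CARD('n) * lengthG c)) {0..1}"
      unfolding lengthG_def
      by (intro has_integral_mult_right integrable_integral integrable_continuous_interval continuous_on_G_logder[OF c])
    have "(1 - e) * (real CARD('n) * lengthG c) \<le> F 1 - F 0"
      by (rule has_integral_le[OF i2 i1 F'_ge])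
    moreover have b: "\<bar>P (cos (\<phi> t j)) - (\<phi> t j - pi / 2)\<bar> \<le> e" if "t \<in> {0..1}" for t j
      using a(2)[OF cb[OF that, of j]] \<phi>[OF that, of j] unfolding P_def by (simp only: arccos_cos less_imp_le)
    \<comment> \<open>Each end of the curve contributes an error \<open>e\<close>, and the positive
      initial angle is dropped.\<close>
    have "P (cos (\<phi> 1 j)) - P (cos (\<phi> 0 j)) \<le> \<phi> 1 j + 2 * e" for j
    proof -
      have "0 < \<phi> 0 j" using \<phi>[of 0 j] by simp
      moreover have "0 \<in> {0..1::real}" "1 \<in> {0..1::real}" by auto
      note b[OF this(1), of j] b[OF this(2), of j]
      ultimately show ?thesis by linarith
    qed
    then have "F 1 - F 0 \<le> (\<Sum>j\<in>UNIV. \<phi> 1 j + 2 * e)"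
      unfolding F[of 1, simplified] F[of 0, simplified] sum_subtractf[symmetric] by (intro sum_mono)
    ultimately show ?thesis by (simp add: sum.distrib)
  qed
  have "(\<Sum>j\<in>UNIV. \<phi> 1 j) = (\<Sum>j\<in>UNIV. \<theta> $ j)"
  proof -
    have "good (c 1) (\<chi> j. \<phi> 1 j)" unfolding good_def using \<phi>[of 1] charpoly_normal_form[OF M[of 1] nf[of 1]] by (simp add: less_imp_le)
    from good_sum_unique[OF this \<theta>] show ?thesis by simp
  qed
  moreover have "((\<lambda>e. (\<Sum>j\<in>UNIV. \<phi> 1 j) + real CARD('n) * (2 * e) - (1 - e) * (real CARD('n) * lengthG c))
      \<longlongrightarrow> (\<Sum>j\<in>UNIV. \<phi> 1 j) + real CARD('n) * (2 * 0) - (1 - 0) * (real CARD('n) * lengthG c)) (at_right 0)"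
    by (intro tendsto_intros)
  then have "0 \<le> (\<Sum>j\<in>UNIV. \<phi> 1 j) + real CARD('n) * (2 * 0) - (1 - 0) * (real CARD('n) * lengthG c)"
  proof (rule tendsto_lowerbound)
    show "\<forall>\<^sub>F e in at_right 0. 0 \<le> (\<Sum>j\<in>UNIV. \<phi> 1 j) + real CARD('n) * (2 * e) - (1 - e) * (real CARD('n) * lengthG c)"
      unfolding eventually_at_right_field using main by (intro exI[of _ 1]) simp
  qed simp
  ultimately show ?thesis by simp
qed

section \<open>Pushing into the interior\<close>

text \<open>Numerator and denominator of \<open>push\<close>. For \<open>0 < d < 1\<close> it acts
  on the scalar rotations \<open>rotr t\<close> as the Moebius map of the unit circle that fixes
  \<open>\<i>\<close> and \<open>-\<i>\<close> and attracts towards \<open>\<i>\<close>, so it moves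
  angles in \<open>[0, pi]\<close> into the open interval.\<close>

definition pnu :: "real \<Rightarrow> 'n::finite sqm \<Rightarrow> 'n sqm" where "pnu d W = W + d *\<^sub>R J0"
definition pde :: "real \<Rightarrow> 'n::finite sqm \<Rightarrow> 'n sqm" where "pde d W = mat 1 - d *\<^sub>R (J0 ** W)"
definition push :: "real \<Rightarrow> 'n::finite sqm \<Rightarrow> 'n sqm" where "push d W = pnu d W ** matrix_inv (pde d W)"

lemma pnu_vec: "pnu d W *v v = W *v v + d *\<^sub>R (J0 *v v)"
  by (simp add: pnu_def matrix_vec_mult.add_left matrix_vec_mult.scaleR_left)

lemma pde_vec: "pde d W *v v = v - d *\<^sub>R (J0 *v (W *v v))"
  by (simp add: pde_def matrix_vec_mult.diff_left matrix_vec_mult.scaleR_left matrix_vector_mul_assoc)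

lemma push_form:
  assumes "W \<in> Sp" shows "omega0 (pnu d W *v u) (pnu d W *v v) = omega0 (pde d W *v u) (pde d W *v v)"
  by (simp add: pnu_vec pde_vec omega.add_left omega.add_right omega.diff_left omega.diff_right omega.scaleR_left omega.scaleR_right
      Sp_omega0[OF assms] omega0_J0_left omega0_J0_right algebra_simps flip: omega0_inner)

lemma pde_invertible:
  assumes W: "W \<in> Snn" and d: "d \<ge> 0"
  shows "invertible (pde d W)"
  unfolding invertible_iff_kernel
proof (intro allI impI)
  fix v assume "pde d W *v v = 0"
  then have "v = d *\<^sub>R (J0 *v (W *v v))" by (simp add: pde_vec)
  then have "v \<bullet> v = d * (v \<bullet> (J0 *v (W *v v)))" by (metis inner_scaleR_right)
  also have "v \<bullet> (J0 *v (W *v v)) = - omega0 v (W *v v)"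
    using omega0_antisym[of v "W *v v"] by (simp add: omega0_inner[of "W *v v"] inner_commute)
  finally have "v \<bullet> v \<le> 0" using W d by (simp add: Snn_def)
  then show "v = 0" using inner_ge_zero[of v] by (metis inner_eq_zero_iff order_antisym)
qed

text \<open>With \<open>u = pde d W *v v\<close> the new form at \<open>u\<close> is
  \<open>1 + d\<^sup>2\<close> times the old form at \<open>v\<close> plus \<open>d\<close> times
  the squared lengths of \<open>v\<close> and \<open>W v\<close>.\<close>

lemma push_Spos:
  assumes W: "W \<in> Snn" and d: "d > 0"
  shows "push d W \<in> Spos"
proof -
  have S: "W \<in> Sp" using W by (simp add: Snn_def)
  have inv: "invertible (pde d W)" using pde_invertible[OF W] d by simp
  have "omega0 u (push d W *v u) > 0" if u: "u \<noteq> 0" for u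
  proof -
    define v where "v = matrix_inv (pde d W) *v u"
    have uv: "u = pde d W *v v" "push d W *v u = pnu d W *v v"
      by (simp_all add: v_def push_def matrix_inv_vec[OF inv] flip: matrix_vector_mul_assoc)
    then have "v \<noteq> 0" using u by auto
    then have "0 < d * (v \<bullet> v)" using d by simp
    moreover have "0 \<le> d * ((W *v v) \<bullet> (W *v v))" "0 \<le> (1 + d\<^sup>2) * omega0 v (W *v v)" using d W by (simp_all add: Snn_def)
    moreover have "omega0 u (push d W *v u) = (1 + d\<^sup>2) * omega0 v (W *v v) + d * (v \<bullet> v) + d * ((W *v v) \<bullet> (W *v v))"
      unfolding uv(2) unfolding uv(1) using omega0_antisym[of v "W *v v"]
      by (simp add: pnu_vec pde_vec omega.add_right omega.diff_left omega.scaleR_left omega.scaleR_right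
          omega0_J0_left omega0_J0_right power2_eq_square algebra_simps flip: omega0_inner)
    ultimately show ?thesis by linarith
  qed
  moreover have "push d W \<in> Sp" unfolding push_def by (rule fractional_Sp[OF inv push_form[OF S]])
  ultimately show ?thesis by (simp add: Spos_def)
qed

lemma det_scaleR_matrix: "det (k *\<^sub>R A) = k ^ CARD('m) * det A" for A :: "real^'m^'m"
proof -
  have "k *\<^sub>R A = dg (\<lambda>i. k) ** A" by (simp add: dg_def vec_eq_iff matrix_matrix_mult_def if_distrib if_distribR cong: if_cong)
  then show ?thesis by (simp add: det_mul dg_def det_diag)
qed

text \<open>The form of the derivative is multiplied by \<open>1 - d\<^sup>2\<close> and transported
  by \<open>pde\<close>; taking determinants yields the factor of \<open>G\<close>, which tends to
  \<open>1\<close> as \<open>d\<close> tends to \<open>0\<close>.\<close>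

lemma push_curve:
  fixes c :: "real \<Rightarrow> 'n::finite sqm"
  assumes c: "wcausal c D" and S: "\<And>t. t \<in> {0..1} \<Longrightarrow> c t \<in> Snn" and d: "0 < d" "d < 1"
  obtains D' where "wcausal (\<lambda>t. push d (c t)) D'"
    "\<And>t. t \<in> {0..1} \<Longrightarrow> G (logder (\<lambda>t. push d (c t)) t)
       = (1 - d\<^sup>2) * ((det (pde d (c t)))\<^sup>2) powr (- (1 / real CARD('n + 'n))) * G (logder c t)"
proof -
  let ?C = "\<lambda>t. push d (c t)" and ?Nu = "\<lambda>t. pnu d (c t)" and ?De = "\<lambda>t. pde d (c t)" and ?N = "CARD('n + 'n)"
  define De' where "De' t = - (d *\<^sub>R (J0 ** D t))" for t
  define D' where "D' t = ?Nu t ** (- (matrix_inv (?De t) ** De' t ** matrix_inv (?De t))) + D t ** matrix_inv (?De t)" for t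
  have c1: "c1sp c D" using c by (simp add: wcausal_def)
  have dc: "(c has_vector_derivative D t) (at t within {0..1})" and SS: "c t \<in> Sp" if "t \<in> {0..1}" for t
    using c1 that by (simp_all add: c1sp_def)
  have cD: "continuous_on {0..1} D" using c1 by (simp add: c1sp_def)
  have d1: "(?Nu has_vector_derivative D t) (at t within {0..1})" if t: "t \<in> {0..1}" for t
    using has_vector_derivative_add[OF dc[OF t] has_vector_derivative_const[of "d *\<^sub>R J0"]] by (simp add: pnu_def)
  have d2: "(?De has_vector_derivative De' t) (at t within {0..1})" if t: "t \<in> {0..1}" for t
  proof -
    have "(?De has_vector_derivative 0 - d *\<^sub>R (J0 ** D t)) (at t within {0..1})"
      unfolding pde_def
      by (intro has_vector_derivative_diff has_vector_derivative_const bounded_linear.has_vector_derivative[OF bounded_linear_scaleR_right]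
        bounded_linear.has_vector_derivative[OF matrix_mult.bounded_linear_right] dc[OF t])
    then show ?thesis by (simp add: De'_def)
  qed
  have cDe: "continuous_on {0..1} De'" unfolding De'_def by (intro continuous_intros matrix_mult.continuous_on cD)
  have inv: "invertible (?De t)" if "t \<in> {0..1}" for t using pde_invertible[OF S[OF that]] d by simp
  note F = fractional_curve[OF d1 d2 cD cDe inv push_form[OF SS], folded push_def D'_def]
  have C1: "c1sp ?C D'" using F(1) by (simp add: D'_def[abs_def] push_def)
  have form: "omega0 (?Nu t *v u) (D' t *v (?De t *v v)) = (1 - d\<^sup>2) * omega0 (c t *v u) (D t *v v)" if t: "t \<in> {0..1}" for t u v
  proof -
    have "?C t *v (?De t *v u) = ?Nu t *v u"
      by (simp add: push_def matrix_inv_vec[OF inv[OF t]] flip: matrix_vector_mul_assoc)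
    then have "omega0 (?Nu t *v u) (D' t *v (?De t *v v)) = omega0 (?Nu t *v u) (D t *v v) - omega0 (?De t *v u) (De' t *v v)"
      using F(2)[OF _ _ _ _ t, of u v] by (simp add: push_def D'_def)
    also have "\<dots> = (1 - d\<^sup>2) * omega0 (c t *v u) (D t *v v)"
      by (simp add: pnu_vec pde_vec De'_def matrix_vec_mult.minus_left matrix_vec_mult.scaleR_left omega.minus_right
          omega.add_left omega.diff_left omega.scaleR_left omega.scaleR_right omega0_J0_left omega0_J0_right
          power2_eq_square algebra_simps flip: matrix_vector_mul_assoc omega0_inner)
    finally show ?thesis .
  qed
  have CNu: "?C t *v x = ?Nu t *v (matrix_inv (?De t) *v x)" for t x by (simp add: push_def matrix_vector_mul_assoc)
  have d0: "1 - d\<^sup>2 > 0" using d by (simp add: abs_square_less_1)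
  have wc: "wcausal ?C D'"
    unfolding wcausal_def
  proof (intro conjI C1 ballI allI)
    fix t :: real and v assume t: "t \<in> {0..1}"
    have "omega0 (?C t *v v) (D' t *v v) = (1 - d\<^sup>2) * omega0 (c t *v (matrix_inv (?De t) *v v)) (D t *v (matrix_inv (?De t) *v v))"
      unfolding CNu using form[OF t, of "matrix_inv (?De t) *v v" "matrix_inv (?De t) *v v"] by (simp add: matrix_inv_vec[OF inv[OF t]])
    then show "0 \<le> omega0 (?C t *v v) (D' t *v v)" using c t d0 by (simp add: wcausal_def)
  qed
  have "G (logder ?C t) = (1 - d\<^sup>2) * ((det (?De t))\<^sup>2) powr (- (1 / real ?N)) * G (logder c t)" if t: "t \<in> {0..1}" for t
  proof -
    let ?X = "logder c t" and ?X' = "logder ?C t"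
    have X: "?X \<in> closure sp_plus" "?X' \<in> closure sp_plus"
      using wcausal_logder[OF c1] wcausal_logder[OF C1] c wc t by auto
    \<comment> \<open>The two forms are compared as congruent matrices; in the determinant of this
      identity the symplectic factors occur squared and drop out.\<close>
    have "transpose (?Nu t) ** sform ?X' ** ?Nu t = (1 - d\<^sup>2) *\<^sub>R (transpose (c t) ** sform ?X ** c t)"
    proof (rule matrix_eqI_inner)
      fix u v
      have Cv: "?C t *v (?De t *v x) = ?Nu t *v x" for x by (simp add: CNu matrix_inv_vec[OF inv[OF t]])
      have "u \<bullet> ((transpose (?Nu t) ** sform ?X' ** ?Nu t) *v v) = omega0 (?Nu t *v u) (?X' *v (?Nu t *v v))"
        unfolding matrix_vector_mul_assoc[symmetric] by (simp only: inner_transpose sform_inner)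
      also have "\<dots> = omega0 (?Nu t *v u) (D' t *v (?De t *v v))"
        using logder_form[OF C1 t, of "?De t *v u" "?De t *v v"] unfolding Cv .
      also have "\<dots> = (1 - d\<^sup>2) * omega0 (c t *v u) (?X *v (c t *v v))" by (simp only: form[OF t] logder_form[OF c1 t])
      also have "\<dots> = u \<bullet> (((1 - d\<^sup>2) *\<^sub>R (transpose (c t) ** sform ?X ** c t)) *v v)"
        unfolding matrix_vec_mult.scaleR_left matrix_vector_mul_assoc[symmetric] inner_scaleR_right by (simp only: inner_transpose sform_inner)
      finally show "u \<bullet> ((transpose (?Nu t) ** sform ?X' ** ?Nu t) *v v) = u \<bullet> (((1 - d\<^sup>2) *\<^sub>R (transpose (c t) ** sform ?X ** c t)) *v v)" .
    qed
    from arg_cong[OF this, of det] have "det ?X' * (det (?Nu t) * det (?Nu t)) = (1 - d\<^sup>2) ^ ?N * (det ?X * (det (c t) * det (c t)))"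
      by (simp add: det_mul det_transpose det_sform det_scaleR_matrix mult_ac del: card_sum)
    moreover have "?Nu t = ?C t ** ?De t" using matrix_inv_left[OF inv[OF t]] by (simp add: push_def flip: matrix_mul_assoc)
    then have "det (?Nu t) * det (?Nu t) = (det (?C t) * det (?C t)) * (det (?De t) * det (?De t))" by (simp add: det_mul)
    moreover have "?C t \<in> Sp" using push_Spos[OF S[OF t] d(1)] by (simp add: Spos_def)
    ultimately have dX: "det ?X' * (det (?De t))\<^sup>2 = (1 - d\<^sup>2) ^ ?N * det ?X"
      using Sp_det_sq[OF SS[OF t]] Sp_det_sq[of "?C t"] by (simp add: power2_eq_square)
    have de: "(det (?De t))\<^sup>2 > 0" using inv[OF t] by (simp add: invertible_det_nz)
    have "det ?X' = (1 - d\<^sup>2) ^ ?N * inverse ((det (?De t))\<^sup>2) * det ?X" using dX de by (simp add: field_simps)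
    then have "G ?X' = ((1 - d\<^sup>2) ^ ?N) powr (1 / real ?N) * (inverse ((det (?De t))\<^sup>2)) powr (1 / real ?N) * G ?X"
      using closure_sp_plus_det[OF X(1)] closure_sp_plus_det[OF X(2)] d0 de by (simp add: powr_mult del: card_sum)
    also have "((1 - d\<^sup>2) ^ ?N) powr (1 / real ?N) = 1 - d\<^sup>2"
      using d0 by (simp add: powr_powr flip: powr_realpow del: card_sum)
    also have "(inverse ((det (?De t))\<^sup>2)) powr (1 / real ?N) = ((det (?De t))\<^sup>2) powr (- (1 / real ?N))"
      by (simp only: inverse_powr powr_minus)
    finally show ?thesis .
  qed
  with wc show ?thesis by (rule that)
qed

lemma continuous_on_pde: "continuous_on S f \<Longrightarrow> continuous_on S g \<Longrightarrow> continuous_on S (\<lambda>x. pde (f x) (g x))"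
  unfolding pde_def by (intro continuous_intros matrix_mult.continuous_on)

text \<open>The pushed curves lie in \<open>Spos\<close>; their lengths eventually exceed every
  fraction of that of \<open>c\<close>, and the angle sums at their end points converge along a
  subsequence to the one of \<open>c 1\<close>.\<close>

theorem length_le_Snn:
  fixes c :: "real \<Rightarrow> 'n::finite sqm"
  assumes c: "wcausal c D" and S: "\<And>t. t \<in> {0..1} \<Longrightarrow> c t \<in> Snn" and \<theta>: "good (c 1) \<theta>"
  shows "real CARD('n) * lengthG c \<le> (\<Sum>j\<in>UNIV. \<theta> $ j)"
proof -
  let ?N = "CARD('n + 'n)" and ?n = "real CARD('n)"
  have c1: "c1sp c D" using c by (simp add: wcausal_def)
  have cc: "continuous_on {0..1} c" using c1 by (meson c1sp_def continuous_on_eq_continuous_within has_vector_derivative_continuous)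
  \<comment> \<open>The index shift by two keeps \<open>\<delta>\<close> strictly below
    \<open>1\<close>, as \<open>push_curve\<close> demands.\<close>
  define \<delta> where "\<delta> k = 1 / real (Suc (Suc k))" for k :: nat
  have \<delta>: "0 < \<delta> k" "\<delta> k < 1" "\<delta> k \<le> 1" for k by (simp_all add: \<delta>_def)
  have \<delta>0: "\<delta> \<longlonglongrightarrow> 0" unfolding \<delta>_def by (rule LIMSEQ_Suc[OF LIMSEQ_Suc[OF lim_1_over_n]])
  define C where "C k t = push (\<delta> k) (c t)" for k t
  define q where "q d t = (1 - d\<^sup>2) * ((det (pde d (c t)))\<^sup>2) powr (- (1 / real ?N))" for d t
  have "\<exists>D'. wcausal (C k) D' \<and> (\<forall>t\<in>{0..1}. G (logder (C k) t) = q (\<delta> k) t * G (logder c t))" for k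
    unfolding C_def q_def by (rule push_curve[OF c S \<delta>(1,2)[of k]]) blast+
  then obtain D' where D': "\<And>k. wcausal (C k) (D' k)" "\<And>k t. t \<in> {0..1} \<Longrightarrow> G (logder (C k) t) = q (\<delta> k) t * G (logder c t)" by metis
  have pos: "C k t \<in> Spos" if "t \<in> {0..1}" for k t unfolding C_def by (rule push_Spos[OF S[OF that] \<delta>(1)])
  have "\<exists>T. good (C k 1) T" for k by (rule good_Spos[OF pos[of 1 k]]) auto
  then obtain T where T: "\<And>k. good (C k 1) (T k)" by metis
  define s where "s k = (\<Sum>j\<in>UNIV. T k $ j)" for k
  have len: "?n * lengthG (C k) \<le> s k" for k unfolding s_def by (rule length_le_Spos[OF D'(1) pos T])
  have "s k \<in> {0..?n * pi}" for k
  proof -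
    have "s k \<le> (\<Sum>j\<in>(UNIV::'n set). pi)" unfolding s_def using T[of k] by (intro sum_mono) (simp add: good_def)
    moreover have "0 \<le> s k" unfolding s_def using T[of k] by (intro sum_nonneg) (simp add: good_def)
    ultimately show ?thesis by simp
  qed
  then obtain y r where r: "strict_mono r" "(s \<circ> r) \<longlonglongrightarrow> y"
    using compact_Icc[of 0 "?n * pi"] unfolding compact_eq_seq_compact_metric seq_compact_def by meson
  have y: "y = (\<Sum>j\<in>UNIV. \<theta> $ j)"
  proof -
    have "continuous_on {0..1} (\<lambda>d. push d (c 1))"
      unfolding push_def pnu_def using pde_invertible[OF S[of 1]]
      by (intro matrix_mult.continuous_on continuous_on_matrix_inv continuous_on_pde continuous_intros) auto
    then have "(\<lambda>k. push (\<delta> (r k)) (c 1)) \<longlonglongrightarrow> push 0 (c 1)"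
      using LIMSEQ_subseq_LIMSEQ[OF \<delta>0 r(1)] \<delta>
      by (intro continuous_on_tendsto_compose[where f = "\<lambda>d. push d (c 1)" and s = "{0..1}"]) (auto simp: o_def less_imp_le)
    moreover have "push 0 (c 1) = c 1"
      using matrix_inv_right[of "mat 1 :: 'n sqm"] by (simp add: push_def pnu_def pde_def invertible_det_nz)
    ultimately have "(\<lambda>k. C (r k) 1) \<longlonglongrightarrow> c 1" by (simp add: C_def)
    from good_limit[OF this T r(2)[unfolded o_def s_def]] obtain \<phi> where "good (c 1) \<phi>" "(\<Sum>j\<in>UNIV. \<phi> $ j) = y" .
    then show ?thesis using good_sum_unique[OF _ \<theta>] by auto
  qed
  \<comment> \<open>The factor \<open>q\<close> equals \<open>1\<close> at \<open>d = 0\<close>, so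
    by uniform continuity it exceeds any \<open>z < 1\<close> for small \<open>d\<close>, at all
    times simultaneously.\<close>
  have "z * (?n * lengthG c) \<le> y" if z: "0 < z" "z < 1" for z
  proof -
    let ?Q = "{0..1/2::real} \<times> {0..1::real}"
    have "continuous_on ?Q (\<lambda>p. q (fst p) (snd p))"
      unfolding q_def
      by (intro continuous_intros continuous_on_det continuous_on_pde continuous_on_compose2[OF cc continuous_on_snd[OF continuous_on_id]])
        (use pde_invertible[OF S] in \<open>auto simp: invertible_det_nz\<close>)
    then have "uniformly_continuous_on ?Q (\<lambda>p. q (fst p) (snd p))"
      by (rule compact_uniformly_continuous) (intro compact_Times compact_Icc)
    then obtain e where e: "e > 0" "\<And>p p'. p \<in> ?Q \<Longrightarrow> p' \<in> ?Q \<Longrightarrow> dist p' p < e \<Longrightarrow> dist (q (fst p') (snd p')) (q (fst p) (snd p)) < 1 - z"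
      unfolding uniformly_continuous_on_def using z(2) by (metis diff_gt_0_iff_gt)
    have "eventually (\<lambda>k. \<delta> (r k) < min e (1 / 2)) sequentially"
      using order_tendstoD(2)[OF LIMSEQ_subseq_LIMSEQ[OF \<delta>0 r(1)], of "min e (1 / 2)"] e(1) by (simp add: o_def)
    then have "eventually (\<lambda>k. z * (?n * lengthG c) \<le> (s \<circ> r) k) sequentially"
    proof eventually_elim
      case (elim k)
      have qz: "z \<le> q (\<delta> (r k)) t" if t: "t \<in> {0..1}" for t
      proof -
        have "dist (q (\<delta> (r k)) t) (q 0 t) < 1 - z"
          using e(2)[of "(0, t)" "(\<delta> (r k), t)"] elim t \<delta>(1)[of "r k"] by (simp add: dist_Pair_Pair less_imp_le)
        moreover have "q 0 t = 1" by (simp add: q_def pde_def)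
        ultimately show ?thesis by (simp add: dist_real_def)
      qed
      have "z * lengthG c \<le> lengthG (C (r k))"
        unfolding lengthG_def integral_mult_right[symmetric]
      proof (rule integral_le)
        show "(\<lambda>t. z * G (logder c t)) integrable_on {0..1}"
          by (intro integrable_continuous_interval continuous_intros continuous_on_G_logder[OF c])
        show "(\<lambda>t. G (logder (C (r k)) t)) integrable_on {0..1}"
          by (intro integrable_continuous_interval continuous_on_G_logder[OF D'(1)])
        fix t :: real assume t: "t \<in> {0..1}"
        show "z * G (logder c t) \<le> G (logder (C (r k)) t)" unfolding D'(2)[OF t]
          by (rule mult_right_mono[OF qz[OF t] G_nonneg])
      qed
      then have "?n * (z * lengthG c) \<le> ?n * lengthG (C (r k))" by (rule mult_left_mono) simp
      also note len[of "r k"]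
      finally show "z * (?n * lengthG c) \<le> (s \<circ> r) k" by (simp add: mult_ac)
    qed
    from tendsto_lowerbound[OF r(2) this] show ?thesis by simp
  qed
  then have "?n * lengthG c \<le> y" by (rule field_le_mult_one_interval)
  then show ?thesis by (simp only: y)
qed

section \<open>Contraction and first exit\<close>

text \<open>With \<open>x = W v + v\<close> and \<open>y = W v - v\<close>, the two sides of the
  Cayley transform, the pair \<open>(x, y)\<close> is replaced by
  \<open>(x - (1 - s) J0 y, s y)\<close>; \<open>eNu\<close> and \<open>eDe\<close> are the sum and
  difference of the new pair. Scaling \<open>y\<close> to zero leads to the identity at
  \<open>s = 0\<close>, and the \<open>J0\<close> term keeps the denominator invertible on vectors
  with \<open>W v = - v\<close>, where \<open>x\<close> vanishes.\<close>

definition eNu :: "'n::finite sqm \<Rightarrow> real \<Rightarrow> 'n sqm" where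
  "eNu W s = (W + mat 1) + s *\<^sub>R (W - mat 1) - (1 - s) *\<^sub>R (J0 ** (W - mat 1))"
definition eDe :: "'n::finite sqm \<Rightarrow> real \<Rightarrow> 'n sqm" where
  "eDe W s = (W + mat 1) - s *\<^sub>R (W - mat 1) - (1 - s) *\<^sub>R (J0 ** (W - mat 1))"
definition eta :: "'n::finite sqm \<Rightarrow> real \<Rightarrow> 'n sqm" where "eta W s = eNu W s ** matrix_inv (eDe W s)"

lemma eNu_vec: "eNu W s *v v = (W *v v + v) + s *\<^sub>R (W *v v - v) - (1 - s) *\<^sub>R (J0 *v (W *v v - v))"
  and eDe_vec: "eDe W s *v v = (W *v v + v) - s *\<^sub>R (W *v v - v) - (1 - s) *\<^sub>R (J0 *v (W *v v - v))"
  by (simp_all add: eNu_def eDe_def matrix_vec_mult.add_left matrix_vec_mult.diff_left matrix_vec_mult.scaleR_left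
      matrix_vec_mult.diff_right flip: matrix_vector_mul_assoc)

lemma eta_xy:
  assumes "W \<in> Sp"
  shows "omega0 (W *v v + v) (W *v v - v) = 2 * omega0 v (W *v v)"
    "omega0 (W *v u + u) (W *v v - v) + omega0 (W *v u - u) (W *v v + v) = 0"
  using omega0_antisym[of v "W *v v"]
  by (simp_all add: omega.add_left omega.add_right omega.diff_left omega.diff_right Sp_omega0[OF assms] omega0_self)

text \<open>On a kernel vector \<open>omega0 x y\<close>, which is nonnegative for \<open>W\<close>
  in \<open>Snn\<close>, equals \<open>- ((1 - s) * (y \<bullet> y))\<close>, so \<open>y\<close>
  and then \<open>x\<close> vanish. At \<open>s = 1\<close> the denominator is twice the
  identity.\<close>

lemma eDe_invertible:
  assumes W: "W \<in> Snn" and s: "s \<in> {0..1}"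
  shows "invertible (eDe W s)"
  unfolding invertible_iff_kernel
proof (intro allI impI)
  fix v assume z: "eDe W s *v v = 0"
  define x y where "x = W *v v + v" and "y = W *v v - v"
  have x: "x = s *\<^sub>R y + (1 - s) *\<^sub>R (J0 *v y)" using z unfolding eDe_vec x_def[symmetric] y_def[symmetric] by (simp add: algebra_simps)
  show "v = 0"
  proof (cases "s = 1")
    case True
    then have "W *v v + v = W *v v - v" using x by (simp add: x_def y_def)
    then have "v + v = 0" by (simp add: algebra_simps eq_diff_eq)
    then show ?thesis by (simp flip: scaleR_2)
  next
    case False
    have "0 \<le> omega0 x y" unfolding x_def y_def using W by (simp add: eta_xy(1) Snn_def)
    also have "\<dots> = - ((1 - s) * (y \<bullet> y))"
      by (simp add: x omega.add_left omega.scaleR_left omega0_self omega0_J0_left)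
    finally have "(1 - s) * (y \<bullet> y) \<le> 0" by simp
    then have "y \<bullet> y \<le> 0" using False s by (simp add: mult_le_0_iff)
    then have "y = 0" using inner_ge_zero[of y] by (metis inner_eq_zero_iff order_antisym)
    moreover then have "x = 0" using x by simp
    ultimately have "v + v = 0" by (simp add: x_def y_def algebra_simps)
    then show ?thesis by (simp flip: scaleR_2)
  qed
qed

lemma eta_form:
  assumes "W \<in> Sp"
  shows "omega0 (eNu W s *v u) (eNu W s *v v) = omega0 (eDe W s *v u) (eDe W s *v v)"
proof -
  define x y x' y' where "x = W *v u + u" and "y = W *v u - u" and "x' = W *v v + v" and "y' = W *v v - v"
  have "omega0 x y' + omega0 y x' = 0" unfolding x_def y_def x'_def y'_def by (rule eta_xy(2)[OF assms])
  then have e: "omega0 y x' = - omega0 x y'" by simp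
  show ?thesis
    unfolding eNu_vec eDe_vec x_def[symmetric] y_def[symmetric] x'_def[symmetric] y'_def[symmetric]
    by (simp add: omega.add_left omega.add_right omega.diff_left omega.diff_right omega.scaleR_left omega.scaleR_right
        omega0_J0_left omega0_J0_right e algebra_simps flip: omega0_inner)
qed

lemma eta_Snn:
  assumes W: "W \<in> Snn" and s: "s \<in> {0..1}"
  shows "eta W s \<in> Snn"
proof -
  have S: "W \<in> Sp" using W by (simp add: Snn_def)
  note inv = eDe_invertible[OF W s]
  have "omega0 u (eta W s *v u) \<ge> 0" for u
  proof -
    define v where "v = matrix_inv (eDe W s) *v u"
    define x y where "x = W *v v + v" and "y = W *v v - v"
    have uv: "u = eDe W s *v v" "eta W s *v u = eNu W s *v v"
      by (simp_all add: v_def eta_def matrix_inv_vec[OF inv] flip: matrix_vector_mul_assoc)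
    have "omega0 u (eta W s *v u) = 2 * s * (omega0 x y + (1 - s) * (y \<bullet> y))"
      unfolding uv(2) unfolding uv(1) eNu_vec eDe_vec x_def[symmetric] y_def[symmetric]
      using omega0_antisym[of y x]
      by (simp add: omega.add_left omega.add_right omega.diff_left omega.diff_right omega.scaleR_left omega.scaleR_right
        omega0_J0_left omega0_J0_right omega0_self inner_commute algebra_simps flip: omega0_inner)
    moreover have "omega0 x y \<ge> 0" unfolding x_def y_def eta_xy(1)[OF S] using W by (simp add: Snn_def)
    ultimately show ?thesis using s by simp
  qed
  moreover have "eta W s \<in> Sp" unfolding eta_def by (rule fractional_Sp[OF inv eta_form[OF S]])
  ultimately show ?thesis by (simp add: Snn_def)
qed

lemma eta_1: "W \<in> Snn \<Longrightarrow> eta W 1 = W"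
proof -
  have n: "eNu W 1 = 2 *\<^sub>R W" and d: "eDe W 1 = 2 *\<^sub>R mat 1" by (simp_all add: eNu_def eDe_def scaleR_2 algebra_simps)
  have "(2 *\<^sub>R mat 1 :: 'a sqm) ** ((1 / 2) *\<^sub>R mat 1) = mat 1" by (simp add: matrix_mult.scaleR_left matrix_mult.scaleR_right)
  assume W: "W \<in> Snn"
  have "eNu W 1 = W ** eDe W 1" by (simp add: n d matrix_mult.scaleR_right)
  then show "eta W 1 = W" unfolding eta_def using matrix_inv_right[OF eDe_invertible[OF W, of 1]] by (simp flip: matrix_mul_assoc)
qed

lemma eta_0: "W \<in> Snn \<Longrightarrow> eta W 0 = mat 1"
  unfolding eta_def using matrix_inv_right[OF eDe_invertible, of W 0] by (simp add: eNu_def eDe_def)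

lemma continuous_on_eta:
  assumes f: "continuous_on S f" and g: "continuous_on S g" and fS: "\<And>x. x \<in> S \<Longrightarrow> f x \<in> Snn" and gS: "\<And>x. x \<in> S \<Longrightarrow> g x \<in> {0..1}"
  shows "continuous_on S (\<lambda>x. eta (f x) (g x))"
proof -
  have "continuous_on S (\<lambda>x. eNu (f x) (g x))" "continuous_on S (\<lambda>x. eDe (f x) (g x))"
    unfolding eNu_def eDe_def by (intro continuous_intros matrix_mult.continuous_on f g)+
  then show ?thesis unfolding eta_def
    by (intro matrix_mult.continuous_on continuous_on_matrix_inv) (use eDe_invertible[OF fS gS] in auto)
qed

text \<open>The contraction of \<open>Snn\<close> to the identity, run backwards, is a weakly causal
  path from the identity to \<open>W\<close>.\<close>

lemma eta_curve:
  fixes W :: "'n::finite sqm"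
  assumes W: "W \<in> Snn"
  obtains E where "wcausal (eta W) E"
proof -
  have S: "W \<in> Sp" using W by (simp add: Snn_def)
  let ?B = "W - mat 1"
  have d1: "((\<lambda>s. eNu W s) has_vector_derivative ?B + J0 ** ?B) (at t within {0..1})" for t
    unfolding eNu_def by (auto intro!: derivative_eq_intros)
  have d2: "((\<lambda>s. eDe W s) has_vector_derivative - ?B + J0 ** ?B) (at t within {0..1})" for t
    unfolding eDe_def by (auto intro!: derivative_eq_intros)
  note F = fractional_curve[OF d1 d2 continuous_on_const continuous_on_const eDe_invertible[OF W] eta_form[OF S], folded eta_def]
  define E where "E t = eNu W t ** (- (matrix_inv (eDe W t) ** (- ?B + J0 ** ?B) ** matrix_inv (eDe W t))) + (?B + J0 ** ?B) ** matrix_inv (eDe W t)" for t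
  have C1: "c1sp (eta W) E" unfolding E_def[abs_def] by (rule F(1))
  have "wcausal (eta W) E"
    unfolding wcausal_def
  proof (intro conjI ballI allI)
    show "c1sp (eta W) E" by (rule C1)
    fix t :: real and u assume t: "t \<in> {0..1}"
    define v where "v = matrix_inv (eDe W t) *v u"
    define x y where "x = W *v v + v" and "y = W *v v - v"
    have u: "u = eDe W t *v v" by (simp add: v_def matrix_inv_vec[OF eDe_invertible[OF W t]])
    have By: "?B *v v = y" by (simp add: y_def matrix_vec_mult.diff_left)
    have "omega0 (eta W t *v u) (E t *v u) = omega0 (eNu W t *v v) ((?B + J0 ** ?B) *v v) - omega0 (eDe W t *v v) ((- ?B + J0 ** ?B) *v v)"
      unfolding u E_def by (rule F(2)[OF _ t])
    also have "\<dots> = omega0 (eNu W t *v v) (y + J0 *v y) - omega0 (eDe W t *v v) (- y + J0 *v y)"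
      by (simp only: matrix_vec_mult.add_left matrix_vec_mult.minus_left By matrix_vector_mul_assoc[symmetric])
    also have "\<dots> = 2 * omega0 x y + 2 * (y \<bullet> y)"
      unfolding eNu_vec eDe_vec x_def[symmetric] y_def[symmetric]
      by (simp add: omega.add_left omega.add_right omega.diff_left omega.diff_right omega.minus_right omega.scaleR_left omega.scaleR_right
        omega0_J0_left omega0_J0_right omega0_self algebra_simps flip: omega0_inner)
    also have "omega0 x y = 2 * omega0 v (W *v v)" unfolding x_def y_def by (rule eta_xy(1)[OF S])
    finally show "0 \<le> omega0 (eta W t *v u) (E t *v u)" using W by (simp add: Snn_def)
  qed
  then show ?thesis by (rule that)
qed

lemma simply_connected_Snn: "simply_connected (Snn :: 'n::finite sqm set)"
proof (rule contractible_imp_simply_connected)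
  show "contractible (Snn :: 'n sqm set)"
    unfolding contractible_def
  proof (intro exI[of _ "mat 1"])
    show "homotopic_with_canon (\<lambda>x. True) Snn Snn id (\<lambda>x. mat 1 :: 'n sqm)"
    proof (subst homotopic_with)
      have "continuous_on ({0..1} \<times> (Snn :: 'n sqm set)) (\<lambda>p. eta (snd p) (1 - fst p))"
        by (rule continuous_on_eta) (auto intro!: continuous_intros)
      then have "continuous_map (prod_topology (top_of_set {0..1::real}) (top_of_set (Snn :: 'n sqm set))) (top_of_set Snn) (\<lambda>p. eta (snd p) (1 - fst p))"
        by (auto intro!: eta_Snn)
      then show "\<exists>h. continuous_map (prod_topology (top_of_set {0..1::real}) (top_of_set (Snn :: 'n sqm set))) (top_of_set Snn) h \<and>
          (\<forall>x\<in>topspace (top_of_set Snn). h (0, x) = id x) \<and> (\<forall>x\<in>topspace (top_of_set Snn). h (1, x) = mat 1) \<and> (\<forall>t\<in>{0..1}. True)"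
        by (intro exI[of _ "\<lambda>p. eta (snd p) (1 - fst p)"] conjI) (simp_all add: eta_0 eta_1)
    qed simp
  qed
qed

text \<open>For nonzero \<open>u\<close> the nilpotent rank one element of the Lie algebra whose
  exponentials \<open>shear u k\<close> are the symplectic transvections along
  \<open>u\<close>.\<close>

definition shr :: "real^('n::finite + 'n) \<Rightarrow> 'n sqm" where "shr u = (\<chi> i j. - ((J0 *v u) $ j) * u $ i)"

lemma shr_vec: "shr u *v y = - (omega0 u y *\<^sub>R u)"
  by (simp add: shr_def matrix_vector_mult_def[of _ y] vec_eq_iff omega0_inner inner_vec_def sum_distrib_left sum_negf mult_ac)

definition shear :: "real^('n::finite + 'n) \<Rightarrow> real \<Rightarrow> 'n sqm" where "shear u k = mat 1 + k *\<^sub>R shr u"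

lemma shear_vec: "shear u k *v y = y - (k * omega0 u y) *\<^sub>R u"
  by (simp add: shear_def matrix_vec_mult.add_left matrix_vec_mult.scaleR_left shr_vec)

lemma shear_Sp: "shear u k \<in> Sp"
  unfolding Sp_def using omega0_antisym[of _ u]
  by (simp add: shear_vec omega.diff_left omega.diff_right omega.scaleR_left omega.scaleR_right omega0_self)

lemma shear_curve:
  assumes "r \<ge> 0"
  shows "wcausal (\<lambda>t. shear u (r * t)) (\<lambda>t. r *\<^sub>R shr u)"
    "omega0 (shear u (r * t) *v y) ((r *\<^sub>R shr u) *v y) = r * (omega0 u y)\<^sup>2"
proof -
  show f: "omega0 (shear u (r * t) *v y) ((r *\<^sub>R shr u) *v y) = r * (omega0 u y)\<^sup>2" for t y
    using omega0_antisym[of y u]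
    by (simp add: shear_vec matrix_vec_mult.scaleR_left shr_vec omega.diff_left omega.minus_right omega.scaleR_left omega.scaleR_right
        omega0_self power2_eq_square)
  have "((\<lambda>t. shear u (r * t)) has_vector_derivative r *\<^sub>R shr u) (at t within {0..1})" for t
    unfolding shear_def by (auto intro!: derivative_eq_intros)
  then show "wcausal (\<lambda>t. shear u (r * t)) (\<lambda>t. r *\<^sub>R shr u)"
    unfolding wcausal_def c1sp_def using f assms by (simp add: shear_Sp)
qed

text \<open>Because \<open>W u = - u\<close>, shearing against the causal direction adds
  \<open>r * (omega0 u v)\<^sup>2\<close> to the form instead of subtracting it. One can thus go
  back arbitrarily far without leaving \<open>Snn\<close>.\<close>

lemma shear_neg_Snn:
  assumes W: "W \<in> Snn" and u: "W *v u = - u" and r: "r \<ge> 0"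
  shows "shear u (- r) ** W \<in> Snn"
proof -
  have S: "W \<in> Sp" using W by (simp add: Snn_def)
  have "omega0 u (W *v v) = - omega0 u v" for v
    using Sp_omega0[OF S, of u v] by (simp add: u omega.minus_left) 
  then have "omega0 v ((shear u (- r) ** W) *v v) = omega0 v (W *v v) + r * (omega0 u v)\<^sup>2" for v
    using omega0_antisym[of v u]
    by (simp add: shear_vec omega.add_right omega.diff_right omega.scaleR_right power2_eq_square flip: matrix_vector_mul_assoc)
  then show ?thesis using W r by (simp add: Snn_def Sp_mult shear_Sp)
qed

section \<open>Uniform positivity of forms and the first exit from the elliptic region\<close>

lemma uniform_form_bound:
  fixes X :: "real \<Rightarrow> 'n::finite sqm"
  assumes X: "continuous_on {0..1} X" and pos: "\<And>t v. t \<in> {0..1} \<Longrightarrow> v \<noteq> 0 \<Longrightarrow> omega0 v (X t *v v) > 0"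
  obtains m where "m > 0" "\<And>t v. t \<in> {0..1} \<Longrightarrow> m * (v \<bullet> v) \<le> omega0 v (X t *v v)"
proof -
  let ?Q = "{0..1::real} \<times> sphere (0::real^('n+'n)) 1"
  define f where "f p = omega0 (snd p) (X (fst p) *v snd p)" for p
  have c: "continuous_on ?Q f" unfolding f_def
    by (intro omega.continuous_on matrix_vec_mult.continuous_on continuous_on_snd continuous_on_id
        continuous_on_compose2[OF X continuous_on_fst[OF continuous_on_id]]) auto
  have "axis undefined 1 \<in> sphere (0::real^('n+'n)) 1" by simp
  then have ne: "?Q \<noteq> {}" by fastforce
  have cp: "compact ?Q" by (intro compact_Times compact_Icc compact_sphere)
  obtain p where p: "p \<in> ?Q" "\<And>q. q \<in> ?Q \<Longrightarrow> f p \<le> f q"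
    using continuous_attains_inf[OF cp ne c] by blast
  show ?thesis
  proof (rule that[of "f p"])
    have "snd p \<noteq> 0" using p(1) by auto
    then show "f p > 0" unfolding f_def using p(1) by (intro pos) auto
    fix t v assume t: "t \<in> {0..1::real}"
    show "f p * (v \<bullet> v) \<le> omega0 v (X t *v v)"
    proof (cases "v = 0")
      case False
      have "f p \<le> f (t, (1 / norm v) *\<^sub>R v)" using False t by (intro p(2)) simp
      also have "\<dots> = omega0 v (X t *v v) / (v \<bullet> v)"
        by (simp add: f_def omega.scaleR_left omega.scaleR_right matrix_vec_mult.scaleR_right dot_square_norm power2_eq_square)
      finally show ?thesis using False by (simp add: pos_le_divide_eq)
    qed simp
  qed
qed

lemma pos_form_nbhd:
  fixes W :: "'n::finite sqm"
  assumes W: "\<And>v. v \<noteq> 0 \<Longrightarrow> omega0 v (W *v v) > 0"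
  obtains e where "e > 0" "\<And>V v. dist V W < e \<Longrightarrow> v \<noteq> 0 \<Longrightarrow> omega0 v (V *v v) > 0"
proof -
  obtain K where K: "K > 0" "\<And>A (v::real^('n+'n)). norm ((A :: 'n sqm) *v v) \<le> norm A * norm v * K"
    using matrix_vec_mult.pos_bounded by blast
  have "\<exists>m>0. \<forall>v. m * (v \<bullet> v) \<le> omega0 v (W *v v)"
  proof (rule uniform_form_bound[where X = "\<lambda>t::real. W"])
    fix m assume "0 < m" "\<And>t v. t \<in> {0..1::real} \<Longrightarrow> m * (v \<bullet> v) \<le> omega0 v (W *v v)"
    then show ?thesis by (intro exI[of _ m]) force
  qed (use W in auto)
  then obtain m where m: "m > 0" "\<And>v. m * (v \<bullet> v) \<le> omega0 v (W *v v)" by blast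
  show ?thesis
  proof (rule that[of "m / K"])
    show "m / K > 0" using m K by simp
    fix V :: "'n sqm" and v :: "real^('n + 'n)" assume V: "dist V W < m / K" and v: "v \<noteq> 0"
    have "- omega0 v ((V - W) *v v) \<le> norm v * norm ((V - W) *v v)" using omega0_le_norm[of v "(V - W) *v v"] by simp
    also have "\<dots> \<le> norm v * (norm (V - W) * norm v * K)" by (intro mult_left_mono K) simp
    also have "\<dots> = (norm (V - W) * K) * (v \<bullet> v)" by (simp add: dot_square_norm power2_eq_square)
    also have "\<dots> < m * (v \<bullet> v)" using V K v by (intro mult_strict_right_mono) (simp_all add: dist_norm pos_less_divide_eq)
    also have "\<dots> \<le> omega0 v (W *v v)" by (rule m)
    finally show "omega0 v (V *v v) > 0" by (simp add: matrix_vec_mult.diff_left omega.diff_right)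
  qed
qed

text \<open>At the identity the form vanishes, so positivity shortly after time \<open>0\<close> is
  read off from the derivative, uniformly in \<open>v\<close>.\<close>

lemma early_Spos:
  fixes c :: "real \<Rightarrow> 'n::finite sqm"
  assumes c: "c1sp c D" "c 0 = mat 1" and pos: "\<And>t v. t \<in> {0..1} \<Longrightarrow> v \<noteq> 0 \<Longrightarrow> omega0 (c t *v v) (D t *v v) > 0"
  obtains d where "d > 0" "\<And>t. 0 < t \<Longrightarrow> t < d \<Longrightarrow> t \<le> 1 \<Longrightarrow> c t \<in> Spos"
proof -
  have p0: "omega0 v (D 0 *v v) > 0" if "v \<noteq> 0" for v using pos[of 0 v] that by (simp add: c(2))
  obtain e where e: "e > 0" "\<And>V v. dist V (D 0) < e \<Longrightarrow> v \<noteq> 0 \<Longrightarrow> omega0 v (V *v v) > 0"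
    by (rule pos_form_nbhd, erule p0, blast)
  have "((\<lambda>s. (c s - c 0) /\<^sub>R (s - 0)) \<longlongrightarrow> D 0) (at 0 within {0..1})"
    using c1sp_C1(6)[OF c(1), of 0] unfolding has_vector_derivative_within_iff_tendsto by simp
  then obtain d where d: "d > 0" "\<And>s. s \<in> {0..1} \<Longrightarrow> 0 < dist s 0 \<Longrightarrow> dist s 0 < d \<Longrightarrow> dist ((c s - c 0) /\<^sub>R (s - 0)) (D 0) < e"
    using e(1) unfolding Lim_within by blast
  show ?thesis
  proof (rule that[OF d(1)])
    fix t :: real assume t: "0 < t" "t < d" "t \<le> 1"
    have "omega0 v (c t *v v) > 0" if v: "v \<noteq> 0" for v
    proof -
      have "0 < omega0 v (((c t - c 0) /\<^sub>R (t - 0)) *v v)" using t by (intro e(2) d(2) v) auto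
      also have "\<dots> = omega0 v (c t *v v) / t"
        by (simp add: matrix_vec_mult.scaleR_left matrix_vec_mult.diff_left omega.scaleR_right omega.diff_right c(2) omega0_self field_simps)
      finally show ?thesis using t by (simp add: zero_less_divide_iff)
    qed
    then show "c t \<in> Spos" using c1sp_C1(2)[OF c(1), of t] t by (simp add: Spos_def)
  qed
qed

text \<open>At the first exit from \<open>Spos\<close> a null vector \<open>v\<close> of the form satisfies \<open>W\<^sup>2 v = v\<close>; if \<open>W v = v\<close>
  then \<open>\<omega>(v, c v)\<close> would be increasing there.\<close>
lemma first_exit:
  fixes c :: "real \<Rightarrow> 'n::finite sqm"
  assumes c: "c1sp c D" "c 0 = mat 1" and pos: "\<And>t v. t \<in> {0..1} \<Longrightarrow> v \<noteq> 0 \<Longrightarrow> omega0 (c t *v v) (D t *v v) > 0"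
    and ex: "t0 \<in> {0<..1}" "c t0 \<notin> Spos"
  obtains T u where "0 < T" "T \<le> 1" "\<And>t. 0 < t \<Longrightarrow> t < T \<Longrightarrow> c t \<in> Spos" "c T \<in> Snn" "u \<noteq> 0" "c T *v u = - u"
proof -
  note C = c1sp_C1[OF c(1)]
  define E where "E = {t \<in> {0<..1}. c t \<notin> Spos}"
  define T where "T = Inf E"
  have E0: "t0 \<in> E" using ex by (simp add: E_def)
  have bdd: "bdd_below E" by (rule bdd_belowI[of _ 0]) (auto simp: E_def)
  obtain d where d: "d > 0" "\<And>t. 0 < t \<Longrightarrow> t < d \<Longrightarrow> t \<le> 1 \<Longrightarrow> c t \<in> Spos" by (rule early_Spos[OF c], erule pos, assumption, blast)
  have "d \<le> T" unfolding T_def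
  proof (rule cInf_greatest)
    show "E \<noteq> {}" using E0 by auto
    fix t assume "t \<in> E" then show "d \<le> t" using d(2)[of t] by (auto simp: E_def not_less[symmetric])
  qed
  then have T0: "0 < T" using d(1) by simp
  have T1: "T \<le> 1" using cInf_lower[OF E0 bdd] ex(1) by (simp add: T_def)
  have Tin: "T \<in> {0..1}" using T0 T1 by simp
  have before: "c t \<in> Spos" if "0 < t" "t < T" for t
  proof (rule ccontr)
    assume "c t \<notin> Spos"
    then have "t \<in> E" using that T1 by (simp add: E_def)
    from cInf_lower[OF this bdd] show False using that by (simp add: T_def)
  qed
  have TS: "c T \<in> Snn"
  proof -
    have "c T *v v = c T *v v \<and> omega0 v (c T *v v) \<ge> 0" for v
    proof
      define X where "X k = T * (1 - 1 / real (Suc (Suc k)))" for k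
      have l: "(\<lambda>k. 1 / real (Suc (Suc k))) \<longlonglongrightarrow> 0" by (rule LIMSEQ_Suc[OF LIMSEQ_Suc[OF lim_1_over_n]])
      have "X \<longlonglongrightarrow> T * (1 - 0)" unfolding X_def by (intro tendsto_intros l)
      then have X: "X \<longlonglongrightarrow> T" by simp
      have Xk: "0 < X k" "X k < T" for k using T0 by (simp_all add: X_def)
      have "(\<lambda>k. c (X k)) \<longlonglongrightarrow> c T"
      proof (rule continuous_on_tendsto_compose[OF C(4) X Tin])
        have "X k \<in> {0..1}" for k using Xk[of k] T1 by simp
        then show "\<forall>\<^sub>F k in sequentially. X k \<in> {0..1}" by simp
      qed
      then have lim: "(\<lambda>k. omega0 v (c (X k) *v v)) \<longlonglongrightarrow> omega0 v (c T *v v)"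
        by (intro omega.tendsto matrix_vec_mult.tendsto tendsto_const)
      have "omega0 v (c (X k) *v v) \<ge> 0" for k
        using subsetD[OF Spos_subset_Snn before[OF Xk]] by (simp add: Snn_def)
      then show "omega0 v (c T *v v) \<ge> 0" by (intro LIMSEQ_le_const[OF lim]) blast
    qed simp
    then show ?thesis using C(2)[OF Tin] by (simp add: Snn_def)
  qed
  have "c T \<notin> Spos"
  proof
    assume "c T \<in> Spos"
    then have p0: "\<And>v. v \<noteq> 0 \<Longrightarrow> omega0 v (c T *v v) > 0" by (simp add: Spos_def)
    obtain e where e: "e > 0" "\<And>V v. dist V (c T) < e \<Longrightarrow> v \<noteq> 0 \<Longrightarrow> omega0 v (V *v v) > 0"
      by (rule pos_form_nbhd, erule p0, blast)
    obtain r where r: "r > 0" "\<And>t. t \<in> {0..1} \<Longrightarrow> dist t T < r \<Longrightarrow> dist (c t) (c T) < e"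
      using C(4) Tin e(1) unfolding continuous_on_iff by blast
    have "T < T + r" using r(1) by simp
    then obtain t where t: "t \<in> E" "t < T + r" using cInf_lessD[of E "T + r"] E0 unfolding T_def by blast
    have "T \<le> t" unfolding T_def by (rule cInf_lower[OF t(1) bdd])
    then have "dist (c t) (c T) < e" using t by (intro r(2)) (auto simp: E_def dist_real_def)
    then have "c t \<in> Spos" using e(2) C(2)[of t] t(1) by (simp add: Spos_def E_def)
    then show False using t(1) by (simp add: E_def)
  qed
  then obtain v where v: "v \<noteq> 0" "omega0 v (c T *v v) \<le> 0" using C(2)[OF Tin] by (auto simp: Spos_def not_less)
  have nn: "omega0 u (c T *v u) \<ge> 0" for u using TS by (simp add: Snn_def)
  have v0: "omega0 v (c T *v v) = 0" using v(2) nn[of v] by simp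
  have ker: "omega0 v (c T *v u) + omega0 u (c T *v v) = 0" for u
  proof (rule psd_kernel[where f = "\<lambda>u v. omega0 u (c T *v v)"])
    show "omega0 (u + s *\<^sub>R x) (c T *v (u + s *\<^sub>R x)) = omega0 u (c T *v u) + s * (omega0 u (c T *v x) + omega0 x (c T *v u)) + s\<^sup>2 * omega0 x (c T *v x)" for u x s
      by (simp add: matrix_vec_mult.add_right matrix_vec_mult.scaleR_right omega.add_left omega.add_right
          omega.scaleR_left omega.scaleR_right power2_eq_square algebra_simps)
  qed (rule nn, rule v0)
  have TSp: "c T \<in> Sp" by (rule C(2)[OF Tin])
  define z where "z = c T *v (c T *v v) - v"
  have "omega0 (c T *v u) z = 0" for u
    using ker[of u] omega0_antisym[of v "c T *v u"] by (simp add: z_def omega.diff_right Sp_omega0[OF TSp])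
  from this[of "matrix_inv (c T) *v (J0 *v z)"] have "omega0 (J0 *v z) z = 0" by (simp add: matrix_inv_vec[OF Sp_invertible[OF TSp]])
  then have "z = 0" by (simp add: omega0_J0_left)
  then have WW: "c T *v (c T *v v) = v" by (simp add: z_def)
  have nfix: "c T *v v \<noteq> v"
  proof
    assume fx: "c T *v v = v"
    have "((\<lambda>t. omega0 v (c t *v v)) has_vector_derivative omega0 v (D T *v v)) (at T within {0..1})"
      by (rule bounded_linear.has_vector_derivative[OF omega.bounded_linear_right
          bounded_linear.has_vector_derivative[OF matrix_vec_mult.bounded_linear_left C(6)[OF Tin]]])
    then have "((\<lambda>t. omega0 v (c t *v v)) has_real_derivative omega0 v (D T *v v)) (at T within {0..1})"
      by (simp add: has_real_derivative_iff_has_vector_derivative)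
    moreover have "0 < omega0 v (D T *v v)" using pos[OF Tin v(1)] by (simp add: fx)
    ultimately obtain r where r: "r > 0" "\<And>h. 0 < h \<Longrightarrow> T - h \<in> {0..1} \<Longrightarrow> h < r \<Longrightarrow> omega0 v (c (T - h) *v v) < omega0 v (c T *v v)"
      using has_real_derivative_pos_inc_left by blast
    define h where "h = min r T / 2"
    have h: "0 < h" "h < r" "h < T" using r(1) T0 by (auto simp: h_def)
    have "omega0 v (c (T - h) *v v) < 0" using r(2)[of h] h T1 v0 by simp
    moreover have "c (T - h) \<in> Spos" using before[of "T - h"] h by simp
    ultimately show False using v(1) by (simp add: Spos_def) (meson less_asym)
  qed
  \<comment> \<open>As \<open>c T\<close> squared fixes \<open>v\<close>, the nonzero difference
    \<open>c T *v v - v\<close> is an eigenvector for \<open>-1\<close>.\<close>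
  show ?thesis
    by (rule that[OF T0 T1 before TS, of "c T *v v - v"]) (use nfix in \<open>simp_all add: matrix_vec_mult.diff_right WW\<close>)
qed

text \<open>Only interior times are constrained, since the end point may be degenerate; cutting the
  path slightly before its end gives elements of \<open>SpT_ell_plus\<close> close to
  \<open>w\<close>.\<close>

lemma closure_of_interior_path:
  fixes w :: "(real \<Rightarrow> 'n::finite sqm) set"
  assumes w: "w \<in> SpT" "c \<in> w" and pos: "\<And>t. 0 < t \<Longrightarrow> t < 1 \<Longrightarrow> c t \<in> Spos"
  shows "w \<in> SpT_top closure_of SpT_ell_plus"
  unfolding in_closure_of
proof (intro conjI allI impI)
  show "w \<in> topspace SpT_top" using w(1) by simp
  have sc: "sp_path c" and wc: "w = cls c" using SpT_mem[OF w] by auto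
  fix U assume U: "w \<in> U \<and> openin SpT_top U"
  then obtain V where V: "open V" "proj w \<in> V" "nbhd w V \<subseteq> U" unfolding openin_SpT_top by blast
  have "c 1 \<in> V" using V(2) proj_eq[OF w] by (simp add: pathfinish_def)
  then obtain e where e: "e > 0" "ball (c 1) e \<subseteq> V" using V(1) openE by blast
  have one: "(1::real) \<in> {0..1}" by simp
  obtain r where r: "r > 0" "\<And>t. t \<in> {0..1} \<Longrightarrow> dist t 1 < r \<Longrightarrow> dist (c t) (c 1) < e"
    using sp_path_D(6)[OF sc] one e(1) unfolding continuous_on_iff by blast
  define t where "t = 1 - min r 1 / 2"
  have t: "0 < t" "t < 1" "1 - t < r" using r(1) by (auto simp: t_def)
  have t': "t \<in> {0..1}" using t by simp
  have pc: "path c" "path_image c \<subseteq> Sp" using sp_path_D[OF sc] by auto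
  let ?d = "subpath 1 t c" and ?p = "subpath 0 t c"
  have "?d s \<in> V \<inter> Sp" if "s \<in> {0..1}" for s
  proof -
    have *: "(t - 1) * s + 1 = 1 - (1 - t) * s" by (simp add: algebra_simps)
    have "(1 - t) * s \<le> 1 - t" "0 \<le> (1 - t) * s" using that t mult_left_le[of s "1 - t"] by auto
    then have "0 \<le> 1 - (1 - t) * s \<and> 1 - (1 - t) * s \<le> 1" "\<bar>1 - (1 - t) * s - 1\<bar> < r" using t by linarith+
    then have "(t - 1) * s + 1 \<in> {0..1}" "dist ((t - 1) * s + 1) 1 < r" unfolding * dist_real_def atLeastAtMost_iff .
    then show ?thesis using r(2)[of "(t - 1) * s + 1"] e(2) sp_path_D(5)[OF sc] by (auto simp: subpath_def dist_commute subset_iff)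
  qed
  then have "path_image ?d \<subseteq> V \<inter> Sp" by (auto simp: path_image_def)
  moreover have "path ?d" by (rule path_subpath[OF pc(1)]) (use t' in auto)
  moreover have "pathstart ?d = pathfinish c" by (simp add: pathstart_def pathfinish_def subpath_def)
  ultimately have "cls (c +++ ?d) \<in> nbhd w V" unfolding nbhd_def using w(2) by blast
  moreover have "homotopic_paths Sp (c +++ ?d) ?p"
    using homotopic_join_subpaths[OF pc, of 0 1 t] t' by simp
  ultimately have "cls ?p \<in> U" using V(3) cls_eqI by (metis subsetD)
  moreover have "cls ?p \<in> SpT_ell_plus"
    unfolding SpT_ell_plus_def
  proof (intro CollectI conjI bexI[of _ ?p] ballI)
    have sp: "sp_path ?p" by (rule sp_path_subpath[OF sc t'])
    show "cls ?p \<in> SpT" "?p \<in> cls ?p" using cls_in_SpT[OF sp] cls_self[OF sp] by auto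
    fix s :: real assume s: "s \<in> {0<..1}"
    have "t * s \<le> t" using s t mult_left_le[of s t] by simp
    then have "t * s < 1" using t by linarith
    then have "c (t * s) \<in> Spos" using s t by (intro pos) auto
    then show "?p s \<in> Sp_ell_plus" by (simp add: Spos_eq[symmetric] subpath_def)
  qed
  ultimately show "\<exists>y. y \<in> SpT_ell_plus \<and> y \<in> U" by blast
qed

section \<open>Curves of unbounded length\<close>

lemma homotopic_pathsI:
  fixes h :: "real \<times> real \<Rightarrow> 'a::real_normed_vector"
  assumes "continuous_on ({0..1} \<times> {0..1}) h" "\<And>s t. s \<in> {0..1} \<Longrightarrow> t \<in> {0..1} \<Longrightarrow> h (s, t) \<in> S"
    "\<And>t. t \<in> {0..1} \<Longrightarrow> h (0, t) = p t" "\<And>t. t \<in> {0..1} \<Longrightarrow> h (1, t) = q t"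
    "\<And>s. s \<in> {0..1} \<Longrightarrow> h (s, 0) = p 0" "\<And>s. s \<in> {0..1} \<Longrightarrow> h (s, 1) = p 1"
  shows "homotopic_paths S p q"
  unfolding homotopic_paths by (intro exI[of _ h]) (use assms in \<open>auto simp: pathstart_def pathfinish_def\<close>)

lemma shear_0 [simp]: "shear u 0 = mat 1"
  by (simp add: shear_def)

lemma shear_inverse: "shear u r ** shear u (- r) = mat 1"
  unfolding matrix_eq
  by (simp add: shear_vec omega.add_right omega.diff_right omega.scaleR_right omega0_self flip: matrix_vector_mul_assoc)

lemma continuous_on_shear: "continuous_on S f \<Longrightarrow> continuous_on S (\<lambda>x. shear u (f x))"
  unfolding shear_def by (intro continuous_intros)

text \<open>The rest of the curve after time \<open>T\<close>, rescaled and translated on the right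
  so as to start at the identity; right translation keeps the logarithmic derivative inside the
  cone.\<close>

lemma tail_curve:
  fixes c :: "real \<Rightarrow> 'n::finite sqm"
  assumes c: "c1sp c D" and pos: "\<And>t v. t \<in> {0..1} \<Longrightarrow> v \<noteq> 0 \<Longrightarrow> omega0 (c t *v v) (D t *v v) > 0"
    and T: "0 < T" "T < 1"
  defines "a \<equiv> \<lambda>t. c (T + t * (1 - T)) ** matrix_inv (c T)"
  obtains A where "wcausal a A" "\<And>t v. t \<in> {0..1} \<Longrightarrow> v \<noteq> 0 \<Longrightarrow> omega0 (a t *v v) (A t *v v) > 0"
proof -
  note C = c1sp_C1[OF c]
  let ?f = "\<lambda>t. T + t * (1 - T)" and ?Wi = "matrix_inv (c T)"
  have f: "?f t \<in> {0..1}" if "t \<in> {0..1}" for t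
  proof -
    have "?f t = 1 - (1 - t) * (1 - T)" by (simp add: algebra_simps)
    moreover have "0 \<le> (1 - t) * (1 - T)" "0 \<le> t * (1 - T)" using that T by auto
    ultimately have "0 \<le> ?f t" "?f t \<le> 1" using T by linarith+
    then show ?thesis by simp
  qed
  have fs: "?f ` {0..1} \<subseteq> {0..1}" by (rule image_subsetI) (rule f)
  have Wi: "?Wi \<in> Sp" using Sp_inv C(2)[of T] T by simp
  define A where "A t = ((1 - T) *\<^sub>R D (?f t)) ** ?Wi" for t
  have form: "omega0 (a t *v v) (A t *v v) = (1 - T) * omega0 (c (?f t) *v (?Wi *v v)) (D (?f t) *v (?Wi *v v))" for t v
    by (simp add: a_def A_def matrix_vec_mult.scaleR_left omega.scaleR_right flip: matrix_vector_mul_assoc)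
  have p: "omega0 (a t *v v) (A t *v v) > 0" if t: "t \<in> {0..1}" and v: "v \<noteq> 0" for t v
  proof -
    have "?Wi *v v \<noteq> 0" using Sp_vec_eq_0[OF Wi] v by simp
    from pos[OF f[OF t] this] show ?thesis using T by (simp add: form)
  qed
  have "c1sp a A"
    unfolding c1sp_def
  proof (intro conjI ballI)
    fix t :: real assume t: "t \<in> {0..1}"
    have "(?f has_vector_derivative (1 - T)) (at t within {0..1})"
      unfolding has_real_derivative_iff_has_vector_derivative[symmetric]
      by (rule DERIV_cong[OF DERIV_add[OF DERIV_const DERIV_cmult_right[OF DERIV_ident]]]) simp
    moreover have "(c has_vector_derivative D (?f t)) (at (?f t) within ?f ` {0..1})"
      by (rule has_vector_derivative_within_subset[OF C(6)[OF f[OF t]] fs])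
    ultimately have "((c \<circ> ?f) has_vector_derivative (1 - T) *\<^sub>R D (?f t)) (at t within {0..1})"
      by (rule vector_diff_chain_within)
    then show "(a has_vector_derivative A t) (at t within {0..1})"
      unfolding a_def A_def o_def by (rule bounded_linear.has_vector_derivative[OF matrix_mult.bounded_linear_left])
    show "a t \<in> Sp" unfolding a_def by (rule Sp_mult[OF C(2)[OF f[OF t]] Wi])
  next
    have "continuous_on {0..1} (\<lambda>t. D (?f t))"
      by (rule continuous_on_compose2[OF C(5) _ fs]) (intro continuous_intros)
    then show "continuous_on {0..1} A" 
      unfolding A_def by (intro matrix_mult.continuous_on continuous_on_scaleR continuous_on_const)
  qed
  moreover have "0 \<le> omega0 (a t *v v) (A t *v v)" if "t \<in> {0..1}" for t v
  proof (cases "v = 0")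
    case True
    then show ?thesis by (simp add: omega.zero_right)
  qed (use p[OF that] in \<open>simp add: less_imp_le\<close>)
  ultimately have "wcausal a A" by (simp add: wcausal_def)
  then show ?thesis using p by (rule that)
qed

text \<open>The factor \<open>eta f\<close> of \<open>P\<close> ends at a point \<open>f = (1 - r N) W\<close> far from \<open>W\<close>; the shear \<open>1 + r t N\<close>, which compensates
  for this, contributes \<open>r\<close> to one eigenvalue of the form.\<close>
lemma long_curves:
  fixes w :: "(real \<Rightarrow> 'n::finite sqm) set"
  assumes w: "w \<in> SpT" "c \<in> w" "w \<notin> SpT_top closure_of SpT_ell_plus"
    and c: "c1sp c D" and pos: "\<And>t v. t \<in> {0..1} \<Longrightarrow> v \<noteq> 0 \<Longrightarrow> omega0 (c t *v v) (D t *v v) > 0"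
  obtains P where "timelike_curve P" "P \<in> w" "B \<le> lengthG P"
proof -
  note C = c1sp_C1[OF c]
  have wc: "w = cls c" and sc: "sp_path c" using SpT_mem[OF w(1,2)] by auto
  have c0: "c 0 = mat 1" by (rule sp_path_D(4)[OF sc])
  have "\<exists>t0\<in>{0<..1}. c t0 \<notin> Spos"
  proof (rule ccontr)
    assume "\<not> ?thesis"
    then have "c t \<in> Spos" if "0 < t" "t < 1" for t using that by auto
    from closure_of_interior_path[OF w(1,2) this] show False using w(3) by blast
  qed
  then obtain t0 where t0: "t0 \<in> {0<..1}" "c t0 \<notin> Spos" by blast
  obtain T u where T0: "0 < T" "T \<le> 1" and before: "\<And>t. 0 < t \<Longrightarrow> t < T \<Longrightarrow> c t \<in> Spos"
    and WS: "c T \<in> Snn" and u: "u \<noteq> 0" "c T *v u = - u"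
    by (rule first_exit[OF c c0 pos t0]) blast+
  have T1: "T < 1"
  proof (rule ccontr)
    assume "\<not> T < 1"
    then have "T = 1" using T0 by simp
    then show False using closure_of_interior_path[OF w(1,2)] before w(3) by blast
  qed
  have Tin: "T \<in> {0..1}" using T0 T1 by simp
  define W where "W = c T"
  have Wi: "matrix_inv W ** W = mat 1" "W ** matrix_inv W = mat 1"
    using matrix_inv_left[OF Sp_invertible] matrix_inv_right[OF Sp_invertible] C(2)[OF Tin] by (simp_all add: W_def)
  have WS: "W \<in> Snn" and Wu: "W *v u = - u" using WS u by (simp_all add: W_def)
  define a where "a = (\<lambda>t. c (T + t * (1 - T)) ** matrix_inv W)"
  obtain A where wa: "wcausal a A" and pa: "\<And>t v. t \<in> {0..1} \<Longrightarrow> v \<noteq> 0 \<Longrightarrow> omega0 (a t *v v) (A t *v v) > 0"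
    unfolding a_def W_def by (rule tail_curve[OF c pos T0(1) T1]) blast+
  have a1: "c1sp a A" using wa by (simp add: wcausal_def)
  note CA = c1sp_C1[OF a1]
  have a0: "a 0 = mat 1" by (simp add: a_def W_def[symmetric] Wi)
  obtain m where m: "m > 0" "\<And>t v. t \<in> {0..1} \<Longrightarrow> m * (v \<bullet> v) \<le> omega0 v (logder a t *v v)"
  proof (rule uniform_form_bound[OF continuous_on_logder[OF a1]])
    fix t v assume "t \<in> {0..1::real}" "v \<noteq> (0 :: real^('n + 'n))"
    then show "0 < omega0 v (logder a t *v v)" using timelike_logder[OF a1, of t] pa by (simp add: sp_plus_def)
  qed blast
  have "continuous_on {0..1} (\<lambda>t. (a t *v (J0 *v u)) \<bullet> (a t *v (J0 *v u)))"
    by (intro continuous_on_inner matrix_vec_mult.continuous_on CA(4) continuous_on_const)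
  then have "\<exists>tm\<in>{0..1}. \<forall>t\<in>{0..1}. (a t *v (J0 *v u)) \<bullet> (a t *v (J0 *v u)) \<le> (a tm *v (J0 *v u)) \<bullet> (a tm *v (J0 *v u))"
    by (intro continuous_attains_sup) auto
  then obtain tm where tm: "\<And>t. t \<in> {0..1} \<Longrightarrow> (a t *v (J0 *v u)) \<bullet> (a t *v (J0 *v u)) \<le> (a tm *v (J0 *v u)) \<bullet> (a tm *v (J0 *v u))"
    by blast
  \<comment> \<open>Bounds the squared lengths of the test vectors \<open>a t *v (J0 *v u)\<close>
    uniformly in \<open>t\<close>; adding \<open>1\<close> makes it positive.\<close>
  define k where "k = (a tm *v (J0 *v u)) \<bullet> (a tm *v (J0 *v u)) + 1"
  have "k > 0" by (simp add: k_def add_nonneg_pos)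
  moreover have "(a t *v (J0 *v u)) \<bullet> (a t *v (J0 *v u)) \<le> k" if "t \<in> {0..1}" for t
    using tm[OF that] unfolding k_def by linarith
  ultimately have k: "k > 0" "\<And>t. t \<in> {0..1} \<Longrightarrow> (a t *v (J0 *v u)) \<bullet> (a t *v (J0 *v u)) \<le> k" .
  let ?N = "CARD('n + 'n)"
  define b where "b = \<bar>B\<bar> + 1"
  \<comment> \<open>Chosen so that, with \<open>K = r * (u \<bullet> u)\<^sup>2 / k\<close>, the
    determinant bound \<open>m ^ (?N - 1) * K\<close> equals \<open>b ^ ?N\<close>, whose root is
    \<open>b\<close>.\<close>
  define r where "r = b ^ ?N * k / (m ^ (?N - 1) * (u \<bullet> u)\<^sup>2)"
  have b: "b > 0" "B \<le> b" by (auto simp: b_def)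
  have uu: "u \<bullet> u > 0" using u by simp
  have r: "r \<ge> 0" using b k m by (simp add: r_def)
  have fS: "shear u (- (s * r)) ** W \<in> Snn" if "s \<in> {0..1}" for s
    using that r by (intro shear_neg_Snn[OF WS Wu]) simp
  define f where "f = shear u (- r) ** W"
  have f: "f \<in> Snn" using fS[of 1] by (simp add: f_def)
  obtain E where E: "wcausal (eta f) E" by (rule eta_curve[OF f])
  define P where "P t = a t ** (shear u (r * t) ** eta f t)" for t
  define B1 where "B1 t = shear u (r * t) ** E t + (r *\<^sub>R shr u) ** eta f t" for t
  define P' where "P' t = a t ** B1 t + A t ** (shear u (r * t) ** eta f t)" for t
  note sh = shear_curve[OF r, of u]
  note w1 = wcausal_mult[OF sh(1) E, folded B1_def]
  have wP: "wcausal P P'" unfolding P_def[abs_def] P'_def[abs_def] by (rule wcausal_mult(1)[OF wa w1(1)])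
  have P1: "c1sp P P'" using wP by (simp add: wcausal_def)
  note CP = c1sp_C1[OF P1]
  have form: "omega0 z (logder P t *v z) \<ge> m * (z \<bullet> z) + r * (omega0 u (matrix_inv (a t) *v z))\<^sup>2" if t: "t \<in> {0..1}" for t z
  proof -
    define v where "v = matrix_inv (P t) *v z"
    define e where "e = eta f t *v v"
    define y where "y = shear u (r * t) *v e"
    have z: "z = P t *v v" by (simp add: v_def matrix_inv_vec[OF Sp_invertible[OF CP(2)[OF t]]])
    have y1: "(shear u (r * t) ** eta f t) *v v = y" by (simp add: y_def e_def matrix_vector_mul_assoc)
    have za: "z = a t *v y" by (simp add: z P_def y1[symmetric] matrix_vector_mul_assoc)
    have "omega0 z (logder P t *v z) = omega0 (P t *v v) (P' t *v v)" unfolding z by (rule logder_form[OF P1 t])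
    also have "\<dots> = omega0 y (B1 t *v v) + omega0 (a t *v y) (A t *v y)"
      unfolding P_def P'_def wcausal_mult(2)[OF wa w1(1) t] y1 ..
    also have "omega0 (a t *v y) (A t *v y) = omega0 z (logder a t *v z)" unfolding za by (rule logder_form[OF a1 t, symmetric])
    also have "omega0 y (B1 t *v v) = omega0 e (E t *v v) + r * (omega0 u e)\<^sup>2"
      using w1(2)[OF t, of v] unfolding y1 e_def[symmetric] sh(2) .
    also have "omega0 u e = omega0 u (matrix_inv (a t) *v z)"
      unfolding za matrix_inv_vec(2)[OF Sp_invertible[OF CA(2)[OF t]]]
      by (simp add: y_def shear_vec omega.diff_right omega.scaleR_right omega0_self)
    finally have "omega0 z (logder P t *v z) = omega0 e (E t *v v) + r * (omega0 u (matrix_inv (a t) *v z))\<^sup>2 + omega0 z (logder a t *v z)" .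
    moreover have "omega0 e (E t *v v) \<ge> 0" unfolding e_def using E t by (simp add: wcausal_def)
    ultimately show ?thesis using m(2)[OF t, of z] by linarith
  qed
  have form': "omega0 z (logder P t *v z) \<ge> m * (z \<bullet> z)" if t: "t \<in> {0..1}" for t z
  proof -
    have "0 \<le> r * (omega0 u (matrix_inv (a t) *v z))\<^sup>2" using r by simp
    then show ?thesis using form[OF t, of z] by linarith
  qed
  have tl: "timelike_curve P"
    unfolding timelike_curve_def
  proof (intro conjI ballI)
    fix t :: real assume t: "t \<in> {0..1}"
    have "0 < omega0 z (logder P t *v z)" if z: "z \<noteq> 0" for z
    proof -
      have "0 < m * (z \<bullet> z)" using m z by simp
      then show ?thesis using form'[OF t, of z] by linarith
    qed
    then show "logder P t \<in> sp_plus" using logder_sp[OF P1 t] by (simp add: sp_plus_def)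
    show "P t \<in> Sp" by (rule CP(2)[OF t])
  qed (rule CP(1))
  have G_ge: "b \<le> G (logder P t)" if t: "t \<in> {0..1}" for t
  proof -
    \<comment> \<open>The preimage of this vector under \<open>a t\<close> is
      \<open>J0 *v u\<close>, on which \<open>omega0 u\<close> takes the value
      \<open>u \<bullet> u\<close>; it detects the shear term at every time.\<close>
    define v where "v = a t *v (J0 *v u)"
    define K where "K = r * (u \<bullet> u)\<^sup>2 / k"
    have "norm (J0 *v u) \<noteq> 0" using u(1) by (simp only: norm_J0 norm_eq_zero not_False_eq_True)
    then have v0: "v \<noteq> 0" unfolding v_def using Sp_vec_eq_0[OF CA(2)[OF t], of "J0 *v u"] by (metis norm_zero)
    have "K * (v \<bullet> v) \<le> K * k" using k(1) k(2)[OF t] r by (intro mult_left_mono) (simp_all add: v_def K_def)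
    also have "\<dots> = r * (omega0 u (matrix_inv (a t) *v v))\<^sup>2"
      using k by (simp add: K_def v_def matrix_inv_vec[OF Sp_invertible[OF CA(2)[OF t]]] omega0_J0_right)
    also have "\<dots> \<le> omega0 v (logder P t *v v)"
    proof -
      have "0 \<le> m * (v \<bullet> v)" using m by simp
      then show ?thesis using form[OF t, of v] by linarith
    qed
    finally have "(m ^ (?N - 1) * K) powr (1 / real ?N) \<le> G (logder P t)"
      by (rule G_lower_bound[OF logder_sp[OF P1 t] form'[OF t] m(1) _ v0]) (use k r in \<open>simp add: K_def\<close>)
    moreover have "m ^ (?N - 1) * K = b ^ ?N" using m k uu by (simp add: K_def r_def field_simps del: card_sum)
    moreover have "(b ^ ?N) powr (1 / real ?N) = b" using b by (simp add: powr_powr flip: powr_realpow del: card_sum)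
    ultimately show ?thesis by simp
  qed
  have len: "B \<le> lengthG P"
  proof -
    have "((\<lambda>t. b) has_integral b) {0..1::real}" using has_integral_const_real[of b 0 1] by simp
    moreover have "((\<lambda>t. G (logder P t)) has_integral lengthG P) {0..1}" unfolding lengthG_def
      by (intro integrable_integral integrable_continuous_interval continuous_on_G_logder[OF wP])
    ultimately have "b \<le> lengthG P" using G_ge by (rule has_integral_le)
    then show ?thesis using b by simp
  qed
  let ?Q = "{0..1::real} \<times> {0..1::real}"
  have ca: "continuous_on ?Q (\<lambda>p. a (snd p))"
    by (rule continuous_on_compose2[OF CA(4) continuous_on_snd[OF continuous_on_id]]) auto
  have cs: "continuous_on ?Q fst" "continuous_on ?Q snd" by (intro continuous_intros)+
  have SnnSp: "V \<in> Snn \<Longrightarrow> V \<in> Sp" for V :: "'n sqm" by (simp add: Snn_def)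
  \<comment> \<open>The strength of the shear is turned on continuously; at time \<open>1\<close>
    the shear and its inverse cancel, so the end point stays \<open>a 1 ** W\<close>.\<close>
  have h1: "homotopic_paths Sp (\<lambda>t. a t ** eta W t) P"
  proof (rule homotopic_pathsI[where h = "\<lambda>p. a (snd p) ** (shear u ((fst p * r) * snd p) ** eta (shear u (- (fst p * r)) ** W) (snd p))"])
    show "continuous_on ?Q (\<lambda>p. a (snd p) ** (shear u ((fst p * r) * snd p) ** eta (shear u (- (fst p * r)) ** W) (snd p)))"
      by (intro matrix_mult.continuous_on ca continuous_on_shear continuous_on_eta continuous_intros cs) (use fS in auto)
    fix s t :: real assume s: "s \<in> {0..1}" and t: "t \<in> {0..1}"
    show "a (snd (s, t)) ** (shear u (fst (s, t) * r * snd (s, t)) ** eta (shear u (- (fst (s, t) * r)) ** W) (snd (s, t))) \<in> Sp"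
      using s t by (simp add: Sp_mult CA(2) shear_Sp SnnSp[OF eta_Snn[OF fS[OF s] t]])
  next
    fix s :: real assume s: "s \<in> {0..1}"
    show "a (snd (s, 1)) ** (shear u (fst (s, 1) * r * snd (s, 1)) ** eta (shear u (- (fst (s, 1) * r)) ** W) (snd (s, 1))) = a 1 ** eta W 1"
      using shear_inverse[of u "s * r"] by (simp add: eta_1[OF fS[OF s]] eta_1[OF WS] matrix_mul_assoc)
    show "a (snd (s, 0)) ** (shear u (fst (s, 0) * r * snd (s, 0)) ** eta (shear u (- (fst (s, 0) * r)) ** W) (snd (s, 0))) = a 0 ** eta W 0"
      by (simp add: eta_0[OF fS[OF s]] eta_0[OF WS])
  qed (simp_all add: P_def f_def)
  \<comment> \<open>The part of \<open>c\<close> up to time \<open>T\<close>. It has the same end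
    points as \<open>eta W\<close> and also stays in \<open>Snn\<close>, which is simply connected,
    so the two are homotopic.\<close>
  define \<kappa> where "\<kappa> t = c (T * t)" for t
  have Tt: "T * t \<in> {0..1}" "T * t \<le> T" if "t \<in> {0..1}" for t
  proof -
    show "T * t \<le> T" using that T0 mult_left_le[of t T] by simp
    then show "T * t \<in> {0..1}" using that T0 T1 order_trans[of "T * t" T 1] by simp
  qed
  have \<kappa>S: "\<kappa> t \<in> Snn" if t: "t \<in> {0..1}" for t
  proof -
    consider "t = 0" | "t = 1" | "0 < t" "t < 1" using t by force
    then show ?thesis
    proof cases
      case 3
      then have "T * t < T" "0 < T * t" using T0 by auto
      then show ?thesis using before Spos_subset_Snn by (auto simp: \<kappa>_def)
    qed (use WS Snn_one in \<open>simp_all add: \<kappa>_def c0 W_def\<close>)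
  qed
  have c\<kappa>: "continuous_on {0..1} \<kappa>" unfolding \<kappa>_def
    by (rule continuous_on_compose2[OF C(4)]) (use Tt in \<open>auto intro!: continuous_intros\<close>)
  have "homotopic_paths Snn (eta W) \<kappa>"
  proof -
    have "path (eta W)" "path \<kappa>" unfolding path_def
      using continuous_on_eta[of "{0..1}" "\<lambda>t. W" "\<lambda>t. t"] WS c\<kappa> by auto
    moreover have "path_image (eta W) \<subseteq> Snn" "path_image \<kappa> \<subseteq> Snn"
      using eta_Snn[OF WS] \<kappa>S by (auto simp: path_image_def)
    moreover have "pathstart \<kappa> = pathstart (eta W)" "pathfinish \<kappa> = pathfinish (eta W)"
      by (simp_all add: pathstart_def pathfinish_def eta_0[OF WS] eta_1[OF WS] \<kappa>_def c0 flip: W_def)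
    ultimately show ?thesis using simply_connected_Snn[where 'n = 'n] unfolding simply_connected_eq_homotopic_paths by blast
  qed
  then obtain H where H: "continuous_on ?Q H" "H \<in> ?Q \<rightarrow> Snn" "\<forall>x\<in>{0..1}. H (0, x) = eta W x" "\<forall>x\<in>{0..1}. H (1, x) = \<kappa> x"
    "\<forall>t\<in>{0..1}. pathstart (H \<circ> Pair t) = pathstart (eta W) \<and> pathfinish (H \<circ> Pair t) = pathfinish (eta W)"
    unfolding homotopic_paths by blast
  have h2: "homotopic_paths Sp (\<lambda>t. a t ** eta W t) (\<lambda>t. a t ** \<kappa> t)"
  proof (rule homotopic_pathsI[where h = "\<lambda>p. a (snd p) ** H p"])
    show "continuous_on ?Q (\<lambda>p. a (snd p) ** H p)" by (intro matrix_mult.continuous_on ca H(1))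
    show "a (snd (s, t)) ** H (s, t) \<in> Sp" if "s \<in> {0..1}" "t \<in> {0..1}" for s t
      using H(2) that by (simp add: Sp_mult CA(2) SnnSp Pi_iff)
  qed (use H(3-5) in \<open>simp_all add: pathstart_def pathfinish_def\<close>)
  have h3: "homotopic_paths Sp (\<lambda>t. a t ** \<kappa> t) c"
  proof -
    \<comment> \<open>The diagonal of the square is deformed to the broken path that first runs
      through \<open>\<kappa>\<close> and then through \<open>a\<close>; along it the product is
      \<open>c\<close> itself.\<close>
    define p where "p t = (max 0 ((t - T) / (1 - T)), min 1 (t / T))" for t
    have pQ: "p t \<in> ?Q" if "t \<in> {0..1}" for t
      using that T0 T1 by (auto simp: p_def divide_le_eq)
    have "homotopic_paths ?Q (\<lambda>t. (t, t)) p"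
    proof (rule homotopic_paths_linear)
      show "path (\<lambda>t::real. (t, t))" "path p" unfolding path_def p_def using T0 T1 by (auto intro!: continuous_intros)
      show "pathstart p = pathstart (\<lambda>t. (t, t))" "pathfinish p = pathfinish (\<lambda>t. (t, t))"
        using T0 T1 by (simp_all add: p_def pathstart_def pathfinish_def max_def min_def divide_le_0_iff)
      show "closed_segment (t, t) (p t) \<subseteq> ?Q" if "t \<in> {0..1}" for t
        by (rule closed_segment_subset) (use that pQ in \<open>auto intro: convex_Times\<close>)
    qed
    then have h31: "homotopic_paths Sp ((\<lambda>q. a (fst q) ** \<kappa> (snd q)) \<circ> (\<lambda>t. (t, t))) ((\<lambda>q. a (fst q) ** \<kappa> (snd q)) \<circ> p)"
    proof (rule homotopic_paths_continuous_image)
      show "continuous_on ?Q (\<lambda>q. a (fst q) ** \<kappa> (snd q))"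
        by (intro matrix_mult.continuous_on continuous_on_compose2[OF CA(4) cs(1)] continuous_on_compose2[OF c\<kappa> cs(2)]) auto
      show "(\<lambda>q. a (fst q) ** \<kappa> (snd q)) \<in> ?Q \<rightarrow> Sp"
        by (intro Pi_I Sp_mult CA(2) SnnSp[OF \<kappa>S]) auto
    qed
    have h32: "homotopic_paths Sp ((\<lambda>q. a (fst q) ** \<kappa> (snd q)) \<circ> p) c"
    proof (rule homotopic_paths_eq)
      show "path ((\<lambda>q. a (fst q) ** \<kappa> (snd q)) \<circ> p)" "path_image ((\<lambda>q. a (fst q) ** \<kappa> (snd q)) \<circ> p) \<subseteq> Sp"
        using homotopic_paths_imp_path[OF h31] homotopic_paths_imp_subset[OF h31] by auto
      fix t :: real assume t: "t \<in> {0..1}"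
      show "((\<lambda>q. a (fst q) ** \<kappa> (snd q)) \<circ> p) t = c t"
      proof (cases "t \<le> T")
        case True
        then have "(t - T) / (1 - T) \<le> 0" "t / T \<le> 1" using T0 T1 by (simp_all add: divide_le_0_iff divide_le_eq)
        then have "p t = (0, t / T)" by (simp add: p_def max_absorb1 min_absorb2)
        then show ?thesis using T0 by (simp add: a0 \<kappa>_def)
      next
        case False
        then have "0 \<le> (t - T) / (1 - T)" "1 \<le> t / T" using T0 T1 by (simp_all add: le_divide_eq)
        then have "p t = ((t - T) / (1 - T), 1)" by (simp add: p_def max_absorb2 min_absorb1)
        moreover have "T + (t - T) / (1 - T) * (1 - T) = t" using T1 by simp
        ultimately show ?thesis using Wi by (simp add: a_def \<kappa>_def W_def[symmetric] flip: matrix_mul_assoc)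
      qed
    qed
    from homotopic_paths_trans[OF h31 h32] show ?thesis by (simp add: o_def)
  qed
  have hom: "homotopic_paths Sp c P"
    by (rule homotopic_paths_trans[OF homotopic_paths_sym[OF h3] homotopic_paths_trans[OF homotopic_paths_sym[OF h2] h1]])
  have "sp_path P"
    using homotopic_paths_imp_path[OF hom] homotopic_paths_imp_subset[OF hom] homotopic_paths_imp_pathstart[OF hom] sp_path_D(3)[OF sc]
    by (simp add: sp_path_def)
  then have "P \<in> w" using hom by (simp add: wc cls_def)
  with tl show ?thesis using len by (rule that)
qed

lemma timelike_imp_causal: "timelike_curve (c :: real \<Rightarrow> 'n::finite sqm) \<Longrightarrow> causal_curve c"
proof -
  have "X \<noteq> 0 \<and> X \<in> closure sp_plus" if "X \<in> sp_plus" for X :: "'n sqm"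
  proof
    show "X \<in> closure sp_plus" using that closure_subset by blast
    have "axis undefined 1 \<noteq> (0 :: real^('n + 'n))" by (simp add: axis_eq_0_iff)
    then have "0 < omega0 (axis undefined 1) (X *v axis undefined 1)" using that unfolding sp_plus_def by blast
    then show "X \<noteq> 0" by (auto simp: omega.zero_right)
  qed
  then show "timelike_curve c \<Longrightarrow> causal_curve c" unfolding timelike_curve_def causal_curve_def by blast
qed

lemma causal_curve_wcausal:
  assumes c: "causal_curve c"
  shows "wcausal c (\<lambda>t. vector_derivative c (at t within {0..1}))" "path c" "path_image c \<subseteq> Sp"
proof -
  have c1: "c1sp c (\<lambda>t. vector_derivative c (at t within {0..1}))" by (rule C1_c1sp) (use c in \<open>auto simp: causal_curve_def\<close>)
  then show "wcausal c (\<lambda>t. vector_derivative c (at t within {0..1}))"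
    using wcausal_logder[OF c1] c by (simp add: causal_curve_def)
  show "path c" "path_image c \<subseteq> Sp" using c1sp_C1(2,4)[OF c1] by (auto simp: path_def path_image_def)
qed

theorem theorem4:
  fixes w :: "(real \<Rightarrow> real^('n::finite + 'n)^('n + 'n)) set"
  assumes "w \<in> SpT"
  shows "(w \<in> SpT_top closure_of SpT_ell_plus \<longrightarrow>
            (\<exists>\<theta> :: 'n \<Rightarrow> real.
               (\<forall>j. 0 \<le> \<theta> j \<and> \<theta> j \<le> pi)
             \<and> (\<forall>z. charpoly (proj w) z =
                   (\<Prod>j\<in>UNIV. (z - exp (\<i> * complex_of_real (\<theta> j))) *
                               (z - exp (- \<i> * complex_of_real (\<theta> j)))))
             \<and> distG idT w \<le> ereal (2 * pi / real CARD('n) * maslov w)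
             \<and> 2 * pi / real CARD('n) * maslov w = (1 / real CARD('n)) * (\<Sum>j\<in>UNIV. \<theta> j)))
       \<and> ((\<exists>c. timelike_curve c \<and> curve_from_to c idT w)
             \<and> w \<notin> SpT_top closure_of SpT_ell_plus \<longrightarrow> distG idT w = \<infinity>)"
proof (intro conjI impI)
  assume cl: "w \<in> SpT_top closure_of SpT_ell_plus"
  obtain \<theta> where \<theta>: "good (proj w) \<theta>" "2 * pi * maslov w = (\<Sum>j\<in>UNIV. \<theta> $ j)" by (rule maslov_closure[OF cl])
  have n: "real CARD('n) > 0" by simp
  have eq: "2 * pi / real CARD('n) * maslov w = (1 / real CARD('n)) * (\<Sum>j\<in>UNIV. \<theta> $ j)" using \<theta>(2) by simp
  \<comment> \<open>The value \<open>0\<close> enters \<open>distG\<close> both as an element of the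
    supremum and as the default outside the causal order, so the bound has to be
    nonnegative.\<close>
  have nn: "0 \<le> (1 / real CARD('n)) * (\<Sum>j\<in>UNIV. \<theta> $ j)" using \<theta>(1) by (intro mult_nonneg_nonneg sum_nonneg) (auto simp: good_def)
  have le: "lengthG c \<le> 2 * pi / real CARD('n) * maslov w" if c: "causal_curve c" "curve_from_to c idT w" for c
  proof -
    note wc = causal_curve_wcausal[OF c(1)]
    have cw: "c \<in> w" using c(2) curve_from_idT_iff[OF assms wc(2,3)] by simp
    have "c 1 = proj w" using proj_eq[OF assms cw] by (simp add: pathfinish_def)
    then have "real CARD('n) * lengthG c \<le> (\<Sum>j\<in>UNIV. \<theta> $ j)"
      using length_le_Snn[OF wc(1) wcausal_in_Snn[OF cl wc(1) cw]] \<theta>(1) by simp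
    then show ?thesis unfolding eq using n by (simp add: field_simps)
  qed
  have "distG idT w \<le> ereal (2 * pi / real CARD('n) * maslov w)"
  proof (cases "causal_le idT w")
    case True
    have "Sup ({0} \<union> {ereal (lengthG c) | c. causal_curve c \<and> curve_from_to c idT w}) \<le> ereal (2 * pi / real CARD('n) * maslov w)"
      by (rule Sup_least) (use le nn eq in auto)
    then show ?thesis using True by (simp add: distG_def)
  next
    case False
    then show ?thesis using nn eq by (simp add: distG_def)
  qed
  then show "\<exists>\<theta> :: 'n \<Rightarrow> real.
               (\<forall>j. 0 \<le> \<theta> j \<and> \<theta> j \<le> pi)
             \<and> (\<forall>z. charpoly (proj w) z =
                   (\<Prod>j\<in>UNIV. (z - exp (\<i> * complex_of_real (\<theta> j))) *
                               (z - exp (- \<i> * complex_of_real (\<theta> j)))))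
             \<and> distG idT w \<le> ereal (2 * pi / real CARD('n) * maslov w)
             \<and> 2 * pi / real CARD('n) * maslov w = (1 / real CARD('n)) * (\<Sum>j\<in>UNIV. \<theta> j)"
    using \<theta>(1) eq unfolding good_def by (intro exI[of _ "\<lambda>j. \<theta> $ j"]) blast
next
  assume "(\<exists>c. timelike_curve c \<and> curve_from_to c idT w) \<and> w \<notin> SpT_top closure_of SpT_ell_plus"
  then obtain c where c: "timelike_curve c" "curve_from_to c idT w" and ncl: "w \<notin> SpT_top closure_of SpT_ell_plus" by blast
  have cc: "causal_curve c" by (rule timelike_imp_causal[OF c(1)])
  note wc = causal_curve_wcausal[OF cc]
  have cw: "c \<in> w" using c(2) curve_from_idT_iff[OF assms wc(2,3)] by simp
  have c1: "c1sp c (\<lambda>t. vector_derivative c (at t within {0..1}))" using wc(1) by (simp add: wcausal_def)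
  have pos: "omega0 (c t *v v) (vector_derivative c (at t within {0..1}) *v v) > 0" if "t \<in> {0..1}" "v \<noteq> 0" for t v
    using timelike_logder[OF c1 that(1)] c(1) that by (simp add: timelike_curve_def)
  have "causal_le idT w" using cc c(2) by (auto simp: causal_le_def)
  moreover have "Sup ({0} \<union> {ereal (lengthG c) | c. causal_curve c \<and> curve_from_to c idT w}) = \<infinity>"
  proof (rule ereal_top)
    fix B
    obtain P where P: "timelike_curve P" "P \<in> w" "B \<le> lengthG P"
      by (rule long_curves[OF assms cw ncl c1 pos]) blast+
    have cP: "causal_curve P" by (rule timelike_imp_causal[OF P(1)])
    have "curve_from_to P idT w" using P(2) curve_from_idT_iff[OF assms causal_curve_wcausal(2,3)[OF cP]] by simp
    then have "ereal (lengthG P) \<le> Sup ({0} \<union> {ereal (lengthG c) | c. causal_curve c \<and> curve_from_to c idT w})"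
      using cP by (intro Sup_upper) blast
    then show "ereal B \<le> Sup ({0} \<union> {ereal (lengthG c) | c. causal_curve c \<and> curve_from_to c idT w})"
      using P(3) by (meson ereal_less_eq(3) order_trans)
  qed
  ultimately show "distG idT w = \<infinity>" by (simp add: distG_def)
qed

end
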